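(* Let $K$ be an algebraically closed field, let $\Lambda$ be a finite-dimensional $K$-algebra, and let $E$ be a generator in $\Lambda\text{-}\mathrm{mod}$. Then $\Lambda$ is CM-$E$-free if and only if $\Gamma=(\mathrm{End}_\Lambda E)^{op}$ is CM-$\tau$-tilting free.
   Context: All algebras are finite-dimensional over an algebraically closed field $K$ and all modules are finitely generated left modules; $A\text{-}\mathrm{mod}$ denotes the category of finitely generated left $A$-modules. $\mathrm{add}\,E$ is the full subcategory of direct summands of finite direct sums of copies of $E$. $E$ is a generator in $\Lambda\text{-}\mathrm{mod}$ if $\Lambda\in\mathrm{add}\,E$. $E$-Gorenstein projective: a module $M\in\Lambda\text{-}\mathrm{mod}$ is $E$-Gorenstein projective if there is an exact sequence $\cdots\to E_{-1}\xrightarrow{d_{-1}}E_0\xrightarrow{d_0}E_1\to\cdots$ with all $E_i\in\mathrm{add}\,E$ which stays exact after applying each of the functors $\mathrm{Hom}_\Lambda(-,E)$ and $\mathrm{Hom}_\Lambda(E,-)$, and such that $M\simeq\mathrm{Im}\,d_0$. $E$-rigid: for $M\in\Lambda\text{-}\mathrm{mod}$, let $E_1\xrightarrow{f_1}E_0\xrightarrow{f_0}M\to 0$ be a minimal $\mathrm{add}\,E$-presentation of $M$, i.e. an exact sequence such that for $i=0,1$ the map $E_i\to\mathrm{Im}\,f_i$ induced by $f_i$ is a minimal right $\mathrm{add}\,E$-approximation of $\mathrm{Im}\,f_i$. $M$ is $E$-rigid if the map $\mathrm{Hom}_\Lambda(f_1,M):\mathrm{Hom}_\Lambda(E_0,M)\to\mathrm{Hom}_\Lambda(E_1,M)$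 is surjective. A module is $E$-Gorenstein projective $E$-rigid if it is both $E$-Gorenstein projective and $E$-rigid. $\Lambda$ is CM-$E$-free if every indecomposable $E$-Gorenstein projective $E$-rigid module in $\Lambda\text{-}\mathrm{mod}$ is a direct summand of $E$. For an algebra $A$, a module $N\in A\text{-}\mathrm{mod}$ is Gorenstein projective if there is an exact sequence $\cdots\to P_{-1}\to P_0\to P_1\to\cdots$ of finitely generated projective left $A$-modules which stays exact under $\mathrm{Hom}_A(-,A)$ and such that $N\simeq\mathrm{Im}(P_{-1}\to P_0)$. $N$ is $\tau$-rigid if $\mathrm{Hom}_A(N,\tau N)=0$, where $\tau$ is the Auslander-Reiten translation. $A$ is CM-$\tau$-tilting free if every module in $A\text{-}\mathrm{mod}$ that is both Gorenstein projective and $\tau$-rigid is projective. *)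

theory Defs
  imports "HOL-Algebra.Algebra"
begin

section \<open>Left modules over a (not necessarily commutative) ring\<close>

text \<open>
  \<^locale>\<open>module\<close> and \<^locale>\<open>algebra\<close> of HOL-Algebra require commutative rings.  We keep the
  record type \<^typ>\<open>('a, 'm) module\<close> and the locale \<^locale>\<open>submodule\<close>, which do not.  The fields
  \<^const>\<open>monoid.mult\<close> and \<^const>\<open>monoid.one\<close> of a record that is used as a module are irrelevant.
\<close>

locale left_module = R?: ring R + M?: abelian_group M
  for R :: "('a, 'b) ring_scheme" (structure) and M :: "('a, 'm) module" (structure) +
  assumes smult_closed [simp, intro]:
      "\<lbrakk>a \<in> carrier R; x \<in> carrier M\<rbrakk> \<Longrightarrow> a \<odot>\<^bsub>M\<^esub> x \<in> carrier M"
    and smult_l_distr: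
      "\<lbrakk>a \<in> carrier R; b \<in> carrier R; x \<in> carrier M\<rbrakk> \<Longrightarrow>
        (a \<oplus> b) \<odot>\<^bsub>M\<^esub> x = a \<odot>\<^bsub>M\<^esub> x \<oplus>\<^bsub>M\<^esub> b \<odot>\<^bsub>M\<^esub> x"
    and smult_r_distr:
      "\<lbrakk>a \<in> carrier R; x \<in> carrier M; y \<in> carrier M\<rbrakk> \<Longrightarrow>
        a \<odot>\<^bsub>M\<^esub> (x \<oplus>\<^bsub>M\<^esub> y) = a \<odot>\<^bsub>M\<^esub> x \<oplus>\<^bsub>M\<^esub> a \<odot>\<^bsub>M\<^esub> y"
    and smult_assoc1:
      "\<lbrakk>a \<in> carrier R; b \<in> carrier R; x \<in> carrier M\<rbrakk> \<Longrightarrow>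
        (a \<otimes> b) \<odot>\<^bsub>M\<^esub> x = a \<odot>\<^bsub>M\<^esub> (b \<odot>\<^bsub>M\<^esub> x)"
    and smult_one [simp]: "x \<in> carrier M \<Longrightarrow> \<one> \<odot>\<^bsub>M\<^esub> x = x"

definition fin_gen :: "('a, 'b) ring_scheme \<Rightarrow> ('a, 'm) module \<Rightarrow> bool" where
  "fin_gen R M \<longleftrightarrow> (\<exists>S. finite S \<and> S \<subseteq> carrier M \<and>
     (\<forall>H. submodule H R M \<longrightarrow> S \<subseteq> H \<longrightarrow> H = carrier M))"

definition fg_module :: "('a, 'b) ring_scheme \<Rightarrow> ('a, 'm) module \<Rightarrow> bool" where
  "fg_module R M \<longleftrightarrow> left_module R M \<and> fin_gen R M"

definition regular :: "('a, 'b) ring_scheme \<Rightarrow> ('a, 'a) module" where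
  "regular R = \<lparr>carrier = carrier R, monoid.mult = monoid.mult R, one = \<one>\<^bsub>R\<^esub>,
     ring.zero = \<zero>\<^bsub>R\<^esub>, ring.add = ring.add R, smult = monoid.mult R\<rparr>"

abbreviation sub_module :: "('a, 'm) module \<Rightarrow> 'm set \<Rightarrow> ('a, 'm) module" where
  "sub_module M H \<equiv> M\<lparr>carrier := H\<rparr>"

definition quot_module :: "('a, 'm) module \<Rightarrow> 'm set \<Rightarrow> ('a, 'm set) module" where
  "quot_module M H = \<lparr>carrier = a_rcosets\<^bsub>M\<^esub> H, monoid.mult = undefined, one = undefined,
     ring.zero = H, ring.add = set_add M,
     smult = (\<lambda>a C. \<Union>x\<in>C. H +>\<^bsub>M\<^esub> (a \<odot>\<^bsub>M\<^esub> x))\<rparr>"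

definition power_module :: "('a, 'm) module \<Rightarrow> nat \<Rightarrow> ('a, nat \<Rightarrow> 'm) module" where
  "power_module M n = \<lparr>carrier = {..<n} \<rightarrow>\<^sub>E carrier M, monoid.mult = undefined, one = undefined,
     ring.zero = (\<lambda>i\<in>{..<n}. \<zero>\<^bsub>M\<^esub>), ring.add = (\<lambda>x y. \<lambda>i\<in>{..<n}. x i \<oplus>\<^bsub>M\<^esub> y i),
     smult = (\<lambda>a x. \<lambda>i\<in>{..<n}. a \<odot>\<^bsub>M\<^esub> x i)\<rparr>"


section \<open>Homomorphisms and exactness\<close>

text \<open>The additive group of \<open>R\<close>-linear maps; homomorphisms are extensional functions, so that
  equality of homomorphisms is equality of functions.\<close>

definition Hom :: "('a, 'b) ring_scheme \<Rightarrow> ('a, 'm) module \<Rightarrow> ('a, 'n) module \<Rightarrow> ('m \<Rightarrow> 'n) ring"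
  where
  "Hom R M N = \<lparr>carrier = {f \<in> carrier M \<rightarrow>\<^sub>E carrier N.
       (\<forall>x\<in>carrier M. \<forall>y\<in>carrier M. f (x \<oplus>\<^bsub>M\<^esub> y) = f x \<oplus>\<^bsub>N\<^esub> f y) \<and>
       (\<forall>a\<in>carrier R. \<forall>x\<in>carrier M. f (a \<odot>\<^bsub>M\<^esub> x) = a \<odot>\<^bsub>N\<^esub> f x)},
     monoid.mult = undefined, one = undefined,
     ring.zero = (\<lambda>x\<in>carrier M. \<zero>\<^bsub>N\<^esub>), ring.add = (\<lambda>f g. \<lambda>x\<in>carrier M. f x \<oplus>\<^bsub>N\<^esub> g x)\<rparr>"

abbreviation hom_set :: "('a, 'b) ring_scheme \<Rightarrow> ('a, 'm) module \<Rightarrow> ('a, 'n) module \<Rightarrow> ('m \<Rightarrow> 'n) set"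
  where "hom_set R M N \<equiv> carrier (Hom R M N)"

definition lmod_iso :: "('a, 'b) ring_scheme \<Rightarrow> ('a, 'm) module \<Rightarrow> ('a, 'n) module \<Rightarrow> bool" where
  "lmod_iso R M N \<longleftrightarrow> (\<exists>f \<in> hom_set R M N. bij_betw f (carrier M) (carrier N))"

text \<open>For \<open>f : M \<rightarrow> N\<close>, \<open>precomp M f\<close> is \<open>Hom(f,Z) : Hom(N,Z) \<rightarrow> Hom(M,Z)\<close>, and
  \<open>postcomp Z f\<close> is \<open>Hom(Z,f) : Hom(Z,M) \<rightarrow> Hom(Z,N)\<close>.\<close>

definition precomp :: "('a, 'm) module \<Rightarrow> ('m \<Rightarrow> 'n) \<Rightarrow> ('n \<Rightarrow> 'x) \<Rightarrow> ('m \<Rightarrow> 'x)" where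
  "precomp M f = (\<lambda>h. compose (carrier M) h f)"

definition postcomp :: "('a, 'x) module \<Rightarrow> ('m \<Rightarrow> 'n) \<Rightarrow> ('x \<Rightarrow> 'm) \<Rightarrow> ('x \<Rightarrow> 'n)" where
  "postcomp Z f = (\<lambda>h. compose (carrier Z) f h)"

definition exact_at ::
  "('m, 'p) ring_scheme \<Rightarrow> ('m \<Rightarrow> 'n) \<Rightarrow> ('n, 'q) ring_scheme \<Rightarrow> ('n \<Rightarrow> 'x) \<Rightarrow> ('x, 'r) ring_scheme \<Rightarrow> bool"
  where
  "exact_at L f M g N \<longleftrightarrow> f ` carrier L = {y \<in> carrier M. g y = \<zero>\<^bsub>N\<^esub>}"

definition exact_sequence ::
  "('a, 'b) ring_scheme \<Rightarrow> (int \<Rightarrow> ('a, 'm) module) \<Rightarrow> (int \<Rightarrow> 'm \<Rightarrow> 'm) \<Rightarrow> bool" where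
  "exact_sequence R Z d \<longleftrightarrow>
     (\<forall>i. d i \<in> hom_set R (Z i) (Z (i + 1))) \<and>
     (\<forall>i. exact_at (Z i) (d i) (Z (i + 1)) (d (i + 1)) (Z (i + 2)))"

definition exact_under_Hom_to ::
  "('a, 'b) ring_scheme \<Rightarrow> (int \<Rightarrow> ('a, 'm) module) \<Rightarrow> (int \<Rightarrow> 'm \<Rightarrow> 'm) \<Rightarrow> ('a, 'e) module \<Rightarrow> bool"
  where
  "exact_under_Hom_to R Z d E \<longleftrightarrow>
     (\<forall>i. exact_at (Hom R (Z (i + 2)) E) (precomp (Z (i + 1)) (d (i + 1)))
                   (Hom R (Z (i + 1)) E) (precomp (Z i) (d i)) (Hom R (Z i) E))"

definition exact_under_Hom_from ::
  "('a, 'b) ring_scheme \<Rightarrow> (int \<Rightarrow> ('a, 'm) module) \<Rightarrow> (int \<Rightarrow> 'm \<Rightarrow> 'm) \<Rightarrow> ('a, 'e) module \<Rightarrow> bool"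
  where
  "exact_under_Hom_from R Z d E \<longleftrightarrow>
     (\<forall>i. exact_at (Hom R E (Z i)) (postcomp E (d i))
                   (Hom R E (Z (i + 1))) (postcomp E (d (i + 1))) (Hom R E (Z (i + 2))))"


section \<open>Direct summands\<close>

definition direct_decomp :: "('a, 'b) ring_scheme \<Rightarrow> ('a, 'm) module \<Rightarrow> 'm set \<Rightarrow> 'm set \<Rightarrow> bool"
  where
  "direct_decomp R M H1 H2 \<longleftrightarrow> submodule H1 R M \<and> submodule H2 R M \<and>
     H1 \<inter> H2 = {\<zero>\<^bsub>M\<^esub>} \<and> H1 <+>\<^bsub>M\<^esub> H2 = carrier M"

definition direct_summand :: "('a, 'b) ring_scheme \<Rightarrow> ('a, 'm) module \<Rightarrow> ('a, 'n) module \<Rightarrow> bool"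
  where
  "direct_summand R M N \<longleftrightarrow>
     (\<exists>H1 H2. direct_decomp R N H1 H2 \<and> lmod_iso R M (sub_module N H1))"

definition indecomposable :: "('a, 'b) ring_scheme \<Rightarrow> ('a, 'm) module \<Rightarrow> bool" where
  "indecomposable R M \<longleftrightarrow> carrier M \<noteq> {\<zero>\<^bsub>M\<^esub>} \<and>
     (\<forall>H1 H2. direct_decomp R M H1 H2 \<longrightarrow> H1 = {\<zero>\<^bsub>M\<^esub>} \<or> H2 = {\<zero>\<^bsub>M\<^esub>})"

definition in_add :: "('a, 'b) ring_scheme \<Rightarrow> ('a, 'e) module \<Rightarrow> ('a, 'm) module \<Rightarrow> bool" where
  "in_add R E Z \<longleftrightarrow> fg_module R Z \<and> (\<exists>n. direct_summand R Z (power_module E n))"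

definition generator :: "('a, 'b) ring_scheme \<Rightarrow> ('a, 'e) module \<Rightarrow> bool" where
  "generator R E \<longleftrightarrow> fg_module R E \<and> in_add R E (regular R)"


section \<open>Finite-dimensional algebras\<close>

locale fd_algebra = K?: field K + A?: ring A for K :: "('k, 'b) ring_scheme" (structure) and A :: "('k, 'a) module" (structure) +
  assumes K_module: "module K A"
    and smult_mult_left:
      "\<lbrakk>k \<in> carrier K; x \<in> carrier A; y \<in> carrier A\<rbrakk> \<Longrightarrow> (k \<odot>\<^bsub>A\<^esub> x) \<otimes>\<^bsub>A\<^esub> y = k \<odot>\<^bsub>A\<^esub> (x \<otimes>\<^bsub>A\<^esub> y)"
    and smult_mult_right:
      "\<lbrakk>k \<in> carrier K; x \<in> carrier A; y \<in> carrier A\<rbrakk> \<Longrightarrow> x \<otimes>\<^bsub>A\<^esub> (k \<odot>\<^bsub>A\<^esub> y) = k \<odot>\<^bsub>A\<^esub> (x \<otimes>\<^bsub>A\<^esub> y)"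
    and finite_dimensional: "fin_gen K A"

definition opposite :: "('k, 'a) module \<Rightarrow> ('k, 'a) module" where
  "opposite A = A\<lparr>monoid.mult := (\<lambda>x y. y \<otimes>\<^bsub>A\<^esub> x)\<rparr>"

definition restrict_scalars :: "('k, 'a) module \<Rightarrow> ('a, 'm) module \<Rightarrow> ('k, 'm) module" where
  "restrict_scalars A M = \<lparr>carrier = carrier M, monoid.mult = monoid.mult M, one = \<one>\<^bsub>M\<^esub>,
     ring.zero = \<zero>\<^bsub>M\<^esub>, ring.add = ring.add M, smult = (\<lambda>k x. (k \<odot>\<^bsub>A\<^esub> \<one>\<^bsub>A\<^esub>) \<odot>\<^bsub>M\<^esub> x)\<rparr>"

definition End_algebra :: "('k, 'a) module \<Rightarrow> ('a, 'e) module \<Rightarrow> ('k, 'e \<Rightarrow> 'e) module" where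
  "End_algebra A E = \<lparr>carrier = hom_set A E E,
     monoid.mult = (\<lambda>f g. compose (carrier E) f g), one = (\<lambda>x\<in>carrier E. x),
     ring.zero = \<zero>\<^bsub>Hom A E E\<^esub>, ring.add = ring.add (Hom A E E),
     smult = (\<lambda>k f. \<lambda>x\<in>carrier E. (k \<odot>\<^bsub>A\<^esub> \<one>\<^bsub>A\<^esub>) \<odot>\<^bsub>E\<^esub> f x)\<rparr>"

text \<open>
  A statement about all modules in \<open>A-mod\<close>, for a finite-dimensional algebra \<open>A\<close> over a field with
  underlying type \<^typ>\<open>'k\<close>, quantifies over the modules whose carrier is some set of elements of
  \<^typ>\<open>nat \<Rightarrow> 'k\<close>.  No isomorphism class is lost: a finitely generated \<open>A\<close>-module is a
  finite-dimensional vector space, hence can be transported to the finite sequences of some length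
  over the field.  The same type accommodates the terms of complexes and presentations.
\<close>

type_synonym ('k, 'a) fd_mod = "('a, nat \<Rightarrow> 'k) module"


section \<open>Relative notions with respect to a module \<open>E\<close>\<close>

definition E_gorenstein_projective ::
  "('k, 'a) module \<Rightarrow> ('a, 'e) module \<Rightarrow> ('k, 'a) fd_mod \<Rightarrow> bool" where
  "E_gorenstein_projective A E M \<longleftrightarrow> fg_module A M \<and>
     (\<exists>(Z :: int \<Rightarrow> ('k, 'a) fd_mod) d.
        (\<forall>i. in_add A E (Z i)) \<and> exact_sequence A Z d \<and>
        exact_under_Hom_to A Z d E \<and> exact_under_Hom_from A Z d E \<and>
        lmod_iso A M (sub_module (Z 1) (d 0 ` carrier (Z 0))))"

definition right_add_approximation ::
  "('k, 'a) module \<Rightarrow> ('a, 'e) module \<Rightarrow> ('k, 'a) fd_mod \<Rightarrow> ((nat \<Rightarrow> 'k) \<Rightarrow> (nat \<Rightarrow> 'k)) \<Rightarrow>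
   ('k, 'a) fd_mod \<Rightarrow> bool" where
  "right_add_approximation A E Z f M \<longleftrightarrow> in_add A E Z \<and> f \<in> hom_set A Z M \<and>
     (\<forall>Y :: ('k, 'a) fd_mod. in_add A E Y \<longrightarrow>
        postcomp Y f ` hom_set A Y Z = hom_set A Y M)"

definition right_minimal ::
  "('a, 'b) ring_scheme \<Rightarrow> ('a, 'm) module \<Rightarrow> ('m \<Rightarrow> 'n) \<Rightarrow> bool" where
  "right_minimal A Z f \<longleftrightarrow>
     (\<forall>h \<in> hom_set A Z Z. compose (carrier Z) f h = f \<longrightarrow> bij_betw h (carrier Z) (carrier Z))"

definition minimal_right_add_approximation ::
  "('k, 'a) module \<Rightarrow> ('a, 'e) module \<Rightarrow> ('k, 'a) fd_mod \<Rightarrow> ((nat \<Rightarrow> 'k) \<Rightarrow> (nat \<Rightarrow> 'k)) \<Rightarrow>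
   ('k, 'a) fd_mod \<Rightarrow> bool" where
  "minimal_right_add_approximation A E Z f M \<longleftrightarrow>
     right_add_approximation A E Z f M \<and> right_minimal A Z f"

definition minimal_add_presentation ::
  "('k, 'a) module \<Rightarrow> ('a, 'e) module \<Rightarrow>
   ('k, 'a) fd_mod \<Rightarrow> ((nat \<Rightarrow> 'k) \<Rightarrow> (nat \<Rightarrow> 'k)) \<Rightarrow>
   ('k, 'a) fd_mod \<Rightarrow> ((nat \<Rightarrow> 'k) \<Rightarrow> (nat \<Rightarrow> 'k)) \<Rightarrow> ('k, 'a) fd_mod \<Rightarrow> bool" where
  "minimal_add_presentation A E E1 f1 E0 f0 M \<longleftrightarrow>
     f1 \<in> hom_set A E1 E0 \<and> f0 \<in> hom_set A E0 M \<and>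
     exact_at E1 f1 E0 f0 M \<and> f0 ` carrier E0 = carrier M \<and>
     minimal_right_add_approximation A E E0 f0 (sub_module M (f0 ` carrier E0)) \<and>
     minimal_right_add_approximation A E E1 f1 (sub_module E0 (f1 ` carrier E1))"

text \<open>Minimal presentations are unique up to isomorphism, so \<open>\<exists>\<close> and \<open>\<forall>\<close> agree below whenever
  one exists.\<close>

definition E_rigid :: "('k, 'a) module \<Rightarrow> ('a, 'e) module \<Rightarrow> ('k, 'a) fd_mod \<Rightarrow> bool" where
  "E_rigid A E M \<longleftrightarrow> fg_module A M \<and>
     (\<exists>E1 f1 E0 f0. minimal_add_presentation A E E1 f1 E0 f0 M \<and>
        precomp E1 f1 ` hom_set A E0 M = hom_set A E1 M)"

definition CM_E_free :: "('k, 'a) module \<Rightarrow> ('a, 'e) module \<Rightarrow> bool" where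
  "CM_E_free A E \<longleftrightarrow>
     (\<forall>M :: ('k, 'a) fd_mod. fg_module A M \<and> indecomposable A M \<and>
        E_gorenstein_projective A E M \<and> E_rigid A E M \<longrightarrow> direct_summand A M E)"


section \<open>Projective and Gorenstein projective modules\<close>

definition fg_projective :: "('k, 'a) module \<Rightarrow> ('k, 'a) fd_mod \<Rightarrow> bool" where
  "fg_projective A P \<longleftrightarrow> fg_module A P \<and>
     (\<forall>(M :: ('k, 'a) fd_mod) (N :: ('k, 'a) fd_mod). \<forall>g \<in> hom_set A M N.
        fg_module A M \<longrightarrow> fg_module A N \<longrightarrow> g ` carrier M = carrier N \<longrightarrow>
        postcomp P g ` hom_set A P M = hom_set A P N)"

definition gorenstein_projective :: "('k, 'a) module \<Rightarrow> ('k, 'a) fd_mod \<Rightarrow> bool" where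
  "gorenstein_projective A N \<longleftrightarrow> fg_module A N \<and>
     (\<exists>(P :: int \<Rightarrow> ('k, 'a) fd_mod) d.
        (\<forall>i. fg_projective A (P i)) \<and> exact_sequence A P d \<and>
        exact_under_Hom_to A P d (regular A) \<and>
        lmod_iso A N (sub_module (P 0) (d (- 1) ` carrier (P (- 1)))))"


section \<open>The Auslander--Reiten translation\<close>

text \<open>The last clause says that the epimorphism \<open>f\<close> is essential (its kernel is superfluous).\<close>

definition projective_cover ::
  "('k, 'a) module \<Rightarrow> ('k, 'a) fd_mod \<Rightarrow> ((nat \<Rightarrow> 'k) \<Rightarrow> (nat \<Rightarrow> 'k)) \<Rightarrow> ('k, 'a) fd_mod \<Rightarrow> bool"
  where
  "projective_cover A P f M \<longleftrightarrow> fg_projective A P \<and> f \<in> hom_set A P M \<and>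
     f ` carrier P = carrier M \<and>
     (\<forall>H. submodule H A P \<longrightarrow> f ` H = carrier M \<longrightarrow> H = carrier P)"

definition minimal_projective_presentation ::
  "('k, 'a) module \<Rightarrow> ('k, 'a) fd_mod \<Rightarrow> ((nat \<Rightarrow> 'k) \<Rightarrow> (nat \<Rightarrow> 'k)) \<Rightarrow>
   ('k, 'a) fd_mod \<Rightarrow> ((nat \<Rightarrow> 'k) \<Rightarrow> (nat \<Rightarrow> 'k)) \<Rightarrow> ('k, 'a) fd_mod \<Rightarrow> bool" where
  "minimal_projective_presentation A P1 f1 P0 f0 N \<longleftrightarrow>
     f1 \<in> hom_set A P1 P0 \<and> exact_at P1 f1 P0 f0 N \<and>
     projective_cover A P0 f0 N \<and>
     projective_cover A P1 f1 (sub_module P0 (f1 ` carrier P1))"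

text \<open>Right modules are left modules over the opposite algebra.  \<open>star A P\<close> is the right module
  \<open>Hom(P,A)\<close>, with \<open>(\<phi> a)(x) = \<phi>(x) a\<close>.\<close>

definition star :: "('k, 'a) module \<Rightarrow> ('a, 'm) module \<Rightarrow> ('a, 'm \<Rightarrow> 'a) module" where
  "star A P = \<lparr>carrier = hom_set A P (regular A), monoid.mult = undefined, one = undefined,
     ring.zero = \<zero>\<^bsub>Hom A P (regular A)\<^esub>, ring.add = ring.add (Hom A P (regular A)),
     smult = (\<lambda>a \<phi>. \<lambda>x\<in>carrier P. \<phi> x \<otimes>\<^bsub>A\<^esub> a)\<rparr>"

text \<open>The transpose \<open>Tr N\<close>, a right module: the cokernel of \<open>Hom(f1,A)\<close> for a chosen minimal
  projective presentation (every choice gives an isomorphic module).\<close>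

definition Tr :: "('k, 'a) module \<Rightarrow> ('k, 'a) fd_mod \<Rightarrow> ('a, ((nat \<Rightarrow> 'k) \<Rightarrow> 'a) set) module" where
  "Tr A N = (let (P1, f1, P0, f0) = (SOME (P1, f1, P0, f0).
        minimal_projective_presentation A P1 f1 P0 f0 N)
     in quot_module (star A P1) (precomp P1 f1 ` carrier (star A P0)))"

text \<open>The left \<open>A\<close>-module \<open>D Z = Hom_K(Z,K)\<close> of a right \<open>A\<close>-module \<open>Z\<close>, with
  \<open>(a \<phi>)(x) = \<phi>(x a)\<close>.\<close>

definition dual :: "'k ring \<Rightarrow> ('k, 'a) module \<Rightarrow> ('a, 'x) module \<Rightarrow> ('a, 'x \<Rightarrow> 'k) module" where
  "dual K A Z = (let H = Hom K (restrict_scalars (opposite A) Z) (regular K)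
     in \<lparr>carrier = carrier H, monoid.mult = undefined, one = undefined,
         ring.zero = \<zero>\<^bsub>H\<^esub>, ring.add = ring.add H,
         smult = (\<lambda>a \<phi>. \<lambda>x\<in>carrier Z. \<phi> (a \<odot>\<^bsub>Z\<^esub> x))\<rparr>)"

definition tau ::
  "'k ring \<Rightarrow> ('k, 'a) module \<Rightarrow> ('k, 'a) fd_mod \<Rightarrow> ('a, ((nat \<Rightarrow> 'k) \<Rightarrow> 'a) set \<Rightarrow> 'k) module" where
  "tau K A N = dual K A (Tr A N)"

definition tau_rigid :: "'k ring \<Rightarrow> ('k, 'a) module \<Rightarrow> ('k, 'a) fd_mod \<Rightarrow> bool" where
  "tau_rigid K A N \<longleftrightarrow> fg_module A N \<and>
     hom_set A N (tau K A N) = {\<zero>\<^bsub>Hom A N (tau K A N)\<^esub>}"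

definition CM_tau_tilting_free :: "'k ring \<Rightarrow> ('k, 'a) module \<Rightarrow> bool" where
  "CM_tau_tilting_free K A \<longleftrightarrow>
     (\<forall>N :: ('k, 'a) fd_mod. fg_module A N \<and> gorenstein_projective A N \<and> tau_rigid K A N \<longrightarrow>
        fg_projective A N)"

end

theory Submission
  imports Defs
begin

text \<open>
  The proof compares modules over \<open>\<Lambda>\<close> and over \<open>\<Gamma>\<close> by the functor \<open>F = Hom(E,-)\<close>. As \<open>E\<close> is a
  generator, \<open>F\<close> is fully faithful on all modules (\<open>F_faithful\<close>, \<open>F_full\<close>), and it restricts to
  an equivalence between \<open>add E\<close> and the finitely generated projective \<open>\<Gamma>\<close>-modules (\<open>F_proj_iff\<close>,
  \<open>proj_is_F\<close>). The two relative notions are exactly what becomes the two absolute notions under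
  \<open>F\<close>.

  Gorenstein projectivity: \<open>F\<close> turns the sequences in \<open>add E\<close> that are exact under \<open>Hom(E,-)\<close> and
  \<open>Hom(-,E)\<close> into the exact complexes of projective modules that are exact under \<open>Hom(-,\<Gamma>)\<close>, and
  every complex of the second kind arises in this way (\<open>E_gorenstein_projective_imp\<close>,
  \<open>E_gorenstein_projectiveI\<close>). Moreover every Gorenstein projective \<open>\<Gamma>\<close>-module, being a kernel of
  a map between projective modules, is isomorphic to some \<open>F M\<close> (\<open>gorenstein_projective_is_F\<close>).

  Rigidity: for a minimal projective presentation \<open>P1 \<rightarrow> P0 \<rightarrow> N \<rightarrow> 0\<close> the space \<open>Hom(N, \<tau> N)\<close> is
  dual to the cokernel of \<open>Hom(P0,N) \<rightarrow> Hom(P1,N)\<close> (\<open>tau_vanishing_iff_rigid\<close>). So \<open>\<tau>\<close>-rigidity is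
  the surjectivity of this map, and \<open>F\<close> identifies minimal \<open>add E\<close>-presentations of \<open>M\<close> with
  minimal projective presentations of \<open>F M\<close> (\<open>E_rigid_imp_presentation\<close>,
  \<open>presentation_imp_E_rigid\<close>).

  Hence the \<open>E\<close>-Gorenstein projective \<open>E\<close>-rigid modules \<open>M\<close> correspond to the Gorenstein
  projective \<open>\<tau>\<close>-rigid modules \<open>F M\<close>, and \<open>M\<close> lies in \<open>add E\<close> exactly when \<open>F M\<close> is projective.
  One condition of the theorem speaks of indecomposable modules and summands of \<open>E\<close>, the other of
  all modules. To pass between them, a module of finite length is decomposed into indecomposable
  ones, whose endomorphism rings are local by Fitting's lemma (\<open>indecomposable_summands_addE\<close>,
  \<open>indecomposable_addE_summand\<close>); and both Gorenstein projectivity and \<open>\<tau>\<close>-rigidity pass to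
  direct summands (\<open>gorenstein_projective_summand\<close>, \<open>rigid_retract\<close>). For Gorenstein projectivity
  the proof avoids infinite direct sums: the class of modules that are summands of Gorenstein
  projective ones up to projectives is closed under syzygies and cosyzygies, which suffices to
  build a complete resolution (\<open>gorenstein_projective_coinduct\<close>).
\<close>

section \<open>Linear maps and submodules\<close>

lemma left_moduleD:
  assumes "left_module A M"
  shows "ring A" "abelian_group M"
  using left_module.axioms[OF assms] by auto

lemma left_module_closed:
  assumes "left_module A M"
  shows "\<zero>\<^bsub>M\<^esub> \<in> carrier M"
    and "x \<in> carrier M \<Longrightarrow> y \<in> carrier M \<Longrightarrow> x \<oplus>\<^bsub>M\<^esub> y \<in> carrier M"
    and "x \<in> carrier M \<Longrightarrow> y \<in> carrier M \<Longrightarrow> x \<ominus>\<^bsub>M\<^esub> y \<in> carrier M"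
    and "x \<in> carrier M \<Longrightarrow> \<ominus>\<^bsub>M\<^esub> x \<in> carrier M"
    and "a \<in> carrier A \<Longrightarrow> x \<in> carrier M \<Longrightarrow> a \<odot>\<^bsub>M\<^esub> x \<in> carrier M"
proof -
  interpret abelian_group M using assms by (rule left_moduleD)
  show "\<zero>\<^bsub>M\<^esub> \<in> carrier M"
    "x \<in> carrier M \<Longrightarrow> y \<in> carrier M \<Longrightarrow> x \<oplus>\<^bsub>M\<^esub> y \<in> carrier M"
    "x \<in> carrier M \<Longrightarrow> y \<in> carrier M \<Longrightarrow> x \<ominus>\<^bsub>M\<^esub> y \<in> carrier M"
    "x \<in> carrier M \<Longrightarrow> \<ominus>\<^bsub>M\<^esub> x \<in> carrier M" by simp_all
  show "a \<in> carrier A \<Longrightarrow> x \<in> carrier M \<Longrightarrow> a \<odot>\<^bsub>M\<^esub> x \<in> carrier M"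
    by (rule left_module.smult_closed[OF assms])
qed

lemma left_module_smult_zero:
  assumes "left_module A M" "a \<in> carrier A"
  shows "a \<odot>\<^bsub>M\<^esub> \<zero>\<^bsub>M\<^esub> = \<zero>\<^bsub>M\<^esub>"
proof -
  interpret M: abelian_group M using assms(1) by (rule left_moduleD)
  have c: "a \<odot>\<^bsub>M\<^esub> \<zero>\<^bsub>M\<^esub> \<in> carrier M"
    by (rule left_module.smult_closed[OF assms]) simp
  have "a \<odot>\<^bsub>M\<^esub> (\<zero>\<^bsub>M\<^esub> \<oplus>\<^bsub>M\<^esub> \<zero>\<^bsub>M\<^esub>) = a \<odot>\<^bsub>M\<^esub> \<zero>\<^bsub>M\<^esub> \<oplus>\<^bsub>M\<^esub> a \<odot>\<^bsub>M\<^esub> \<zero>\<^bsub>M\<^esub>"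
    by (rule left_module.smult_r_distr[OF assms(1)]) (use assms in auto)
  then show ?thesis using c by simp
qed

lemma left_module_zero_smult:
  assumes "left_module A M" "x \<in> carrier M"
  shows "\<zero>\<^bsub>A\<^esub> \<odot>\<^bsub>M\<^esub> x = \<zero>\<^bsub>M\<^esub>"
proof -
  interpret M: abelian_group M using assms(1) by (rule left_moduleD)
  interpret A: ring A using assms(1) by (rule left_moduleD)
  have c: "\<zero>\<^bsub>A\<^esub> \<odot>\<^bsub>M\<^esub> x \<in> carrier M"
    by (rule left_module.smult_closed[OF assms(1)]) (use assms in auto)
  have "(\<zero>\<^bsub>A\<^esub> \<oplus>\<^bsub>A\<^esub> \<zero>\<^bsub>A\<^esub>) \<odot>\<^bsub>M\<^esub> x = \<zero>\<^bsub>A\<^esub> \<odot>\<^bsub>M\<^esub> x \<oplus>\<^bsub>M\<^esub> \<zero>\<^bsub>A\<^esub> \<odot>\<^bsub>M\<^esub> x"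
    by (rule left_module.smult_l_distr[OF assms(1)]) (use assms in auto)
  then show ?thesis using c by simp
qed

lemma left_module_neg:
  assumes "left_module A M" "x \<in> carrier M"
  shows "(\<ominus>\<^bsub>A\<^esub> \<one>\<^bsub>A\<^esub>) \<odot>\<^bsub>M\<^esub> x = \<ominus>\<^bsub>M\<^esub> x"
proof -
  interpret M: abelian_group M using assms(1) by (rule left_moduleD)
  interpret A: ring A using assms(1) by (rule left_moduleD)
  have c: "(\<ominus>\<^bsub>A\<^esub> \<one>\<^bsub>A\<^esub>) \<odot>\<^bsub>M\<^esub> x \<in> carrier M"
    by (rule left_module.smult_closed[OF assms(1)]) (use assms in auto)
  have "((\<ominus>\<^bsub>A\<^esub> \<one>\<^bsub>A\<^esub>) \<oplus>\<^bsub>A\<^esub> \<one>\<^bsub>A\<^esub>) \<odot>\<^bsub>M\<^esub> x = (\<ominus>\<^bsub>A\<^esub> \<one>\<^bsub>A\<^esub>) \<odot>\<^bsub>M\<^esub> x \<oplus>\<^bsub>M\<^esub> \<one>\<^bsub>A\<^esub> \<odot>\<^bsub>M\<^esub> x"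
    by (rule left_module.smult_l_distr[OF assms(1)]) (use assms in auto)
  then have "\<zero>\<^bsub>M\<^esub> = (\<ominus>\<^bsub>A\<^esub> \<one>\<^bsub>A\<^esub>) \<odot>\<^bsub>M\<^esub> x \<oplus>\<^bsub>M\<^esub> x"
    using assms by (simp add: A.l_neg left_module.smult_one left_module_zero_smult[OF assms])
  then show ?thesis using c assms by (metis M.minus_equality)
qed

text \<open>In contrast to the members of \<^const>\<open>hom_set\<close>, such a map may take any values outside the
  carrier.  So pointwise sums, composites and restrictions to submodules are again linear without
  being cut off.\<close>

definition lin :: "('a, 'b) ring_scheme \<Rightarrow> ('a, 'm) module \<Rightarrow> ('a, 'n) module \<Rightarrow> ('m \<Rightarrow> 'n) \<Rightarrow> bool"
  where "lin A M N f \<longleftrightarrow> left_module A M \<and> left_module A N \<and> f \<in> carrier M \<rightarrow> carrier N \<and>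
     (\<forall>x\<in>carrier M. \<forall>y\<in>carrier M. f (x \<oplus>\<^bsub>M\<^esub> y) = f x \<oplus>\<^bsub>N\<^esub> f y) \<and>
     (\<forall>a\<in>carrier A. \<forall>x\<in>carrier M. f (a \<odot>\<^bsub>M\<^esub> x) = a \<odot>\<^bsub>N\<^esub> f x)"

lemma linI:
  assumes "left_module A M" "left_module A N" "\<And>x. x \<in> carrier M \<Longrightarrow> f x \<in> carrier N"
    and "\<And>x y. x \<in> carrier M \<Longrightarrow> y \<in> carrier M \<Longrightarrow> f (x \<oplus>\<^bsub>M\<^esub> y) = f x \<oplus>\<^bsub>N\<^esub> f y"
    and "\<And>a x. a \<in> carrier A \<Longrightarrow> x \<in> carrier M \<Longrightarrow> f (a \<odot>\<^bsub>M\<^esub> x) = a \<odot>\<^bsub>N\<^esub> f x"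
  shows "lin A M N f"
  using assms by (auto simp: lin_def)

lemma linD:
  assumes "lin A M N f"
  shows "left_module A M" "left_module A N" "x \<in> carrier M \<Longrightarrow> f x \<in> carrier N"
    and "x \<in> carrier M \<Longrightarrow> y \<in> carrier M \<Longrightarrow> f (x \<oplus>\<^bsub>M\<^esub> y) = f x \<oplus>\<^bsub>N\<^esub> f y"
    and "a \<in> carrier A \<Longrightarrow> x \<in> carrier M \<Longrightarrow> f (a \<odot>\<^bsub>M\<^esub> x) = a \<odot>\<^bsub>N\<^esub> f x"
    and "abelian_group M" "abelian_group N" "ring A"
  using assms by (auto simp: lin_def dest: left_moduleD)

lemma hom_set_lin: "f \<in> hom_set A M N \<Longrightarrow> left_module A M \<Longrightarrow> left_module A N \<Longrightarrow> lin A M N f"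
  by (auto simp: lin_def Hom_def PiE_def)

lemma hom_set_eqI: "f \<in> hom_set A M N \<Longrightarrow> g \<in> hom_set A M N \<Longrightarrow> (\<And>x. x \<in> carrier M \<Longrightarrow> f x = g x) \<Longrightarrow> f = g"
  by (auto simp: Hom_def intro: PiE_ext)

lemma lin_hom_set: "lin A M N f \<Longrightarrow> restrict f (carrier M) \<in> hom_set A M N"
  using left_module_closed[of A M] unfolding lin_def Hom_def by auto

lemma lin_zero:
  assumes "lin A M N f"
  shows "f \<zero>\<^bsub>M\<^esub> = \<zero>\<^bsub>N\<^esub>"
proof -
  interpret M: abelian_group M using assms by (rule linD)
  interpret N: abelian_group N using assms by (rule linD)
  have "f (\<zero>\<^bsub>M\<^esub> \<oplus>\<^bsub>M\<^esub> \<zero>\<^bsub>M\<^esub>) = f \<zero>\<^bsub>M\<^esub> \<oplus>\<^bsub>N\<^esub> f \<zero>\<^bsub>M\<^esub>" by (rule linD(4)[OF assms]) auto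
  moreover have "f \<zero>\<^bsub>M\<^esub> \<in> carrier N" by (rule linD(3)[OF assms]) simp
  ultimately show ?thesis by simp
qed

lemma lin_neg:
  assumes "lin A M N f" "x \<in> carrier M"
  shows "f (\<ominus>\<^bsub>M\<^esub> x) = \<ominus>\<^bsub>N\<^esub> f x"
proof -
  interpret A: ring A using assms(1) by (rule linD)
  show ?thesis
    using assms linD(3,5)[OF assms(1)] by (metis A.a_inv_closed A.one_closed left_module_neg linD(1,2))
qed

lemma lin_minus:
  assumes "lin A M N f" "x \<in> carrier M" "y \<in> carrier M"
  shows "f (x \<ominus>\<^bsub>M\<^esub> y) = f x \<ominus>\<^bsub>N\<^esub> f y"
proof -
  interpret M: abelian_group M using assms(1) by (rule linD)
  show ?thesis using assms by (simp add: a_minus_def linD(4)[OF assms(1)] lin_neg)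
qed

lemma lin_injI:
  assumes f: "lin A M N f" and k: "\<And>x. x \<in> carrier M \<Longrightarrow> f x = \<zero>\<^bsub>N\<^esub> \<Longrightarrow> x = \<zero>\<^bsub>M\<^esub>"
  shows "inj_on f (carrier M)"
proof (rule inj_onI)
  interpret M: abelian_group M using f by (rule linD)
  interpret N: abelian_group N using f by (rule linD)
  fix x y assume xy: "x \<in> carrier M" "y \<in> carrier M" "f x = f y"
  then have "f (x \<ominus>\<^bsub>M\<^esub> y) = \<zero>\<^bsub>N\<^esub>"
    using linD(3)[OF f xy(2)] by (simp add: lin_minus[OF f]) (simp add: a_minus_def N.r_neg)
  then have "x \<ominus>\<^bsub>M\<^esub> y = \<zero>\<^bsub>M\<^esub>" using k xy by simp
  moreover have "(x \<ominus>\<^bsub>M\<^esub> y) \<oplus>\<^bsub>M\<^esub> y = x" using xy by (simp add: a_minus_def M.a_assoc M.l_neg)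
  ultimately show "x = y" using xy by simp
qed

lemma lin_cong: "lin A M N f \<Longrightarrow> (\<And>x. x \<in> carrier M \<Longrightarrow> g x = f x) \<Longrightarrow> lin A M N g"
  using left_module_closed[of A M] unfolding lin_def by auto

lemma lin_restrict: "lin A M N f \<Longrightarrow> lin A M N (restrict f (carrier M))"
  by (erule lin_cong) auto

lemma lin_id: "left_module A M \<Longrightarrow> lin A M M (\<lambda>x. x)"
  by (auto simp: lin_def)

lemma lin_compose: "lin A M N f \<Longrightarrow> lin A N L g \<Longrightarrow> lin A M L (\<lambda>x. g (f x))"
  by (auto simp: lin_def Pi_iff)

lemma lin_0:
  assumes "left_module A M" "left_module A N"
  shows "lin A M N (\<lambda>x. \<zero>\<^bsub>N\<^esub>)"
proof -
  interpret N: abelian_group N using assms(2) by (rule left_moduleD)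
  show ?thesis by (rule linI[OF assms]) (auto simp: left_module_smult_zero[OF assms(2)])
qed

lemma lin_plus:
  assumes "lin A M N f" "lin A M N g"
  shows "lin A M N (\<lambda>x. f x \<oplus>\<^bsub>N\<^esub> g x)"
proof -
  interpret N: abelian_group N using assms(1) by (rule linD)
  show ?thesis
    using linD[OF assms(1)] linD[OF assms(2)] by (intro linI) (simp_all add: N.a_ac left_module.smult_r_distr)
qed

lemma lin_uminus:
  assumes "lin A M N f"
  shows "lin A M N (\<lambda>x. \<ominus>\<^bsub>N\<^esub> f x)"
proof -
  interpret N: abelian_group N using assms(1) by (rule linD)
  have n: "lin A N N (\<lambda>x. \<ominus>\<^bsub>N\<^esub> x)"
  proof (rule linI)
    fix a x assume a: "a \<in> carrier A" "x \<in> carrier N"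
    have "\<zero>\<^bsub>N\<^esub> = a \<odot>\<^bsub>N\<^esub> (x \<oplus>\<^bsub>N\<^esub> \<ominus>\<^bsub>N\<^esub> x)"
      using a by (simp add: N.r_neg left_module_smult_zero[OF linD(2)[OF assms]])
    also have "\<dots> = a \<odot>\<^bsub>N\<^esub> x \<oplus>\<^bsub>N\<^esub> a \<odot>\<^bsub>N\<^esub> (\<ominus>\<^bsub>N\<^esub> x)"
      by (rule left_module.smult_r_distr[OF linD(2)[OF assms]]) (use a in auto)
    finally show "\<ominus>\<^bsub>N\<^esub> (a \<odot>\<^bsub>N\<^esub> x) = a \<odot>\<^bsub>N\<^esub> \<ominus>\<^bsub>N\<^esub> x"
      using a by (metis N.a_inv_closed N.add.inv_equality N.a_comm left_module.smult_closed[OF linD(2)[OF assms]])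
  qed (use linD(2)[OF assms] in \<open>auto simp: N.minus_add N.a_comm\<close>)
  show ?thesis by (rule lin_compose[OF assms n])
qed

lemma lin_diff: "lin A M N f \<Longrightarrow> lin A M N g \<Longrightarrow> lin A M N (\<lambda>x. f x \<ominus>\<^bsub>N\<^esub> g x)"
  unfolding a_minus_def by (intro lin_plus lin_uminus)

lemma lin_funpow: "lin A M M f \<Longrightarrow> lin A M M (f ^^ n)"
proof (induction n)
  case 0 then show ?case using lin_id[OF linD(1)] by (simp add: id_def)
next
  case (Suc n) then show ?case using lin_compose[of A M M "f ^^ n" M f] by (simp add: comp_def)
qed

lemma lin_inverse:
  assumes "lin A M N f" "bij_betw f (carrier M) (carrier N)"
  shows "lin A N M (inv_into (carrier M) f)"
proof -
  let ?g = "inv_into (carrier M) f"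
  interpret M: abelian_group M using assms(1) by (rule linD)
  have g: "?g y \<in> carrier M" "f (?g y) = y" if "y \<in> carrier N" for y
    using assms(2) that by (auto simp: bij_betw_def inv_into_into f_inv_into_f)
  have i: "?g (f x) = x" if "x \<in> carrier M" for x
    using assms(2) that by (auto simp: bij_betw_def)
  show ?thesis
  proof (rule linI)
    fix x y assume xy: "x \<in> carrier N" "y \<in> carrier N"
    then have "f (?g x \<oplus>\<^bsub>M\<^esub> ?g y) = x \<oplus>\<^bsub>N\<^esub> y"
      using g by (simp add: linD(4)[OF assms(1)])
    then show "?g (x \<oplus>\<^bsub>N\<^esub> y) = ?g x \<oplus>\<^bsub>M\<^esub> ?g y"
      using i[of "?g x \<oplus>\<^bsub>M\<^esub> ?g y"] g xy by simp
  next
    fix a x assume ax: "a \<in> carrier A" "x \<in> carrier N"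
    then have "f (a \<odot>\<^bsub>M\<^esub> ?g x) = a \<odot>\<^bsub>N\<^esub> x"
      using g by (simp add: linD(5)[OF assms(1)])
    then show "?g (a \<odot>\<^bsub>N\<^esub> x) = a \<odot>\<^bsub>M\<^esub> ?g x"
      using i[of "a \<odot>\<^bsub>M\<^esub> ?g x"] g ax left_module_closed(5)[OF linD(1)[OF assms(1)]] by simp
  qed (use assms(1) g linD(1,2)[OF assms(1)] in auto)
qed

lemma submoduleI:
  assumes "left_module A M" "H \<subseteq> carrier M" "\<zero>\<^bsub>M\<^esub> \<in> H"
    and "\<And>x y. x \<in> H \<Longrightarrow> y \<in> H \<Longrightarrow> x \<oplus>\<^bsub>M\<^esub> y \<in> H"
    and "\<And>a x. a \<in> carrier A \<Longrightarrow> x \<in> H \<Longrightarrow> a \<odot>\<^bsub>M\<^esub> x \<in> H"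
  shows "submodule H A M"
proof -
  interpret M: abelian_group M using assms(1) by (rule left_moduleD)
  interpret A: ring A using assms(1) by (rule left_moduleD)
  have "\<ominus>\<^bsub>M\<^esub> x \<in> H" if "x \<in> H" for x
    using assms(2) assms(5)[OF _ that] that left_module_neg[OF assms(1)] by (metis A.a_inv_closed A.one_closed subsetD)
  then show ?thesis
    using assms by (intro submodule.intro subgroup.intro submodule_axioms.intro) (auto simp: a_inv_def)
qed

lemma submoduleD:
  assumes "submodule H A M"
  shows "H \<subseteq> carrier M" "\<zero>\<^bsub>M\<^esub> \<in> H" "x \<in> H \<Longrightarrow> y \<in> H \<Longrightarrow> x \<oplus>\<^bsub>M\<^esub> y \<in> H"
    and "a \<in> carrier A \<Longrightarrow> x \<in> H \<Longrightarrow> a \<odot>\<^bsub>M\<^esub> x \<in> H" "x \<in> H \<Longrightarrow> x \<in> carrier M"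
    and "x \<in> H \<Longrightarrow> \<ominus>\<^bsub>M\<^esub> x \<in> H"  "x \<in> H \<Longrightarrow> y \<in> H \<Longrightarrow> x \<ominus>\<^bsub>M\<^esub> y \<in> H"
proof -
  have s: "subgroup H (add_monoid M)" using assms by (simp add: submodule_def)
  show "H \<subseteq> carrier M" using subgroup.subset[OF s] by simp
  show "x \<in> H \<Longrightarrow> x \<in> carrier M" using subgroup.subset[OF s] by auto
  show "\<zero>\<^bsub>M\<^esub> \<in> H" using subgroup.one_closed[OF s] by simp
  show p: "x \<in> H \<Longrightarrow> y \<in> H \<Longrightarrow> x \<oplus>\<^bsub>M\<^esub> y \<in> H" for x y using subgroup.m_closed[OF s] by simp
  show n: "x \<in> H \<Longrightarrow> \<ominus>\<^bsub>M\<^esub> x \<in> H" for x using subgroup.m_inv_closed[OF s] by (simp add: a_inv_def)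
  show "x \<in> H \<Longrightarrow> y \<in> H \<Longrightarrow> x \<ominus>\<^bsub>M\<^esub> y \<in> H" by (simp add: a_minus_def n p)
  show "a \<in> carrier A \<Longrightarrow> x \<in> H \<Longrightarrow> a \<odot>\<^bsub>M\<^esub> x \<in> H" by (rule submodule.smult_closed[OF assms])
qed

lemma submodule_carrier: "left_module A M \<Longrightarrow> submodule (carrier M) A M"
  by (rule submoduleI) (auto intro: left_module_closed)

lemma submodule_zero:
  assumes "left_module A M"
  shows "submodule {\<zero>\<^bsub>M\<^esub>} A M"
proof -
  interpret M: abelian_group M using assms by (rule left_moduleD)
  show ?thesis by (rule submoduleI[OF assms]) (auto simp: left_module_smult_zero[OF assms])
qed

lemma submodule_Int: "left_module A M \<Longrightarrow> submodule H A M \<Longrightarrow> submodule H' A M \<Longrightarrow> submodule (H \<inter> H') A M"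
  by (rule submoduleI) (auto dest: submoduleD)

lemma submodule_image:
  assumes "lin A M N f" "submodule H A M"
  shows "submodule (f ` H) A N"
proof (rule submoduleI)
  show "\<zero>\<^bsub>N\<^esub> \<in> f ` H" using lin_zero[OF assms(1)] submoduleD(2)[OF assms(2)] by (metis imageI)
  show "x \<oplus>\<^bsub>N\<^esub> y \<in> f ` H" if "x \<in> f ` H" "y \<in> f ` H" for x y
  proof -
    obtain u v where "u \<in> H" "v \<in> H" "x = f u" "y = f v" using \<open>x \<in> f ` H\<close> \<open>y \<in> f ` H\<close> by auto
    then show ?thesis
      using linD(4)[OF assms(1), of u v] submoduleD(3,5)[OF assms(2)] by (intro image_eqI[of _ _ "u \<oplus>\<^bsub>M\<^esub> v"]) auto
  qed
  show "a \<odot>\<^bsub>N\<^esub> x \<in> f ` H" if "a \<in> carrier A" "x \<in> f ` H" for a x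
  proof -
    obtain u where "u \<in> H" "x = f u" using \<open>x \<in> f ` H\<close> by auto
    then show ?thesis
      using linD(5)[OF assms(1), of a u] submoduleD(4,5)[OF assms(2)] \<open>a \<in> carrier A\<close>
      by (intro image_eqI[of _ _ "a \<odot>\<^bsub>M\<^esub> u"]) auto
  qed
qed (use linD(2,3)[OF assms(1)] submoduleD(5)[OF assms(2)] in auto)

lemma submodule_vimage:
  assumes "lin A M N f" "submodule H A N"
  shows "submodule {x \<in> carrier M. f x \<in> H} A M"
proof -
  interpret M: abelian_group M using assms(1) by (rule linD)
  show ?thesis
    by (rule submoduleI)
      (use linD[OF assms(1)] submoduleD[OF assms(2)] in
        \<open>auto simp: lin_zero[OF assms(1)] left_module.smult_closed[OF linD(1)[OF assms(1)]]\<close>)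
qed

lemma submodule_kernel:
  assumes "lin A M N f"
  shows "submodule {x \<in> carrier M. f x = \<zero>\<^bsub>N\<^esub>} A M"
  using submodule_vimage[OF assms submodule_zero[OF linD(2)[OF assms]]] by simp

lemma left_module_sub:
  assumes "left_module A M" "submodule H A M"
  shows "left_module A (sub_module M H)"
proof -
  interpret M: abelian_group M using assms(1) by (rule left_moduleD)
  interpret A: ring A using assms(1) by (rule left_moduleD)
  note c = submoduleD(5)[OF assms(2)]
  have g: "abelian_group (sub_module M H)"
  proof (rule abelian_groupI)
    fix x assume "x \<in> carrier (sub_module M H)"
    then show "\<exists>y\<in>carrier (sub_module M H). y \<oplus>\<^bsub>sub_module M H\<^esub> x = \<zero>\<^bsub>sub_module M H\<^esub>"
      by (intro bexI[of _ "\<ominus>\<^bsub>M\<^esub> x"]) (auto simp: M.l_neg submoduleD(6)[OF assms(2)] c)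
  qed (use c submoduleD[OF assms(2)] in \<open>auto simp: M.a_ac\<close>)
  show ?thesis
    by (intro left_module.intro left_module_axioms.intro g A.ring_axioms)
      (use c submoduleD[OF assms(2)] in \<open>auto simp: left_module.smult_one[OF assms(1)]
        left_module.smult_l_distr[OF assms(1)] left_module.smult_r_distr[OF assms(1)]
        left_module.smult_assoc1[OF assms(1)]\<close>)
qed

lemma lin_sub_incl: "left_module A M \<Longrightarrow> submodule H A M \<Longrightarrow> lin A (sub_module M H) M (\<lambda>x. x)"
  using left_module_sub[of A M H] submoduleD[of H A M] by (auto simp: lin_def)

lemma lin_into_sub:
  assumes "lin A L M f" "submodule H A M" "f ` carrier L \<subseteq> H"
  shows "lin A L (sub_module M H) f"
  using left_module_sub[of A M H] assms by (auto simp: lin_def)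

lemma submodule_sub_iff:
  assumes "left_module A M" "submodule H A M"
  shows "submodule H' A (sub_module M H) \<longleftrightarrow> submodule H' A M \<and> H' \<subseteq> H"
proof
  assume s: "submodule H' A (sub_module M H)"
  show "submodule H' A M \<and> H' \<subseteq> H"
    using submoduleD[OF s] submoduleD(1)[OF assms(2)] by (auto intro!: submoduleI[OF assms(1)])
next
  assume s: "submodule H' A M \<and> H' \<subseteq> H"
  then show "submodule H' A (sub_module M H)"
    using submoduleD[of H' A M] by (intro submoduleI[OF left_module_sub[OF assms]]) auto
qed

lemma sub_module_carrier [simp]: "sub_module M (carrier M) = M"
  by (cases M) simp

section \<open>Finite generation and finite length\<close>

definition gen :: "('a, 'b) ring_scheme \<Rightarrow> ('a, 'm) module \<Rightarrow> 'm set \<Rightarrow> 'm set" where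
  "gen R M S = \<Inter>{H. submodule H R M \<and> S \<subseteq> H}"

lemma gen_incl: "S \<subseteq> gen R M S"
  by (auto simp: gen_def)

lemma gen_least: "submodule H R M \<Longrightarrow> S \<subseteq> H \<Longrightarrow> gen R M S \<subseteq> H"
  by (auto simp: gen_def)

lemma submodule_gen:
  assumes "left_module R M" "S \<subseteq> carrier M"
  shows "submodule (gen R M S) R M"
proof (rule submoduleI[OF assms(1)])
  show "gen R M S \<subseteq> carrier M" by (rule gen_least[OF submodule_carrier]) (use assms in auto)
qed (auto simp: gen_def submoduleD)

lemma gen_mono: "left_module R M \<Longrightarrow> T \<subseteq> carrier M \<Longrightarrow> S \<subseteq> T \<Longrightarrow> gen R M S \<subseteq> gen R M T"
  by (rule gen_least[OF submodule_gen]) (assumption | erule subset_trans[OF _ gen_incl])+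

lemma fg_module_iff_gen:
  "fg_module R M \<longleftrightarrow> left_module R M \<and> (\<exists>S. finite S \<and> S \<subseteq> carrier M \<and> gen R M S = carrier M)"
proof -
  have "(\<forall>H. submodule H R M \<longrightarrow> S \<subseteq> H \<longrightarrow> H = carrier M) \<longleftrightarrow> gen R M S = carrier M" (is "?l \<longleftrightarrow> ?r")
    if "left_module R M" "S \<subseteq> carrier M" for S
  proof
    assume ?l then show ?r using submodule_gen[OF that] gen_incl[of S R M] by simp
  next
    assume r: ?r
    show ?l
    proof (intro allI impI equalityI)
      fix H assume H: "submodule H R M" "S \<subseteq> H"
      show "H \<subseteq> carrier M" by (rule submoduleD(1)[OF H(1)])
      show "carrier M \<subseteq> H" using gen_least[OF H] r by simp
    qed
  qed
  then show ?thesis unfolding fg_module_def fin_gen_def by metis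
qed

lemma fg_moduleE:
  assumes "fg_module R M"
  obtains S where "left_module R M" "finite S" "S \<subseteq> carrier M"
    and "\<And>H. submodule H R M \<Longrightarrow> S \<subseteq> H \<Longrightarrow> H = carrier M"
  using assms unfolding fg_module_def fin_gen_def by metis

lemma fg_moduleI:
  assumes "left_module R M" "finite S" "S \<subseteq> carrier M"
    and "\<And>H. submodule H R M \<Longrightarrow> S \<subseteq> H \<Longrightarrow> carrier M \<subseteq> H"
  shows "fg_module R M"
proof -
  have "H = carrier M" if "submodule H R M" "S \<subseteq> H" for H
    using submoduleD(1)[OF that(1)] assms(4)[OF that] by simp
  then show ?thesis using assms(1-3) unfolding fg_module_def fin_gen_def by metis
qed

lemma fg_left: "fg_module R M \<Longrightarrow> left_module R M"
  by (simp add: fg_module_def)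

text \<open>Finite length, in the form in which it gets used: the length of a submodule is a natural
  number that strictly increases along proper inclusions.  So every nonempty family of submodules
  has a minimal and a maximal member.\<close>

definition strict_measure :: "('a, 'b) ring_scheme \<Rightarrow> ('a, 'm) module \<Rightarrow> ('m set \<Rightarrow> nat) \<Rightarrow> bool" where
  "strict_measure R M \<mu> \<longleftrightarrow>
     (\<forall>H H'. submodule H R M \<longrightarrow> submodule H' R M \<longrightarrow> H \<subset> H' \<longrightarrow> \<mu> H < \<mu> H')"

definition fin_len :: "('a, 'b) ring_scheme \<Rightarrow> ('a, 'm) module \<Rightarrow> bool" where
  "fin_len R M \<longleftrightarrow> left_module R M \<and> (\<exists>\<mu>. strict_measure R M \<mu>)"

lemma fin_len_left: "fin_len R M \<Longrightarrow> left_module R M"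
  by (simp add: fin_len_def)

lemma strict_measureD: "strict_measure R M \<mu> \<Longrightarrow> submodule H R M \<Longrightarrow> submodule H' R M \<Longrightarrow> H \<subset> H' \<Longrightarrow> \<mu> H < \<mu> H'"
  by (auto simp: strict_measure_def)

lemma strict_measure_le: "strict_measure R M \<mu> \<Longrightarrow> submodule H R M \<Longrightarrow> submodule H' R M \<Longrightarrow> H \<subseteq> H' \<Longrightarrow> \<mu> H \<le> \<mu> H'"
  by (metis less_imp_le order_refl psubsetI strict_measureD)

lemma strict_measure_eq: "strict_measure R M \<mu> \<Longrightarrow> submodule H R M \<Longrightarrow> submodule H' R M \<Longrightarrow> H \<subseteq> H' \<Longrightarrow> \<mu> H' \<le> \<mu> H \<Longrightarrow> H = H'"
  by (metis leD psubsetI strict_measureD)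

lemma fin_len_sub:
  assumes "fin_len R M" "submodule H R M"
  shows "fin_len R (sub_module M H)"
proof -
  obtain \<mu> where m: "strict_measure R M \<mu>" and l: "left_module R M" using assms(1) by (auto simp: fin_len_def)
  have "strict_measure R (sub_module M H) \<mu>"
    using m unfolding strict_measure_def submodule_sub_iff[OF l assms(2)] by simp
  then show ?thesis using left_module_sub[OF l assms(2)] by (auto simp: fin_len_def)
qed

lemma fin_len_max:
  assumes "fin_len R M" "P H0" "\<And>H. P H \<Longrightarrow> submodule H R M"
  obtains H where "P H" "\<And>H'. P H' \<Longrightarrow> H \<subseteq> H' \<Longrightarrow> H' = H"
proof -
  obtain \<mu> where m: "strict_measure R M \<mu>" and l: "left_module R M" using assms(1) by (auto simp: fin_len_def)
  have b: "\<forall>H. P H \<longrightarrow> \<mu> H \<le> \<mu> (carrier M)"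
    using strict_measure_le[OF m assms(3) submodule_carrier[OF l] submoduleD(1)[OF assms(3)]] by simp
  have "\<exists>H. P H \<and> (\<forall>H'. P H' \<longrightarrow> \<mu> H' \<le> \<mu> H)"
    by (rule ex_has_greatest_nat[of P H0 \<mu> "Suc (\<mu> (carrier M))"]) (use assms(2) b in \<open>auto simp: less_Suc_eq_le\<close>)
  then obtain H where "P H" "\<And>H'. P H' \<Longrightarrow> \<mu> H' \<le> \<mu> H" by metis
  then show ?thesis using that strict_measure_eq[OF m] assms(3) by metis
qed

text \<open>A maximal finitely generated submodule contains every element.\<close>

lemma fin_len_fg:
  assumes "fin_len R M"
  shows "fg_module R M"
proof -
  have l: "left_module R M" using assms by (rule fin_len_left)
  let ?P = "\<lambda>H. \<exists>S. finite S \<and> S \<subseteq> carrier M \<and> H = gen R M S"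
  obtain H where H: "?P H" and m: "\<And>H'. ?P H' \<Longrightarrow> H \<subseteq> H' \<Longrightarrow> H' = H"
    by (rule fin_len_max[OF assms, of ?P "gen R M {}"]) (use submodule_gen[OF l] in auto)
  obtain S where S: "finite S" "S \<subseteq> carrier M" "H = gen R M S" using H by blast
  have "x \<in> H" if x: "x \<in> carrier M" for x
  proof -
    have "gen R M (insert x S) = H"
      by (rule m) (use S x gen_mono[OF l, of "insert x S" S] in \<open>auto intro!: exI[of _ "insert x S"]\<close>)
    then show ?thesis using gen_incl[of "insert x S" R M] by auto
  qed
  then have "gen R M S = carrier M" using S submoduleD(1)[OF submodule_gen[OF l S(2)]] by auto
  then show ?thesis using l S fg_module_iff_gen by blast
qed

lemma gen_insert:
  assumes l: "left_module R M" and b: "b \<in> carrier M" and S: "S \<subseteq> carrier M"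
  shows "gen R M (insert b S) = {c \<odot>\<^bsub>M\<^esub> b \<oplus>\<^bsub>M\<^esub> v | c v. c \<in> carrier R \<and> v \<in> gen R M S}" (is "_ = ?G")
proof
  interpret M: abelian_group M using l by (rule left_moduleD)
  interpret R: ring R using l by (rule left_moduleD)
  note V = submodule_gen[OF l S]
  note lc = left_module_closed[OF l] submoduleD[OF V] left_module_zero_smult[OF l b]
  have z: "x \<in> gen R M S \<Longrightarrow> x \<in> ?G" for x
    using lc by (intro CollectI exI[of _ "\<zero>\<^bsub>R\<^esub>"] exI[of _ x]) auto
  show "gen R M (insert b S) \<subseteq> ?G"
  proof (rule gen_least)
    show "submodule ?G R M"
    proof (rule submoduleI[OF l])
      show "\<zero>\<^bsub>M\<^esub> \<in> ?G" using z lc by blast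
    next
      fix x y assume "x \<in> ?G" "y \<in> ?G"
      then obtain c v d w where e: "c \<in> carrier R" "d \<in> carrier R" "v \<in> gen R M S" "w \<in> gen R M S"
        "x = c \<odot>\<^bsub>M\<^esub> b \<oplus>\<^bsub>M\<^esub> v" "y = d \<odot>\<^bsub>M\<^esub> b \<oplus>\<^bsub>M\<^esub> w" by auto
      then have "x \<oplus>\<^bsub>M\<^esub> y = (c \<oplus>\<^bsub>R\<^esub> d) \<odot>\<^bsub>M\<^esub> b \<oplus>\<^bsub>M\<^esub> (v \<oplus>\<^bsub>M\<^esub> w)"
        using b lc by (simp add: left_module.smult_l_distr[OF l] M.a_ac)
      moreover have "c \<oplus>\<^bsub>R\<^esub> d \<in> carrier R" "v \<oplus>\<^bsub>M\<^esub> w \<in> gen R M S" using e lc by auto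
      ultimately show "x \<oplus>\<^bsub>M\<^esub> y \<in> ?G" by blast
    next
      fix a x assume a: "a \<in> carrier R" and "x \<in> ?G"
      then obtain c v where e: "c \<in> carrier R" "v \<in> gen R M S" "x = c \<odot>\<^bsub>M\<^esub> b \<oplus>\<^bsub>M\<^esub> v" by auto
      then have "a \<odot>\<^bsub>M\<^esub> x = (a \<otimes>\<^bsub>R\<^esub> c) \<odot>\<^bsub>M\<^esub> b \<oplus>\<^bsub>M\<^esub> (a \<odot>\<^bsub>M\<^esub> v)"
        using a b lc by (simp add: left_module.smult_r_distr[OF l] left_module.smult_assoc1[OF l])
      moreover have "a \<otimes>\<^bsub>R\<^esub> c \<in> carrier R" "a \<odot>\<^bsub>M\<^esub> v \<in> gen R M S" using e a lc by auto
      ultimately show "a \<odot>\<^bsub>M\<^esub> x \<in> ?G" by blast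
    qed (use b lc in auto)
    have "b \<in> ?G"
      using lc b left_module.smult_one[OF l b] by (intro CollectI exI[of _ "\<one>\<^bsub>R\<^esub>"] exI[of _ "\<zero>\<^bsub>M\<^esub>"]) auto
    then show "insert b S \<subseteq> ?G" using z gen_incl[of S R M] by blast
  qed
  have I: "submodule (gen R M (insert b S)) R M" by (rule submodule_gen[OF l]) (use b S in auto)
  have "b \<in> gen R M (insert b S)" using gen_incl by fastforce
  moreover have "gen R M S \<subseteq> gen R M (insert b S)" by (rule gen_mono[OF l]) (use b S in auto)
  ultimately show "?G \<subseteq> gen R M (insert b S)" using submoduleD(3,4)[OF I] by blast
qed

text \<open>For the subspaces of the span of a finite set, count the elements of the set at which the
  subspace contains a vector with leading term there.  By row reduction two nested subspaces with the
  same leading terms are equal; the finite set need not be linearly independent.\<close>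

lemma span_measure:
  assumes K: "field K" and l: "left_module K V" and "finite S" "S \<subseteq> carrier V"
  shows "\<exists>\<mu>::'v set \<Rightarrow> nat. \<forall>H H'. submodule H K V \<longrightarrow> submodule H' K V \<longrightarrow> H \<subset> H' \<longrightarrow> H' \<subseteq> gen K V S \<longrightarrow> \<mu> H < \<mu> H'"
  using assms(3,4)
proof (induction S rule: finite_induct)
  case empty
  have "gen K V {} \<subseteq> {\<zero>\<^bsub>V\<^esub>}" by (rule gen_least[OF submodule_zero[OF l]]) auto
  then have "\<not> (submodule H K V \<and> H \<subset> H' \<and> H' \<subseteq> gen K V {})" for H H'
    using submoduleD(2)[of H K V] by blast
  then show ?case by blast
next
  case (insert b S)
  interpret K: field K by (rule K)
  interpret V: abelian_group V using l by (rule left_moduleD)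
  have b: "b \<in> carrier V" and S: "S \<subseteq> carrier V" using insert.prems by auto
  let ?U = "gen K V S"
  have U: "submodule ?U K V" by (rule submodule_gen[OF l S])
  obtain \<mu> :: "'v set \<Rightarrow> nat" where \<mu>: "\<And>H H'. submodule H K V \<Longrightarrow> submodule H' K V \<Longrightarrow> H \<subset> H' \<Longrightarrow> H' \<subseteq> ?U \<Longrightarrow> \<mu> H < \<mu> H'"
    using insert.IH[OF S] by blast
  show ?case
  \<comment> \<open>The second summand records whether \<open>H\<close> leaves the span of \<open>S\<close>.\<close>
  proof (intro exI[of _ "\<lambda>H. \<mu> (H \<inter> ?U) + (if H \<subseteq> ?U then 0 else 1)"] allI impI)
    fix H H' assume H: "submodule H K V" and H': "submodule H' K V" and lt: "H \<subset> H'"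
      and sub: "H' \<subseteq> gen K V (insert b S)"
    show "\<mu> (H \<inter> ?U) + (if H \<subseteq> ?U then 0 else 1) < \<mu> (H' \<inter> ?U) + (if H' \<subseteq> ?U then 0 else 1)"
    proof (cases "H \<inter> ?U = H' \<inter> ?U")
      case False
      then have "\<mu> (H \<inter> ?U) < \<mu> (H' \<inter> ?U)"
        by (intro \<mu> submodule_Int[OF l] H H' U) (use lt in auto)
      then show ?thesis using lt by auto
    next
      case True
      have "H \<subseteq> ?U"
      proof (rule ccontr)
        assume "\<not> H \<subseteq> ?U"
        then obtain h where h: "h \<in> H" "h \<notin> ?U" by auto
        then have "h \<in> gen K V (insert b S)" using lt sub by auto
        then obtain c v where cv: "c \<in> carrier K" "v \<in> ?U" "h = c \<odot>\<^bsub>V\<^esub> b \<oplus>\<^bsub>V\<^esub> v"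
          unfolding gen_insert[OF l b S] by auto
        note cl = left_module_closed[OF l] submoduleD[OF U] submoduleD[OF H] submoduleD[OF H']
        have c0: "c \<noteq> \<zero>\<^bsub>K\<^esub>" using cv h b cl by (auto simp: left_module_zero_smult[OF l])
        have ic: "inv\<^bsub>K\<^esub> c \<in> carrier K" "inv\<^bsub>K\<^esub> c \<otimes>\<^bsub>K\<^esub> c = \<one>\<^bsub>K\<^esub>"
          using c0 cv by (auto simp: K.field_Units)
        have bb: "inv\<^bsub>K\<^esub> c \<odot>\<^bsub>V\<^esub> h = b \<oplus>\<^bsub>V\<^esub> inv\<^bsub>K\<^esub> c \<odot>\<^bsub>V\<^esub> v"
          using cv ic b cl by (simp add: left_module.smult_r_distr[OF l] left_module.smult_one[OF l]
            left_module.smult_assoc1[OF l, symmetric])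
        define w where "w = inv\<^bsub>K\<^esub> c \<odot>\<^bsub>V\<^esub> v"
        have w: "w \<in> ?U" "b \<oplus>\<^bsub>V\<^esub> w \<in> H" using bb cl ic cv h(1) by (auto simp: w_def simp flip: bb)
        have "y \<in> H" if y: "y \<in> H'" for y
        proof -
          obtain d u where du: "d \<in> carrier K" "u \<in> ?U" "y = d \<odot>\<^bsub>V\<^esub> b \<oplus>\<^bsub>V\<^esub> u"
            using y sub unfolding gen_insert[OF l b S] by auto
          have "w \<in> carrier V" "u \<in> carrier V" "d \<odot>\<^bsub>V\<^esub> b \<in> carrier V" "d \<odot>\<^bsub>V\<^esub> w \<in> carrier V" using cl w du b by auto
          then have "y \<ominus>\<^bsub>V\<^esub> d \<odot>\<^bsub>V\<^esub> (b \<oplus>\<^bsub>V\<^esub> w) = u \<ominus>\<^bsub>V\<^esub> d \<odot>\<^bsub>V\<^esub> w"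
            using du b by (simp add: left_module.smult_r_distr[OF l] a_minus_def V.minus_add V.a_ac V.r_neg1)
              (metis V.a_inv_closed V.a_closed V.a_lcomm V.r_neg2 V.a_comm)
          moreover have "u \<ominus>\<^bsub>V\<^esub> d \<odot>\<^bsub>V\<^esub> w \<in> ?U" using cl du w by auto
          moreover have "y \<ominus>\<^bsub>V\<^esub> d \<odot>\<^bsub>V\<^esub> (b \<oplus>\<^bsub>V\<^esub> w) \<in> H'"
            using lt w(2) by (intro submoduleD(7)[OF H'] submoduleD(4)[OF H'] y du(1)) auto
          ultimately have m: "y \<ominus>\<^bsub>V\<^esub> d \<odot>\<^bsub>V\<^esub> (b \<oplus>\<^bsub>V\<^esub> w) \<in> H" using True by auto
          have "y = (y \<ominus>\<^bsub>V\<^esub> d \<odot>\<^bsub>V\<^esub> (b \<oplus>\<^bsub>V\<^esub> w)) \<oplus>\<^bsub>V\<^esub> d \<odot>\<^bsub>V\<^esub> (b \<oplus>\<^bsub>V\<^esub> w)"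
            using cl y w du by (simp add: a_minus_def V.a_assoc V.l_neg)
          then show "y \<in> H" using m cl w du by metis
        qed
        then show False using lt by auto
      qed
      moreover have "\<not> H' \<subseteq> ?U" using True lt by auto
      ultimately show ?thesis using True by auto
    qed
  qed
qed

lemma fg_field_fin_len:
  assumes "field K" "fg_module K V"
  shows "fin_len K V"
proof -
  obtain S where l: "left_module K V" and S: "finite S" "S \<subseteq> carrier V" "gen K V S = carrier V"
    using assms(2) unfolding fg_module_iff_gen by auto
  obtain \<mu> :: "'c set \<Rightarrow> nat" where "\<forall>H H'. submodule H K V \<longrightarrow> submodule H' K V \<longrightarrow> H \<subset> H' \<longrightarrow> H' \<subseteq> gen K V S \<longrightarrow> \<mu> H < \<mu> H'"
    using span_measure[OF assms(1) l S(1,2)] by blast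
  then have "strict_measure K V \<mu>" unfolding strict_measure_def S(3) using submoduleD(1) by metis
  then show ?thesis using l unfolding fin_len_def by metis
qed

lemma fg_image:
  assumes "lin R M N f" "f ` carrier M = carrier N" "fg_module R M"
  shows "fg_module R N"
proof -
  obtain S where S: "finite S" "S \<subseteq> carrier M" "\<And>H. submodule H R M \<Longrightarrow> S \<subseteq> H \<Longrightarrow> H = carrier M"
    using fg_moduleE[OF assms(3)] by metis
  show ?thesis
  proof (rule fg_moduleI[OF linD(2)[OF assms(1)]])
    fix H assume "submodule H R N" "f ` S \<subseteq> H"
    then have "{x \<in> carrier M. f x \<in> H} = carrier M"
      using S(2) by (intro S(3) submodule_vimage[OF assms(1)]) auto
    then show "carrier N \<subseteq> H" unfolding assms(2)[symmetric] by auto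
  qed (use S linD(3)[OF assms(1)] in auto)
qed

text \<open>Lifts of generators of the image, together with generators of the kernel, generate.\<close>

lemma fg_extension:
  assumes f: "lin R M N f" and k: "fg_module R (sub_module M {x \<in> carrier M. f x = \<zero>\<^bsub>N\<^esub>})"
    and i: "fg_module R (sub_module N (f ` carrier M))"
  shows "fg_module R M"
proof -
  let ?k = "{x \<in> carrier M. f x = \<zero>\<^bsub>N\<^esub>}" and ?i = "f ` carrier M"
  have lM: "left_module R M" and lN: "left_module R N" using f by (auto dest: linD)
  interpret M: abelian_group M using lM by (rule left_moduleD)
  interpret N: abelian_group N using lN by (rule left_moduleD)
  have sk: "submodule ?k R M" by (rule submodule_kernel[OF f])
  have si: "submodule ?i R N" by (rule submodule_image[OF f submodule_carrier[OF lM]])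
  obtain S where S: "finite S" "S \<subseteq> ?k" "\<And>H. submodule H R (sub_module M ?k) \<Longrightarrow> S \<subseteq> H \<Longrightarrow> H = ?k"
    by (rule fg_moduleE[OF k]) simp
  obtain T where T: "finite T" "T \<subseteq> ?i" "\<And>H. submodule H R (sub_module N ?i) \<Longrightarrow> T \<subseteq> H \<Longrightarrow> H = ?i"
    by (rule fg_moduleE[OF i]) simp
  obtain T' where T': "finite T'" "T' \<subseteq> carrier M" "T = f ` T'" using T(1,2) by (metis finite_subset_image)
  show ?thesis
  proof (rule fg_moduleI[OF lM, of "S \<union> T'"])
    fix H assume H: "submodule H R M" "S \<union> T' \<subseteq> H"
    have 1: "H \<inter> ?k = ?k"
      by (rule S(3)) (use H S(2) in \<open>auto simp: submodule_sub_iff[OF lM sk] intro: submodule_Int[OF lM _ sk]\<close>)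
    have 2: "f ` H = ?i"
      by (rule T(3)) (use H T' submoduleD(1)[OF H(1)] in
        \<open>auto simp: submodule_sub_iff[OF lN si] intro!: submodule_image[OF f]\<close>)
    show "carrier M \<subseteq> H"
    proof
      fix x assume x: "x \<in> carrier M"
      then obtain y where y: "y \<in> H" "f x = f y" using 2 by (metis image_iff)
      have yM: "y \<in> carrier M" using y submoduleD(5)[OF H(1)] by auto
      have "f (x \<ominus>\<^bsub>M\<^esub> y) = \<zero>\<^bsub>N\<^esub>"
        using x yM y linD(3)[OF f yM] by (simp add: lin_minus[OF f]) (simp add: N.r_neg a_minus_def)
      then have "x \<ominus>\<^bsub>M\<^esub> y \<in> H" using 1 x yM by auto
      then have "(x \<ominus>\<^bsub>M\<^esub> y) \<oplus>\<^bsub>M\<^esub> y \<in> H" using y submoduleD[OF H(1)] by blast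
      then show "x \<in> H" using x yM by (simp add: a_minus_def M.a_assoc M.l_neg)
    qed
  qed (use S T' in auto)
qed

lemma fg_zero: "left_module R M \<Longrightarrow> carrier M = {\<zero>\<^bsub>M\<^esub>} \<Longrightarrow> fg_module R M"
  by (rule fg_moduleI[of _ _ "{}"]) (auto dest: submoduleD(2))

lemma regular_simps [simp]:
  "carrier (regular R) = carrier R" "\<zero>\<^bsub>regular R\<^esub> = \<zero>\<^bsub>R\<^esub>" "ring.add (regular R) = ring.add R" "smult (regular R) = monoid.mult R"
  by (simp_all add: regular_def)

lemma left_module_regular:
  assumes "ring R"
  shows "left_module R (regular R)"
proof -
  interpret ring R by (rule assms)
  have "abelian_group (regular R)"
    by (rule abelian_groupI) (auto simp: a_ac intro: bexI[of _ "\<ominus>\<^bsub>R\<^esub> x" for x] l_neg)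
  then show ?thesis
    by (intro left_module.intro left_module_axioms.intro) (auto simp: assms l_distr r_distr m_assoc)
qed

lemma fg_regular:
  assumes "ring R"
  shows "fg_module R (regular R)"
proof (rule fg_moduleI[of _ _ "{\<one>\<^bsub>R\<^esub>}"])
  interpret ring R by (rule assms)
  show "carrier (regular R) \<subseteq> H" if H: "submodule H R (regular R)" "{\<one>\<^bsub>R\<^esub>} \<subseteq> H" for H
    using submoduleD(4)[OF H(1), of _ "\<one>\<^bsub>R\<^esub>"] H(2) by auto
qed (use left_module_regular[OF assms] ring.ring_simprules(6)[OF assms] in auto)

text \<open>A maximal proper subspace containing the given one has codimension one; the functional reads off
  the coordinate along a vector outside of it.\<close>

lemma separating_functional:
  assumes K: "field K" and V: "fg_module K V" and W: "submodule W K V" "W \<noteq> carrier V"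
  shows "\<exists>\<phi>. lin K V (regular K) \<phi> \<and> (\<forall>w\<in>W. \<phi> w = \<zero>\<^bsub>K\<^esub>) \<and> (\<exists>v\<in>carrier V. \<phi> v \<noteq> \<zero>\<^bsub>K\<^esub>)"
proof -
  interpret K: field K by (rule K)
  have l: "left_module K V" using V by (rule fg_left)
  interpret V: abelian_group V using l by (rule left_moduleD)
  let ?P = "\<lambda>H. submodule H K V \<and> W \<subseteq> H \<and> H \<noteq> carrier V"
  obtain U where U: "submodule U K V" "W \<subseteq> U" "U \<noteq> carrier V" and max: "\<And>H. ?P H \<Longrightarrow> U \<subseteq> H \<Longrightarrow> H = U"
    by (rule fin_len_max[OF fg_field_fin_len[OF K V], of ?P W]) (use W in auto)
  obtain v where v: "v \<in> carrier V" "v \<notin> U" using U submoduleD(1)[OF U(1)] by auto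
  note cl = left_module_closed[OF l] submoduleD[OF U(1)]
  have gU: "gen K V U = U" using gen_incl[of U K V] gen_least[OF U(1), of U] by auto
  let ?G = "gen K V (insert v U)"
  have Us: "U \<subseteq> carrier V" using cl by auto
  have "?G = carrier V"
  proof (rule ccontr)
    assume n: "?G \<noteq> carrier V"
    have "?G = U" by (rule max) (use n U v Us gen_incl[of "insert v U" K V] submodule_gen[OF l, of "insert v U"] in auto)
    then show False using v gen_incl[of "insert v U" K V] by auto
  qed
  then have ex: "\<exists>c\<in>carrier K. \<exists>u\<in>U. x = c \<odot>\<^bsub>V\<^esub> v \<oplus>\<^bsub>V\<^esub> u" if "x \<in> carrier V" for x
    using gen_insert[OF l v(1) Us] gU that by blast
  have uq: "c = d" if "c \<in> carrier K" "d \<in> carrier K" "u \<in> U" "w \<in> U"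
    "c \<odot>\<^bsub>V\<^esub> v \<oplus>\<^bsub>V\<^esub> u = d \<odot>\<^bsub>V\<^esub> v \<oplus>\<^bsub>V\<^esub> w" for c d u w
  proof (rule ccontr)
    assume cd: "c \<noteq> d"
    let ?e = "c \<ominus>\<^bsub>K\<^esub> d"
    have e: "?e \<in> carrier K" "?e \<noteq> \<zero>\<^bsub>K\<^esub>" using that cd by auto
    have cc: "c \<odot>\<^bsub>V\<^esub> v \<in> carrier V" "d \<odot>\<^bsub>V\<^esub> v \<in> carrier V" "u \<in> carrier V" "w \<in> carrier V" "?e \<odot>\<^bsub>V\<^esub> v \<in> carrier V"
      using that v cl e by auto
    have "c \<odot>\<^bsub>V\<^esub> v = ?e \<odot>\<^bsub>V\<^esub> v \<oplus>\<^bsub>V\<^esub> d \<odot>\<^bsub>V\<^esub> v"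
      using that v e by (simp add: left_module.smult_l_distr[OF l, symmetric] a_minus_def K.a_assoc K.l_neg)
    then have "?e \<odot>\<^bsub>V\<^esub> v \<oplus>\<^bsub>V\<^esub> d \<odot>\<^bsub>V\<^esub> v \<oplus>\<^bsub>V\<^esub> u = w \<oplus>\<^bsub>V\<^esub> d \<odot>\<^bsub>V\<^esub> v" using that cc by (simp add: V.a_comm)
    then have "(?e \<odot>\<^bsub>V\<^esub> v \<oplus>\<^bsub>V\<^esub> u) \<oplus>\<^bsub>V\<^esub> d \<odot>\<^bsub>V\<^esub> v = w \<oplus>\<^bsub>V\<^esub> d \<odot>\<^bsub>V\<^esub> v" using cc by (simp add: V.a_ac)
    then have "?e \<odot>\<^bsub>V\<^esub> v \<oplus>\<^bsub>V\<^esub> u = w" using cc by simp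
    then have "?e \<odot>\<^bsub>V\<^esub> v = w \<ominus>\<^bsub>V\<^esub> u" using cc by (auto simp: a_minus_def V.a_assoc V.r_neg)
    then have "?e \<odot>\<^bsub>V\<^esub> v \<in> U" using that cl by auto
    then have "inv\<^bsub>K\<^esub> ?e \<odot>\<^bsub>V\<^esub> (?e \<odot>\<^bsub>V\<^esub> v) \<in> U" using e cl by (auto simp: K.field_Units)
    moreover have "inv\<^bsub>K\<^esub> ?e \<odot>\<^bsub>V\<^esub> (?e \<odot>\<^bsub>V\<^esub> v) = v"
      using e v by (simp add: left_module.smult_assoc1[OF l, symmetric] K.field_Units left_module.smult_one[OF l])
    ultimately show False using v by simp
  qed
  define \<phi> where "\<phi> x = (THE c. c \<in> carrier K \<and> (\<exists>u\<in>U. x = c \<odot>\<^bsub>V\<^esub> v \<oplus>\<^bsub>V\<^esub> u))" for x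
  have phi: "\<phi> (c \<odot>\<^bsub>V\<^esub> v \<oplus>\<^bsub>V\<^esub> u) = c" if "c \<in> carrier K" "u \<in> U" for c u
    unfolding \<phi>_def by (rule the_equality) (use that uq in blast)+
  have "lin K V (regular K) \<phi>"
  proof (rule linI[OF l left_module_regular[OF K.ring_axioms]])
    show "\<phi> x \<in> carrier (regular K)" if "x \<in> carrier V" for x using ex[OF that] phi by auto
  next
    fix x y assume "x \<in> carrier V" "y \<in> carrier V"
    then obtain c u d w where e: "c \<in> carrier K" "u \<in> U" "x = c \<odot>\<^bsub>V\<^esub> v \<oplus>\<^bsub>V\<^esub> u" "d \<in> carrier K" "w \<in> U" "y = d \<odot>\<^bsub>V\<^esub> v \<oplus>\<^bsub>V\<^esub> w"
      using ex by metis
    then have "x \<oplus>\<^bsub>V\<^esub> y = (c \<oplus>\<^bsub>K\<^esub> d) \<odot>\<^bsub>V\<^esub> v \<oplus>\<^bsub>V\<^esub> (u \<oplus>\<^bsub>V\<^esub> w)"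
      using v cl by (simp add: left_module.smult_l_distr[OF l] V.a_ac)
    then show "\<phi> (x \<oplus>\<^bsub>V\<^esub> y) = \<phi> x \<oplus>\<^bsub>regular K\<^esub> \<phi> y" using e cl by (simp add: phi)
  next
    fix a x assume a: "a \<in> carrier K" and "x \<in> carrier V"
    then obtain c u where e: "c \<in> carrier K" "u \<in> U" "x = c \<odot>\<^bsub>V\<^esub> v \<oplus>\<^bsub>V\<^esub> u" using ex by metis
    then have "a \<odot>\<^bsub>V\<^esub> x = (a \<otimes>\<^bsub>K\<^esub> c) \<odot>\<^bsub>V\<^esub> v \<oplus>\<^bsub>V\<^esub> (a \<odot>\<^bsub>V\<^esub> u)"
      using a v cl by (simp add: left_module.smult_r_distr[OF l] left_module.smult_assoc1[OF l])
    then show "\<phi> (a \<odot>\<^bsub>V\<^esub> x) = a \<odot>\<^bsub>regular K\<^esub> \<phi> x" using e a cl by (simp add: phi)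
  qed
  moreover have "\<phi> w = \<zero>\<^bsub>K\<^esub>" if "w \<in> W" for w
  proof -
    have "w \<in> U" using that U by auto
    then show ?thesis using phi[of "\<zero>\<^bsub>K\<^esub>" w] v cl by (simp add: left_module_zero_smult[OF l])
  qed
  moreover have "\<phi> v \<noteq> \<zero>\<^bsub>K\<^esub>"
    using phi[of "\<one>\<^bsub>K\<^esub>" "\<zero>\<^bsub>V\<^esub>"] v cl by (simp add: left_module.smult_one[OF l])
  ultimately show ?thesis using v by blast
qed

section \<open>Finite-dimensional algebras and their modules\<close>

lemma restrict_scalars_simps [simp]:
  "carrier (restrict_scalars A M) = carrier M" "\<zero>\<^bsub>restrict_scalars A M\<^esub> = \<zero>\<^bsub>M\<^esub>"
  "ring.add (restrict_scalars A M) = ring.add M"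
  "k \<odot>\<^bsub>restrict_scalars A M\<^esub> x = (k \<odot>\<^bsub>A\<^esub> \<one>\<^bsub>A\<^esub>) \<odot>\<^bsub>M\<^esub> x"
  by (simp_all add: restrict_scalars_def)

lemma fd_algebraD:
  assumes "fd_algebra K A"
  shows "field K" "ring K" "ring A" "left_module K A" "fg_module K A"
    and "k \<in> carrier K \<Longrightarrow> k \<odot>\<^bsub>A\<^esub> \<one>\<^bsub>A\<^esub> \<in> carrier A"
    and "k \<in> carrier K \<Longrightarrow> a \<in> carrier A \<Longrightarrow> (k \<odot>\<^bsub>A\<^esub> \<one>\<^bsub>A\<^esub>) \<otimes>\<^bsub>A\<^esub> a = k \<odot>\<^bsub>A\<^esub> a"
    and "k \<in> carrier K \<Longrightarrow> a \<in> carrier A \<Longrightarrow> a \<otimes>\<^bsub>A\<^esub> (k \<odot>\<^bsub>A\<^esub> \<one>\<^bsub>A\<^esub>) = k \<odot>\<^bsub>A\<^esub> a"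
proof -
  interpret fd_algebra K A by (rule assms)
  interpret KA: module K A by (rule K_module)
  show f: "field K" "ring K" "ring A"
    by (rule K.field_axioms, rule K.ring_axioms, rule A.ring_axioms)
  show l: "left_module K A"
    by (intro left_module.intro left_module_axioms.intro f A.abelian_group_axioms)
      (auto simp: KA.smult_l_distr KA.smult_r_distr KA.smult_assoc1)
  show "fg_module K A" using l finite_dimensional by (simp add: fg_module_def)
  show "k \<in> carrier K \<Longrightarrow> k \<odot>\<^bsub>A\<^esub> \<one>\<^bsub>A\<^esub> \<in> carrier A" by simp
  show "k \<in> carrier K \<Longrightarrow> a \<in> carrier A \<Longrightarrow> (k \<odot>\<^bsub>A\<^esub> \<one>\<^bsub>A\<^esub>) \<otimes>\<^bsub>A\<^esub> a = k \<odot>\<^bsub>A\<^esub> a"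
    by (simp add: smult_mult_left)
  show "k \<in> carrier K \<Longrightarrow> a \<in> carrier A \<Longrightarrow> a \<otimes>\<^bsub>A\<^esub> (k \<odot>\<^bsub>A\<^esub> \<one>\<^bsub>A\<^esub>) = k \<odot>\<^bsub>A\<^esub> a"
    by (simp add: smult_mult_right)
qed

lemma left_module_restrict:
  assumes "fd_algebra K A" "left_module A M"
  shows "left_module K (restrict_scalars A M)"
proof -
  interpret M: abelian_group M using assms(2) by (rule left_moduleD)
  have g: "abelian_group (restrict_scalars A M)"
    by (rule abelian_groupI) (auto simp: M.a_ac intro: bexI[of _ "\<ominus>\<^bsub>M\<^esub> x" for x] M.l_neg)
  note D = fd_algebraD[OF assms(1)] and m = left_module.smult_l_distr[OF assms(2)]
    left_module.smult_r_distr[OF assms(2)] left_module.smult_assoc1[OF assms(2)] left_module.smult_one[OF assms(2)]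
  interpret A: ring A by (rule D)
  interpret K: ring K by (rule D)
  show ?thesis
  proof (intro left_module.intro left_module_axioms.intro g)
    fix a b x assume "a \<in> carrier K" "b \<in> carrier K" "x \<in> carrier (restrict_scalars A M)"
    then show "(a \<oplus>\<^bsub>K\<^esub> b) \<odot>\<^bsub>restrict_scalars A M\<^esub> x =
      a \<odot>\<^bsub>restrict_scalars A M\<^esub> x \<oplus>\<^bsub>restrict_scalars A M\<^esub> b \<odot>\<^bsub>restrict_scalars A M\<^esub> x"
      using D(6) by (simp add: left_module.smult_l_distr[OF D(4)] m)
  next
    fix a b x assume ab: "a \<in> carrier K" "b \<in> carrier K" "x \<in> carrier (restrict_scalars A M)"
    then have "(a \<otimes>\<^bsub>K\<^esub> b) \<odot>\<^bsub>A\<^esub> \<one>\<^bsub>A\<^esub> = (a \<odot>\<^bsub>A\<^esub> \<one>\<^bsub>A\<^esub>) \<otimes>\<^bsub>A\<^esub> (b \<odot>\<^bsub>A\<^esub> \<one>\<^bsub>A\<^esub>)"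
      using D(6)[of b] D(7)[of a "b \<odot>\<^bsub>A\<^esub> \<one>\<^bsub>A\<^esub>"] by (simp add: left_module.smult_assoc1[OF D(4)])
    then show "(a \<otimes>\<^bsub>K\<^esub> b) \<odot>\<^bsub>restrict_scalars A M\<^esub> x = a \<odot>\<^bsub>restrict_scalars A M\<^esub> (b \<odot>\<^bsub>restrict_scalars A M\<^esub> x)"
      using D(6) ab by (simp add: m)
  qed (use D left_module_closed(5)[OF assms(2)] in \<open>auto simp: m left_module.smult_one[OF D(4)]\<close>)
qed

lemma submodule_restrict:
  assumes "fd_algebra K A" "left_module A M" "submodule H A M"
  shows "submodule H K (restrict_scalars A M)"
  by (rule submoduleI[OF left_module_restrict[OF assms(1,2)]])
    (use submoduleD[OF assms(3)] fd_algebraD(6)[OF assms(1)] in auto)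

text \<open>The products of a spanning set of the algebra with generators of the module span it over \<open>K\<close>.\<close>

lemma fg_restrict:
  assumes A: "fd_algebra K A" and M: "fg_module A M"
  shows "fg_module K (restrict_scalars A M)"
proof -
  note D = fd_algebraD[OF A]
  interpret A: ring A by (rule D)
  have l: "left_module A M" using M by (rule fg_left)
  note m = left_module.smult_l_distr[OF l]
    left_module.smult_r_distr[OF l] left_module.smult_assoc1[OF l] left_module.smult_one[OF l]
  obtain S where S: "finite S" "S \<subseteq> carrier M" "\<And>H. submodule H A M \<Longrightarrow> S \<subseteq> H \<Longrightarrow> H = carrier M"
    using fg_moduleE[OF M] by metis
  obtain T where T: "finite T" "T \<subseteq> carrier A" "\<And>H. submodule H K A \<Longrightarrow> T \<subseteq> H \<Longrightarrow> H = carrier A"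
    using fg_moduleE[OF D(5)] by metis
  let ?G = "(\<lambda>(t, s). t \<odot>\<^bsub>M\<^esub> s) ` (T \<times> S)"
  show ?thesis
  proof (rule fg_moduleI[OF left_module_restrict[OF A l], of ?G])
    show "?G \<subseteq> carrier (restrict_scalars A M)" using S(2) T(2) by (auto intro!: left_module_closed(5)[OF l])
    fix H assume H: "submodule H K (restrict_scalars A M)" "?G \<subseteq> H"
    note hD = submoduleD[OF H(1), simplified]
    have 1: "a \<odot>\<^bsub>M\<^esub> s \<in> H" if s: "s \<in> S" and a: "a \<in> carrier A" for a s
    proof -
      have sM: "s \<in> carrier M" using s S by auto
      have "submodule {a \<in> carrier A. a \<odot>\<^bsub>M\<^esub> s \<in> H} K A"
      proof (rule submoduleI[OF D(4)])
        fix k x assume k: "k \<in> carrier K" and x: "x \<in> {a \<in> carrier A. a \<odot>\<^bsub>M\<^esub> s \<in> H}"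
        have "(k \<odot>\<^bsub>A\<^esub> x) \<odot>\<^bsub>M\<^esub> s = (k \<odot>\<^bsub>A\<^esub> \<one>\<^bsub>A\<^esub>) \<odot>\<^bsub>M\<^esub> (x \<odot>\<^bsub>M\<^esub> s)"
          using D(6,7) k x sM by (simp add: m(3)[symmetric])
        then show "k \<odot>\<^bsub>A\<^esub> x \<in> {a \<in> carrier A. a \<odot>\<^bsub>M\<^esub> s \<in> H}"
          using hD(4)[OF k, of "x \<odot>\<^bsub>M\<^esub> s"] x left_module_closed(5)[OF D(4) k] by auto
      qed (use hD sM in \<open>auto simp: m left_module_zero_smult[OF l]\<close>)
      then have "{a \<in> carrier A. a \<odot>\<^bsub>M\<^esub> s \<in> H} = carrier A"
        by (rule T(3)) (use T(2) H(2) s in force)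
      then show ?thesis using a by auto
    qed
    have "submodule {x \<in> carrier M. \<forall>a\<in>carrier A. a \<odot>\<^bsub>M\<^esub> x \<in> H} A M"
      by (rule submoduleI[OF l])
        (use hD left_module_closed[OF l] in \<open>auto simp: m left_module_smult_zero[OF l] simp flip: m(3)\<close>)
    then have "{x \<in> carrier M. \<forall>a\<in>carrier A. a \<odot>\<^bsub>M\<^esub> x \<in> H} = carrier M"
      by (rule S(3)) (use 1 S(2) in auto)
    then show "carrier (restrict_scalars A M) \<subseteq> H"
      using m(4) A.one_closed by force
  qed (use S T in auto)
qed

lemma fg_of_restrict:
  assumes A: "fd_algebra K A" and l: "left_module A M" and "fg_module K (restrict_scalars A M)"
  shows "fg_module A M"
proof -
  obtain S where S: "finite S" "S \<subseteq> carrier M"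
    "\<And>H. submodule H K (restrict_scalars A M) \<Longrightarrow> S \<subseteq> H \<Longrightarrow> H = carrier M"
    using fg_moduleE[OF assms(3)] by (metis restrict_scalars_simps(1))
  show ?thesis
    by (rule fg_moduleI[OF l S(1,2)]) (use S(3) submodule_restrict[OF A l] in auto)
qed

text \<open>Submodules are in particular subspaces.\<close>

lemma fd_fin_len:
  assumes A: "fd_algebra K A" and M: "fg_module A M"
  shows "fin_len A M"
proof -
  have l: "left_module A M" using M by (rule fg_left)
  obtain \<mu> where "strict_measure K (restrict_scalars A M) \<mu>"
    using fg_field_fin_len[OF fd_algebraD(1)[OF A] fg_restrict[OF A M]] by (auto simp: fin_len_def)
  then have "strict_measure A M \<mu>"
    using submodule_restrict[OF A l] unfolding strict_measure_def by simp
  then show ?thesis using l by (auto simp: fin_len_def)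
qed

lemma fd_fg_sub:
  assumes "fd_algebra K A" "fg_module A M" "submodule H A M"
  shows "fg_module A (sub_module M H)"
  by (rule fin_len_fg[OF fin_len_sub[OF fd_fin_len[OF assms(1,2)] assms(3)]])

text \<open>The \<open>K\<close>-linear structure on \<open>Hom(M,N)\<close>.\<close>

definition Hom_space :: "('k, 'a) module \<Rightarrow> ('a, 'm) module \<Rightarrow> ('a, 'n) module \<Rightarrow> ('k, 'm \<Rightarrow> 'n) module"
  where "Hom_space A M N = \<lparr>carrier = hom_set A M N, monoid.mult = undefined, one = undefined,
     ring.zero = \<zero>\<^bsub>Hom A M N\<^esub>, ring.add = ring.add (Hom A M N),
     smult = (\<lambda>k f. \<lambda>x\<in>carrier M. (k \<odot>\<^bsub>A\<^esub> \<one>\<^bsub>A\<^esub>) \<odot>\<^bsub>N\<^esub> f x)\<rparr>"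

lemma Hom_simps:
  "\<zero>\<^bsub>Hom A M N\<^esub> = (\<lambda>x\<in>carrier M. \<zero>\<^bsub>N\<^esub>)" "f \<oplus>\<^bsub>Hom A M N\<^esub> g = (\<lambda>x\<in>carrier M. f x \<oplus>\<^bsub>N\<^esub> g x)"
  by (simp_all add: Hom_def)

lemma Hom_space_simps [simp]:
  "carrier (Hom_space A M N) = hom_set A M N"
  "\<zero>\<^bsub>Hom_space A M N\<^esub> = (\<lambda>x\<in>carrier M. \<zero>\<^bsub>N\<^esub>)"
  "f \<oplus>\<^bsub>Hom_space A M N\<^esub> g = (\<lambda>x\<in>carrier M. f x \<oplus>\<^bsub>N\<^esub> g x)"
  "k \<odot>\<^bsub>Hom_space A M N\<^esub> f = (\<lambda>x\<in>carrier M. (k \<odot>\<^bsub>A\<^esub> \<one>\<^bsub>A\<^esub>) \<odot>\<^bsub>N\<^esub> f x)"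
  by (simp_all add: Hom_space_def Hom_simps)

lemma hom_set_restrictI:
  "lin A M N f \<Longrightarrow> (\<And>x. x \<in> carrier M \<Longrightarrow> g x = f x) \<Longrightarrow> (\<And>x. x \<notin> carrier M \<Longrightarrow> g x = undefined) \<Longrightarrow> g \<in> hom_set A M N"
proof -
  assume "lin A M N f" "\<And>x. x \<in> carrier M \<Longrightarrow> g x = f x" "\<And>x. x \<notin> carrier M \<Longrightarrow> g x = undefined"
  moreover from this have "g = restrict f (carrier M)" by (auto simp: fun_eq_iff restrict_def)
  ultimately show ?thesis using lin_hom_set by metis
qed

lemma hom_set_undefined: "f \<in> hom_set A M N \<Longrightarrow> x \<notin> carrier M \<Longrightarrow> f x = undefined"
  by (auto simp: Hom_def PiE_def extensional_def)

lemma hom_set_restrict: "f \<in> hom_set A M N \<Longrightarrow> restrict f (carrier M) = f"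
  by (auto simp: Hom_def PiE_def extensional_restrict)

lemma lin_smult_central:
  assumes A: "fd_algebra K A" and f: "lin A M N f" and k: "k \<in> carrier K"
  shows "lin A M N (\<lambda>x. (k \<odot>\<^bsub>A\<^esub> \<one>\<^bsub>A\<^esub>) \<odot>\<^bsub>N\<^esub> f x)"
proof -
  note D = fd_algebraD[OF A] and l = linD[OF f]
  show ?thesis
  proof (rule linI[OF l(1,2)])
    fix a x assume ax: "a \<in> carrier A" "x \<in> carrier M"
    then have "(k \<odot>\<^bsub>A\<^esub> \<one>\<^bsub>A\<^esub>) \<odot>\<^bsub>N\<^esub> f (a \<odot>\<^bsub>M\<^esub> x) = ((k \<odot>\<^bsub>A\<^esub> \<one>\<^bsub>A\<^esub>) \<otimes>\<^bsub>A\<^esub> a) \<odot>\<^bsub>N\<^esub> f x"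
      using l D(6)[OF k] by (simp add: left_module.smult_assoc1[OF l(2)])
    also have "\<dots> = (a \<otimes>\<^bsub>A\<^esub> (k \<odot>\<^bsub>A\<^esub> \<one>\<^bsub>A\<^esub>)) \<odot>\<^bsub>N\<^esub> f x" using D(7,8) k ax by simp
    also have "\<dots> = a \<odot>\<^bsub>N\<^esub> ((k \<odot>\<^bsub>A\<^esub> \<one>\<^bsub>A\<^esub>) \<odot>\<^bsub>N\<^esub> f x)"
      by (rule left_module.smult_assoc1[OF l(2)]) (use l ax k D in auto)
    finally show "(k \<odot>\<^bsub>A\<^esub> \<one>\<^bsub>A\<^esub>) \<odot>\<^bsub>N\<^esub> f (a \<odot>\<^bsub>M\<^esub> x) = a \<odot>\<^bsub>N\<^esub> ((k \<odot>\<^bsub>A\<^esub> \<one>\<^bsub>A\<^esub>) \<odot>\<^bsub>N\<^esub> f x)" .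
  qed (use l D(6)[OF k] in \<open>auto intro: left_module_closed simp: left_module.smult_r_distr\<close>)
qed

lemma left_module_Hom_space:
  assumes A: "fd_algebra K A" and M: "left_module A M" and N: "left_module A N"
  shows "left_module K (Hom_space A M N)"
proof -
  note D = fd_algebraD[OF A]
  interpret N: abelian_group N using N by (rule left_moduleD)
  interpret K: ring K by (rule D)
  note h = hom_set_lin[OF _ M N]
  have c: "f x \<in> carrier N" if "f \<in> hom_set A M N" "x \<in> carrier M" for f x using linD(3)[OF h[OF that(1)] that(2)] .
  have add: "(\<lambda>x\<in>carrier M. f x \<oplus>\<^bsub>N\<^esub> g x) \<in> hom_set A M N" if "f \<in> hom_set A M N" "g \<in> hom_set A M N" for f g
    by (rule lin_hom_set[OF lin_plus[OF h[OF that(1)] h[OF that(2)]]])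
  have g: "abelian_group (Hom_space A M N)"
  proof (rule abelian_groupI)
    fix f assume f: "f \<in> carrier (Hom_space A M N)"
    show "\<exists>g\<in>carrier (Hom_space A M N). g \<oplus>\<^bsub>Hom_space A M N\<^esub> f = \<zero>\<^bsub>Hom_space A M N\<^esub>"
    proof (rule bexI)
      show "(\<lambda>x\<in>carrier M. \<ominus>\<^bsub>N\<^esub> f x) \<in> carrier (Hom_space A M N)"
        using lin_hom_set[OF lin_uminus[OF h]] f by simp
      show "(\<lambda>x\<in>carrier M. \<ominus>\<^bsub>N\<^esub> f x) \<oplus>\<^bsub>Hom_space A M N\<^esub> f = \<zero>\<^bsub>Hom_space A M N\<^esub>"
        using c[of f] f by (auto simp: N.l_neg restrict_def)
    qed
    show "\<zero>\<^bsub>Hom_space A M N\<^esub> \<oplus>\<^bsub>Hom_space A M N\<^esub> f = f"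
      using c[of f] hom_set_undefined[of f A M N] f by (auto simp: restrict_def)
  qed (use c add lin_hom_set[OF lin_0[OF M N]] in \<open>auto simp: restrict_def fun_eq_iff N.a_ac\<close>)
  note r = left_module_restrict[OF A N]
  have s: "(\<lambda>x\<in>carrier M. (k \<odot>\<^bsub>A\<^esub> \<one>\<^bsub>A\<^esub>) \<odot>\<^bsub>N\<^esub> f x) \<in> hom_set A M N" if "k \<in> carrier K" "f \<in> hom_set A M N" for k f
    by (rule lin_hom_set[OF lin_smult_central[OF A h]]) (use that in auto)
  note rr = left_module.smult_l_distr[OF r, simplified] left_module.smult_r_distr[OF r, simplified]
    left_module.smult_assoc1[OF r, simplified] left_module.smult_one[OF r, simplified] left_module_closed(5)[OF r, simplified]
  show ?thesis
  proof (intro left_module.intro left_module_axioms.intro g D(2))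
    show "a \<odot>\<^bsub>Hom_space A M N\<^esub> f \<in> carrier (Hom_space A M N)" if "a \<in> carrier K" "f \<in> carrier (Hom_space A M N)" for a f
      using s that by simp
    show "\<one>\<^bsub>K\<^esub> \<odot>\<^bsub>Hom_space A M N\<^esub> f = f" if "f \<in> carrier (Hom_space A M N)" for f
      by (rule ext) (use that c[of f] hom_set_undefined[of f A M N] in \<open>simp add: rr restrict_def\<close>)
  qed (rule ext, simp add: rr c restrict_def)+
qed

text \<open>A homomorphism is determined by its values on generators: evaluate at one generator after the
  other.\<close>

lemma fg_Hom_space:
  assumes A: "fd_algebra K A" and M: "fg_module A M" and N: "fg_module A N"
  shows "fg_module K (Hom_space A M N)"
proof -
  note D = fd_algebraD[OF A]
  have lM: "left_module A M" and lN: "left_module A N" using M N by (auto intro: fg_left)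
  let ?V = "Hom_space A M N" and ?N = "restrict_scalars A N"
  have V: "left_module K ?V" by (rule left_module_Hom_space[OF A lM lN])
  have N': "left_module K ?N" by (rule left_module_restrict[OF A lN])
  note h = hom_set_lin[OF _ lM lN]
  define Z where "Z U = {f \<in> hom_set A M N. \<forall>s\<in>U. f s = \<zero>\<^bsub>N\<^esub>}" for U
  have ev: "lin K ?V ?N (\<lambda>f. f t)" if "t \<in> carrier M" for t
    by (rule linI[OF V N']) (use that linD(3)[OF h] in auto)
  have sZ: "submodule (Z U) K ?V" if "U \<subseteq> carrier M" for U
  proof -
    interpret N: abelian_group N using lN by (rule left_moduleD)
    show ?thesis
      by (rule submoduleI[OF V])
        (use that left_module_closed[OF V] left_module_smult_zero[OF N'] in \<open>auto simp: Z_def subset_iff\<close>)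
  qed
  obtain S where S: "finite S" "S \<subseteq> carrier M" "\<And>H. submodule H A M \<Longrightarrow> S \<subseteq> H \<Longrightarrow> H = carrier M"
    using fg_moduleE[OF M] by metis
  have step: "fg_module K (sub_module ?V (Z U))" if t: "t \<in> carrier M" and U: "U \<subseteq> carrier M"
    and fg: "fg_module K (sub_module ?V (Z (insert t U)))" for t U
  proof (rule fg_extension)
    have lZ: "left_module K (sub_module ?V (Z U))" by (rule left_module_sub[OF V sZ[OF U]])
    show e: "lin K (sub_module ?V (Z U)) ?N (\<lambda>f. f t)"
      by (rule lin_compose[OF lin_sub_incl[OF V sZ[OF U]] ev[OF t]])
    have "{x \<in> Z U. x t = \<zero>\<^bsub>N\<^esub>} = Z (insert t U)" by (auto simp: Z_def)
    then show "fg_module K (sub_module (sub_module ?V (Z U)) {x \<in> carrier (sub_module ?V (Z U)). x t = \<zero>\<^bsub>?N\<^esub>})"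
      using fg by simp
    show "fg_module K (sub_module ?N ((\<lambda>f. f t) ` carrier (sub_module ?V (Z U))))"
      by (rule fin_len_fg[OF fin_len_sub[OF fg_field_fin_len[OF D(1) fg_restrict[OF A N]]]])
        (rule submodule_image[OF e submodule_carrier[OF lZ]])
  qed
  have "fg_module K (sub_module ?V (Z U))" if "finite T" "T \<subseteq> carrier M" "U \<subseteq> carrier M"
    "fg_module K (sub_module ?V (Z (U \<union> T)))" for T U
    using that
  proof (induction T arbitrary: U rule: finite_induct)
    case empty then show ?case by simp
  next
    case (insert t T)
    have "fg_module K (sub_module ?V (Z (insert t U)))"
      by (rule insert.IH) (use insert.prems in auto)
    then show ?case by (intro step[of t U]) (use insert.prems in auto)
  qed
  moreover have "Z S = {\<zero>\<^bsub>?V\<^esub>}"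
  proof -
    have "f = (\<lambda>x\<in>carrier M. \<zero>\<^bsub>N\<^esub>)" if f: "f \<in> Z S" for f
    proof -
      have "{x \<in> carrier M. f x = \<zero>\<^bsub>N\<^esub>} = carrier M"
        by (rule S(3)[OF submodule_kernel[OF h]]) (use f S(2) in \<open>auto simp: Z_def\<close>)
      then have "f x = \<zero>\<^bsub>N\<^esub>" if "x \<in> carrier M" for x using that by blast
      then show ?thesis using hom_set_undefined[of f A M N] f by (simp add: Z_def fun_eq_iff)
    qed
    moreover have "(\<lambda>x\<in>carrier M. \<zero>\<^bsub>N\<^esub>) \<in> Z S"
      using submoduleD(2)[OF sZ[OF S(2)]] by simp
    ultimately have "Z S = {\<lambda>x\<in>carrier M. \<zero>\<^bsub>N\<^esub>}" by blast
    then show ?thesis by simp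
  qed
  then have "fg_module K (sub_module ?V (Z S))"
    by (intro fg_zero left_module_sub[OF V sZ[OF S(2)]]) simp
  ultimately have "fg_module K (sub_module ?V (Z {}))" using S(1,2) by simp
  moreover have "Z {} = carrier ?V" by (simp add: Z_def)
  ultimately show ?thesis by (metis sub_module_carrier)
qed

section \<open>Models of subquotients inside a given type\<close>

text \<open>A finite-dimensional space injects, as a set, into \<^typ>\<open>nat \<Rightarrow> 'k\<close>; the module structure
  is then transported along the injection.  Choosing representatives of cosets first gives
  models of quotients in the same way.\<close>

lemma fd_coding:
  assumes K: "field (K :: ('k, 'b) ring_scheme)" and V: "fg_module K V"
  shows "\<exists>u :: 'v \<Rightarrow> nat \<Rightarrow> 'k. inj_on u (carrier V)"
proof -
  obtain S where l: "left_module K V" and S: "finite S" "S \<subseteq> carrier V" "gen K V S = carrier V"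
    using V unfolding fg_module_iff_gen by auto
  \<comment> \<open>Beyond some index all codes agree, which leaves the next index free for one more coefficient.\<close>
  have "\<exists>(u :: 'v \<Rightarrow> nat \<Rightarrow> 'k) n. inj_on u (gen K V S) \<and> (\<forall>x. \<forall>j\<ge>n. u x j = undefined)"
    using S(1,2)
  proof (induction S rule: finite_induct)
    case empty
    have "gen K V {} \<subseteq> {\<zero>\<^bsub>V\<^esub>}" by (rule gen_least[OF submodule_zero[OF l]]) auto
    then show ?case by (intro exI[of _ "\<lambda>_ _. undefined"]) (auto simp: inj_on_def)
  next
    case (insert b S)
    have b: "b \<in> carrier V" and S: "S \<subseteq> carrier V" using insert.prems by auto
    obtain u :: "'v \<Rightarrow> nat \<Rightarrow> 'k" and n where u: "inj_on u (gen K V S)" "\<And>x j. j \<ge> n \<Longrightarrow> u x j = undefined"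
      using insert.IH[OF S] by blast
    have "\<exists>c v. v \<in> gen K V S \<and> x = c \<odot>\<^bsub>V\<^esub> b \<oplus>\<^bsub>V\<^esub> v" if "x \<in> gen K V (insert b S)" for x
      using that gen_insert[OF l b S] by auto
    then obtain c v where cv: "\<And>x. x \<in> gen K V (insert b S) \<Longrightarrow> v x \<in> gen K V S \<and> x = c x \<odot>\<^bsub>V\<^esub> b \<oplus>\<^bsub>V\<^esub> v x"
      by metis
    let ?w = "\<lambda>x. (u (v x))(n := c x)"
    have "inj_on ?w (gen K V (insert b S))"
    proof (rule inj_onI)
      fix x y assume x: "x \<in> gen K V (insert b S)" "y \<in> gen K V (insert b S)" and e: "?w x = ?w y"
      have "u (v x) j = u (v y) j" for j
        using fun_cong[OF e, of j] u(2)[of n] by (cases "j = n") auto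
      then have "v x = v y" using u(1) cv x by (auto simp: inj_on_def fun_eq_iff)
      moreover have "c x = c y" using fun_cong[OF e, of n] by simp
      ultimately show "x = y" using cv x by metis
    qed
    moreover have "\<forall>x. \<forall>j\<ge>Suc n. ?w x j = undefined" using u(2) by simp
    ultimately show ?case by (intro exI conjI)
  qed
  then show ?thesis using S(3) by auto
qed

text \<open>The structure that the image of \<open>u\<close> inherits from \<open>M\<close> when the fibres of \<open>u\<close> are the cosets of a
  submodule; the inverse image picks a representative.\<close>

definition image_model :: "('a, 'm) module \<Rightarrow> ('m \<Rightarrow> 'n) \<Rightarrow> ('a, 'n) module" where
  "image_model M u = \<lparr>carrier = u ` carrier M, monoid.mult = undefined, one = undefined,
     ring.zero = u \<zero>\<^bsub>M\<^esub>,
     ring.add = (\<lambda>p q. u (inv_into (carrier M) u p \<oplus>\<^bsub>M\<^esub> inv_into (carrier M) u q)),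
     smult = (\<lambda>a p. u (a \<odot>\<^bsub>M\<^esub> inv_into (carrier M) u p))\<rparr>"

lemma image_model:
  assumes l: "left_module A M" and H: "submodule H A M"
    and u: "\<And>x y. x \<in> carrier M \<Longrightarrow> y \<in> carrier M \<Longrightarrow> u x = u y \<longleftrightarrow> x \<ominus>\<^bsub>M\<^esub> y \<in> H"
  shows "lin A M (image_model M u) u" "carrier (image_model M u) = u ` carrier M"
    and "\<And>x. x \<in> carrier M \<Longrightarrow> u x = \<zero>\<^bsub>image_model M u\<^esub> \<longleftrightarrow> x \<in> H"
proof -
  interpret M: abelian_group M using l by (rule left_moduleD)
  interpret A: ring A using l by (rule left_moduleD)
  note cl = left_module_closed[OF l] submoduleD[OF H]
  let ?N = "image_model M u" and ?i = "inv_into (carrier M) u"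
  show c: "carrier ?N = u ` carrier M" by (simp add: image_model_def)
  have i: "?i (u x) \<in> carrier M" "?i (u x) \<ominus>\<^bsub>M\<^esub> x \<in> H" if "x \<in> carrier M" for x
    using that u[of "?i (u x)" x] by (auto simp: inv_into_into f_inv_into_f)
  have add: "u x \<oplus>\<^bsub>?N\<^esub> u y = u (x \<oplus>\<^bsub>M\<^esub> y)" if "x \<in> carrier M" "y \<in> carrier M" for x y
  proof -
    have "(?i (u x) \<oplus>\<^bsub>M\<^esub> ?i (u y)) \<ominus>\<^bsub>M\<^esub> (x \<oplus>\<^bsub>M\<^esub> y) = (?i (u x) \<ominus>\<^bsub>M\<^esub> x) \<oplus>\<^bsub>M\<^esub> (?i (u y) \<ominus>\<^bsub>M\<^esub> y)"
      using i(1)[OF that(1)] i(1)[OF that(2)] that by (simp add: a_minus_def M.minus_add M.a_ac)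
    also have "\<dots> \<in> H" using i(2)[OF that(1)] i(2)[OF that(2)] cl by auto
    finally show ?thesis using u i(1)[OF that(1)] i(1)[OF that(2)] that by (simp add: image_model_def)
  qed
  have sm: "a \<odot>\<^bsub>?N\<^esub> u x = u (a \<odot>\<^bsub>M\<^esub> x)" if "a \<in> carrier A" "x \<in> carrier M" for a x
  proof -
    have "a \<odot>\<^bsub>M\<^esub> (?i (u x)) \<ominus>\<^bsub>M\<^esub> a \<odot>\<^bsub>M\<^esub> x = a \<odot>\<^bsub>M\<^esub> (?i (u x) \<ominus>\<^bsub>M\<^esub> x)"
      using i(1)[OF that(2)] that linD(5)[OF lin_uminus[OF lin_id[OF l]]]
      by (simp add: a_minus_def left_module.smult_r_distr[OF l])
    also have "\<dots> \<in> H" using i(2)[OF that(2)] that cl by auto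
    finally show ?thesis using u i(1)[OF that(2)] that cl by (simp add: image_model_def)
  qed
  have z: "\<zero>\<^bsub>?N\<^esub> = u \<zero>\<^bsub>M\<^esub>" by (simp add: image_model_def)
  have g: "abelian_group ?N"
  proof (rule abelian_groupI)
    fix p assume "p \<in> carrier ?N"
    then obtain x where x: "x \<in> carrier M" "p = u x" using c by auto
    then show "\<exists>q\<in>carrier ?N. q \<oplus>\<^bsub>?N\<^esub> p = \<zero>\<^bsub>?N\<^esub>"
      by (intro bexI[of _ "u (\<ominus>\<^bsub>M\<^esub> x)"]) (auto simp: c add z M.l_neg)
  qed (auto simp: c add z M.a_ac)
  have lN: "left_module A ?N"
    by (intro left_module.intro left_module_axioms.intro g A.ring_axioms)
      (use cl in \<open>auto simp: c add sm left_module.smult_l_distr[OF l] left_module.smult_r_distr[OF l]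
        left_module.smult_assoc1[OF l] left_module.smult_one[OF l]\<close>)
  show "lin A M ?N u" by (rule linI[OF l lN]) (auto simp: c add sm)
  show "u x = \<zero>\<^bsub>?N\<^esub> \<longleftrightarrow> x \<in> H" if "x \<in> carrier M" for x
    using u[OF that M.zero_closed] that lin_zero[OF lin_uminus[OF lin_id[OF l]]] by (simp add: z a_minus_def)
qed

lemma fd_quotient:
  fixes A :: "('k, 'a) module"
  assumes A: "fd_algebra K A" and M: "fg_module A M" and H: "submodule H A M"
  shows "\<exists>(C :: ('k, 'a) fd_mod) \<pi>. fg_module A C \<and> lin A M C \<pi> \<and> \<pi> ` carrier M = carrier C \<and>
    (\<forall>x\<in>carrier M. \<pi> x = \<zero>\<^bsub>C\<^esub> \<longleftrightarrow> x \<in> H)"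
proof -
  have l: "left_module A M" using M by (rule fg_left)
  interpret M: abelian_group M using l by (rule left_moduleD)
  note cl = submoduleD[OF H]
  obtain v :: "'c \<Rightarrow> nat \<Rightarrow> 'k" where v: "inj_on v (carrier M)"
    using fd_coding[OF fd_algebraD(1)[OF A] fg_restrict[OF A M]] by auto
  define r where "r x = (SOME y. y \<in> carrier M \<and> y \<ominus>\<^bsub>M\<^esub> x \<in> H)" for x
  have r: "r x \<in> carrier M \<and> r x \<ominus>\<^bsub>M\<^esub> x \<in> H" if "x \<in> carrier M" for x
    unfolding r_def by (rule someI[of _ x]) (use that cl in \<open>auto simp: a_minus_def M.r_neg\<close>)
  have tr: "y \<ominus>\<^bsub>M\<^esub> z \<in> H" if "x \<ominus>\<^bsub>M\<^esub> z \<in> H" "x \<ominus>\<^bsub>M\<^esub> y \<in> H" "x \<in> carrier M" "y \<in> carrier M" "z \<in> carrier M" for x y z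
  proof -
    have "(x \<ominus>\<^bsub>M\<^esub> z) \<ominus>\<^bsub>M\<^esub> (x \<ominus>\<^bsub>M\<^esub> y) = y \<ominus>\<^bsub>M\<^esub> z"
      using that by (simp add: a_minus_def M.minus_add M.a_ac M.r_neg1 M.r_neg2)
    then show ?thesis using cl(7)[OF that(1,2)] by simp
  qed
  have sy: "y \<ominus>\<^bsub>M\<^esub> x \<in> H" if "x \<ominus>\<^bsub>M\<^esub> y \<in> H" "x \<in> carrier M" "y \<in> carrier M" for x y
    using tr[of x x y] that cl(2) by (simp add: a_minus_def M.r_neg)
  have re: "r x = r y \<longleftrightarrow> x \<ominus>\<^bsub>M\<^esub> y \<in> H" if "x \<in> carrier M" "y \<in> carrier M" for x y
  proof
    assume "r x = r y"
    then show "x \<ominus>\<^bsub>M\<^esub> y \<in> H" using r[OF that(1)] r[OF that(2)] tr[of "r x" y x] that by simp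
  next
    assume e: "x \<ominus>\<^bsub>M\<^esub> y \<in> H"
    have "z \<ominus>\<^bsub>M\<^esub> x \<in> H \<longleftrightarrow> z \<ominus>\<^bsub>M\<^esub> y \<in> H" if z: "z \<in> carrier M" for z
      using e sy tr z that \<open>x \<in> carrier M\<close> \<open>y \<in> carrier M\<close> by meson
    then show "r x = r y" unfolding r_def by metis
  qed
  let ?u = "\<lambda>x. v (r x)"
  have u: "?u x = ?u y \<longleftrightarrow> x \<ominus>\<^bsub>M\<^esub> y \<in> H" if "x \<in> carrier M" "y \<in> carrier M" for x y
    using re[OF that] r[OF that(1)] r[OF that(2)] inj_on_eq_iff[OF v] by simp
  note m = image_model[OF l H u]
  have "fg_module A (image_model M ?u)" by (rule fg_image[OF m(1) m(2)[symmetric] M])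
  then show ?thesis using m by (intro exI[of _ "image_model M ?u"] exI[of _ ?u]) auto
qed

definition iso_pair :: "('a, 'b) ring_scheme \<Rightarrow> ('a, 'm) module \<Rightarrow> ('a, 'n) module \<Rightarrow> ('m \<Rightarrow> 'n) \<Rightarrow> ('n \<Rightarrow> 'm) \<Rightarrow> bool"
  where "iso_pair A M N f g \<longleftrightarrow> lin A M N f \<and> lin A N M g \<and>
    (\<forall>x\<in>carrier M. g (f x) = x) \<and> (\<forall>y\<in>carrier N. f (g y) = y)"

lemma iso_pairD:
  assumes "iso_pair A M N f g"
  shows "lin A M N f" "lin A N M g" "x \<in> carrier M \<Longrightarrow> g (f x) = x" "y \<in> carrier N \<Longrightarrow> f (g y) = y"
  using assms by (auto simp: iso_pair_def)

lemma bij_iso_pair: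
  assumes "lin A M N f" "bij_betw f (carrier M) (carrier N)"
  shows "iso_pair A M N f (inv_into (carrier M) f)"
  using lin_inverse[OF assms] assms by (auto simp: iso_pair_def bij_betw_def f_inv_into_f)

lemma iso_pair_bij: "iso_pair A M N f g \<Longrightarrow> bij_betw f (carrier M) (carrier N)"
  by (rule bij_betw_byWitness[of _ g]) (auto simp: iso_pair_def linD(3))

lemma lmod_iso_iff:
  assumes "left_module A M" "left_module A N"
  shows "lmod_iso A M N \<longleftrightarrow> (\<exists>f g. iso_pair A M N f g)"
proof
  assume "lmod_iso A M N"
  then show "\<exists>f g. iso_pair A M N f g"
    unfolding lmod_iso_def using hom_set_lin[OF _ assms] bij_iso_pair by blast
next
  assume "\<exists>f g. iso_pair A M N f g"
  then obtain f g where i: "iso_pair A M N f g" by blast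
  have "bij_betw (restrict f (carrier M)) (carrier M) (carrier N)"
    using iso_pair_bij[OF i] by (simp cong: bij_betw_cong)
  then show "lmod_iso A M N" unfolding lmod_iso_def using lin_hom_set[OF iso_pairD(1)[OF i]] by blast
qed

lemma fd_copy:
  fixes A :: "('k, 'a) module"
  assumes A: "fd_algebra K A" and M: "fg_module A M"
  obtains N :: "('k, 'a) fd_mod" and f g where "fg_module A N" "iso_pair A M N f g"
proof -
  have l: "left_module A M" using M by (rule fg_left)
  obtain N :: "('k, 'a) fd_mod" and f where f: "fg_module A N" "lin A M N f" "f ` carrier M = carrier N"
    "\<And>x. x \<in> carrier M \<Longrightarrow> f x = \<zero>\<^bsub>N\<^esub> \<Longrightarrow> x \<in> {\<zero>\<^bsub>M\<^esub>}"
    using fd_quotient[OF A M submodule_zero[OF l]] by metis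
  have "inj_on f (carrier M)" by (rule lin_injI[OF f(2)]) (use f(4) in auto)
  then have "bij_betw f (carrier M) (carrier N)" using f(3) by (simp add: bij_betw_def)
  then show thesis using that[OF f(1) bij_iso_pair[OF f(2)]] by blast
qed

section \<open>Direct summands\<close>

text \<open>A direct summand given by an inclusion and a projection, without a chosen complement.\<close>

definition summand_pair :: "('a, 'b) ring_scheme \<Rightarrow> ('a, 'm) module \<Rightarrow> ('a, 'n) module \<Rightarrow> ('m \<Rightarrow> 'n) \<Rightarrow> ('n \<Rightarrow> 'm) \<Rightarrow> bool"
  where "summand_pair A V N i p \<longleftrightarrow> lin A V N i \<and> lin A N V p \<and> (\<forall>x\<in>carrier V. p (i x) = x)"

lemma retractD:
  assumes "summand_pair A V N i p"
  shows "lin A V N i" "lin A N V p" "x \<in> carrier V \<Longrightarrow> p (i x) = x"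
  using assms by (auto simp: summand_pair_def)

lemma iso_pair_retract: "iso_pair A M N f g \<Longrightarrow> summand_pair A M N f g" "iso_pair A M N f g \<Longrightarrow> summand_pair A N M g f"
  by (auto simp: iso_pair_def summand_pair_def)

lemma iso_pair_sym: "iso_pair A M N f g \<Longrightarrow> iso_pair A N M g f"
  by (auto simp: iso_pair_def)

lemma iso_pair_trans: "iso_pair A M N f g \<Longrightarrow> iso_pair A N L f' g' \<Longrightarrow> iso_pair A M L (\<lambda>x. f' (f x)) (\<lambda>x. g (g' x))"
  using lin_compose[of A M N f L f'] lin_compose[of A L N g' M g] by (auto simp: iso_pair_def linD(3))

lemma retract_trans: "summand_pair A V Y i p \<Longrightarrow> summand_pair A Y Z j q \<Longrightarrow> summand_pair A V Z (\<lambda>x. j (i x)) (\<lambda>x. p (q x))"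
  using lin_compose[of A V Y i Z j] lin_compose[of A Z Y q V p] by (auto simp: summand_pair_def linD(3))

lemma direct_decomp_projections:
  assumes l: "left_module A M" and d: "direct_decomp A M H1 H2"
  shows "\<exists>r s. lin A M M r \<and> lin A M M s \<and>
    (\<forall>x\<in>carrier M. r x \<in> H1 \<and> s x \<in> H2 \<and> x = r x \<oplus>\<^bsub>M\<^esub> s x) \<and>
    (\<forall>x\<in>H1. r x = x) \<and> (\<forall>x\<in>H2. s x = x)"
proof -
  interpret M: abelian_group M using l by (rule left_moduleD)
  have H: "submodule H1 A M" "submodule H2 A M" "H1 \<inter> H2 = {\<zero>\<^bsub>M\<^esub>}" "H1 <+>\<^bsub>M\<^esub> H2 = carrier M"
    using d by (auto simp: direct_decomp_def)
  note c1 = submoduleD[OF H(1)] and c2 = submoduleD[OF H(2)]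
  have "\<exists>u v. u \<in> H1 \<and> v \<in> H2 \<and> x = u \<oplus>\<^bsub>M\<^esub> v" if "x \<in> carrier M" for x
    using that H(4) by (auto simp: set_add_def')
  then obtain r s where rs: "\<And>x. x \<in> carrier M \<Longrightarrow> r x \<in> H1 \<and> s x \<in> H2 \<and> x = r x \<oplus>\<^bsub>M\<^esub> s x"
    by metis
  have sum: "r x \<oplus>\<^bsub>M\<^esub> s x = x" if "x \<in> carrier M" for x using rs[OF that] by simp
  have uq: "u = u' \<and> v = v'" if e: "u \<oplus>\<^bsub>M\<^esub> v = u' \<oplus>\<^bsub>M\<^esub> v'" and m: "u \<in> H1" "u' \<in> H1" "v \<in> H2" "v' \<in> H2" for u v u' v'
  proof -
    have c: "u \<in> carrier M" "u' \<in> carrier M" "v \<in> carrier M" "v' \<in> carrier M" using m c1 c2 by auto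
    have "(u \<ominus>\<^bsub>M\<^esub> u') \<oplus>\<^bsub>M\<^esub> (v \<ominus>\<^bsub>M\<^esub> v') = (u \<oplus>\<^bsub>M\<^esub> v) \<ominus>\<^bsub>M\<^esub> (u' \<oplus>\<^bsub>M\<^esub> v')"
      using c by (simp add: a_minus_def M.minus_add M.a_ac)
    also have "\<dots> = \<zero>\<^bsub>M\<^esub>" unfolding e using c by (simp add: a_minus_def M.r_neg)
    finally have "u \<ominus>\<^bsub>M\<^esub> u' = \<ominus>\<^bsub>M\<^esub> (v \<ominus>\<^bsub>M\<^esub> v')" using c by (simp add: M.minus_equality)
    then have "u \<ominus>\<^bsub>M\<^esub> u' \<in> H2" using c2(6)[OF c2(7)[OF m(3,4)]] by simp
    then have "u \<ominus>\<^bsub>M\<^esub> u' \<in> H1 \<inter> H2" using c1(7)[OF m(1,2)] by simp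
    then have "u \<ominus>\<^bsub>M\<^esub> u' = \<zero>\<^bsub>M\<^esub>" using H(3) by auto
    moreover have "(u \<ominus>\<^bsub>M\<^esub> u') \<oplus>\<^bsub>M\<^esub> u' = u" using c by (simp add: a_minus_def M.a_assoc M.l_neg)
    ultimately have "u = u'" using c by simp
    then show ?thesis using e c by simp
  qed
  have "r (x \<oplus>\<^bsub>M\<^esub> y) = r x \<oplus>\<^bsub>M\<^esub> r y \<and> s (x \<oplus>\<^bsub>M\<^esub> y) = s x \<oplus>\<^bsub>M\<^esub> s y" if "x \<in> carrier M" "y \<in> carrier M" for x y
  proof (rule uq)
    note R = rs[OF that(1)] rs[OF that(2)]
    have "r x \<in> carrier M" "s x \<in> carrier M" "r y \<in> carrier M" "s y \<in> carrier M" using R c1(5) c2(5) by auto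
    then have e: "(r x \<oplus>\<^bsub>M\<^esub> s x) \<oplus>\<^bsub>M\<^esub> (r y \<oplus>\<^bsub>M\<^esub> s y) = r x \<oplus>\<^bsub>M\<^esub> r y \<oplus>\<^bsub>M\<^esub> (s x \<oplus>\<^bsub>M\<^esub> s y)" by (simp add: M.a_ac)
    show "r (x \<oplus>\<^bsub>M\<^esub> y) \<oplus>\<^bsub>M\<^esub> s (x \<oplus>\<^bsub>M\<^esub> y) = r x \<oplus>\<^bsub>M\<^esub> r y \<oplus>\<^bsub>M\<^esub> (s x \<oplus>\<^bsub>M\<^esub> s y)"
      unfolding e[symmetric] sum[OF that(1)] sum[OF that(2)] by (rule sum) (use that in simp)
  qed (use that rs c1(3) c2(3) in auto)
  moreover have "r (a \<odot>\<^bsub>M\<^esub> x) = a \<odot>\<^bsub>M\<^esub> r x \<and> s (a \<odot>\<^bsub>M\<^esub> x) = a \<odot>\<^bsub>M\<^esub> s x" if "a \<in> carrier A" "x \<in> carrier M" for a x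
  proof (rule uq)
    note R = rs[OF that(2)]
    have "r x \<in> carrier M" "s x \<in> carrier M" using R c1(5) c2(5) by auto
    then have e: "a \<odot>\<^bsub>M\<^esub> (r x \<oplus>\<^bsub>M\<^esub> s x) = a \<odot>\<^bsub>M\<^esub> r x \<oplus>\<^bsub>M\<^esub> a \<odot>\<^bsub>M\<^esub> s x"
      using that by (simp add: left_module.smult_r_distr[OF l])
    show "r (a \<odot>\<^bsub>M\<^esub> x) \<oplus>\<^bsub>M\<^esub> s (a \<odot>\<^bsub>M\<^esub> x) = a \<odot>\<^bsub>M\<^esub> r x \<oplus>\<^bsub>M\<^esub> a \<odot>\<^bsub>M\<^esub> s x"
      unfolding e[symmetric] sum[OF that(2)] by (rule sum[OF left_module_closed(5)[OF l that]])
  qed (use that rs c1(4) c2(4) left_module_closed(5)[OF l that] in auto)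
  moreover have "r x \<in> carrier M" "s x \<in> carrier M" if "x \<in> carrier M" for x using rs[OF that] c1(5) c2(5) by auto
  ultimately have "lin A M M r" "lin A M M s" by (auto intro!: linI[OF l l])
  moreover have "r x = x" if "x \<in> H1" for x
  proof -
    have "r x \<oplus>\<^bsub>M\<^esub> s x = x \<oplus>\<^bsub>M\<^esub> \<zero>\<^bsub>M\<^esub>" using sum[OF c1(5)[OF that]] c1(5)[OF that] by simp
    then show ?thesis using uq[of "r x" "s x" x "\<zero>\<^bsub>M\<^esub>"] rs[OF c1(5)[OF that]] that c2(2) by blast
  qed
  moreover have "s x = x" if "x \<in> H2" for x
  proof -
    have "r x \<oplus>\<^bsub>M\<^esub> s x = \<zero>\<^bsub>M\<^esub> \<oplus>\<^bsub>M\<^esub> x" using sum[OF c2(5)[OF that]] c2(5)[OF that] by simp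
    then show ?thesis using uq[of "r x" "s x" "\<zero>\<^bsub>M\<^esub>" x] rs[OF c2(5)[OF that]] that c1(2) by blast
  qed
  ultimately show ?thesis using rs by (intro exI[of _ r] exI[of _ s]) auto
qed

lemma direct_decomp_retract:
  assumes l: "left_module A M" and d: "direct_decomp A M H1 H2"
  shows "\<exists>r s. summand_pair A (sub_module M H1) M (\<lambda>x. x) r \<and> summand_pair A (sub_module M H2) M (\<lambda>x. x) s \<and>
    (\<forall>x\<in>carrier M. x = r x \<oplus>\<^bsub>M\<^esub> s x)"
proof -
  have H: "submodule H1 A M" "submodule H2 A M" using d by (auto simp: direct_decomp_def)
  obtain r s where rs: "lin A M M r" "lin A M M s"
    "\<And>x. x \<in> carrier M \<Longrightarrow> r x \<in> H1 \<and> s x \<in> H2 \<and> x = r x \<oplus>\<^bsub>M\<^esub> s x"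
    "\<And>x. x \<in> H1 \<Longrightarrow> r x = x" "\<And>x. x \<in> H2 \<Longrightarrow> s x = x"
    using direct_decomp_projections[OF l d] by metis
  have "lin A M (sub_module M H1) r" "lin A M (sub_module M H2) s"
    using rs by (auto intro!: lin_into_sub H)
  then show ?thesis
    using rs lin_sub_incl[OF l H(1)] lin_sub_incl[OF l H(2)]
    by (intro exI[of _ r] exI[of _ s]) (auto simp: summand_pair_def)
qed

lemma direct_summand_iff:
  assumes M: "left_module A M" and N: "left_module A N"
  shows "direct_summand A M N \<longleftrightarrow> (\<exists>i p. summand_pair A M N i p)"
proof
  assume "direct_summand A M N"
  then obtain H1 H2 where d: "direct_decomp A N H1 H2" and i: "lmod_iso A M (sub_module N H1)"
    by (auto simp: direct_summand_def)
  have H: "submodule H1 A N" using d by (auto simp: direct_decomp_def)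
  obtain f g where "iso_pair A M (sub_module N H1) f g"
    using i lmod_iso_iff[OF M left_module_sub[OF N H]] by auto
  then have "summand_pair A M (sub_module N H1) f g" by (rule iso_pair_retract)
  then show "\<exists>i p. summand_pair A M N i p"
    using direct_decomp_retract[OF N d] retract_trans by blast
next
  assume "\<exists>i p. summand_pair A M N i p"
  then obtain i p where r: "lin A M N i" "lin A N M p" "\<And>x. x \<in> carrier M \<Longrightarrow> p (i x) = x"
    by (auto simp: summand_pair_def)
  interpret N: abelian_group N using N by (rule left_moduleD)
  interpret M: abelian_group M using M by (rule left_moduleD)
  let ?I = "i ` carrier M" and ?Q = "{y \<in> carrier N. p y = \<zero>\<^bsub>M\<^esub>}"
  have I: "submodule ?I A N" by (rule submodule_image[OF r(1) submodule_carrier[OF M]])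
  have Q: "submodule ?Q A N" by (rule submodule_kernel[OF r(2)])
  have "direct_decomp A N ?I ?Q"
    unfolding direct_decomp_def
  proof (intro conjI I Q)
    have "x = \<zero>\<^bsub>N\<^esub>" if "x \<in> ?I \<inter> ?Q" for x using that r(3) lin_zero[OF r(1)] by auto
    then show "?I \<inter> ?Q = {\<zero>\<^bsub>N\<^esub>}" using submoduleD(2)[OF I] submoduleD(2)[OF Q] by blast
    show "?I <+>\<^bsub>N\<^esub> ?Q = carrier N"
    proof
      show "?I <+>\<^bsub>N\<^esub> ?Q \<subseteq> carrier N" using linD(3)[OF r(1)] by (auto simp: set_add_def')
      show "carrier N \<subseteq> ?I <+>\<^bsub>N\<^esub> ?Q"
      proof
        fix y assume y: "y \<in> carrier N"
        have c: "p y \<in> carrier M" "i (p y) \<in> carrier N" using linD(3)[OF r(1)] linD(3)[OF r(2)] y by auto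
        have "p (y \<ominus>\<^bsub>N\<^esub> i (p y)) = \<zero>\<^bsub>M\<^esub>"
          using c y by (simp add: lin_minus[OF r(2)] r(3)) (simp add: a_minus_def M.r_neg)
        moreover have "y = i (p y) \<oplus>\<^bsub>N\<^esub> (y \<ominus>\<^bsub>N\<^esub> i (p y))" using c y by (simp add: a_minus_def N.a_ac N.r_neg2 N.r_neg1 N.r_neg)
        ultimately show "y \<in> ?I <+>\<^bsub>N\<^esub> ?Q" using c y unfolding set_add_def' by blast
      qed
    qed
  qed
  moreover have "bij_betw i (carrier M) ?I" using r(3) by (intro bij_betw_byWitness[of _ p]) auto
  then have "iso_pair A M (sub_module N ?I) i (inv_into (carrier M) i)"
    by (intro bij_iso_pair lin_into_sub[OF r(1) I]) auto
  then have "lmod_iso A M (sub_module N ?I)" using lmod_iso_iff[OF M left_module_sub[OF N I]] by blast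
  ultimately show "direct_summand A M N" unfolding direct_summand_def by blast
qed

text \<open>Fitting's lemma.  Along the powers of \<open>h\<close>, the length of the image decreases and the length
  of the kernel increases; take a power at which both have become stationary.\<close>

lemma fitting:
  assumes fl: "fin_len A M" and h: "lin A M M h"
  obtains k where "k > 0" "direct_decomp A M ((h ^^ k) ` carrier M) {x \<in> carrier M. (h ^^ k) x = \<zero>\<^bsub>M\<^esub>}"
proof -
  obtain \<mu> where m: "strict_measure A M \<mu>" and l: "left_module A M" using fl by (auto simp: fin_len_def)
  interpret M: abelian_group M using l by (rule left_moduleD)
  define I where "I n = (h ^^ n) ` carrier M" for n
  define Q where "Q n = {x \<in> carrier M. (h ^^ n) x = \<zero>\<^bsub>M\<^esub>}" for n
  note hn = lin_funpow[OF h]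
  have sI: "submodule (I n) A M" for n unfolding I_def by (rule submodule_image[OF hn submodule_carrier[OF l]])
  have sQ: "submodule (Q n) A M" for n unfolding Q_def by (rule submodule_kernel[OF hn])
  have IQ: "I (n + j) \<subseteq> I n" "Q n \<subseteq> Q (j + n)" for n j
  proof -
    show "I (n + j) \<subseteq> I n" unfolding I_def funpow_add using linD(3)[OF hn[of j]] by auto
    show "Q n \<subseteq> Q (j + n)" unfolding Q_def funpow_add using lin_zero[OF hn[of j]] by auto
  qed
  \<comment> \<open>The minimum of this sum is attained where neither the image shrinks nor the kernel grows.\<close>
  let ?m = "\<lambda>n. \<mu> (I (Suc n)) + (\<mu> (carrier M) - \<mu> (Q (Suc n)))"
  define n where "n = arg_min ?m (\<lambda>_. True)"
  have min: "?m n \<le> ?m j" for j unfolding n_def by (rule arg_min_nat_le) simp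
  let ?k = "Suc n"
  have e: "Suc (n + Suc n) = ?k + ?k" by simp
  have "\<mu> (I (?k + ?k)) \<le> \<mu> (I ?k)" "\<mu> (Q ?k) \<le> \<mu> (Q (?k + ?k))" "\<mu> (Q (?k + ?k)) \<le> \<mu> (carrier M)"
    using strict_measure_le[OF m sI sI IQ(1), of ?k ?k] strict_measure_le[OF m sQ sQ IQ(2), of ?k ?k]
      strict_measure_le[OF m sQ submodule_carrier[OF l] submoduleD(1)[OF sQ], of "?k + ?k"] by (simp_all only:)
  then have "\<mu> (I ?k) \<le> \<mu> (I (?k + ?k))" "\<mu> (Q (?k + ?k)) \<le> \<mu> (Q ?k)"
    using min[of "n + Suc n"] unfolding e by linarith+
  then have st: "I (?k + ?k) = I ?k" "Q ?k = Q (?k + ?k)"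
    using strict_measure_eq[OF m sI sI IQ(1), of ?k ?k] strict_measure_eq[OF m sQ sQ IQ(2), of ?k ?k] by (simp_all only:)
  have "direct_decomp A M (I ?k) (Q ?k)"
    unfolding direct_decomp_def
  proof (intro conjI sI sQ)
    have "x = \<zero>\<^bsub>M\<^esub>" if x: "x \<in> I ?k \<inter> Q ?k" for x
    proof -
      obtain y where y: "y \<in> carrier M" "x = (h ^^ ?k) y" using x by (auto simp: I_def)
      then have "y \<in> Q (?k + ?k)" using x unfolding Q_def funpow_add by simp
      then have "y \<in> Q ?k" by (simp only: st(2))
      then show ?thesis using y(2) by (simp add: Q_def del: funpow.simps)
    qed
    then show "I ?k \<inter> Q ?k = {\<zero>\<^bsub>M\<^esub>}" using submoduleD(2)[OF sI] submoduleD(2)[OF sQ] by blast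
    show "I ?k <+>\<^bsub>M\<^esub> Q ?k = carrier M"
    proof
      show "I ?k <+>\<^bsub>M\<^esub> Q ?k \<subseteq> carrier M"
        using submoduleD(1)[OF sI[of ?k]] submoduleD(1)[OF sQ[of ?k]] by (auto simp: set_add_def')
      show "carrier M \<subseteq> I ?k <+>\<^bsub>M\<^esub> Q ?k"
      proof
        fix x assume x: "x \<in> carrier M"
        then have "(h ^^ ?k) x \<in> I (?k + ?k)" unfolding st(1) by (simp add: I_def del: funpow.simps)
        then obtain y where y: "y \<in> carrier M" "(h ^^ ?k) x = (h ^^ ?k) ((h ^^ ?k) y)"
          unfolding I_def funpow_add by auto
        let ?z = "(h ^^ ?k) y"
        have c: "?z \<in> carrier M" "(h ^^ ?k) ?z \<in> carrier M" using linD(3)[OF hn] y by blast+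
        have "(h ^^ ?k) (x \<ominus>\<^bsub>M\<^esub> ?z) = \<zero>\<^bsub>M\<^esub>"
          using c x y(2) lin_minus[OF hn[of ?k]] by (simp add: a_minus_def M.r_neg del: funpow.simps)
        then have "x \<ominus>\<^bsub>M\<^esub> ?z \<in> Q ?k" using x c by (simp add: Q_def del: funpow.simps)
        moreover have "?z \<in> I ?k" using y by (simp add: I_def del: funpow.simps)
        moreover have "x = ?z \<oplus>\<^bsub>M\<^esub> (x \<ominus>\<^bsub>M\<^esub> ?z)" using c x by (simp add: a_minus_def M.a_ac M.r_neg2 M.r_neg1 M.r_neg del: funpow.simps)
        ultimately show "x \<in> I ?k <+>\<^bsub>M\<^esub> Q ?k" unfolding set_add_def' by blast
      qed
    qed
  qed
  then show thesis using that[of ?k] unfolding I_def Q_def by blast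
qed

section \<open>Maps that factor through copies of \<open>E\<close>\<close>

text \<open>Finite sums of maps \<open>V \<rightarrow> E \<rightarrow> Y\<close>.  The module \<open>V\<close> is a direct summand of some \<open>E\<^sup>n\<close> exactly
  when its identity is such a sum, so statements about \<open>add E\<close> become inductions along this
  definition, without coordinates.\<close>

inductive through :: "('a, 'b) ring_scheme \<Rightarrow> ('a, 'e) module \<Rightarrow> ('a, 'm) module \<Rightarrow> ('a, 'n) module \<Rightarrow> ('m \<Rightarrow> 'n) \<Rightarrow> bool"
  for A E V Y where
  zero: "\<forall>x\<in>carrier V. f x = \<zero>\<^bsub>Y\<^esub> \<Longrightarrow> through A E V Y f"
| step: "through A E V Y f \<Longrightarrow> lin A V E p \<Longrightarrow> lin A E Y i \<Longrightarrow>
    \<forall>x\<in>carrier V. g x = f x \<oplus>\<^bsub>Y\<^esub> i (p x) \<Longrightarrow> through A E V Y g"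

lemma through_cong:
  assumes "through A E V Y f" "\<And>x. x \<in> carrier V \<Longrightarrow> g x = f x"
  shows "through A E V Y g"
  using assms by (cases rule: through.cases) (auto intro: through.intros)

lemma through_lin:
  assumes "through A E V Y f" "left_module A V" "left_module A Y"
  shows "lin A V Y f"
  using assms
proof induction
  case (zero f)
  then show ?case by (intro lin_cong[OF lin_0]) auto
next
  case (step f p i g)
  then show ?case by (intro lin_cong[OF lin_plus[OF step.IH lin_compose[OF step(2,3)]]]) auto
qed

lemma through_post:
  assumes "through A E V Y f" "left_module A V" and g: "lin A Y Z g"
  shows "through A E V Z (\<lambda>x. g (f x))"
  using assms(1,2)
proof induction
  case (zero f)
  then show ?case by (intro through.zero) (auto simp: lin_zero[OF g])
next
  case (step f p i h)
  have f: "lin A V Y f" by (rule through_lin[OF step(1) step.prems linD(1)[OF g]])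
  show ?case
    by (rule through.step[OF step.IH[OF step.prems] step(2) lin_compose[OF step(3) g]])
      (use step(4) linD(3)[OF f] linD(3)[OF step(2)] linD(3)[OF step(3)] linD(4)[OF g] in auto)
qed

lemma through_pre:
  assumes "through A E V Y f" and k: "lin A W V k"
  shows "through A E W Y (\<lambda>x. f (k x))"
  using assms(1)
proof induction
  case (zero f)
  then show ?case by (intro through.zero) (auto simp: linD(3)[OF k])
next
  case (step f p i h)
  show ?case
    by (rule through.step[OF step.IH lin_compose[OF k step(2)] step(3)]) (use step(4) linD(3)[OF k] in auto)
qed

lemma through_single:
  assumes p: "lin A V E p" and i: "lin A E Y i"
  shows "through A E V Y (\<lambda>x. i (p x))"
proof -
  interpret Y: abelian_group Y using i by (rule linD)
  show ?thesis
    by (rule through.step[OF through.zero p i, of "\<lambda>_. \<zero>\<^bsub>Y\<^esub>"]) (use linD(3)[OF p] linD(3)[OF i] in auto)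
qed

lemma through_add:
  assumes f: "through A E V Y f" and "through A E V Y g" and l: "left_module A V" "left_module A Y"
  shows "through A E V Y (\<lambda>x. f x \<oplus>\<^bsub>Y\<^esub> g x)"
  using assms(2)
proof induction
  interpret Y: abelian_group Y using l(2) by (rule left_moduleD)
  note fc = linD(3)[OF through_lin[OF f l]]
  { case (zero g)
    then show ?case by (intro through_cong[OF f]) (auto simp: fc) }
  { case (step g p i h)
    show ?case
      by (rule through.step[OF step.IH step(2,3)])
        (use step(4) fc linD(3)[OF step(2)] linD(3)[OF step(3)] linD(3)[OF through_lin[OF step(1) l]] in
          \<open>auto simp: Y.a_assoc\<close>) }
qed

definition addE :: "('a, 'b) ring_scheme \<Rightarrow> ('a, 'e) module \<Rightarrow> ('a, 'm) module \<Rightarrow> bool" where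
  "addE A E V \<longleftrightarrow> left_module A E \<and> left_module A V \<and> through A E V V (\<lambda>x. x)"

lemma addED: "addE A E V \<Longrightarrow> left_module A E" "addE A E V \<Longrightarrow> left_module A V" "addE A E V \<Longrightarrow> through A E V V (\<lambda>x. x)"
  by (auto simp: addE_def)

lemma addE_self: "left_module A E \<Longrightarrow> addE A E E"
  using through_single[OF lin_id lin_id] by (simp add: addE_def)

lemma addE_through: "addE A E V \<Longrightarrow> lin A V Y u \<Longrightarrow> through A E V Y u"
  using through_post[of A E V V "\<lambda>x. x"] by (auto simp: addE_def)

lemma addE_through': "addE A E V \<Longrightarrow> lin A W V u \<Longrightarrow> through A E W V u"
  using through_pre[of A E V V "\<lambda>x. x"] by (auto simp: addE_def)

lemma addE_retract:
  assumes r: "summand_pair A V N i p" and N: "addE A E N"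
  shows "addE A E V"
proof -
  note R = retractD[OF r]
  have "through A E V V (\<lambda>x. p (i x))"
    by (rule through_post[OF addE_through'[OF N R(1)] linD(1)[OF R(1)] R(2)])
  then have "through A E V V (\<lambda>x. x)" by (rule through_cong) (use R(3) in auto)
  then show ?thesis using N linD(1)[OF R(1)] by (simp add: addE_def)
qed

text \<open>Lifting from \<open>E\<close> and extending to \<open>E\<close> are enough for all of \<open>add E\<close>: lift or extend the summands
  of the identity.\<close>

lemma addE_lift:
  assumes V: "addE A E V" and g: "lin A M N g" and u: "lin A V N u"
    and l: "\<And>k. lin A E N k \<Longrightarrow> \<exists>k'. lin A E M k' \<and> (\<forall>e\<in>carrier E. g (k' e) = k e)"
  shows "\<exists>u'. lin A V M u' \<and> (\<forall>x\<in>carrier V. g (u' x) = u x)"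
  using addE_through[OF V u]
proof induction
  case (zero f)
  then show ?case using lin_0[OF linD(1)[OF u] linD(1)[OF g]] lin_zero[OF g] by (intro exI[of _ "\<lambda>_. \<zero>\<^bsub>M\<^esub>"]) auto
next
  case (step f p i h)
  obtain u' where u': "lin A V M u'" "\<And>x. x \<in> carrier V \<Longrightarrow> g (u' x) = f x" using step.IH by auto
  obtain k where k: "lin A E M k" "\<And>e. e \<in> carrier E \<Longrightarrow> g (k e) = i e" using l[OF step(3)] by auto
  show ?case
    by (rule exI[of _ "\<lambda>x. u' x \<oplus>\<^bsub>M\<^esub> k (p x)"])
      (use lin_plus[OF u'(1) lin_compose[OF step(2) k(1)]] step(4) u' k linD(3)[OF step(2)] linD(3)[OF u'(1)]
        linD(3)[OF k(1)] in \<open>auto simp: linD(4)[OF g]\<close>)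
qed

lemma addE_extend:
  assumes Q: "addE A E Q" and j: "lin A N P j" and u: "lin A N Q u"
    and l: "\<And>\<phi>. lin A N E \<phi> \<Longrightarrow> \<exists>\<psi>. lin A P E \<psi> \<and> (\<forall>x\<in>carrier N. \<psi> (j x) = \<phi> x)"
  shows "\<exists>u'. lin A P Q u' \<and> (\<forall>x\<in>carrier N. u' (j x) = u x)"
  using addE_through'[OF Q u]
proof induction
  case (zero f)
  then show ?case using lin_0[OF linD(2)[OF j] linD(2)[OF u]] by (intro exI[of _ "\<lambda>_. \<zero>\<^bsub>Q\<^esub>"]) auto
next
  case (step f p i h)
  obtain u' where u': "lin A P Q u'" "\<And>x. x \<in> carrier N \<Longrightarrow> u' (j x) = f x" using step.IH by auto
  obtain k where k: "lin A P E k" "\<And>x. x \<in> carrier N \<Longrightarrow> k (j x) = p x" using l[OF step(2)] by auto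
  show ?case
    by (rule exI[of _ "\<lambda>x. u' x \<oplus>\<^bsub>Q\<^esub> i (k x)"])
      (use lin_plus[OF u'(1) lin_compose[OF k(1) step(3)]] step(4) u' k in auto)
qed

lemma through_fg:
  assumes E: "fg_module A E" and "through A E V Y f" and Y: "left_module A Y"
  shows "\<exists>S. finite S \<and> S \<subseteq> carrier Y \<and> f ` carrier V \<subseteq> gen A Y S"
  using assms(2)
proof induction
  case (zero f)
  have "\<zero>\<^bsub>Y\<^esub> \<in> gen A Y {}" by (rule submoduleD(2)[OF submodule_gen[OF Y]]) auto
  then show ?case using zero by (intro exI[of _ "{}"]) auto
next
  case (step f p i g)
  obtain S where S: "finite S" "S \<subseteq> carrier Y" "f ` carrier V \<subseteq> gen A Y S" using step.IH by auto
  obtain T where T: "finite T" "T \<subseteq> carrier E" "\<And>H. submodule H A E \<Longrightarrow> T \<subseteq> H \<Longrightarrow> H = carrier E"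
    using fg_moduleE[OF E] by metis
  let ?G = "gen A Y (S \<union> i ` T)"
  have sub: "S \<union> i ` T \<subseteq> carrier Y" using S T linD(3)[OF step(3)] by auto
  have G: "submodule ?G A Y" by (rule submodule_gen[OF Y sub])
  have "{e \<in> carrier E. i e \<in> ?G} = carrier E"
    by (rule T(3)[OF submodule_vimage[OF step(3) G]]) (use T(2) gen_incl[of "S \<union> i ` T" A Y] in auto)
  moreover have "gen A Y S \<subseteq> ?G" by (rule gen_mono[OF Y sub]) auto
  ultimately have "g ` carrier V \<subseteq> ?G"
    using step(4) S(3) linD(3)[OF step(2)] by (auto simp: image_subset_iff intro!: submoduleD(3)[OF G])
  then show ?case using S T sub by (intro exI[of _ "S \<union> i ` T"]) auto
qed

lemma addE_fg:
  assumes E: "fg_module A E" and V: "addE A E V"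
  shows "fg_module A V"
proof -
  note D = addED[OF V]
  obtain S where S: "finite S" "S \<subseteq> carrier V" "carrier V \<subseteq> gen A V S"
    using through_fg[OF E D(3) D(2)] by auto
  then have "gen A V S = carrier V" using submoduleD(1)[OF submodule_gen[OF D(2) S(2)]] by auto
  then show ?thesis using S D(2) fg_module_iff_gen by blast
qed

lemma power_module_simps [simp]:
  "carrier (power_module M n) = {..<n} \<rightarrow>\<^sub>E carrier M" "\<zero>\<^bsub>power_module M n\<^esub> = (\<lambda>i\<in>{..<n}. \<zero>\<^bsub>M\<^esub>)"
  "x \<oplus>\<^bsub>power_module M n\<^esub> y = (\<lambda>i\<in>{..<n}. x i \<oplus>\<^bsub>M\<^esub> y i)"
  "a \<odot>\<^bsub>power_module M n\<^esub> x = (\<lambda>i\<in>{..<n}. a \<odot>\<^bsub>M\<^esub> x i)"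
  by (simp_all add: power_module_def)

lemma left_module_power:
  assumes l: "left_module A M"
  shows "left_module A (power_module M n)"
proof -
  interpret M: abelian_group M using l by (rule left_moduleD)
  interpret A: ring A using l by (rule left_moduleD)
  have c: "x i \<in> carrier M" if "x \<in> {..<n} \<rightarrow>\<^sub>E carrier M" "i < n" for x i using that by auto
  have u: "(\<lambda>i\<in>{..<n}. x i) = x" if "x \<in> {..<n} \<rightarrow>\<^sub>E carrier M" for x using that by (simp add: PiE_def extensional_restrict)
  have g: "abelian_group (power_module M n)"
  proof (rule abelian_groupI)
    fix x assume x: "x \<in> carrier (power_module M n)"
    then have x': "x \<in> {..<n} \<rightarrow>\<^sub>E carrier M" by simp
    show "\<exists>y\<in>carrier (power_module M n). y \<oplus>\<^bsub>power_module M n\<^esub> x = \<zero>\<^bsub>power_module M n\<^esub>"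
      by (rule bexI[of _ "\<lambda>i\<in>{..<n}. \<ominus>\<^bsub>M\<^esub> x i"])
        (use c[OF x'] in \<open>auto simp: M.l_neg restrict_PiE_iff intro!: restrict_ext\<close>)
    have "(\<lambda>i\<in>{..<n}. \<zero>\<^bsub>M\<^esub> \<oplus>\<^bsub>M\<^esub> x i) = (\<lambda>i\<in>{..<n}. x i)" by (rule restrict_ext) (use c[OF x'] in simp)
    then show "\<zero>\<^bsub>power_module M n\<^esub> \<oplus>\<^bsub>power_module M n\<^esub> x = x"
      using u[OF x'] by (simp cong: restrict_cong)
    fix y assume y: "y \<in> carrier (power_module M n)"
    then have y': "y \<in> {..<n} \<rightarrow>\<^sub>E carrier M" by simp
    show "x \<oplus>\<^bsub>power_module M n\<^esub> y \<in> carrier (power_module M n)"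
      using c[OF x'] c[OF y'] by (simp add: restrict_PiE_iff)
    show "x \<oplus>\<^bsub>power_module M n\<^esub> y = y \<oplus>\<^bsub>power_module M n\<^esub> x"
      using c[OF x'] c[OF y'] by (auto intro!: restrict_ext simp: M.a_comm)
    fix z assume "z \<in> carrier (power_module M n)"
    then have z': "z \<in> {..<n} \<rightarrow>\<^sub>E carrier M" by simp
    show "x \<oplus>\<^bsub>power_module M n\<^esub> y \<oplus>\<^bsub>power_module M n\<^esub> z = x \<oplus>\<^bsub>power_module M n\<^esub> (y \<oplus>\<^bsub>power_module M n\<^esub> z)"
      using c[OF x'] c[OF y'] c[OF z'] by (auto intro!: restrict_ext simp: M.a_assoc)
  qed (simp add: restrict_PiE_iff)
  show ?thesis
  proof (intro left_module.intro left_module_axioms.intro g A.ring_axioms)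
    fix x assume "x \<in> carrier (power_module M n)"
    then have x': "x \<in> {..<n} \<rightarrow>\<^sub>E carrier M" by simp
    have "(\<lambda>i\<in>{..<n}. \<one>\<^bsub>A\<^esub> \<odot>\<^bsub>M\<^esub> x i) = (\<lambda>i\<in>{..<n}. x i)"
      by (rule restrict_ext) (use c[OF x'] in \<open>simp add: left_module.smult_one[OF l]\<close>)
    then show "\<one>\<^bsub>A\<^esub> \<odot>\<^bsub>power_module M n\<^esub> x = x" using u[OF x'] by simp
    fix a assume a: "a \<in> carrier A"
    then show "a \<odot>\<^bsub>power_module M n\<^esub> x \<in> carrier (power_module M n)"
      using c[OF x'] left_module_closed(5)[OF l a] by (simp add: restrict_PiE_iff)
    { fix b assume b: "b \<in> carrier A"
      show "(a \<oplus>\<^bsub>A\<^esub> b) \<odot>\<^bsub>power_module M n\<^esub> x = a \<odot>\<^bsub>power_module M n\<^esub> x \<oplus>\<^bsub>power_module M n\<^esub> b \<odot>\<^bsub>power_module M n\<^esub> x"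
        using c[OF x'] a b by (auto intro!: restrict_ext simp: left_module.smult_l_distr[OF l])
      show "(a \<otimes>\<^bsub>A\<^esub> b) \<odot>\<^bsub>power_module M n\<^esub> x = a \<odot>\<^bsub>power_module M n\<^esub> (b \<odot>\<^bsub>power_module M n\<^esub> x)"
        using c[OF x'] a b by (auto intro!: restrict_ext simp: left_module.smult_assoc1[OF l]) }
    fix y assume "y \<in> carrier (power_module M n)"
    then have y': "y \<in> {..<n} \<rightarrow>\<^sub>E carrier M" by simp
    show "a \<odot>\<^bsub>power_module M n\<^esub> (x \<oplus>\<^bsub>power_module M n\<^esub> y) = a \<odot>\<^bsub>power_module M n\<^esub> x \<oplus>\<^bsub>power_module M n\<^esub> a \<odot>\<^bsub>power_module M n\<^esub> y"
      using c[OF x'] c[OF y'] a by (auto intro!: restrict_ext simp: left_module.smult_r_distr[OF l])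
  qed
qed

lemma lin_power_nth:
  assumes "left_module A M" "i < n"
  shows "lin A (power_module M n) M (\<lambda>x. x i)"
  by (rule linI[OF left_module_power]) (use assms in auto)

lemma lin_power_restrict:
  assumes "left_module A M"
  shows "lin A (power_module M (Suc n)) (power_module M n) (\<lambda>x. restrict x {..<n})"
proof (rule linI[OF left_module_power[OF assms] left_module_power[OF assms]])
  show "restrict x {..<n} \<in> carrier (power_module M n)" if "x \<in> carrier (power_module M (Suc n))" for x
    using PiE_mem[of x "{..<Suc n}" "\<lambda>_. carrier M"] that by (simp add: restrict_PiE_iff)
qed (simp_all add: restrict_def fun_eq_iff)

lemma lin_power_extend:
  assumes a: "lin A V (power_module M n) a" and p: "lin A V M p"
  shows "lin A V (power_module M (Suc n)) (\<lambda>x. (a x)(n := p x))"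
proof (rule linI)
  fix x assume x: "x \<in> carrier V"
  show "(a x)(n := p x) \<in> carrier (power_module M (Suc n))"
    using linD(3)[OF a x] linD(3)[OF p x] by (auto simp: PiE_def extensional_def Pi_def less_Suc_eq)
qed (use a p linD(4,5)[OF a] linD(4,5)[OF p] in \<open>auto simp: fun_eq_iff restrict_def less_Suc_eq intro: left_module_power linD(1,2)\<close>)

lemma lin_power_unit:
  assumes l: "left_module A M"
  shows "lin A M (power_module M n) (\<lambda>e. \<lambda>i\<in>{..<n}. if i = m then e else \<zero>\<^bsub>M\<^esub>)"
proof -
  interpret M: abelian_group M using l by (rule left_moduleD)
  show ?thesis
    by (rule linI[OF l left_module_power[OF l]])
      (auto simp: restrict_PiE_iff left_module_smult_zero[OF l] intro!: restrict_ext)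
qed

lemma addE_power:
  assumes l: "left_module A M"
  shows "addE A M (power_module M n)"
proof -
  interpret M: abelian_group M using l by (rule left_moduleD)
  let ?P = "power_module M n"
  let ?t = "\<lambda>m x. \<lambda>i\<in>{..<n}. if i < m then x i else \<zero>\<^bsub>M\<^esub>"
  have "m \<le> n \<Longrightarrow> through A M ?P ?P (?t m)" for m
  proof (induction m)
    case 0 show ?case by (rule through.zero) (simp add: restrict_def)
  next
    case (Suc m)
    show ?case
    proof (rule through.step[OF Suc.IH lin_power_nth[OF l, of m n] lin_power_unit[OF l, of n m]])
      show "\<forall>x\<in>carrier ?P. ?t (Suc m) x = ?t m x \<oplus>\<^bsub>?P\<^esub> (\<lambda>i\<in>{..<n}. if i = m then x m else \<zero>\<^bsub>M\<^esub>)"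
      proof
        fix x assume "x \<in> carrier ?P"
        then have c: "x i \<in> carrier M" if "i < n" for i using that PiE_mem[of x "{..<n}" "\<lambda>_. carrier M" i] by simp
        show "?t (Suc m) x = ?t m x \<oplus>\<^bsub>?P\<^esub> (\<lambda>i\<in>{..<n}. if i = m then x m else \<zero>\<^bsub>M\<^esub>)"
          unfolding power_module_simps by (rule restrict_ext) (use c in \<open>simp add: less_Suc_eq\<close>)
      qed
    qed (use Suc.prems in simp_all)
  qed
  from this[of n] have "through A M ?P ?P (\<lambda>x. x)"
  proof (rule through_cong)
    fix x assume "x \<in> carrier ?P"
    then show "x = ?t n x" by (auto simp: restrict_def fun_eq_iff PiE_def extensional_def)
  qed simp
  then show ?thesis using l left_module_power[OF l] by (simp add: addE_def)
qed

text \<open>Collecting the maps to \<open>E\<close> and the maps from \<open>E\<close> that occur in the sum gives a factorization through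
  one power.\<close>

lemma through_power_factor:
  assumes "through A E V Y f" and V: "left_module A V" and Y: "left_module A Y" and E: "left_module A E"
  shows "\<exists>n a b. lin A V (power_module E n) a \<and> lin A (power_module E n) Y b \<and> (\<forall>x\<in>carrier V. f x = b (a x))"
  using assms(1)
proof induction
  case (zero f)
  show ?case
    by (rule exI[of _ 0], rule exI[of _ "\<lambda>_ _. undefined"], rule exI[of _ "\<lambda>_. \<zero>\<^bsub>Y\<^esub>"])
      (use zero lin_0[OF left_module_power[OF E] Y] in \<open>auto intro!: linI[OF V left_module_power[OF E]]\<close>)
next
  case (step f p i g)
  obtain n a b where ab: "lin A V (power_module E n) a" "lin A (power_module E n) Y b" "\<And>x. x \<in> carrier V \<Longrightarrow> f x = b (a x)"
    using step.IH by auto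
  have b': "lin A (power_module E (Suc n)) Y (\<lambda>y. b (restrict y {..<n}) \<oplus>\<^bsub>Y\<^esub> i (y n))"
    by (rule lin_plus[OF lin_compose[OF lin_power_restrict[OF E] ab(2)] lin_compose[OF lin_power_nth[OF E] step(3)]]) simp
  have r: "restrict ((a x)(n := p x)) {..<n} = a x" if "x \<in> carrier V" for x
    using linD(3)[OF ab(1) that] by (auto simp: fun_eq_iff restrict_def PiE_def extensional_def)
  show ?case
    by (rule exI[of _ "Suc n"], rule exI[of _ "\<lambda>x. (a x)(n := p x)"], rule exI[of _ "\<lambda>y. b (restrict y {..<n}) \<oplus>\<^bsub>Y\<^esub> i (y n)"])
      (use lin_power_extend[OF ab(1) step(2)] b' step(4) ab(3) r in \<open>simp del: restrict_fupd fun_upd_apply add: fun_upd_same\<close>)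
qed

lemma addE_iff_retract_power:
  assumes E: "left_module A E" and V: "left_module A V"
  shows "addE A E V \<longleftrightarrow> (\<exists>n i p. summand_pair A V (power_module E n) i p)"
proof
  assume "addE A E V"
  then obtain n a b where "lin A V (power_module E n) a" "lin A (power_module E n) V b" "\<forall>x\<in>carrier V. x = b (a x)"
    using through_power_factor[OF addED(3) V V E] by blast
  then show "\<exists>n i p. summand_pair A V (power_module E n) i p" unfolding summand_pair_def by metis
next
  assume "\<exists>n i p. summand_pair A V (power_module E n) i p"
  then show "addE A E V" using addE_retract[OF _ addE_power[OF E]] by blast
qed

lemma in_add_iff:
  assumes "left_module A E"
  shows "in_add A E Z \<longleftrightarrow> fg_module A Z \<and> addE A E Z"
  using addE_iff_retract_power[OF assms] direct_summand_iff[OF _ left_module_power[OF assms]] fg_left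
  unfolding in_add_def by metis

section \<open>Projective modules\<close>

text \<open>Finitely generated projective modules as the direct summands of the free modules \<open>A\<^sup>n\<close>.  Unlike
  the lifting property \<^const>\<open>fg_projective\<close>, which tests against modules on one fixed type only, this
  makes sense for modules on any type and allows induction.\<close>

abbreviation proj :: "('a, 'b) ring_scheme \<Rightarrow> ('a, 'm) module \<Rightarrow> bool" where
  "proj A P \<equiv> addE A (regular A) P"

lemma lin_from_regular:
  assumes "left_module A N" "y \<in> carrier N"
  shows "lin A (regular A) N (\<lambda>a. a \<odot>\<^bsub>N\<^esub> y)"
  by (rule linI[OF left_module_regular[OF left_moduleD(1)[OF assms(1)]] assms(1)])
    (use assms left_module_closed(5)[OF assms(1)] in \<open>auto simp: left_module.smult_l_distr left_module.smult_assoc1\<close>)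

lemma lin_regular_eval:
  assumes "lin A (regular A) N k" "a \<in> carrier A"
  shows "k a = a \<odot>\<^bsub>N\<^esub> k \<one>\<^bsub>A\<^esub>"
proof -
  interpret A: ring A using assms(1) by (rule linD)
  show ?thesis using linD(5)[OF assms(1), of a "\<one>\<^bsub>A\<^esub>"] assms(2) by simp
qed

lemma proj_lift:
  assumes P: "proj A P" and g: "lin A M N g" and u: "lin A P N u" and im: "u ` carrier P \<subseteq> g ` carrier M"
  shows "\<exists>u'. lin A P M u' \<and> (\<forall>x\<in>carrier P. g (u' x) = u x)"
proof -
  interpret A: ring A using g by (rule linD)
  let ?I = "g ` carrier M"
  have I: "submodule ?I A N" by (rule submodule_image[OF g submodule_carrier[OF linD(1)[OF g]]])
  show ?thesis
  proof (rule addE_lift[OF P lin_into_sub[OF g I] lin_into_sub[OF u I im]])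
    fix k assume k: "lin A (regular A) (sub_module N ?I) k"
    have "k \<one>\<^bsub>A\<^esub> \<in> ?I" using linD(3)[OF k, of "\<one>\<^bsub>A\<^esub>"] by simp
    then obtain y where y: "y \<in> carrier M" "k \<one>\<^bsub>A\<^esub> = g y" by auto
    have "g (a \<odot>\<^bsub>M\<^esub> y) = k a" if "a \<in> carrier A" for a
      using lin_regular_eval[OF k that] linD(5)[OF g that y(1)] y(2) by simp
    then show "\<exists>k'. lin A (regular A) M k' \<and> (\<forall>e\<in>carrier (regular A). g (k' e) = k e)"
      using lin_from_regular[OF linD(1)[OF g] y(1)] by (intro exI[of _ "\<lambda>a. a \<odot>\<^bsub>M\<^esub> y"]) simp
  qed simp
qed

lemma free_cover:
  assumes M: "fg_module A M"
  shows "\<exists>n b. lin A (power_module (regular A) n) M b \<and> b ` carrier (power_module (regular A) n) = carrier M"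
proof -
  have l: "left_module A M" using M by (rule fg_left)
  interpret A: ring A using l by (rule left_moduleD)
  interpret M: abelian_group M using l by (rule left_moduleD)
  have r: "left_module A (regular A)" by (rule left_module_regular[OF A.ring_axioms])
  obtain S where S: "finite S" "S \<subseteq> carrier M" "\<And>H. submodule H A M \<Longrightarrow> S \<subseteq> H \<Longrightarrow> H = carrier M"
    using fg_moduleE[OF M] by metis
  have "\<exists>n b. lin A (power_module (regular A) n) M b \<and> S \<subseteq> b ` carrier (power_module (regular A) n)"
    using S(1,2)
  proof (induction S rule: finite_induct)
    case empty
    show ?case by (intro exI[of _ 0] exI[of _ "\<lambda>_. \<zero>\<^bsub>M\<^esub>"] conjI lin_0 left_module_power r l) auto
  next
    case (insert t T)
    let ?R = "regular A"
    obtain n b where b: "lin A (power_module ?R n) M b" "T \<subseteq> b ` carrier (power_module ?R n)"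
      using insert.IH insert.prems by auto
    have t: "t \<in> carrier M" using insert.prems by auto
    let ?b = "\<lambda>x. b (restrict x {..<n}) \<oplus>\<^bsub>M\<^esub> x n \<odot>\<^bsub>M\<^esub> t"
    have lb: "lin A (power_module ?R (Suc n)) M ?b"
      by (rule lin_plus[OF lin_compose[OF lin_power_restrict[OF r] b(1)]
            lin_compose[OF lin_power_nth[OF r] lin_from_regular[OF l t]]]) simp
    have e: "x(n := c) \<in> carrier (power_module ?R (Suc n))" "?b (x(n := c)) = b x \<oplus>\<^bsub>M\<^esub> c \<odot>\<^bsub>M\<^esub> t"
      if x: "x \<in> carrier (power_module ?R n)" and c: "c \<in> carrier A" for x c
    proof -
      have "x \<in> {..<n} \<rightarrow>\<^sub>E carrier A" using x by simp
      then show "x(n := c) \<in> carrier (power_module ?R (Suc n))"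
        using c by (simp add: lessThan_Suc PiE_fun_upd)
      have "restrict (x(n := c)) {..<n} = restrict x {..<n}" by (rule restrict_ext) simp
      also have "\<dots> = x" using \<open>x \<in> {..<n} \<rightarrow>\<^sub>E carrier A\<close> by (simp add: PiE_def extensional_restrict)
      finally show "?b (x(n := c)) = b x \<oplus>\<^bsub>M\<^esub> c \<odot>\<^bsub>M\<^esub> t" by (simp only: fun_upd_same)
    qed
    have z: "\<zero>\<^bsub>power_module ?R n\<^esub> \<in> carrier (power_module ?R n)" by (rule left_module_closed(1)[OF left_module_power[OF r]])
    have "t \<in> ?b ` carrier (power_module ?R (Suc n))"
      using e[OF z A.one_closed] t left_module.smult_one[OF l t] by (intro image_eqI[of _ ?b]) (simp_all only: lin_zero[OF b(1)] M.l_zero)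
    moreover have "s \<in> ?b ` carrier (power_module ?R (Suc n))" if sT: "s \<in> T" for s
    proof -
      obtain x where x: "x \<in> carrier (power_module ?R n)" "s = b x" using b(2) sT by blast
      then have "s \<in> carrier M" using linD(3)[OF b(1)] by simp
      then show ?thesis
        using e[OF x(1) A.zero_closed] x(2) left_module_zero_smult[OF l t]
        by (intro image_eqI[of _ ?b]) (simp_all only: M.r_zero)
    qed
    ultimately show ?case using lb by blast
  qed
  then obtain n b where b: "lin A (power_module (regular A) n) M b" "S \<subseteq> b ` carrier (power_module (regular A) n)" by blast
  have "b ` carrier (power_module (regular A) n) = carrier M"
    by (rule S(3)[OF submodule_image[OF b(1) submodule_carrier[OF linD(1)[OF b(1)]]] b(2)])
  then show ?thesis using b(1) by blast
qed

lemma proj_power: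
  assumes "ring A"
  shows "proj A (power_module (regular A) n)" "fg_module A (power_module (regular A) n)"
  using addE_power[OF left_module_regular[OF assms]] addE_fg[OF fg_regular[OF assms]] by auto

lemma enough_proj:
  fixes A :: "('k, 'a) module"
  assumes A: "fd_algebra K A" and M: "fg_module A M"
  shows "\<exists>(Q :: ('k, 'a) fd_mod) f. fg_module A Q \<and> proj A Q \<and> lin A Q M f \<and> f ` carrier Q = carrier M"
proof -
  note rA = fd_algebraD(3)[OF A]
  obtain n b where b: "lin A (power_module (regular A) n) M b" "b ` carrier (power_module (regular A) n) = carrier M"
    using free_cover[OF M] by blast
  obtain Q :: "('k, 'a) fd_mod" and u v where Q: "fg_module A Q" and i: "iso_pair A (power_module (regular A) n) Q u v"
    using fd_copy[OF A proj_power(2)[OF rA, of n]] by metis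
  have "proj A Q" by (rule addE_retract[OF iso_pair_retract(2)[OF i] proj_power(1)[OF rA]])
  moreover have "lin A Q M (\<lambda>x. b (v x))" by (rule lin_compose[OF iso_pairD(2)[OF i] b(1)])
  moreover have "(\<lambda>x. b (v x)) ` carrier Q = carrier M"
    using iso_pair_bij[OF iso_pair_sym[OF i]] b(2) by (simp add: bij_betw_def flip: image_image)
  ultimately show ?thesis using Q by blast
qed

text \<open>The lifting property splits a surjection from a finitely generated free module.\<close>

lemma fg_projective_iff:
  fixes A :: "('k, 'a) module"
  assumes A: "fd_algebra K A"
  shows "fg_projective A P \<longleftrightarrow> fg_module A P \<and> proj A P"
proof
  assume P: "fg_projective A P"
  then have fg: "fg_module A P" by (simp add: fg_projective_def)
  have l: "left_module A P" by (rule fg_left[OF fg])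
  obtain Q :: "('k, 'a) fd_mod" and f where Q: "fg_module A Q" "proj A Q" "lin A Q P f" "f ` carrier Q = carrier P"
    using enough_proj[OF A fg] by blast
  let ?f = "restrict f (carrier Q)"
  have "?f \<in> hom_set A Q P" "?f ` carrier Q = carrier P" using lin_hom_set[OF Q(3)] Q(4) by auto
  then have "postcomp P ?f ` hom_set A P Q = hom_set A P P"
    using P Q(1) fg by (simp add: fg_projective_def)
  moreover have "restrict (\<lambda>x. x) (carrier P) \<in> hom_set A P P" by (rule lin_hom_set[OF lin_id[OF l]])
  ultimately have "restrict (\<lambda>x. x) (carrier P) \<in> postcomp P ?f ` hom_set A P Q" by simp
  then obtain s where s: "s \<in> hom_set A P Q" "postcomp P ?f s = restrict (\<lambda>x. x) (carrier P)"
    by (rule imageE) simp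
  have ls: "lin A P Q s" by (rule hom_set_lin[OF s(1) l fg_left[OF Q(1)]])
  have "f (s x) = x" if x: "x \<in> carrier P" for x
    using fun_cong[OF s(2), of x] linD(3)[OF ls x] x by (simp add: postcomp_def compose_def)
  then have "summand_pair A P Q s f" using ls Q(3) by (simp add: summand_pair_def)
  then show "fg_module A P \<and> proj A P" using fg addE_retract Q(2) by blast
next
  assume P: "fg_module A P \<and> proj A P"
  then have l: "left_module A P" by (simp add: fg_left)
  show "fg_projective A P"
    unfolding fg_projective_def
  proof (intro conjI allI ballI impI)
    fix M N :: "('k, 'a) fd_mod" and g
    assume g: "g \<in> hom_set A M N" and M: "fg_module A M" and N: "fg_module A N" and su: "g ` carrier M = carrier N"
    have lg: "lin A M N g" by (rule hom_set_lin[OF g fg_left[OF M] fg_left[OF N]])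
    show "postcomp P g ` hom_set A P M = hom_set A P N"
    proof (intro equalityI subsetI)
      fix h assume "h \<in> postcomp P g ` hom_set A P M"
      then obtain k where k: "k \<in> hom_set A P M" "h = restrict (\<lambda>x. g (k x)) (carrier P)"
        by (auto simp: postcomp_def compose_def)
      show "h \<in> hom_set A P N" unfolding k(2)
        by (rule lin_hom_set[OF lin_compose[OF hom_set_lin[OF k(1) l fg_left[OF M]] lg]])
    next
      fix h assume h: "h \<in> hom_set A P N"
      have lh: "lin A P N h" by (rule hom_set_lin[OF h l fg_left[OF N]])
      have "h ` carrier P \<subseteq> g ` carrier M" unfolding su using linD(3)[OF lh] by auto
      then obtain k where k: "lin A P M k" "\<And>x. x \<in> carrier P \<Longrightarrow> g (k x) = h x"
        using proj_lift[OF conjunct2[OF P] lg lh] by auto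
      have "h = postcomp P g (restrict k (carrier P))"
        by (rule ext) (simp add: postcomp_def compose_def k(2) hom_set_undefined[OF h])
      then show "h \<in> postcomp P g ` hom_set A P M" using lin_hom_set[OF k(1)] by blast
    qed
  qed (use P in simp)
qed

text \<open>Finitely many linear forms span \<open>Hom(V,A)\<close> over \<open>K\<close>; together they map \<open>V\<close> to a free
  module through which every map to a projective module factors.\<close>

lemma left_proj_approximation:
  fixes A :: "('k, 'a) module"
  assumes A: "fd_algebra K A" and V: "fg_module A V"
  shows "\<exists>(Q :: ('k, 'a) fd_mod) f. fg_module A Q \<and> proj A Q \<and> lin A V Q f \<and>
    (\<forall>\<phi>. lin A V (regular A) \<phi> \<longrightarrow> (\<exists>\<psi>. lin A Q (regular A) \<psi> \<and> (\<forall>x\<in>carrier V. \<psi> (f x) = \<phi> x)))"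
proof -
  note rA = fd_algebraD(3)[OF A]
  interpret A: ring A by (rule rA)
  let ?R = "regular A" and ?H = "Hom_space A V (regular A)"
  have l: "left_module A V" by (rule fg_left[OF V])
  have r: "left_module A ?R" by (rule left_module_regular[OF rA])
  \<comment> \<open>The linear forms that factor through a given map form a subspace, so a spanning set is enough.\<close>
  define fac where "fac Q f \<phi> \<longleftrightarrow> (\<exists>\<psi>. lin A Q ?R \<psi> \<and> (\<forall>x\<in>carrier V. \<psi> (f x) = \<phi> x))"
    for Q :: "('a, nat \<Rightarrow> 'a) module" and f \<phi>
  obtain S where S: "finite S" "S \<subseteq> carrier ?H" "\<And>H. submodule H K ?H \<Longrightarrow> S \<subseteq> H \<Longrightarrow> H = carrier ?H"
    using fg_moduleE[OF fg_Hom_space[OF A V fg_regular[OF rA]]] by metis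
  have "\<exists>n a. lin A V (power_module ?R n) a \<and> (\<forall>\<phi>\<in>S. fac (power_module ?R n) a \<phi>)"
    using S(1,2)
  proof (induction S rule: finite_induct)
    case empty
    show ?case using lin_0[OF l left_module_power[OF r]] by blast
  next
    case (insert \<phi> T)
    obtain n a where a: "lin A V (power_module ?R n) a" "\<And>\<chi>. \<chi> \<in> T \<Longrightarrow> fac (power_module ?R n) a \<chi>"
      using insert.IH insert.prems by auto
    have p: "lin A V ?R \<phi>" by (rule hom_set_lin[OF _ l r]) (use insert.prems in simp)
    let ?a = "\<lambda>x. (a x)(n := \<phi> x)"
    have re: "restrict (?a x) {..<n} = a x" if "x \<in> carrier V" for x
    proof -
      have "restrict (?a x) {..<n} = restrict (a x) {..<n}" by (rule restrict_ext) simp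
      then show ?thesis using linD(3)[OF a(1) that] by (simp add: PiE_def extensional_restrict)
    qed
    have "fac (power_module ?R (Suc n)) ?a \<phi>"
      unfolding fac_def using lin_power_nth[OF r, of n "Suc n"] by (intro exI[of _ "\<lambda>x. x n"]) auto
    moreover have "fac (power_module ?R (Suc n)) ?a \<chi>" if chi: "\<chi> \<in> T" for \<chi>
    proof -
      obtain \<psi> where "lin A (power_module ?R n) ?R \<psi>" "\<forall>x\<in>carrier V. \<psi> (a x) = \<chi> x" using a(2)[OF chi] by (auto simp: fac_def)
      then show ?thesis
        unfolding fac_def using lin_compose[OF lin_power_restrict[OF r]] re
        by (intro exI[of _ "\<lambda>x. \<psi> (restrict x {..<n})"]) (auto simp del: restrict_fupd)
    qed
    ultimately show ?case using lin_power_extend[OF a(1) p] by blast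
  qed
  then obtain n a where a: "lin A V (power_module ?R n) a" "\<And>\<phi>. \<phi> \<in> S \<Longrightarrow> fac (power_module ?R n) a \<phi>" by blast
  let ?P = "power_module ?R n"
  have "submodule {\<phi> \<in> hom_set A V ?R. fac ?P a \<phi>} K ?H"
  proof (rule submoduleI[OF left_module_Hom_space[OF A l r]])
    note lP = left_module_power[OF r, of n] and lH = left_module_closed[OF left_module_Hom_space[OF A l r]]
    show "\<zero>\<^bsub>?H\<^esub> \<in> {\<phi> \<in> hom_set A V ?R. fac ?P a \<phi>}"
      using lH(1) lin_0[OF lP r] by (auto simp: fac_def)
    fix \<phi> assume "\<phi> \<in> {\<phi> \<in> hom_set A V ?R. fac ?P a \<phi>}"
    then obtain \<psi> where p: "\<phi> \<in> hom_set A V ?R" "lin A ?P ?R \<psi>" "\<forall>x\<in>carrier V. \<psi> (a x) = \<phi> x" by (auto simp: fac_def)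
    { fix k assume k: "k \<in> carrier K"
      have "fac ?P a (k \<odot>\<^bsub>?H\<^esub> \<phi>)"
        unfolding fac_def using lin_smult_central[OF A p(2) k] p(3) by (intro exI) auto
      then show "k \<odot>\<^bsub>?H\<^esub> \<phi> \<in> {\<phi> \<in> hom_set A V ?R. fac ?P a \<phi>}"
        using lH(5)[OF k, of \<phi>] p(1) by simp }
    fix \<chi> assume "\<chi> \<in> {\<phi> \<in> hom_set A V ?R. fac ?P a \<phi>}"
    then obtain \<xi> where q: "\<chi> \<in> hom_set A V ?R" "lin A ?P ?R \<xi>" "\<forall>x\<in>carrier V. \<xi> (a x) = \<chi> x" by (auto simp: fac_def)
    have "fac ?P a (\<phi> \<oplus>\<^bsub>?H\<^esub> \<chi>)"
      unfolding fac_def using lin_plus[OF p(2) q(2)] p(3) q(3) by (intro exI) auto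
    then show "\<phi> \<oplus>\<^bsub>?H\<^esub> \<chi> \<in> {\<phi> \<in> hom_set A V ?R. fac ?P a \<phi>}"
      using lH(2)[of \<phi> \<chi>] p(1) q(1) by simp
  qed auto
  then have "{\<phi> \<in> hom_set A V ?R. fac ?P a \<phi>} = hom_set A V ?R"
    using S(3) a(2) S(2) by auto
  then have fac: "fac ?P a \<phi>" if "lin A V ?R \<phi>" for \<phi>
  proof -
    have "fac ?P a (restrict \<phi> (carrier V))"
      using lin_hom_set[OF that] \<open>{\<phi> \<in> hom_set A V ?R. fac ?P a \<phi>} = hom_set A V ?R\<close> by blast
    then show ?thesis by (simp add: fac_def)
  qed
  obtain Q :: "('k, 'a) fd_mod" and u v where Q: "fg_module A Q" and i: "iso_pair A ?P Q u v"
    using fd_copy[OF A proj_power(2)[OF rA, of n]] by metis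
  show ?thesis
  proof (intro exI[of _ Q] exI[of _ "\<lambda>x. u (a x)"] conjI allI impI)
    show "fg_module A Q" by (rule Q)
    show "proj A Q" by (rule addE_retract[OF iso_pair_retract(2)[OF i] proj_power(1)[OF rA]])
    show "lin A V Q (\<lambda>x. u (a x))" by (rule lin_compose[OF a(1) iso_pairD(1)[OF i]])
    fix \<phi> assume "lin A V ?R \<phi>"
    then obtain \<psi> where p: "lin A ?P ?R \<psi>" "\<forall>x\<in>carrier V. \<psi> (a x) = \<phi> x" using fac by (auto simp: fac_def)
    show "\<exists>\<psi>. lin A Q ?R \<psi> \<and> (\<forall>x\<in>carrier V. \<psi> (u (a x)) = \<phi> x)"
      by (rule exI[of _ "\<lambda>y. \<psi> (v y)"])
        (use lin_compose[OF iso_pairD(2)[OF i] p(1)] p(2) iso_pairD(3)[OF i linD(3)[OF a(1)]] in auto)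
  qed
qed

section \<open>Minimal presentations\<close>

text \<open>The condition \<^const>\<open>right_minimal\<close> for maps that are not extensional.\<close>

definition rmin :: "('a, 'b) ring_scheme \<Rightarrow> ('a, 'm) module \<Rightarrow> ('m \<Rightarrow> 'n) \<Rightarrow> bool" where
  "rmin A Z f \<longleftrightarrow> (\<forall>h. lin A Z Z h \<longrightarrow> (\<forall>x\<in>carrier Z. f (h x) = f x) \<longrightarrow> bij_betw h (carrier Z) (carrier Z))"

lemma fin_len_min:
  assumes "fin_len A M" "P H0" "\<And>H. P H \<Longrightarrow> submodule H A M"
  shows "\<exists>H. P H \<and> (\<forall>H'. P H' \<longrightarrow> H' \<subseteq> H \<longrightarrow> H' = H)"
proof -
  obtain \<mu> where m: "strict_measure A M \<mu>" using assms(1) by (auto simp: fin_len_def)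
  have "P (arg_min \<mu> P) \<and> (\<forall>H'. P H' \<longrightarrow> \<mu> (arg_min \<mu> P) \<le> \<mu> H')"
    using arg_min_nat_lemma[of P H0 \<mu>] assms(2) by blast
  then show ?thesis using strict_measure_eq[OF m assms(3) assms(3)] by metis
qed

text \<open>By Fitting's lemma: all powers of a surjective endomorphism are surjective, so the kernel of a
  large power meets \<open>M\<close> trivially.\<close>

lemma surj_endo_bij:
  assumes fl: "fin_len A M" and h: "lin A M M h" and su: "h ` carrier M = carrier M"
  shows "bij_betw h (carrier M) (carrier M)"
proof -
  obtain k where k: "k > 0" "direct_decomp A M ((h ^^ k) ` carrier M) {x \<in> carrier M. (h ^^ k) x = \<zero>\<^bsub>M\<^esub>}"
    by (rule fitting[OF fl h])
  have "(h ^^ n) ` carrier M = carrier M" for n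
  proof (induction n)
    case (Suc n)
    have "(h ^^ Suc n) ` carrier M = h ` ((h ^^ n) ` carrier M)" by (simp add: image_image)
    then show ?case unfolding Suc.IH su .
  qed simp
  then have z: "carrier M \<inter> {x \<in> carrier M. (h ^^ k) x = \<zero>\<^bsub>M\<^esub>} = {\<zero>\<^bsub>M\<^esub>}"
    using k(2) by (simp add: direct_decomp_def)
  obtain j where j: "k = j + 1" using k(1) by (metis Suc_eq_plus1 gr0_implies_Suc)
  have "inj_on h (carrier M)"
  proof (rule lin_injI[OF h])
    fix x assume x: "x \<in> carrier M" "h x = \<zero>\<^bsub>M\<^esub>"
    then have "(h ^^ k) x = \<zero>\<^bsub>M\<^esub>" using lin_zero[OF lin_funpow[OF h, of j]] unfolding j funpow_add by simp
    then show "x = \<zero>\<^bsub>M\<^esub>" using z x by blast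
  qed
  then show ?thesis using su by (simp add: bij_betw_def)
qed

text \<open>An endomorphism over a projective cover has an image that still covers \<open>N\<close>, so it is onto.\<close>

lemma projective_coverD:
  assumes A: "fd_algebra K A" and c: "projective_cover A P f N" and N: "left_module A N"
  shows "fg_module A P" "proj A P" "lin A P N f" "f ` carrier P = carrier N" "rmin A P f"
proof -
  show P: "fg_module A P" "proj A P" using c fg_projective_iff[OF A] by (auto simp: projective_cover_def)
  show f: "lin A P N f" by (rule hom_set_lin[OF _ fg_left[OF P(1)] N]) (use c in \<open>simp add: projective_cover_def\<close>)
  show su: "f ` carrier P = carrier N" using c by (simp add: projective_cover_def)
  show "rmin A P f"
    unfolding rmin_def
  proof (intro allI impI)
    fix h assume h: "lin A P P h" and e: "\<forall>x\<in>carrier P. f (h x) = f x"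
    have "f ` (h ` carrier P) = carrier N" unfolding su[symmetric] image_image using e by (intro image_cong) auto
    moreover have "H = carrier P" if "submodule H A P" "f ` H = carrier N" for H
      using c that unfolding projective_cover_def by metis
    ultimately have "h ` carrier P = carrier P"
      using submodule_image[OF h submodule_carrier[OF linD(1)[OF h]]] by metis
    then show "bij_betw h (carrier P) (carrier P)" by (rule surj_endo_bij[OF fd_fin_len[OF A P(1)] h])
  qed
qed

text \<open>Among the direct summands of a projective module \<open>Q\<close> that map onto \<open>N\<close>, take a minimal one.
  If a submodule \<open>H\<close> of it still maps onto \<open>N\<close>, then lifting gives an endomorphism with image in \<open>H\<close>,
  and by Fitting's lemma the image of a power is again such a summand.\<close>

lemma projective_cover_exists:
  fixes A :: "('k, 'a) module" and N :: "('k, 'a) fd_mod"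
  assumes A: "fd_algebra K A" and N: "fg_module A N"
  shows "\<exists>P f. projective_cover A P f N"
proof -
  obtain Q :: "('k, 'a) fd_mod" and f where Q: "fg_module A Q" "proj A Q" and f: "lin A Q N f" "f ` carrier Q = carrier N"
    using enough_proj[OF A N] by blast
  have lQ: "left_module A Q" by (rule fg_left[OF Q(1)])
  define good where "good H \<longleftrightarrow> submodule H A Q \<and> f ` H = carrier N \<and>
    (\<exists>p. summand_pair A (sub_module Q H) Q (\<lambda>x. x) p)" for H
  have "summand_pair A Q Q (\<lambda>x. x) (\<lambda>x. x)" using lin_id[OF lQ] by (simp add: summand_pair_def)
  then have "good (carrier Q)" using submodule_carrier[OF lQ] f(2) unfolding good_def sub_module_carrier by blast
  then obtain H where H': "good H" and min: "\<And>H'. good H' \<Longrightarrow> H' \<subseteq> H \<Longrightarrow> H' = H"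
    using fin_len_min[OF fd_fin_len[OF A Q(1)], of good "carrier Q"] unfolding good_def by metis
  have H: "submodule H A Q" "f ` H = carrier N" and ret: "\<exists>p. summand_pair A (sub_module Q H) Q (\<lambda>x. x) p"
    using H' by (auto simp: good_def)
  let ?P = "sub_module Q H"
  obtain p where p: "summand_pair A ?P Q (\<lambda>x. x) p" using ret by blast
  have lP: "left_module A ?P" by (rule left_module_sub[OF lQ H(1)])
  have P: "fg_module A ?P" "proj A ?P" using fd_fg_sub[OF A Q(1) H(1)] addE_retract[OF p Q(2)] by auto
  have fP: "lin A ?P N f" by (rule lin_compose[OF lin_sub_incl[OF lQ H(1)] f(1)])
  have ess: "H' = H" if H': "submodule H' A ?P" "f ` H' = carrier N" for H'
  proof -
    have H'': "submodule H' A Q" "H' \<subseteq> H" using H'(1) submodule_sub_iff[OF lQ H(1)] by auto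
    have g: "lin A (sub_module Q H') N f" by (rule lin_compose[OF lin_sub_incl[OF lQ H''(1)] f(1)])
    obtain h where h: "lin A ?P (sub_module Q H') h" "\<And>x. x \<in> H \<Longrightarrow> f (h x) = f x"
      using proj_lift[OF P(2) g fP] H(2) H'(2) by auto
    have hP: "lin A ?P ?P h"
      by (rule lin_into_sub[OF lin_compose[OF h(1) lin_sub_incl[OF lQ H''(1)]] H(1)]) (use linD(3)[OF h(1)] H'' in auto)
    obtain k where k: "k > 0" "direct_decomp A ?P ((h ^^ k) ` carrier ?P) {x \<in> carrier ?P. (h ^^ k) x = \<zero>\<^bsub>?P\<^esub>}"
      by (rule fitting[OF fd_fin_len[OF A P(1)] hP])
    let ?I = "(h ^^ k) ` H"
    have fh: "(h ^^ n) x \<in> H \<and> f ((h ^^ n) x) = f x" if "x \<in> H" for n x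
      using that by (induction n) (use linD(3)[OF hP] h(2) in auto)
    have I: "submodule ?I A ?P" using k(2) by (simp add: direct_decomp_def)
    then have I': "submodule ?I A Q" "?I \<subseteq> H" using submodule_sub_iff[OF lQ H(1)] by auto
    have "f ` ?I = carrier N" unfolding H(2)[symmetric] image_image using fh by (intro image_cong) auto
    moreover obtain r where "summand_pair A (sub_module ?P ?I) ?P (\<lambda>x. x) r"
      using direct_decomp_retract[OF lP k(2)] by auto
    then have "summand_pair A (sub_module Q ?I) Q (\<lambda>x. x) (\<lambda>x. r (p x))" using retract_trans[OF _ p] by fastforce
    ultimately have "?I = H" using I' by (intro min) (auto simp: good_def)
    moreover obtain j where j: "k = Suc j" using k(1) gr0_implies_Suc by blast
    have "?I \<subseteq> H'" unfolding j using fh linD(3)[OF h(1)] by auto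
    ultimately show "H' = H" using H'' by auto
  qed
  let ?f = "restrict f H"
  have "projective_cover A ?P ?f N"
    unfolding projective_cover_def fg_projective_iff[OF A]
  proof (intro conjI P allI impI)
    show "?f \<in> hom_set A ?P N" using lin_hom_set[OF fP] by simp
    show "?f ` carrier ?P = carrier N" using H(2) by simp
    fix H' assume H': "submodule H' A ?P" "?f ` H' = carrier N"
    moreover have "?f ` H' = f ` H'" using submoduleD(1)[OF H'(1)] by (intro image_cong) auto
    ultimately show "H' = carrier ?P" using ess by simp
  qed
  then show ?thesis by blast
qed

text \<open>Minimality is expressed by \<^const>\<open>rmin\<close> instead of essential epimorphisms, because a fully faithful
  functor transports the former; and the terms may live on any types.\<close>

definition min_pres :: "('a, 'b) ring_scheme \<Rightarrow> ('a, 'p1) module \<Rightarrow> ('p1 \<Rightarrow> 'p0) \<Rightarrow> ('a, 'p0) module \<Rightarrow> ('p0 \<Rightarrow> 'n) \<Rightarrow> ('a, 'n) module \<Rightarrow> bool"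
  where "min_pres A P1 f1 P0 f0 N \<longleftrightarrow> proj A P1 \<and> proj A P0 \<and> lin A P1 P0 f1 \<and> lin A P0 N f0 \<and>
    f0 ` carrier P0 = carrier N \<and> f1 ` carrier P1 = {x \<in> carrier P0. f0 x = \<zero>\<^bsub>N\<^esub>} \<and> rmin A P0 f0 \<and> rmin A P1 f1"

lemma min_presD:
  assumes "min_pres A P1 f1 P0 f0 N"
  shows "proj A P1" "proj A P0" "lin A P1 P0 f1" "lin A P0 N f0" "f0 ` carrier P0 = carrier N"
    "f1 ` carrier P1 = {x \<in> carrier P0. f0 x = \<zero>\<^bsub>N\<^esub>}" "rmin A P0 f0" "rmin A P1 f1"
  using assms by (auto simp: min_pres_def)

lemma minimal_projective_presentation_min_pres:
  assumes A: "fd_algebra K A" and N: "left_module A N" and p: "minimal_projective_presentation A P1 f1 P0 f0 N"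
  shows "min_pres A P1 f1 P0 f0 N" "fg_module A P1" "fg_module A P0" "f1 \<in> hom_set A P1 P0"
proof -
  have p': "f1 \<in> hom_set A P1 P0" "exact_at P1 f1 P0 f0 N" "projective_cover A P0 f0 N"
    "projective_cover A P1 f1 (sub_module P0 (f1 ` carrier P1))" using p by (auto simp: minimal_projective_presentation_def)
  note c0 = projective_coverD[OF A p'(3) N]
  have l1: "left_module A P1" using p'(4) fg_projective_iff[OF A] by (auto simp: projective_cover_def fg_left)
  have f1: "lin A P1 P0 f1" by (rule hom_set_lin[OF p'(1) l1 fg_left[OF c0(1)]])
  note c1 = projective_coverD[OF A p'(4) left_module_sub[OF fg_left[OF c0(1)] submodule_image[OF f1 submodule_carrier[OF l1]]]]
  show "min_pres A P1 f1 P0 f0 N" using c0 c1 f1 p'(2) by (simp add: min_pres_def exact_at_def)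
  show "fg_module A P1" "fg_module A P0" "f1 \<in> hom_set A P1 P0" using c0 c1 p' by auto
qed

lemma minimal_projective_presentation_exists:
  fixes A :: "('k, 'a) module" and N :: "('k, 'a) fd_mod"
  assumes A: "fd_algebra K A" and N: "fg_module A N"
  shows "\<exists>P1 f1 P0 f0. minimal_projective_presentation A P1 f1 P0 f0 N"
proof -
  obtain P0 f0 where c0: "projective_cover A P0 f0 N" using projective_cover_exists[OF A N] by blast
  note C0 = projective_coverD[OF A c0 fg_left[OF N]]
  let ?Z = "{x \<in> carrier P0. f0 x = \<zero>\<^bsub>N\<^esub>}"
  have Z: "submodule ?Z A P0" by (rule submodule_kernel[OF C0(3)])
  obtain P1 f1 where c1: "projective_cover A P1 f1 (sub_module P0 ?Z)"
    using projective_cover_exists[OF A fd_fg_sub[OF A C0(1) Z]] by blast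
  have lZ: "left_module A (sub_module P0 ?Z)" by (rule left_module_sub[OF fg_left[OF C0(1)] Z])
  note C1 = projective_coverD[OF A c1 lZ]
  have im: "f1 ` carrier P1 = ?Z" using C1(4) by simp
  have h: "f1 \<in> hom_set A P1 (sub_module P0 ?Z)" using c1 by (simp add: projective_cover_def)
  have "f1 \<in> hom_set A P1 P0"
    by (rule hom_set_restrictI[OF lin_compose[OF C1(3) lin_sub_incl[OF fg_left[OF C0(1)] Z]] refl hom_set_undefined[OF h]])
  then have "minimal_projective_presentation A P1 f1 P0 f0 N"
    using c0 c1 unfolding minimal_projective_presentation_def exact_at_def im by simp
  then show ?thesis by blast
qed

text \<open>The map \<open>Hom(f1,N)\<close> is onto.\<close>

definition rigid :: "('a, 'b) ring_scheme \<Rightarrow> ('a, 'p1) module \<Rightarrow> ('p1 \<Rightarrow> 'p0) \<Rightarrow> ('a, 'p0) module \<Rightarrow> ('a, 'n) module \<Rightarrow> bool"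
  where "rigid A P1 f1 P0 N \<longleftrightarrow>
    (\<forall>v. lin A P1 N v \<longrightarrow> (\<exists>w. lin A P0 N w \<and> (\<forall>x\<in>carrier P1. w (f1 x) = v x)))"

text \<open>Lift inclusion and projection to the presentations.  Because the presentation of \<open>V\<close> is minimal,
  the lifts can be corrected so that the composites on its two terms are isomorphisms compatible
  with the presentation; then a map out of \<open>Q1\<close> extends because its composite with the lifted
  projection does.  For isomorphic \<open>V\<close> and \<open>N\<close> this says that rigidity does not depend on the
  choice of the minimal presentation.\<close>

lemma rigid_retract:
  assumes r: "summand_pair A V N i p" and P: "min_pres A P1 f1 P0 f0 N" and Q: "min_pres A Q1 g1 Q0 g0 V"
    and rig: "rigid A P1 f1 P0 N"
  shows "rigid A Q1 g1 Q0 V"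
proof -
  note R = retractD[OF r] and P' = min_presD[OF P] and Q' = min_presD[OF Q]
  have P01: "f0 (f1 x) = \<zero>\<^bsub>N\<^esub>" if "x \<in> carrier P1" for x using P'(6) that by blast
  have Q01: "g0 (g1 x) = \<zero>\<^bsub>V\<^esub>" if "x \<in> carrier Q1" for x using Q'(6) that by blast
  have "(\<lambda>x. i (g0 x)) ` carrier Q0 \<subseteq> f0 ` carrier P0"
    unfolding P'(5) using linD(3)[OF R(1)] linD(3)[OF Q'(4)] by auto
  then obtain i0 where i0: "lin A Q0 P0 i0" "\<And>x. x \<in> carrier Q0 \<Longrightarrow> f0 (i0 x) = i (g0 x)"
    using proj_lift[OF Q'(2) P'(4) lin_compose[OF Q'(4) R(1)]] by auto
  have "(\<lambda>x. p (f0 x)) ` carrier P0 \<subseteq> g0 ` carrier Q0"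
    unfolding Q'(5) using linD(3)[OF R(2)] linD(3)[OF P'(4)] by auto
  then obtain q where q: "lin A P0 Q0 q" "\<And>x. x \<in> carrier P0 \<Longrightarrow> g0 (q x) = p (f0 x)"
    using proj_lift[OF P'(2) Q'(4) lin_compose[OF P'(4) R(2)]] by auto
  let ?s = "\<lambda>x. q (i0 x)"
  have s: "lin A Q0 Q0 ?s" by (rule lin_compose[OF i0(1) q(1)])
  have gs: "g0 (?s x) = g0 x" if "x \<in> carrier Q0" for x
    using that i0(2) q(2) linD(3)[OF i0(1)] linD(3)[OF Q'(4)] R(3) by simp
  have "bij_betw ?s (carrier Q0) (carrier Q0)" using Q'(7) s gs by (auto simp: rmin_def)
  then obtain t where t: "iso_pair A Q0 Q0 ?s t" using bij_iso_pair[OF s] by blast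
  have gt: "g0 (t x) = g0 x" if x: "x \<in> carrier Q0" for x
    using gs[OF linD(3)[OF iso_pairD(2)[OF t] x]] iso_pairD(4)[OF t x] by simp
  define p0 where "p0 x = t (q x)" for x
  have p0: "lin A P0 Q0 p0" unfolding p0_def by (rule lin_compose[OF q(1) iso_pairD(2)[OF t]])
  have gp: "g0 (p0 x) = p (f0 x)" if "x \<in> carrier P0" for x
    unfolding p0_def using gt q(2) linD(3)[OF q(1)] that by simp
  have pi: "p0 (i0 x) = x" if "x \<in> carrier Q0" for x
    unfolding p0_def using iso_pairD(3)[OF t that] .
  have "(\<lambda>x. i0 (g1 x)) ` carrier Q1 \<subseteq> f1 ` carrier P1"
    using i0(2) linD(3)[OF i0(1)] linD(3)[OF Q'(3)] Q01 lin_zero[OF R(1)] unfolding P'(6) by auto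
  then obtain i1 where i1: "lin A Q1 P1 i1" "\<And>x. x \<in> carrier Q1 \<Longrightarrow> f1 (i1 x) = i0 (g1 x)"
    using proj_lift[OF Q'(1) P'(3) lin_compose[OF Q'(3) i0(1)]] by auto
  have "(\<lambda>x. p0 (f1 x)) ` carrier P1 \<subseteq> g1 ` carrier Q1"
    using gp linD(3)[OF p0] linD(3)[OF P'(3)] P01 lin_zero[OF R(2)] unfolding Q'(6) by auto
  then obtain p1 where p1: "lin A P1 Q1 p1" "\<And>x. x \<in> carrier P1 \<Longrightarrow> g1 (p1 x) = p0 (f1 x)"
    using proj_lift[OF P'(1) Q'(3) lin_compose[OF P'(3) p0]] by auto
  let ?t = "\<lambda>x. p1 (i1 x)"
  have t1: "lin A Q1 Q1 ?t" by (rule lin_compose[OF i1(1) p1(1)])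
  have g1t: "g1 (?t x) = g1 x" if "x \<in> carrier Q1" for x
    using that p1(2) i1(2) linD(3)[OF i1(1)] linD(3)[OF Q'(3)] pi by simp
  have "bij_betw ?t (carrier Q1) (carrier Q1)" using Q'(8) t1 g1t by (auto simp: rmin_def)
  then obtain t' where t': "iso_pair A Q1 Q1 ?t t'" using bij_iso_pair[OF t1] by blast
  show ?thesis
    unfolding rigid_def
  proof (intro allI impI)
    fix v assume v: "lin A Q1 V v"
    obtain w where w: "lin A P0 N w" "\<And>x. x \<in> carrier P1 \<Longrightarrow> w (f1 x) = i (v (p1 x))"
      using rig lin_compose[OF p1(1) lin_compose[OF v R(1)]] by (auto simp: rigid_def)
    show "\<exists>w. lin A Q0 V w \<and> (\<forall>x\<in>carrier Q1. w (g1 x) = v x)"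
    proof (intro exI conjI ballI)
      show "lin A Q0 V (\<lambda>x. p (w (i0 x)))" by (rule lin_compose[OF lin_compose[OF i0(1) w(1)] R(2)])
      fix x assume x: "x \<in> carrier Q1"
      let ?y = "t' x"
      have y: "?y \<in> carrier Q1" "?t ?y = x" using linD(3)[OF iso_pairD(2)[OF t'] x] iso_pairD(4)[OF t' x] by auto
      have "p (w (i0 (g1 ?y))) = p (i (v (?t ?y)))" using i1(2)[OF y(1)] w(2)[OF linD(3)[OF i1(1) y(1)]] by simp
      then show "p (w (i0 (g1 x))) = v x"
        using g1t[OF y(1)] y(2) R(3) linD(3)[OF v x] by simp
    qed
  qed
qed

section \<open>The Auslander--Reiten translation and rigidity\<close>

lemma opposite_simps [simp]:
  "carrier (opposite A) = carrier A" "\<one>\<^bsub>opposite A\<^esub> = \<one>\<^bsub>A\<^esub>" "\<zero>\<^bsub>opposite A\<^esub> = \<zero>\<^bsub>A\<^esub>"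
  "ring.add (opposite A) = ring.add A" "smult (opposite A) = smult A" "x \<otimes>\<^bsub>opposite A\<^esub> y = y \<otimes>\<^bsub>A\<^esub> x"
  by (simp_all add: opposite_def)

lemma ring_opposite:
  assumes "ring A"
  shows "ring (opposite A)"
proof -
  interpret A: ring A by (rule assms)
  have "abelian_group (opposite A)"
    by (rule abelian_groupI) (auto simp: A.a_ac intro: bexI[of _ "\<ominus>\<^bsub>A\<^esub> x" for x] A.l_neg)
  moreover have "monoid (opposite A)" by (rule monoidI) (auto simp: A.m_assoc)
  ultimately show ?thesis by (rule ringI) (auto simp: A.l_distr A.r_distr)
qed

lemma quot_module_coset:
  assumes l: "left_module R M" and H: "submodule H R M"
  shows "carrier (quot_module M H) = (\<lambda>x. H +>\<^bsub>M\<^esub> x) ` carrier M" "\<zero>\<^bsub>quot_module M H\<^esub> = H"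
    and "x \<in> carrier M \<Longrightarrow> y \<in> carrier M \<Longrightarrow>
      (H +>\<^bsub>M\<^esub> x) \<oplus>\<^bsub>quot_module M H\<^esub> (H +>\<^bsub>M\<^esub> y) = H +>\<^bsub>M\<^esub> (x \<oplus>\<^bsub>M\<^esub> y)"
    and "a \<in> carrier R \<Longrightarrow> x \<in> carrier M \<Longrightarrow> a \<odot>\<^bsub>quot_module M H\<^esub> (H +>\<^bsub>M\<^esub> x) = H +>\<^bsub>M\<^esub> (a \<odot>\<^bsub>M\<^esub> x)"
    and "x \<in> carrier M \<Longrightarrow> y \<in> carrier M \<Longrightarrow> H +>\<^bsub>M\<^esub> x = H +>\<^bsub>M\<^esub> y \<Longrightarrow> x \<ominus>\<^bsub>M\<^esub> y \<in> H"
    and "x \<in> H \<Longrightarrow> H +>\<^bsub>M\<^esub> x = H"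
proof -
  interpret M: abelian_group M using l by (rule left_moduleD)
  have sg: "subgroup H (add_monoid M)" using H by (simp add: submodule_def)
  interpret S: abelian_subgroup H M
    by (intro abelian_subgroupI3 additive_subgroup.intro sg M.abelian_group_axioms)
  note h = submoduleD[OF H]
  show "carrier (quot_module M H) = (\<lambda>x. H +>\<^bsub>M\<^esub> x) ` carrier M"
    by (auto simp: quot_module_def A_RCOSETS_def')
  show "\<zero>\<^bsub>quot_module M H\<^esub> = H" by (simp add: quot_module_def)
  show "x \<in> carrier M \<Longrightarrow> y \<in> carrier M \<Longrightarrow>
      (H +>\<^bsub>M\<^esub> x) \<oplus>\<^bsub>quot_module M H\<^esub> (H +>\<^bsub>M\<^esub> y) = H +>\<^bsub>M\<^esub> (x \<oplus>\<^bsub>M\<^esub> y)"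
    by (simp add: quot_module_def S.a_rcos_sum)
  show "a \<odot>\<^bsub>quot_module M H\<^esub> (H +>\<^bsub>M\<^esub> x) = H +>\<^bsub>M\<^esub> (a \<odot>\<^bsub>M\<^esub> x)" if a: "a \<in> carrier R" and x: "x \<in> carrier M"
  proof -
    have e: "H +>\<^bsub>M\<^esub> (a \<odot>\<^bsub>M\<^esub> y) = H +>\<^bsub>M\<^esub> (a \<odot>\<^bsub>M\<^esub> x)" if y: "y \<in> H +>\<^bsub>M\<^esub> x" for y
    proof -
      obtain u where u: "u \<in> H" "y = u \<oplus>\<^bsub>M\<^esub> x" using y by (auto simp: a_r_coset_def')
      then have "a \<odot>\<^bsub>M\<^esub> y = a \<odot>\<^bsub>M\<^esub> u \<oplus>\<^bsub>M\<^esub> a \<odot>\<^bsub>M\<^esub> x" using a x h by (simp add: left_module.smult_r_distr[OF l])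
      then have "a \<odot>\<^bsub>M\<^esub> y \<in> H +>\<^bsub>M\<^esub> (a \<odot>\<^bsub>M\<^esub> x)" using h(4)[OF a u(1)] by (auto simp: a_r_coset_def')
      then show ?thesis using S.a_repr_independence'[OF _ left_module_closed(5)[OF l a x]] by simp
    qed
    have "(\<Union>y\<in>H +>\<^bsub>M\<^esub> x. H +>\<^bsub>M\<^esub> (a \<odot>\<^bsub>M\<^esub> y)) = H +>\<^bsub>M\<^esub> (a \<odot>\<^bsub>M\<^esub> x)"
      by (rule UN_constant_eq[OF S.a_rcos_self[OF x]]) (intro ballI e)
    then show ?thesis by (simp add: quot_module_def)
  qed
  show "x \<ominus>\<^bsub>M\<^esub> y \<in> H" if x: "x \<in> carrier M" and y: "y \<in> carrier M" and e: "H +>\<^bsub>M\<^esub> x = H +>\<^bsub>M\<^esub> y"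
  proof -
    have "x \<in> H +>\<^bsub>M\<^esub> y" using S.a_rcos_self[OF x] e by simp
    then obtain u where "u \<in> H" "x = u \<oplus>\<^bsub>M\<^esub> y" by (auto simp: a_r_coset_def')
    then show ?thesis using h y by (simp add: a_minus_def M.a_assoc M.r_neg)
  qed
  show "x \<in> H \<Longrightarrow> H +>\<^bsub>M\<^esub> x = H" by (rule M.a_coset_join2[OF h(5) sg])
qed

lemma star_simps [simp]:
  "carrier (star A P) = hom_set A P (regular A)" "\<zero>\<^bsub>star A P\<^esub> = (\<lambda>x\<in>carrier P. \<zero>\<^bsub>A\<^esub>)"
  "\<phi> \<oplus>\<^bsub>star A P\<^esub> \<psi> = (\<lambda>x\<in>carrier P. \<phi> x \<oplus>\<^bsub>A\<^esub> \<psi> x)" "a \<odot>\<^bsub>star A P\<^esub> \<phi> = (\<lambda>x\<in>carrier P. \<phi> x \<otimes>\<^bsub>A\<^esub> a)"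
  by (simp_all add: star_def Hom_simps)

lemma lin_times_right:
  assumes f: "lin A P (regular A) \<phi>" and a: "a \<in> carrier A"
  shows "lin A P (regular A) (\<lambda>x. \<phi> x \<otimes>\<^bsub>A\<^esub> a)"
proof -
  interpret A: ring A using f by (rule linD)
  show ?thesis using lin_compose[OF f lin_from_regular[OF linD(2)[OF f], of a]] a by simp
qed

lemma left_module_star:
  assumes P: "left_module A P"
  shows "left_module (opposite A) (star A P)"
proof -
  interpret A: ring A using P by (rule left_moduleD)
  note r = left_module_regular[OF A.ring_axioms]
  note h = hom_set_lin[OF _ P r]
  have c: "\<phi> x \<in> carrier A" if "\<phi> \<in> hom_set A P (regular A)" "x \<in> carrier P" for \<phi> x using linD(3)[OF h[OF that(1)] that(2)] by simp
  have e: "(\<lambda>x\<in>carrier P. \<phi> x) = \<phi>" if "\<phi> \<in> hom_set A P (regular A)" for \<phi> using hom_set_restrict[OF that] .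
  have g: "abelian_group (star A P)"
  proof (rule abelian_groupI)
    fix \<phi> assume "\<phi> \<in> carrier (star A P)"
    then have p: "\<phi> \<in> hom_set A P (regular A)" by simp
    show "\<exists>\<psi>\<in>carrier (star A P). \<psi> \<oplus>\<^bsub>star A P\<^esub> \<phi> = \<zero>\<^bsub>star A P\<^esub>"
    proof (rule bexI)
      show "(\<lambda>x\<in>carrier P. \<ominus>\<^bsub>regular A\<^esub> \<phi> x) \<in> carrier (star A P)"
        using lin_hom_set[OF lin_uminus[OF h[OF p]]] by simp
      interpret RA: abelian_group "regular A" using r by (rule left_moduleD)
      have "\<ominus>\<^bsub>regular A\<^esub> \<phi> x \<oplus>\<^bsub>A\<^esub> \<phi> x = \<zero>\<^bsub>A\<^esub>" if "x \<in> carrier P" for x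
        using RA.l_neg[of "\<phi> x"] c[OF p that] by simp
      then show "(\<lambda>x\<in>carrier P. \<ominus>\<^bsub>regular A\<^esub> \<phi> x) \<oplus>\<^bsub>star A P\<^esub> \<phi> = \<zero>\<^bsub>star A P\<^esub>"
        by (simp cong: restrict_cong)
    qed
    have "(\<lambda>x\<in>carrier P. \<zero>\<^bsub>A\<^esub> \<oplus>\<^bsub>A\<^esub> \<phi> x) = (\<lambda>x\<in>carrier P. \<phi> x)" by (rule restrict_ext) (use c[OF p] in simp)
    then show "\<zero>\<^bsub>star A P\<^esub> \<oplus>\<^bsub>star A P\<^esub> \<phi> = \<phi>" using e[OF p] by (simp cong: restrict_cong)
    fix \<psi> assume "\<psi> \<in> carrier (star A P)"
    then have q: "\<psi> \<in> hom_set A P (regular A)" by simp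
    show "\<phi> \<oplus>\<^bsub>star A P\<^esub> \<psi> \<in> carrier (star A P)" using lin_hom_set[OF lin_plus[OF h[OF p] h[OF q]]] by simp
    show "\<phi> \<oplus>\<^bsub>star A P\<^esub> \<psi> = \<psi> \<oplus>\<^bsub>star A P\<^esub> \<phi>"
      unfolding star_simps by (rule restrict_ext) (use c[OF p] c[OF q] in \<open>simp add: A.a_comm\<close>)
    fix \<chi> assume "\<chi> \<in> carrier (star A P)"
    then have s: "\<chi> \<in> hom_set A P (regular A)" by simp
    show "\<phi> \<oplus>\<^bsub>star A P\<^esub> \<psi> \<oplus>\<^bsub>star A P\<^esub> \<chi> = \<phi> \<oplus>\<^bsub>star A P\<^esub> (\<psi> \<oplus>\<^bsub>star A P\<^esub> \<chi>)"
      unfolding star_simps by (rule restrict_ext) (use c[OF p] c[OF q] c[OF s] in \<open>simp add: A.a_assoc\<close>)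
  qed (use lin_hom_set[OF lin_0[OF P r]] in simp)
  show ?thesis
  proof (intro left_module.intro left_module_axioms.intro g ring_opposite[OF A.ring_axioms])
    fix \<phi> assume "\<phi> \<in> carrier (star A P)"
    then have p: "\<phi> \<in> hom_set A P (regular A)" by simp
    have "(\<lambda>x\<in>carrier P. \<phi> x \<otimes>\<^bsub>A\<^esub> \<one>\<^bsub>A\<^esub>) = (\<lambda>x\<in>carrier P. \<phi> x)" by (rule restrict_ext) (use c[OF p] in simp)
    then show "\<one>\<^bsub>opposite A\<^esub> \<odot>\<^bsub>star A P\<^esub> \<phi> = \<phi>" using e[OF p] by simp
    fix a assume "a \<in> carrier (opposite A)" then have a: "a \<in> carrier A" by simp
    show "a \<odot>\<^bsub>star A P\<^esub> \<phi> \<in> carrier (star A P)" using lin_hom_set[OF lin_times_right[OF h[OF p] a]] by simp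
    { fix b assume "b \<in> carrier (opposite A)" then have b: "b \<in> carrier A" by simp
      show "(a \<oplus>\<^bsub>opposite A\<^esub> b) \<odot>\<^bsub>star A P\<^esub> \<phi> = a \<odot>\<^bsub>star A P\<^esub> \<phi> \<oplus>\<^bsub>star A P\<^esub> b \<odot>\<^bsub>star A P\<^esub> \<phi>"
        unfolding star_simps opposite_simps by (rule restrict_ext) (use c[OF p] a b in \<open>simp add: A.r_distr\<close>)
      show "(a \<otimes>\<^bsub>opposite A\<^esub> b) \<odot>\<^bsub>star A P\<^esub> \<phi> = a \<odot>\<^bsub>star A P\<^esub> (b \<odot>\<^bsub>star A P\<^esub> \<phi>)"
        unfolding star_simps opposite_simps by (rule restrict_ext) (use c[OF p] a b in \<open>simp add: A.m_assoc\<close>) }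
    fix \<psi> assume "\<psi> \<in> carrier (star A P)"
    then have q: "\<psi> \<in> hom_set A P (regular A)" by simp
    show "a \<odot>\<^bsub>star A P\<^esub> (\<phi> \<oplus>\<^bsub>star A P\<^esub> \<psi>) = a \<odot>\<^bsub>star A P\<^esub> \<phi> \<oplus>\<^bsub>star A P\<^esub> a \<odot>\<^bsub>star A P\<^esub> \<psi>"
      unfolding star_simps by (rule restrict_ext) (use c[OF p] c[OF q] a in \<open>simp add: A.l_distr\<close>)
  qed
qed

lemma precomp_eq: "precomp M f \<psi> = (\<lambda>x\<in>carrier M. \<psi> (f x))"
  by (simp add: precomp_def compose_def)

lemma lin_precomp_star:
  assumes f: "lin A P1 P0 f"
  shows "lin (opposite A) (star A P0) (star A P1) (precomp P1 f)"
proof -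
  note l = linD[OF f]
  interpret A: ring A by (rule l)
  note h = hom_set_lin[OF _ l(2) left_module_regular[OF A.ring_axioms]]
  show ?thesis
    by (rule linI[OF left_module_star[OF l(2)] left_module_star[OF l(1)]])
      (use lin_hom_set[OF lin_compose[OF f h]] l(3) in \<open>auto simp: precomp_eq intro!: restrict_ext\<close>)
qed

text \<open>The elementary tensor \<open>\<phi> \<otimes> n\<close> in \<open>Hom(P,A) \<otimes> N\<close>, viewed in \<open>Hom(P,N)\<close>.\<close>

definition tens :: "('a, 'p) module \<Rightarrow> ('a, 'n) module \<Rightarrow> ('p \<Rightarrow> 'a) \<Rightarrow> 'n \<Rightarrow> 'p \<Rightarrow> 'n" where
  "tens P N \<phi> n = (\<lambda>x\<in>carrier P. \<phi> x \<odot>\<^bsub>N\<^esub> n)"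

lemma lin_tens:
  assumes "lin A P (regular A) \<phi>" "left_module A N" "n \<in> carrier N"
  shows "lin A P N (\<lambda>x. \<phi> x \<odot>\<^bsub>N\<^esub> n)" "tens P N \<phi> n \<in> hom_set A P N"
proof -
  show 1: "lin A P N (\<lambda>x. \<phi> x \<odot>\<^bsub>N\<^esub> n)" by (rule lin_compose[OF assms(1) lin_from_regular[OF assms(2,3)]])
  show "tens P N \<phi> n \<in> hom_set A P N" unfolding tens_def by (rule lin_hom_set[OF 1])
qed

text \<open>The identity of a projective module is a sum of maps \<open>P \<rightarrow> A \<rightarrow> P\<close>, so every map out of it is a sum of
  elementary tensors.\<close>

lemma Hom_induct_tens:
  assumes P: "proj A P" and N: "left_module A N" and g: "g \<in> hom_set A P N"
    and z: "Q (\<lambda>x\<in>carrier P. \<zero>\<^bsub>N\<^esub>)"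
    and s: "\<And>f \<phi> n. f \<in> hom_set A P N \<Longrightarrow> Q f \<Longrightarrow> \<phi> \<in> hom_set A P (regular A) \<Longrightarrow> n \<in> carrier N \<Longrightarrow>
      Q (\<lambda>x\<in>carrier P. f x \<oplus>\<^bsub>N\<^esub> tens P N \<phi> n x)"
  shows "Q g"
proof -
  have l: "left_module A P" using P by (rule addED)
  interpret A: ring A using l by (rule left_moduleD)
  have "Q (restrict f (carrier P))" if "through A (regular A) P N f" for f
    using that
  proof induction
    case (zero f)
    then have "restrict f (carrier P) = (\<lambda>x\<in>carrier P. \<zero>\<^bsub>N\<^esub>)" by (intro restrict_ext) auto
    then show ?case using z by (simp only:)
  next
    case (step f p i h)
    let ?n = "i \<one>\<^bsub>A\<^esub>"
    have n: "?n \<in> carrier N" using linD(3)[OF step(3), of "\<one>\<^bsub>A\<^esub>"] by simp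
    have "restrict h (carrier P) = (\<lambda>x\<in>carrier P. restrict f (carrier P) x \<oplus>\<^bsub>N\<^esub> tens P N (restrict p (carrier P)) ?n x)"
    proof (rule restrict_ext)
      fix x assume x: "x \<in> carrier P"
      then have "i (p x) = p x \<odot>\<^bsub>N\<^esub> ?n" using lin_regular_eval[OF step(3), of "p x"] linD(3)[OF step(2) x] by simp
      then show "h x = restrict f (carrier P) x \<oplus>\<^bsub>N\<^esub> tens P N (restrict p (carrier P)) ?n x"
        using step(4) x by (simp add: tens_def)
    qed
    moreover have "Q \<dots>"
      by (rule s[of "restrict f (carrier P)" "restrict p (carrier P)" ?n])
        (rule lin_hom_set[OF through_lin[OF step(1) l N]] step.IH lin_hom_set[OF step(2)] n)+
    ultimately show ?case by (simp only:)
  qed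
  from this[OF addE_through[OF P hom_set_lin[OF g l N]]] show "Q g" using hom_set_restrict[OF g] by simp
qed

text \<open>The sum over a dual basis of \<open>P\<close>, built here one summand at a time.  It replaces the isomorphism
  \<open>Hom(P,A) \<otimes> N = Hom(P,N)\<close>.\<close>

lemma balanced_form_factors:
  assumes P: "proj A P" and N: "left_module A N" and G: "abelian_group G"
    and cl: "\<And>\<phi> n. \<phi> \<in> hom_set A P (regular A) \<Longrightarrow> n \<in> carrier N \<Longrightarrow> \<beta> \<phi> n \<in> carrier G"
    and a1: "\<And>\<phi> \<psi> n. \<phi> \<in> hom_set A P (regular A) \<Longrightarrow> \<psi> \<in> hom_set A P (regular A) \<Longrightarrow> n \<in> carrier N \<Longrightarrow>
      \<beta> (\<phi> \<oplus>\<^bsub>star A P\<^esub> \<psi>) n = \<beta> \<phi> n \<oplus>\<^bsub>G\<^esub> \<beta> \<psi> n"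
    and a2: "\<And>\<phi> m n. \<phi> \<in> hom_set A P (regular A) \<Longrightarrow> m \<in> carrier N \<Longrightarrow> n \<in> carrier N \<Longrightarrow>
      \<beta> \<phi> (m \<oplus>\<^bsub>N\<^esub> n) = \<beta> \<phi> m \<oplus>\<^bsub>G\<^esub> \<beta> \<phi> n"
    and bal: "\<And>\<phi> a n. \<phi> \<in> hom_set A P (regular A) \<Longrightarrow> a \<in> carrier A \<Longrightarrow> n \<in> carrier N \<Longrightarrow>
      \<beta> (a \<odot>\<^bsub>star A P\<^esub> \<phi>) n = \<beta> \<phi> (a \<odot>\<^bsub>N\<^esub> n)"
  obtains l where "\<And>g. g \<in> hom_set A P N \<Longrightarrow> l g \<in> carrier G"
    and "\<And>g h. g \<in> hom_set A P N \<Longrightarrow> h \<in> hom_set A P N \<Longrightarrow> l (\<lambda>x\<in>carrier P. g x \<oplus>\<^bsub>N\<^esub> h x) = l g \<oplus>\<^bsub>G\<^esub> l h"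
    and "\<And>\<phi> n. \<phi> \<in> hom_set A P (regular A) \<Longrightarrow> n \<in> carrier N \<Longrightarrow> l (tens P N \<phi> n) = \<beta> \<phi> n"
proof -
  have lP: "left_module A P" using P by (rule addED)
  interpret A: ring A using lP by (rule left_moduleD)
  interpret G: abelian_group G by (rule G)
  note r = left_module_regular[OF A.ring_axioms]
  let ?S = "hom_set A P (regular A)"
  note h = hom_set_lin[OF _ lP r] and hN = hom_set_lin[OF _ lP N]
  have "\<exists>l. (\<forall>g\<in>hom_set A P N. l g \<in> carrier G) \<and>
    (\<forall>g\<in>hom_set A P N. \<forall>h\<in>hom_set A P N. l (\<lambda>x\<in>carrier P. g x \<oplus>\<^bsub>N\<^esub> h x) = l g \<oplus>\<^bsub>G\<^esub> l h) \<and>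
    (\<forall>\<phi>\<in>?S. \<forall>n\<in>carrier N. l (tens P N \<phi> n) = \<beta> (\<lambda>x\<in>carrier P. \<phi> (f x)) n)"
    if "through A (regular A) P P f" for f
    using that
  proof induction
    case (zero f)
    have z: "\<beta> (\<lambda>x\<in>carrier P. \<phi> (f x)) n = \<zero>\<^bsub>G\<^esub>" if p: "\<phi> \<in> ?S" and n: "n \<in> carrier N" for \<phi> n
    proof -
      have 0: "(\<lambda>x\<in>carrier P. \<phi> (f x)) = (\<lambda>x\<in>carrier P. \<zero>\<^bsub>A\<^esub>)"
        using zero lin_zero[OF h[OF p]] by (intro restrict_ext) auto
      have o: "(\<lambda>x\<in>carrier P. \<zero>\<^bsub>A\<^esub>) \<in> ?S" using lin_hom_set[OF lin_0[OF lP r]] by simp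
      have "(\<lambda>x\<in>carrier P. \<zero>\<^bsub>A\<^esub>) \<oplus>\<^bsub>star A P\<^esub> (\<lambda>x\<in>carrier P. \<zero>\<^bsub>A\<^esub>) = (\<lambda>x\<in>carrier P. \<zero>\<^bsub>A\<^esub>)"
        unfolding star_simps by (intro restrict_ext) simp
      then show ?thesis using a1[OF o o n] cl[OF o n] unfolding 0 by simp
    qed
    show ?case
    proof (intro exI[of _ "\<lambda>_. \<zero>\<^bsub>G\<^esub>"] conjI ballI)
      show "\<zero>\<^bsub>G\<^esub> = \<beta> (\<lambda>x\<in>carrier P. \<phi> (f x)) n" if "\<phi> \<in> ?S" "n \<in> carrier N" for \<phi> n
        by (rule z[OF that, symmetric])
    qed simp_all
  next
    case (step f p i g)
    obtain l where l: "\<And>g. g \<in> hom_set A P N \<Longrightarrow> l g \<in> carrier G"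
      "\<And>g h. g \<in> hom_set A P N \<Longrightarrow> h \<in> hom_set A P N \<Longrightarrow> l (\<lambda>x\<in>carrier P. g x \<oplus>\<^bsub>N\<^esub> h x) = l g \<oplus>\<^bsub>G\<^esub> l h"
      "\<And>\<phi> n. \<phi> \<in> ?S \<Longrightarrow> n \<in> carrier N \<Longrightarrow> l (tens P N \<phi> n) = \<beta> (\<lambda>x\<in>carrier P. \<phi> (f x)) n"
      using step.IH by blast
    let ?p = "restrict p (carrier P)" and ?e = "i \<one>\<^bsub>A\<^esub>"
    have p: "?p \<in> ?S" by (rule lin_hom_set[OF step(2)])
    have e: "?e \<in> carrier P" using linD(3)[OF step(3), of "\<one>\<^bsub>A\<^esub>"] by simp
    have f: "lin A P P f" by (rule through_lin[OF step(1) lP lP])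
    have gc: "g' ?e \<in> carrier N" if "g' \<in> hom_set A P N" for g' using linD(3)[OF hN[OF that] e] .
    let ?l = "\<lambda>g. l g \<oplus>\<^bsub>G\<^esub> \<beta> ?p (g ?e)"
    have "?l (\<lambda>x\<in>carrier P. g x \<oplus>\<^bsub>N\<^esub> h x) = ?l g \<oplus>\<^bsub>G\<^esub> ?l h" if "g \<in> hom_set A P N" "h \<in> hom_set A P N" for g h
      using l(1)[OF that(1)] l(1)[OF that(2)] cl[OF p gc[OF that(1)]] cl[OF p gc[OF that(2)]]
      by (simp add: l(2)[OF that] e a2[OF p gc[OF that(1)] gc[OF that(2)]] G.a_ac)
    moreover have "?l (tens P N \<phi> n) = \<beta> (\<lambda>x\<in>carrier P. \<phi> (g x)) n" if q: "\<phi> \<in> ?S" and n: "n \<in> carrier N" for \<phi> n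
    proof -
      have c: "\<phi> ?e \<in> carrier A" using linD(3)[OF h[OF q] e] by simp
      have ff: "(\<lambda>x\<in>carrier P. \<phi> (f x)) \<in> ?S" by (rule lin_hom_set[OF lin_compose[OF f h[OF q]]])
      have pe: "\<phi> ?e \<odot>\<^bsub>star A P\<^esub> ?p \<in> ?S" using left_module_closed(5)[OF left_module_star[OF lP], of "\<phi> ?e" ?p] c p by simp
      have "?l (tens P N \<phi> n) = \<beta> (\<lambda>x\<in>carrier P. \<phi> (f x)) n \<oplus>\<^bsub>G\<^esub> \<beta> ?p (\<phi> ?e \<odot>\<^bsub>N\<^esub> n)"
        using l(3)[OF q n] e by (simp add: tens_def)
      also have "\<dots> = \<beta> ((\<lambda>x\<in>carrier P. \<phi> (f x)) \<oplus>\<^bsub>star A P\<^esub> \<phi> ?e \<odot>\<^bsub>star A P\<^esub> ?p) n"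
        using a1[OF ff pe n] bal[OF p c n] by simp
      also have "(\<lambda>x\<in>carrier P. \<phi> (f x)) \<oplus>\<^bsub>star A P\<^esub> \<phi> ?e \<odot>\<^bsub>star A P\<^esub> ?p = (\<lambda>x\<in>carrier P. \<phi> (g x))"
        unfolding star_simps
      proof (rule restrict_ext)
        fix x assume x: "x \<in> carrier P"
        have px: "p x \<in> carrier A" using linD(3)[OF step(2) x] by simp
        have "\<phi> (g x) = \<phi> (f x) \<oplus>\<^bsub>A\<^esub> \<phi> (p x \<odot>\<^bsub>P\<^esub> ?e)"
          using step(4) x lin_regular_eval[OF step(3) px] linD(4)[OF h[OF q] linD(3)[OF f x], of "p x \<odot>\<^bsub>P\<^esub> ?e"]
            left_module_closed(5)[OF lP px e] by simp
        then show "(\<lambda>x\<in>carrier P. \<phi> (f x)) x \<oplus>\<^bsub>A\<^esub> (\<lambda>x\<in>carrier P. ?p x \<otimes>\<^bsub>A\<^esub> \<phi> ?e) x = \<phi> (g x)"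
          using x linD(5)[OF h[OF q] px e] by simp
      qed
      finally show ?thesis .
    qed
    moreover have "?l g \<in> carrier G" if "g \<in> hom_set A P N" for g using l(1)[OF that] cl[OF p gc[OF that]] by simp
    ultimately show ?case by (intro exI[of _ ?l]) blast
  qed
  from this[OF addED(3)[OF P]] obtain l where l: "\<And>g. g \<in> hom_set A P N \<Longrightarrow> l g \<in> carrier G"
    "\<And>g h. g \<in> hom_set A P N \<Longrightarrow> h \<in> hom_set A P N \<Longrightarrow> l (\<lambda>x\<in>carrier P. g x \<oplus>\<^bsub>N\<^esub> h x) = l g \<oplus>\<^bsub>G\<^esub> l h"
    "\<And>\<phi> n. \<phi> \<in> ?S \<Longrightarrow> n \<in> carrier N \<Longrightarrow> l (tens P N \<phi> n) = \<beta> (\<lambda>x\<in>carrier P. \<phi> x) n"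
    by blast
  show thesis
  proof (rule that[of l])
    show "l (tens P N \<phi> n) = \<beta> \<phi> n" if "\<phi> \<in> ?S" "n \<in> carrier N" for \<phi> n
      using l(3)[OF that] hom_set_restrict[OF that(1)] by simp
  qed (use l in auto)
qed

lemma dual_simps [simp]:
  "carrier (dual K A Z) = hom_set K (restrict_scalars (opposite A) Z) (regular K)"
  "\<zero>\<^bsub>dual K A Z\<^esub> = (\<lambda>x\<in>carrier Z. \<zero>\<^bsub>K\<^esub>)"
  "\<phi> \<oplus>\<^bsub>dual K A Z\<^esub> \<psi> = (\<lambda>x\<in>carrier Z. \<phi> x \<oplus>\<^bsub>K\<^esub> \<psi> x)"
  "a \<odot>\<^bsub>dual K A Z\<^esub> \<phi> = (\<lambda>x\<in>carrier Z. \<phi> (a \<odot>\<^bsub>Z\<^esub> x))"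
  by (simp_all add: dual_def Let_def Hom_simps)

text \<open>This is the formula \<open>Hom(N, D Tr N) = D (Tr N \<otimes> N)\<close> combined with the right exactness of the tensor
  product: \<open>Tr N \<otimes> N\<close> is the cokernel of \<open>Hom(P0,A) \<otimes> N \<rightarrow> Hom(P1,A) \<otimes> N\<close>, and \<open>Hom(P,A) \<otimes> N = Hom(P,N)\<close>
  for projective \<open>P\<close>; so it vanishes exactly when \<open>Hom(P0,N) \<rightarrow> Hom(P1,N)\<close> is onto.  Tensor products are
  avoided by working with forms: a homomorphism from \<open>N\<close> to \<open>D Tr N\<close> is a balanced form on
  \<open>Hom(P1,A) \<times> N\<close> that vanishes on the image of \<open>Hom(P0,A)\<close>, that is, a \<open>K\<close>-linear form on \<open>Hom(P1,N)\<close>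
  that vanishes on the image of \<open>Hom(P0,N)\<close>.\<close>

lemma tau_vanishing_iff_rigid:
  fixes K :: "'k ring" and A :: "('k, 'a) module"
  assumes A: "fd_algebra K A" and N: "fg_module A N" and P1: "proj A P1" "fg_module A P1" and P0: "proj A P0"
    and f: "f1 \<in> hom_set A P1 P0"
  defines "T \<equiv> quot_module (star A P1) (precomp P1 f1 ` carrier (star A P0))"
  shows "hom_set A N (dual K A T) = {\<zero>\<^bsub>Hom A N (dual K A T)\<^esub>} \<longleftrightarrow> rigid A P1 f1 P0 N"
proof -
  note D = fd_algebraD[OF A]
  interpret K: field K by (rule D)
  interpret A: ring A by (rule D)
  have lN: "left_module A N" by (rule fg_left[OF N])
  note l1 = addED(2)[OF P1(1)] and l0 = addED(2)[OF P0]
  have lf: "lin A P1 P0 f1" by (rule hom_set_lin[OF f l1 l0])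
  note r = left_module_regular[OF A.ring_axioms]
  let ?S = "star A P1" and ?W = "precomp P1 f1 ` carrier (star A P0)" and ?R = "restrict_scalars (opposite A) T"
  have lS: "left_module (opposite A) ?S" by (rule left_module_star[OF l1])
  have W: "submodule ?W (opposite A) ?S"
    by (rule submodule_image[OF lin_precomp_star[OF lf] submodule_carrier[OF left_module_star[OF l0]]])
  let ?q = "\<lambda>\<phi>. ?W +>\<^bsub>?S\<^esub> \<phi>"
  note q = quot_module_coset[OF lS W, folded T_def]
  have qc: "?q \<phi> \<in> carrier T" if "\<phi> \<in> hom_set A P1 (regular A)" for \<phi> using q(1) that by auto
  have sc: "\<phi> \<oplus>\<^bsub>?S\<^esub> \<psi> \<in> hom_set A P1 (regular A)" "a \<odot>\<^bsub>?S\<^esub> \<phi> \<in> hom_set A P1 (regular A)"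
    if "\<phi> \<in> hom_set A P1 (regular A)" "\<psi> \<in> hom_set A P1 (regular A)" "a \<in> carrier A" for \<phi> \<psi> a
    using left_module_closed(2)[OF lS, of \<phi> \<psi>] left_module_closed(5)[OF lS, of a \<phi>] that by (simp_all only: star_simps opposite_simps)
  let ?D = "dual K A T"
  let ?Z = "\<lambda>x\<in>carrier T. \<zero>\<^bsub>K\<^esub>"
  have Tadd: "x \<oplus>\<^bsub>T\<^esub> y \<in> carrier T" if xy: "x \<in> carrier T" "y \<in> carrier T" for x y
  proof -
    obtain \<phi> \<psi> where p: "\<phi> \<in> hom_set A P1 (regular A)" "x = ?q \<phi>" "\<psi> \<in> hom_set A P1 (regular A)" "y = ?q \<psi>"
      using xy q(1) unfolding star_simps(1) by auto
    show ?thesis using q(3)[of \<phi> \<psi>] qc[OF sc(1)[OF p(1,3) A.one_closed]] p by (simp only: star_simps(1))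
  qed
  have Tsm: "a \<odot>\<^bsub>T\<^esub> x \<in> carrier T" if xa: "x \<in> carrier T" "a \<in> carrier A" for x a
  proof -
    obtain \<phi> where p: "\<phi> \<in> hom_set A P1 (regular A)" "x = ?q \<phi>"
      using xa q(1) unfolding star_simps(1) by auto
    show ?thesis using q(4)[of a \<phi>] qc[OF sc(2)[OF p(1,1) xa(2)]] p xa(2) by (simp only: star_simps(1) opposite_simps)
  qed
  note Tadd = Tadd Tsm
  have Zd: "?Z \<in> carrier ?D"
    unfolding dual_simps Hom_def using Tadd D(6) by simp
  have Zhom: "(\<lambda>n\<in>carrier N. ?Z) \<in> hom_set A N ?D"
  proof -
    have "?Z \<oplus>\<^bsub>?D\<^esub> ?Z = ?Z" unfolding dual_simps by (rule restrict_ext) simp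
    moreover have "a \<odot>\<^bsub>?D\<^esub> ?Z = ?Z" if "a \<in> carrier A" for a
      unfolding dual_simps by (rule restrict_ext) (use Tadd that in simp)
    ultimately show ?thesis
      unfolding Hom_def[of A N ?D] using Zd left_module_closed[OF lN] by (simp del: dual_simps)
  qed
  have homD: "h n \<in> carrier ?D" if h: "h \<in> hom_set A N ?D" and n: "n \<in> carrier N" for h n
  proof -
    have "h \<in> carrier N \<rightarrow>\<^sub>E carrier ?D" using h unfolding Hom_def[of A N ?D] by simp
    then show ?thesis using n by (rule PiE_mem)
  qed
  \<comment> \<open>Elements of the dual of the transpose are tested on the classes of linear forms on \<open>P1\<close>.\<close>
  have triv: "hom_set A N ?D = {\<zero>\<^bsub>Hom A N ?D\<^esub>} \<longleftrightarrow>
    (\<forall>h\<in>hom_set A N ?D. \<forall>n\<in>carrier N. \<forall>\<phi>\<in>hom_set A P1 (regular A). h n (?q \<phi>) = \<zero>\<^bsub>K\<^esub>)" (is "?l \<longleftrightarrow> ?r")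
  proof
    assume ?l then show ?r using qc by (auto simp: Hom_simps)
  next
    assume z: ?r
    have all: "h = (\<lambda>n\<in>carrier N. ?Z)" if h: "h \<in> hom_set A N ?D" for h
    proof (rule hom_set_eqI[OF h Zhom])
      fix n assume n: "n \<in> carrier N"
      have "h n \<in> carrier ?D" by (rule homD[OF h n])
      then have "h n = ?Z"
        unfolding dual_simps(1)
      proof (rule hom_set_eqI[OF _ Zd[unfolded dual_simps(1)]])
        fix x assume "x \<in> carrier ?R"
        then show "h n x = ?Z x" using z h n q(1) by auto
      qed
      then show "h n = (\<lambda>n\<in>carrier N. ?Z) n" using n by simp
    qed
    have zeq: "\<zero>\<^bsub>Hom A N ?D\<^esub> = (\<lambda>n\<in>carrier N. ?Z)" by (simp only: Hom_simps dual_simps)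
    show ?l
      unfolding zeq
    proof (intro equalityI subsetI)
      show "h \<in> {\<lambda>n\<in>carrier N. ?Z}" if "h \<in> hom_set A N ?D" for h by (subst all[OF that]) (rule singletonI)
      show "h \<in> hom_set A N ?D" if "h \<in> {\<lambda>n\<in>carrier N. ?Z}" for h using Zhom singletonD[OF that] by (simp only:)
    qed
  qed
  show ?thesis
    unfolding triv
  proof
    assume rig: "rigid A P1 f1 P0 N"
    show "\<forall>h\<in>hom_set A N ?D. \<forall>n\<in>carrier N. \<forall>\<phi>\<in>hom_set A P1 (regular A). h n (?q \<phi>) = \<zero>\<^bsub>K\<^esub>"
    proof
      fix h assume h: "h \<in> hom_set A N ?D"
      have hn: "h n \<in> hom_set K ?R (regular K)" if "n \<in> carrier N" for n using homD[OF h that] by simp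
      \<comment> \<open>From a homomorphism to a form: \<open>\<beta>\<close> is balanced and extends to a form \<open>l\<close> on \<open>Hom(P1,N)\<close>.\<close>
      define \<beta> where "\<beta> \<phi> n = h n (?q \<phi>)" for \<phi> n
      have \<beta>c: "\<beta> \<phi> n \<in> carrier K" if "\<phi> \<in> hom_set A P1 (regular A)" "n \<in> carrier N" for \<phi> n
      proof -
        have "h n \<in> carrier T \<rightarrow>\<^sub>E carrier K" using hn[OF that(2)] unfolding Hom_def by simp
        then show ?thesis unfolding \<beta>_def using qc[OF that(1)] by (rule PiE_mem)
      qed
      have b1: "\<beta> (\<phi> \<oplus>\<^bsub>?S\<^esub> \<psi>) n = \<beta> \<phi> n \<oplus>\<^bsub>K\<^esub> \<beta> \<psi> n"
        if "\<phi> \<in> hom_set A P1 (regular A)" "\<psi> \<in> hom_set A P1 (regular A)" "n \<in> carrier N" for \<phi> \<psi> n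
      proof -
        have "h n (?q \<phi> \<oplus>\<^bsub>T\<^esub> ?q \<psi>) = h n (?q \<phi>) \<oplus>\<^bsub>K\<^esub> h n (?q \<psi>)"
          using hn[OF that(3)] qc[OF that(1)] qc[OF that(2)] unfolding Hom_def by simp
        then show ?thesis unfolding \<beta>_def using q(3)[of \<phi> \<psi>] that by (simp only: star_simps(1))
      qed
      have b2: "\<beta> \<phi> (m \<oplus>\<^bsub>N\<^esub> n) = \<beta> \<phi> m \<oplus>\<^bsub>K\<^esub> \<beta> \<phi> n"
        if "\<phi> \<in> hom_set A P1 (regular A)" "m \<in> carrier N" "n \<in> carrier N" for \<phi> m n
      proof -
        have "h (m \<oplus>\<^bsub>N\<^esub> n) = h m \<oplus>\<^bsub>?D\<^esub> h n" using h that unfolding Hom_def[of A N ?D] by simp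
        then show ?thesis using qc[OF that(1)] by (simp add: \<beta>_def)
      qed
      have b3: "\<beta> (a \<odot>\<^bsub>?S\<^esub> \<phi>) n = \<beta> \<phi> (a \<odot>\<^bsub>N\<^esub> n)"
        if "\<phi> \<in> hom_set A P1 (regular A)" "a \<in> carrier A" "n \<in> carrier N" for \<phi> a n
      proof -
        have "h (a \<odot>\<^bsub>N\<^esub> n) = a \<odot>\<^bsub>?D\<^esub> h n" using h that unfolding Hom_def[of A N ?D] by simp
        then have "\<beta> \<phi> (a \<odot>\<^bsub>N\<^esub> n) = h n (a \<odot>\<^bsub>T\<^esub> ?q \<phi>)" using qc[OF that(1)] by (simp add: \<beta>_def)
        then show ?thesis unfolding \<beta>_def using q(4)[of a \<phi>] that by (simp only: star_simps(1) opposite_simps)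
      qed
      have b4: "\<beta> \<phi> n = \<zero>\<^bsub>K\<^esub>" if "\<phi> \<in> ?W" "n \<in> carrier N" for \<phi> n
      proof -
        have p: "\<phi> \<in> hom_set A P1 (regular A)" using submoduleD(5)[OF W that(1)] by simp
        have "\<phi> \<oplus>\<^bsub>?S\<^esub> \<phi> \<in> ?W" using submoduleD(3)[OF W that(1) that(1)] .
        then have "?q (\<phi> \<oplus>\<^bsub>?S\<^esub> \<phi>) = ?q \<phi>" using q(6) that(1) by simp
        then have "\<beta> \<phi> n \<oplus>\<^bsub>K\<^esub> \<beta> \<phi> n = \<beta> \<phi> n" using b1[OF p p that(2)] by (simp only: \<beta>_def)
        then show ?thesis using \<beta>c[OF p that(2)] by simp
      qed
      obtain l where l: "\<And>g. g \<in> hom_set A P1 N \<Longrightarrow> l g \<in> carrier K"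
        "\<And>g h. g \<in> hom_set A P1 N \<Longrightarrow> h \<in> hom_set A P1 N \<Longrightarrow> l (\<lambda>x\<in>carrier P1. g x \<oplus>\<^bsub>N\<^esub> h x) = l g \<oplus>\<^bsub>K\<^esub> l h"
        "\<And>\<phi> n. \<phi> \<in> hom_set A P1 (regular A) \<Longrightarrow> n \<in> carrier N \<Longrightarrow> l (tens P1 N \<phi> n) = \<beta> \<phi> n"
        by (rule balanced_form_factors[OF P1(1) lN K.abelian_group_axioms \<beta>c b1 b2 b3]) auto
      have pull: "(\<lambda>x\<in>carrier P1. g (f1 x)) \<in> hom_set A P1 N" if "g \<in> hom_set A P0 N" for g
        by (rule lin_hom_set[OF lin_compose[OF lf hom_set_lin[OF that l0 lN]]])
      have l0': "l (\<lambda>x\<in>carrier P1. g (f1 x)) = \<zero>\<^bsub>K\<^esub>" if g: "g \<in> hom_set A P0 N" for g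
      proof (rule Hom_induct_tens[OF P0 lN g, where Q="\<lambda>g. l (\<lambda>x\<in>carrier P1. g (f1 x)) = \<zero>\<^bsub>K\<^esub>"])
        let ?z = "\<lambda>x\<in>carrier P1. \<zero>\<^bsub>N\<^esub>"
        interpret N: abelian_group N using lN by (rule left_moduleD)
        have e: "(\<lambda>x\<in>carrier P1. (\<lambda>x\<in>carrier P0. \<zero>\<^bsub>N\<^esub>) (f1 x)) = ?z"
          by (rule restrict_ext) (use linD(3)[OF lf] in simp)
        have z: "?z \<in> hom_set A P1 N" using lin_hom_set[OF lin_0[OF l1 lN]] .
        have "(\<lambda>x\<in>carrier P1. ?z x \<oplus>\<^bsub>N\<^esub> ?z x) = ?z" by (rule restrict_ext) simp
        then have "l ?z \<oplus>\<^bsub>K\<^esub> l ?z = l ?z" using l(2)[OF z z] by (simp only:)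
        then show "l (\<lambda>x\<in>carrier P1. (\<lambda>x\<in>carrier P0. \<zero>\<^bsub>N\<^esub>) (f1 x)) = \<zero>\<^bsub>K\<^esub>" unfolding e using l(1)[OF z] by simp
      next
        fix g \<phi> n assume a: "g \<in> hom_set A P0 N" "l (\<lambda>x\<in>carrier P1. g (f1 x)) = \<zero>\<^bsub>K\<^esub>"
          "\<phi> \<in> hom_set A P0 (regular A)" "n \<in> carrier N"
        let ?f = "precomp P1 f1 \<phi>"
        have w: "?f \<in> ?W" using a(3) by simp
        have fs: "?f \<in> hom_set A P1 (regular A)" using submoduleD(5)[OF W w] by simp
        have tf: "tens P1 N ?f n \<in> hom_set A P1 N" by (rule lin_tens(2)[OF hom_set_lin[OF fs l1 r] lN a(4)])
        have "(\<lambda>x\<in>carrier P1. (\<lambda>x\<in>carrier P0. g x \<oplus>\<^bsub>N\<^esub> tens P0 N \<phi> n x) (f1 x)) =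
          (\<lambda>x\<in>carrier P1. (\<lambda>x\<in>carrier P1. g (f1 x)) x \<oplus>\<^bsub>N\<^esub> tens P1 N ?f n x)"
          by (rule restrict_ext) (use linD(3)[OF lf] in \<open>simp add: tens_def precomp_eq\<close>)
        then have "l (\<lambda>x\<in>carrier P1. (\<lambda>x\<in>carrier P0. g x \<oplus>\<^bsub>N\<^esub> tens P0 N \<phi> n x) (f1 x)) =
          l (\<lambda>x\<in>carrier P1. g (f1 x)) \<oplus>\<^bsub>K\<^esub> l (tens P1 N ?f n)"
          using l(2)[OF pull[OF a(1)] tf] by (simp only:)
        also have "\<dots> = \<zero>\<^bsub>K\<^esub>" using a(2) l(3)[OF fs a(4)] b4[OF w a(4)] by simp
        finally show "l (\<lambda>x\<in>carrier P1. (\<lambda>x\<in>carrier P0. g x \<oplus>\<^bsub>N\<^esub> tens P0 N \<phi> n x) (f1 x)) = \<zero>\<^bsub>K\<^esub>" .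
      qed
      show "\<forall>n\<in>carrier N. \<forall>\<phi>\<in>hom_set A P1 (regular A). h n (?q \<phi>) = \<zero>\<^bsub>K\<^esub>"
      proof (intro ballI)
        fix n \<phi> assume n: "n \<in> carrier N" and p: "\<phi> \<in> hom_set A P1 (regular A)"
        obtain w where w: "lin A P0 N w" "\<And>x. x \<in> carrier P1 \<Longrightarrow> w (f1 x) = \<phi> x \<odot>\<^bsub>N\<^esub> n"
          using rig lin_tens(1)[OF hom_set_lin[OF p l1 r] lN n] by (auto simp: rigid_def)
        have "tens P1 N \<phi> n = (\<lambda>x\<in>carrier P1. restrict w (carrier P0) (f1 x))"
          unfolding tens_def by (rule restrict_ext) (use w(2) linD(3)[OF lf] in simp)
        then have "l (tens P1 N \<phi> n) = \<zero>\<^bsub>K\<^esub>" using l0'[OF lin_hom_set[OF w(1)]] by (simp only:)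
        then show "h n (?q \<phi>) = \<zero>\<^bsub>K\<^esub>" using l(3)[OF p n] by (simp add: \<beta>_def)
      qed
    qed
  next
    assume van: "\<forall>h\<in>hom_set A N ?D. \<forall>n\<in>carrier N. \<forall>\<phi>\<in>hom_set A P1 (regular A). h n (?q \<phi>) = \<zero>\<^bsub>K\<^esub>"
    show "rigid A P1 f1 P0 N"
    proof (rule ccontr)
      assume nr: "\<not> rigid A P1 f1 P0 N"
      \<comment> \<open>From a form to a homomorphism: a nonzero form \<open>l\<close> on \<open>Hom(P1,N)\<close> that vanishes on the proper
        subspace of the maps that extend along \<open>f1\<close> defines a nonzero homomorphism \<open>h\<close>.\<close>
      let ?V = "Hom_space A P1 N" and ?Vp = "Hom_space A P0 N"
      have V: "fg_module K ?V" by (rule fg_Hom_space[OF A P1(2) N])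
      have lV: "left_module K ?V" "left_module K ?Vp" by (rule left_module_Hom_space[OF A l1 lN], rule left_module_Hom_space[OF A l0 lN])
      have pull: "lin K ?Vp ?V (\<lambda>g. \<lambda>x\<in>carrier P1. g (f1 x))"
        by (rule linI[OF lV(2,1)])
          (use lin_hom_set[OF lin_compose[OF lf hom_set_lin[OF _ l0 lN]]] linD(3)[OF lf] in \<open>auto intro!: restrict_ext\<close>)
      let ?U = "(\<lambda>g. \<lambda>x\<in>carrier P1. g (f1 x)) ` carrier ?Vp"
      have U: "submodule ?U K ?V" by (rule submodule_image[OF pull submodule_carrier[OF lV(2)]])
      have "?U \<noteq> carrier ?V"
      proof
        assume UV: "?U = carrier ?V"
        have "rigid A P1 f1 P0 N"
          unfolding rigid_def
        proof (intro allI impI)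
          fix v assume v: "lin A P1 N v"
          have "restrict v (carrier P1) \<in> ?U" unfolding UV using lin_hom_set[OF v] by simp
          then obtain g where g: "g \<in> hom_set A P0 N" "restrict v (carrier P1) = (\<lambda>x\<in>carrier P1. g (f1 x))" by auto
          have "g (f1 x) = v x" if "x \<in> carrier P1" for x using fun_cong[OF g(2), of x] that by simp
          then show "\<exists>w. lin A P0 N w \<and> (\<forall>x\<in>carrier P1. w (f1 x) = v x)" using hom_set_lin[OF g(1) l0 lN] by blast
        qed
        then show False using nr by simp
      qed
      then obtain l where l: "lin K ?V (regular K) l" "\<And>u. u \<in> ?U \<Longrightarrow> l u = \<zero>\<^bsub>K\<^esub>" "\<exists>v\<in>carrier ?V. l v \<noteq> \<zero>\<^bsub>K\<^esub>"
        using separating_functional[OF D(1) V U] by blast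
      note hS = hom_set_lin[OF _ l1 r]
      have t: "tens P1 N \<phi> n \<in> hom_set A P1 N" if "\<phi> \<in> hom_set A P1 (regular A)" "n \<in> carrier N" for \<phi> n
        by (rule lin_tens(2)[OF hS[OF that(1)] lN that(2)])
      have sc': "\<phi> x \<in> carrier A" if "\<phi> \<in> hom_set A P1 (regular A)" "x \<in> carrier P1" for \<phi> x using linD(3)[OF hS[OF that(1)] that(2)] by simp
      \<comment> \<open>A representative of each class; by \<open>lW\<close> below its choice does not affect the values.\<close>
      define c where "c C = (SOME \<phi>. \<phi> \<in> hom_set A P1 (regular A) \<and> C = ?q \<phi>)" for C
      define b where "b n C = l (tens P1 N (c C) n)" for n C
      have lt1: "l (tens P1 N (\<phi> \<oplus>\<^bsub>?S\<^esub> \<psi>) n) = l (tens P1 N \<phi> n) \<oplus>\<^bsub>K\<^esub> l (tens P1 N \<psi> n)"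
        if "\<phi> \<in> hom_set A P1 (regular A)" "\<psi> \<in> hom_set A P1 (regular A)" "n \<in> carrier N" for \<phi> \<psi> n
      proof -
        have "tens P1 N (\<phi> \<oplus>\<^bsub>?S\<^esub> \<psi>) n = tens P1 N \<phi> n \<oplus>\<^bsub>?V\<^esub> tens P1 N \<psi> n"
          unfolding tens_def Hom_space_simps
          by (rule restrict_ext) (use that sc'[OF that(1)] sc'[OF that(2)] in \<open>simp add: left_module.smult_l_distr[OF lN]\<close>)
        then show ?thesis using linD(4)[OF l(1), of "tens P1 N \<phi> n" "tens P1 N \<psi> n"] t that by (simp only: Hom_space_simps(1) regular_simps)
      qed
      have lt2: "l (tens P1 N \<phi> (m \<oplus>\<^bsub>N\<^esub> n)) = l (tens P1 N \<phi> m) \<oplus>\<^bsub>K\<^esub> l (tens P1 N \<phi> n)"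
        if "\<phi> \<in> hom_set A P1 (regular A)" "m \<in> carrier N" "n \<in> carrier N" for \<phi> m n
      proof -
        have "tens P1 N \<phi> (m \<oplus>\<^bsub>N\<^esub> n) = tens P1 N \<phi> m \<oplus>\<^bsub>?V\<^esub> tens P1 N \<phi> n"
          unfolding tens_def Hom_space_simps
          by (rule restrict_ext) (use that sc'[OF that(1)] in \<open>simp add: left_module.smult_r_distr[OF lN]\<close>)
        then show ?thesis using linD(4)[OF l(1), of "tens P1 N \<phi> m" "tens P1 N \<phi> n"] t that by (simp only: Hom_space_simps(1) regular_simps)
      qed
      have lt3: "tens P1 N (a \<odot>\<^bsub>?S\<^esub> \<phi>) n = tens P1 N \<phi> (a \<odot>\<^bsub>N\<^esub> n)"
        if "\<phi> \<in> hom_set A P1 (regular A)" "a \<in> carrier A" "n \<in> carrier N" for \<phi> a n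
        unfolding tens_def
        by (rule restrict_ext) (use that sc'[OF that(1)] in \<open>simp add: left_module.smult_assoc1[OF lN]\<close>)
      have lt4: "l (tens P1 N \<phi> ((k \<odot>\<^bsub>A\<^esub> \<one>\<^bsub>A\<^esub>) \<odot>\<^bsub>N\<^esub> n)) = k \<otimes>\<^bsub>K\<^esub> l (tens P1 N \<phi> n)"
        if "\<phi> \<in> hom_set A P1 (regular A)" "k \<in> carrier K" "n \<in> carrier N" for \<phi> k n
      proof -
        have "tens P1 N \<phi> ((k \<odot>\<^bsub>A\<^esub> \<one>\<^bsub>A\<^esub>) \<odot>\<^bsub>N\<^esub> n) = k \<odot>\<^bsub>?V\<^esub> tens P1 N \<phi> n"
          unfolding tens_def Hom_space_simps
          by (rule restrict_ext)
            (use that sc'[OF that(1)] D(6-8) in \<open>simp add: left_module.smult_assoc1[OF lN, symmetric]\<close>)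
        then show ?thesis using linD(5)[OF l(1) that(2), of "tens P1 N \<phi> n"] t that by (simp only: Hom_space_simps(1) regular_simps)
      qed
      have lW: "l (tens P1 N \<phi> n) = \<zero>\<^bsub>K\<^esub>" if "\<phi> \<in> ?W" and n: "n \<in> carrier N" for \<phi> n
      proof -
        obtain \<psi> where p: "\<psi> \<in> hom_set A P0 (regular A)" "\<phi> = precomp P1 f1 \<psi>" using \<open>\<phi> \<in> ?W\<close> by auto
        have "tens P1 N \<phi> n = (\<lambda>x\<in>carrier P1. tens P0 N \<psi> n (f1 x))"
          unfolding tens_def p(2) by (rule restrict_ext) (use linD(3)[OF lf] in \<open>simp add: precomp_eq\<close>)
        moreover have "tens P0 N \<psi> n \<in> hom_set A P0 N" by (rule lin_tens(2)[OF hom_set_lin[OF p(1) l0 r] lN n])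
        ultimately have "tens P1 N \<phi> n \<in> ?U" by simp
        then show ?thesis by (rule l(2))
      qed
      have bq: "b n (?q \<phi>) = l (tens P1 N \<phi> n)" if p: "\<phi> \<in> hom_set A P1 (regular A)" and n: "n \<in> carrier N" for \<phi> n
      proof -
        have "c (?q \<phi>) \<in> hom_set A P1 (regular A) \<and> ?q \<phi> = ?q (c (?q \<phi>))"
          unfolding c_def by (rule someI[of _ \<phi>]) (use p in simp)
        then have cc: "c (?q \<phi>) \<in> hom_set A P1 (regular A)" "?q \<phi> = ?q (c (?q \<phi>))" by auto
        interpret S: abelian_group ?S using lS by (rule left_moduleD)
        let ?d = "c (?q \<phi>) \<ominus>\<^bsub>?S\<^esub> \<phi>"
        have d: "?d \<in> ?W" using q(5)[of "c (?q \<phi>)" \<phi>] cc p by (simp only: star_simps(1))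
        have dS: "?d \<in> hom_set A P1 (regular A)" using submoduleD(5)[OF W d] by simp
        have "?d \<oplus>\<^bsub>?S\<^esub> \<phi> = c (?q \<phi>)"
          using cc(1) p S.l_neg[of \<phi>] S.r_zero[of "c (?q \<phi>)"] S.a_assoc[of "c (?q \<phi>)" "\<ominus>\<^bsub>?S\<^esub> \<phi>" \<phi>] S.a_inv_closed[of \<phi>]
          by (simp only: a_minus_def star_simps(1))
        then have "b n (?q \<phi>) = l (tens P1 N ?d n) \<oplus>\<^bsub>K\<^esub> l (tens P1 N \<phi> n)"
          using lt1[OF dS p n] by (simp only: b_def)
        moreover have "l (tens P1 N \<phi> n) \<in> carrier K" using linD(3)[OF l(1), of "tens P1 N \<phi> n"] t[OF p n] by simp
        ultimately show ?thesis using lW[OF d n] by simp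
      qed
      define h where "h = (\<lambda>n\<in>carrier N. \<lambda>C\<in>carrier T. b n C)"
      have lc: "l (tens P1 N \<phi> n) \<in> carrier K" if "\<phi> \<in> hom_set A P1 (regular A)" "n \<in> carrier N" for \<phi> n
        using linD(3)[OF l(1), of "tens P1 N \<phi> n"] t[OF that] by simp
      have Tc: "\<exists>\<phi>. \<phi> \<in> hom_set A P1 (regular A) \<and> C = ?q \<phi>" if "C \<in> carrier T" for C using that q(1) by auto
      have q3: "?q \<phi> \<oplus>\<^bsub>T\<^esub> ?q \<psi> = ?q (\<phi> \<oplus>\<^bsub>?S\<^esub> \<psi>)" "a \<odot>\<^bsub>T\<^esub> ?q \<phi> = ?q (a \<odot>\<^bsub>?S\<^esub> \<phi>)"
        if "\<phi> \<in> hom_set A P1 (regular A)" "\<psi> \<in> hom_set A P1 (regular A)" "a \<in> carrier A" for \<phi> \<psi> a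
        using q(3)[of \<phi> \<psi>] q(4)[of a \<phi>] that by (simp_all only: star_simps(1) opposite_simps)
      have hd: "(\<lambda>C\<in>carrier T. b n C) \<in> carrier ?D" if n: "n \<in> carrier N" for n
      proof -
        have 1: "b n C \<in> carrier K" if "C \<in> carrier T" for C using Tc[OF that] bq[OF _ n] lc[OF _ n] by auto
        have 2: "C \<oplus>\<^bsub>T\<^esub> C' \<in> carrier T \<and> b n (C \<oplus>\<^bsub>T\<^esub> C') = b n C \<oplus>\<^bsub>K\<^esub> b n C'" if C: "C \<in> carrier T" "C' \<in> carrier T" for C C'
        proof -
          obtain \<phi> \<psi> where p: "\<phi> \<in> hom_set A P1 (regular A)" "C = ?q \<phi>" "\<psi> \<in> hom_set A P1 (regular A)" "C' = ?q \<psi>" using C Tc by metis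
          note s = sc(1)[OF p(1,3) A.one_closed]
          show ?thesis unfolding p q3(1)[OF p(1,3) A.one_closed]
            using qc[OF s] bq[OF s n] bq[OF p(1) n] bq[OF p(3) n] lt1[OF p(1,3) n] by (simp only:)
        qed
        have 3: "(k \<odot>\<^bsub>A\<^esub> \<one>\<^bsub>A\<^esub>) \<odot>\<^bsub>T\<^esub> C \<in> carrier T \<and> b n ((k \<odot>\<^bsub>A\<^esub> \<one>\<^bsub>A\<^esub>) \<odot>\<^bsub>T\<^esub> C) = k \<otimes>\<^bsub>K\<^esub> b n C" if k: "k \<in> carrier K" and C: "C \<in> carrier T" for k C
        proof -
          obtain \<phi> where p: "\<phi> \<in> hom_set A P1 (regular A)" "C = ?q \<phi>" using C Tc by metis
          note s = sc(2)[OF p(1) p(1) D(6)[OF k]]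
          show ?thesis unfolding p q3(2)[OF p(1) p(1) D(6)[OF k]]
            using qc[OF s] bq[OF s n] bq[OF p(1) n] lt3[OF p(1) D(6)[OF k] n] lt4[OF p(1) k n] by (simp only:)
        qed
        show ?thesis unfolding dual_simps Hom_def using 1 2 3 by simp
      qed
      have "h \<in> hom_set A N ?D"
      proof -
        note lNc = left_module_closed[OF lN]
        have 1: "(\<lambda>C\<in>carrier T. b (m \<oplus>\<^bsub>N\<^esub> n) C) = (\<lambda>C\<in>carrier T. b m C) \<oplus>\<^bsub>?D\<^esub> (\<lambda>C\<in>carrier T. b n C)"
          if "m \<in> carrier N" "n \<in> carrier N" for m n
          unfolding dual_simps
        proof (rule restrict_ext)
          fix C assume C: "C \<in> carrier T"
          obtain \<phi> where p: "\<phi> \<in> hom_set A P1 (regular A)" "C = ?q \<phi>" using C Tc by metis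
          show "b (m \<oplus>\<^bsub>N\<^esub> n) C = (\<lambda>C\<in>carrier T. b m C) C \<oplus>\<^bsub>K\<^esub> (\<lambda>C\<in>carrier T. b n C) C"
            using C unfolding p using bq[OF p(1) lNc(2)[OF that]] bq[OF p(1) that(1)] bq[OF p(1) that(2)] lt2[OF p(1) that] by simp
        qed
        have 2: "(\<lambda>C\<in>carrier T. b (a \<odot>\<^bsub>N\<^esub> n) C) = a \<odot>\<^bsub>?D\<^esub> (\<lambda>C\<in>carrier T. b n C)"
          if "a \<in> carrier A" "n \<in> carrier N" for a n
          unfolding dual_simps
        proof (rule restrict_ext)
          fix C assume C: "C \<in> carrier T"
          obtain \<phi> where p: "\<phi> \<in> hom_set A P1 (regular A)" "C = ?q \<phi>" using C Tc by metis
          note s = sc(2)[OF p(1) p(1) that(1)]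
          show "b (a \<odot>\<^bsub>N\<^esub> n) C = (\<lambda>C\<in>carrier T. b n C) (a \<odot>\<^bsub>T\<^esub> C)"
            unfolding p q3(2)[OF p(1) p(1) that(1)]
            using qc[OF s] bq[OF s that(2)] bq[OF p(1) lNc(5)[OF that]] lt3[OF p(1) that] by simp
        qed
        show ?thesis unfolding Hom_def[of A N ?D] h_def using hd 1 2 lNc(2,5) by (simp del: dual_simps)
      qed
      then have z: "l (tens P1 N \<phi> n) = \<zero>\<^bsub>K\<^esub>" if "\<phi> \<in> hom_set A P1 (regular A)" "n \<in> carrier N" for \<phi> n
        using van that bq[OF that] qc[OF that(1)] by (force simp: h_def)
      have "l g = \<zero>\<^bsub>K\<^esub>" if g: "g \<in> hom_set A P1 N" for g
      proof (rule Hom_induct_tens[OF P1(1) lN g, where Q="\<lambda>g. l g = \<zero>\<^bsub>K\<^esub>"])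
        show "l (\<lambda>x\<in>carrier P1. \<zero>\<^bsub>N\<^esub>) = \<zero>\<^bsub>K\<^esub>" using lin_zero[OF l(1)] by simp
        fix f \<phi> n assume a: "f \<in> hom_set A P1 N" "l f = \<zero>\<^bsub>K\<^esub>" "\<phi> \<in> hom_set A P1 (regular A)" "n \<in> carrier N"
        show "l (\<lambda>x\<in>carrier P1. f x \<oplus>\<^bsub>N\<^esub> tens P1 N \<phi> n x) = \<zero>\<^bsub>K\<^esub>"
          using linD(4)[OF l(1), of f "tens P1 N \<phi> n"] a t[OF a(3,4)] z[OF a(3,4)] by simp
      qed
      then show False using l(3) by auto
    qed
  qed
qed

text \<open>The transpose is computed from a presentation that is fixed but unknown.\<close>

lemma Tr_presentation:
  fixes A :: "('k, 'a) module" and N :: "('k, 'a) fd_mod"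
  assumes A: "fd_algebra K A" and fg: "fg_module A N"
  obtains P1 P0 :: "('k, 'a) fd_mod" and f1 f0
  where "min_pres A P1 f1 P0 f0 N" "fg_module A P1" "f1 \<in> hom_set A P1 P0"
    "Tr A N = quot_module (star A P1) (precomp P1 f1 ` carrier (star A P0))"
proof -
  define s where "s = (SOME (P1, f1, P0, f0). minimal_projective_presentation A P1 f1 P0 f0 N)"
  obtain P1 f1 P0 f0 where s': "s = (P1, f1, P0, f0)" by (metis prod_cases4)
  have "case s of (P1, f1, P0, f0) \<Rightarrow> minimal_projective_presentation A P1 f1 P0 f0 N"
    unfolding s_def by (rule someI_ex) (use minimal_projective_presentation_exists[OF A fg] in auto)
  then have m: "minimal_projective_presentation A P1 f1 P0 f0 N" by (simp add: s')
  have "Tr A N = quot_module (star A P1) (precomp P1 f1 ` carrier (star A P0))"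
    unfolding Tr_def s_def[symmetric] s' by simp
  then show thesis using minimal_projective_presentation_min_pres[OF A fg_left[OF fg] m] by (intro that)
qed

lemma tau_rigid_imp_rigid_presentation:
  fixes K :: "'k ring" and A :: "('k, 'a) module"
  assumes A: "fd_algebra K A" and N: "tau_rigid K A N"
  shows "\<exists>(P1 :: ('k, 'a) fd_mod) f1 (P0 :: ('k, 'a) fd_mod) f0. min_pres A P1 f1 P0 f0 N \<and> rigid A P1 f1 P0 N"
proof -
  have fg: "fg_module A N" using N by (simp add: tau_rigid_def)
  obtain P1 P0 :: "('k, 'a) fd_mod" and f1 f0 where p: "min_pres A P1 f1 P0 f0 N" "fg_module A P1" "f1 \<in> hom_set A P1 P0"
    and T: "Tr A N = quot_module (star A P1) (precomp P1 f1 ` carrier (star A P0))"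
    by (rule Tr_presentation[OF A fg])
  have "rigid A P1 f1 P0 N"
    using N tau_vanishing_iff_rigid[OF A fg min_presD(1)[OF p(1)] p(2) min_presD(2)[OF p(1)] p(3)]
    by (simp add: tau_rigid_def tau_def T)
  then show ?thesis using p(1) by blast
qed

text \<open>Since rigidity passes to summands, any minimal presentation of a module of which \<open>N\<close> is a summand
  can serve as the witness.\<close>

lemma rigid_presentation_imp_tau_rigid:
  fixes K :: "'k ring" and A :: "('k, 'a) module"
  assumes A: "fd_algebra K A" and fg: "fg_module A N" and r: "summand_pair A N M i p"
    and M: "min_pres A Q1 g1 Q0 g0 M" "rigid A Q1 g1 Q0 M"
  shows "tau_rigid K A N"
proof -
  obtain P1 P0 :: "('k, 'a) fd_mod" and f1 f0 where p: "min_pres A P1 f1 P0 f0 N" "fg_module A P1" "f1 \<in> hom_set A P1 P0"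
    and T: "Tr A N = quot_module (star A P1) (precomp P1 f1 ` carrier (star A P0))"
    by (rule Tr_presentation[OF A fg])
  show ?thesis
    using fg tau_vanishing_iff_rigid[OF A fg min_presD(1)[OF p(1)] p(2) min_presD(2)[OF p(1)] p(3)]
      rigid_retract[OF r M(1) p(1) M(2)]
    by (simp add: tau_rigid_def tau_def T)
qed

section \<open>Gorenstein projective modules\<close>

lemma lin_factor:
  assumes g: "lin A P C g" "g ` carrier P = carrier C" and y: "lin A P Y y"
    and k: "\<And>x. x \<in> carrier P \<Longrightarrow> g x = \<zero>\<^bsub>C\<^esub> \<Longrightarrow> y x = \<zero>\<^bsub>Y\<^esub>"
  shows "\<exists>\<phi>. lin A C Y \<phi> \<and> (\<forall>x\<in>carrier P. \<phi> (g x) = y x)"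
proof -
  note lg = linD[OF g(1)] and ly = linD[OF y]
  interpret P: abelian_group P by (rule lg)
  interpret C: abelian_group C by (rule lg)
  interpret Y: abelian_group Y by (rule ly)
  have ex: "\<exists>x. x \<in> carrier P \<and> g x = c" if "c \<in> carrier C" for c using that g(2) by (metis imageE)
  have eq: "y x = y x'" if x: "x \<in> carrier P" "x' \<in> carrier P" "g x = g x'" for x x'
  proof -
    have "g (x \<ominus>\<^bsub>P\<^esub> x') = \<zero>\<^bsub>C\<^esub>"
      using x lg(3)[OF x(2)] by (simp add: lin_minus[OF g(1)]) (simp add: a_minus_def C.r_neg)
    then have "y x \<ominus>\<^bsub>Y\<^esub> y x' = \<zero>\<^bsub>Y\<^esub>" using k[of "x \<ominus>\<^bsub>P\<^esub> x'"] x by (simp add: lin_minus[OF y])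
    moreover have "(y x \<ominus>\<^bsub>Y\<^esub> y x') \<oplus>\<^bsub>Y\<^esub> y x' = y x" using ly(3) x by (simp add: a_minus_def Y.a_assoc Y.l_neg)
    ultimately show ?thesis using ly(3) x by simp
  qed
  define \<phi> where "\<phi> c = y (SOME x. x \<in> carrier P \<and> g x = c)" for c
  have ph: "\<phi> (g x) = y x" if x: "x \<in> carrier P" for x
  proof -
    have "(SOME x'. x' \<in> carrier P \<and> g x' = g x) \<in> carrier P \<and> g (SOME x'. x' \<in> carrier P \<and> g x' = g x) = g x"
      by (rule someI[of _ x]) (use x in simp)
    then show ?thesis unfolding \<phi>_def using eq x by blast
  qed
  have "lin A C Y \<phi>"
  proof (rule linI[OF lg(2) ly(2)])
    show "\<phi> c \<in> carrier Y" if "c \<in> carrier C" for c using ex[OF that] ph ly(3) by auto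
  next
    fix c d assume "c \<in> carrier C" "d \<in> carrier C"
    then obtain x x' where x: "x \<in> carrier P" "c = g x" "x' \<in> carrier P" "d = g x'" using ex by metis
    then show "\<phi> (c \<oplus>\<^bsub>C\<^esub> d) = \<phi> c \<oplus>\<^bsub>Y\<^esub> \<phi> d"
      using ph[of "x \<oplus>\<^bsub>P\<^esub> x'"] by (simp add: ph ly(4) flip: lg(4))
  next
    fix a c assume a: "a \<in> carrier A" and "c \<in> carrier C"
    then obtain x where x: "x \<in> carrier P" "c = g x" using ex by metis
    then show "\<phi> (a \<odot>\<^bsub>C\<^esub> c) = a \<odot>\<^bsub>Y\<^esub> \<phi> c"
      using a ph[of "a \<odot>\<^bsub>P\<^esub> x"] left_module_closed(5)[OF lg(1) a x(1)] by (simp add: ph ly(5) flip: lg(5))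
  qed
  then show ?thesis using ph by blast
qed

text \<open>A short exact sequence \<open>0 \<rightarrow> N \<rightarrow> P \<rightarrow> C \<rightarrow> 0\<close> with \<open>P\<close> projective that stays exact under
  \<open>Hom(-,A)\<close>.  A complete resolution is a doubly infinite splice of such sequences.\<close>

definition gp_step :: "('k, 'a) module \<Rightarrow> ('k, 'a) fd_mod \<Rightarrow> ((nat \<Rightarrow> 'k) \<Rightarrow> (nat \<Rightarrow> 'k)) \<Rightarrow> ('k, 'a) fd_mod \<Rightarrow>
    ((nat \<Rightarrow> 'k) \<Rightarrow> (nat \<Rightarrow> 'k)) \<Rightarrow> ('k, 'a) fd_mod \<Rightarrow> bool" where
  "gp_step A N f P g C \<longleftrightarrow> fg_module A N \<and> fg_module A P \<and> fg_module A C \<and> proj A P \<and>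
     lin A N P f \<and> lin A P C g \<and> inj_on f (carrier N) \<and> g ` carrier P = carrier C \<and>
     f ` carrier N = {x \<in> carrier P. g x = \<zero>\<^bsub>C\<^esub>} \<and>
     (\<forall>\<phi>. lin A N (regular A) \<phi> \<longrightarrow> (\<exists>\<psi>. lin A P (regular A) \<psi> \<and> (\<forall>x\<in>carrier N. \<psi> (f x) = \<phi> x)))"

lemma gp_stepD:
  assumes "gp_step A N f P g C"
  shows "fg_module A N" "fg_module A P" "fg_module A C" "proj A P" "lin A N P f" "lin A P C g"
    "inj_on f (carrier N)" "g ` carrier P = carrier C" "f ` carrier N = {x \<in> carrier P. g x = \<zero>\<^bsub>C\<^esub>}"
    "lin A N (regular A) \<phi> \<Longrightarrow> \<exists>\<psi>. lin A P (regular A) \<psi> \<and> (\<forall>x\<in>carrier N. \<psi> (f x) = \<phi> x)"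
  using assms unfolding gp_step_def by blast+

lemma gp_step_zero:
  assumes "gp_step A N f P g C" "x \<in> carrier N"
  shows "g (f x) = \<zero>\<^bsub>C\<^esub>"
  using gp_stepD(9)[OF assms(1)] assms(2) by blast

lemma complex_imp_steps:
  assumes A: "fd_algebra K A" and P: "\<And>i. fg_projective A (P i)" and ex: "exact_sequence A P d"
    and hom: "exact_under_Hom_to A P d (regular A)"
  shows "gp_step A (sub_module (P i) (d (i - 1) ` carrier (P (i - 1)))) (\<lambda>x. x) (P i) (d i)
    (sub_module (P (i + 1)) (d i ` carrier (P i)))"
proof -
  note rA = fd_algebraD(3)[OF A]
  have Pi: "fg_module A (P i)" "proj A (P i)" for i using P fg_projective_iff[OF A] by auto
  note lP = fg_left[OF Pi(1)]
  have d: "lin A (P i) (P (i + 1)) (d i)" for i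
    by (rule hom_set_lin[OF _ lP lP]) (use ex in \<open>simp add: exact_sequence_def\<close>)
  have ker: "d i ` carrier (P i) = {y \<in> carrier (P (i + 1)). d (i + 1) y = \<zero>\<^bsub>P (i + 2)\<^esub>}" for i
    using ex by (simp add: exact_sequence_def exact_at_def)
  let ?j = "i - 1" and ?l = "i - 2"
  have ji: "?j + 1 = i" "?l + 1 = ?j" "?l + 2 = i" "?j + 2 = i + 1" by auto
  have dj: "lin A (P ?j) (P i) (d ?j)" using d[of ?j] unfolding ji .
  have kj: "d ?j ` carrier (P ?j) = {y \<in> carrier (P i). d i y = \<zero>\<^bsub>P (i + 1)\<^esub>}" using ker[of ?j] unfolding ji .
  have kl: "d ?l ` carrier (P ?l) = {y \<in> carrier (P ?j). d ?j y = \<zero>\<^bsub>P i\<^esub>}" using ker[of ?l] unfolding ji .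
  have hl: "precomp (P ?j) (d ?j) ` hom_set A (P i) (regular A) =
    {y \<in> hom_set A (P ?j) (regular A). precomp (P ?l) (d ?l) y = \<zero>\<^bsub>Hom A (P ?l) (regular A)\<^esub>}"
    using hom[unfolded exact_under_Hom_to_def, rule_format, of ?l] unfolding exact_at_def ji .
  let ?N = "d ?j ` carrier (P ?j)" and ?C = "d i ` carrier (P i)"
  have sN: "submodule ?N A (P i)" by (rule submodule_image[OF dj submodule_carrier[OF lP]])
  have sC: "submodule ?C A (P (i + 1))" by (rule submodule_image[OF d submodule_carrier[OF lP]])
  show ?thesis
    unfolding gp_step_def
  proof (intro conjI allI impI)
    show "lin A (P i) (sub_module (P (i + 1)) ?C) (d i)" by (rule lin_into_sub[OF d sC]) simp
    show "lin A (sub_module (P i) ?N) (P i) (\<lambda>x. x)" by (rule lin_sub_incl[OF lP sN])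
    fix \<phi> assume p: "lin A (sub_module (P i) ?N) (regular A) \<phi>"
    have dN: "lin A (P ?j) (sub_module (P i) ?N) (d ?j)" by (rule lin_into_sub[OF dj sN]) simp
    let ?y = "\<lambda>x\<in>carrier (P ?j). \<phi> (d ?j x)"
    have "?y \<in> hom_set A (P ?j) (regular A)" by (rule lin_hom_set[OF lin_compose[OF dN p]])
    moreover have "precomp (P ?l) (d ?l) ?y = \<zero>\<^bsub>Hom A (P ?l) (regular A)\<^esub>"
      unfolding precomp_eq Hom_simps
    proof (rule restrict_ext)
      fix x assume x: "x \<in> carrier (P ?l)"
      then have "d ?l x \<in> carrier (P ?j)" "d ?j (d ?l x) = \<zero>\<^bsub>P i\<^esub>" using kl by auto
      then show "?y (d ?l x) = \<zero>\<^bsub>regular A\<^esub>" using lin_zero[OF p] by simp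
    qed
    ultimately have "?y \<in> precomp (P ?j) (d ?j) ` hom_set A (P i) (regular A)" unfolding hl by simp
    then obtain \<psi> where ps: "\<psi> \<in> hom_set A (P i) (regular A)" "?y = (\<lambda>x\<in>carrier (P ?j). \<psi> (d ?j x))"
      by (auto simp: precomp_eq)
    have "\<psi> (d ?j x) = \<phi> (d ?j x)" if "x \<in> carrier (P ?j)" for x using fun_cong[OF ps(2), of x] that by simp
    then show "\<exists>\<psi>. lin A (P i) (regular A) \<psi> \<and> (\<forall>x\<in>carrier (sub_module (P i) ?N). \<psi> x = \<phi> x)"
      using hom_set_lin[OF ps(1) lP left_module_regular[OF rA]] by auto
  qed (use Pi kj fd_fg_sub[OF A Pi(1) sN] fd_fg_sub[OF A Pi(1) sC] in auto)
qed

text \<open>Exactness under \<open>Hom(-,A)\<close> at \<open>P (i + 1)\<close>: a form that vanishes on the boundaries descends to the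
  cokernel \<open>S (i + 2)\<close> and extends from there to \<open>P (i + 2)\<close>.\<close>

lemma steps_imp_complex:
  fixes A :: "('k, 'a) module"
  assumes A: "fd_algebra K A" and st: "\<And>i::int. gp_step A (S i) (f i) (P i) (g i) (S (i + 1))"
  defines "d \<equiv> \<lambda>i. restrict (\<lambda>x. f (i + 1) (g i x)) (carrier (P i))"
  shows "exact_sequence A P d" "exact_under_Hom_to A P d (regular A)" "d i ` carrier (P i) = f (i + 1) ` carrier (S (i + 1))"
proof -
  note s = gp_stepD[OF st]
  note rA = fd_algebraD(3)[OF A]
  note lP = fg_left[OF s(2)]
  have dd: "lin A (P i) (P (i + 1)) (\<lambda>x. f (i + 1) (g i x))" for i by (rule lin_compose[OF s(6) s(5)])
  have dh: "d i \<in> hom_set A (P i) (P (i + 1))" for i unfolding d_def by (rule lin_hom_set[OF dd])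
  have de: "d i x = f (i + 1) (g i x)" if "x \<in> carrier (P i)" for i x using that by (simp add: d_def)
  have gz: "g (i + 1) y = \<zero>\<^bsub>S (i + 2)\<^esub> \<longleftrightarrow> d (i + 1) y = \<zero>\<^bsub>P (i + 2)\<^esub>" if y: "y \<in> carrier (P (i + 1))" for i y
  proof -
    have 2: "i + 1 + 1 = i + 2" by simp
    have c: "g (i + 1) y \<in> carrier (S (i + 2))" using linD(3)[OF s(6)[of "i + 1"] y] unfolding 2 .
    have z: "f (i + 2) \<zero>\<^bsub>S (i + 2)\<^esub> = \<zero>\<^bsub>P (i + 2)\<^esub>" "\<zero>\<^bsub>S (i + 2)\<^esub> \<in> carrier (S (i + 2))"
      using lin_zero[OF s(5)] left_module_closed(1)[OF linD(1)[OF s(5)]] by auto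
    have "d (i + 1) y = f (i + 2) (g (i + 1) y)" using de[OF y] unfolding 2 .
    then show ?thesis using z(1) inj_onD[OF s(7)[of "i + 2"] _ c z(2)] by metis
  qed
  show im: "d i ` carrier (P i) = f (i + 1) ` carrier (S (i + 1))" for i
    unfolding s(8)[of i, symmetric] image_image using de by (intro image_cong) auto
  have im': "d i ` carrier (P i) = {y \<in> carrier (P (i + 1)). d (i + 1) y = \<zero>\<^bsub>P (i + 2)\<^esub>}" for i
  proof -
    have 2: "i + 1 + 1 = i + 2" by simp
    show ?thesis unfolding im s(9)[of "i + 1"] 2 using gz[of _ i] by auto
  qed
  show "exact_sequence A P d" unfolding exact_sequence_def exact_at_def using dh im' by simp
  show "exact_under_Hom_to A P d (regular A)"
    unfolding exact_under_Hom_to_def exact_at_def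
  proof (intro allI equalityI subsetI)
    fix i y assume "y \<in> precomp (P (i + 1)) (d (i + 1)) ` hom_set A (P (i + 2)) (regular A)"
    then obtain \<psi> where ps: "\<psi> \<in> hom_set A (P (i + 2)) (regular A)" "y = precomp (P (i + 1)) (d (i + 1)) \<psi>" by auto
    have lps: "lin A (P (i + 2)) (regular A) \<psi>" by (rule hom_set_lin[OF ps(1) lP left_module_regular[OF rA]])
    have l1: "lin A (P (i + 1)) (P (i + 2)) (d (i + 1))" using hom_set_lin[OF dh[of "i + 1"] lP lP] by (simp add: add.assoc)
    have "y \<in> hom_set A (P (i + 1)) (regular A)" unfolding ps(2) precomp_eq by (rule lin_hom_set[OF lin_compose[OF l1 lps]])
    moreover have "precomp (P i) (d i) y = \<zero>\<^bsub>Hom A (P i) (regular A)\<^esub>"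
      unfolding ps(2) precomp_eq Hom_simps
    proof (rule restrict_ext)
      fix x assume x: "x \<in> carrier (P i)"
      then have "d i x \<in> carrier (P (i + 1)) \<and> d (i + 1) (d i x) = \<zero>\<^bsub>P (i + 2)\<^esub>" using im'[of i] by blast
      then show "(\<lambda>x\<in>carrier (P (i + 1)). \<psi> (d (i + 1) x)) (d i x) = \<zero>\<^bsub>regular A\<^esub>" using lin_zero[OF lps] by simp
    qed
    ultimately show "y \<in> {y \<in> hom_set A (P (i + 1)) (regular A). precomp (P i) (d i) y = \<zero>\<^bsub>Hom A (P i) (regular A)\<^esub>}" by simp
  next
    fix i y assume "y \<in> {y \<in> hom_set A (P (i + 1)) (regular A). precomp (P i) (d i) y = \<zero>\<^bsub>Hom A (P i) (regular A)\<^esub>}"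
    then have y: "y \<in> hom_set A (P (i + 1)) (regular A)" and z: "(\<lambda>x\<in>carrier (P i). y (d i x)) = (\<lambda>x\<in>carrier (P i). \<zero>\<^bsub>A\<^esub>)"
      by (auto simp: precomp_eq Hom_simps)
    have ly: "lin A (P (i + 1)) (regular A) y" by (rule hom_set_lin[OF y lP left_module_regular[OF rA]])
    have k: "y x = \<zero>\<^bsub>regular A\<^esub>" if x: "x \<in> carrier (P (i + 1))" "g (i + 1) x = \<zero>\<^bsub>S (i + 1 + 1)\<^esub>" for x
    proof -
      have "x \<in> d i ` carrier (P i)" unfolding im s(9)[of "i + 1"] using x by simp
      then obtain w where w: "w \<in> carrier (P i)" "x = d i w" by auto
      show ?thesis using fun_cong[OF z, of w] w by simp
    qed
    obtain \<phi> where p: "lin A (S (i + 1 + 1)) (regular A) \<phi>" "\<And>x. x \<in> carrier (P (i + 1)) \<Longrightarrow> \<phi> (g (i + 1) x) = y x"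
      using lin_factor[OF s(6) s(8) ly k] by blast
    have 2: "i + 1 + 1 = i + 2" by simp
    obtain \<psi> where ps: "lin A (P (i + 2)) (regular A) \<psi>" "\<And>x. x \<in> carrier (S (i + 2)) \<Longrightarrow> \<psi> (f (i + 2) x) = \<phi> x"
      using s(10)[OF p(1)] unfolding 2 by blast
    have "y = precomp (P (i + 1)) (d (i + 1)) (restrict \<psi> (carrier (P (i + 2))))"
      unfolding precomp_eq
    proof
      fix x show "y x = (\<lambda>x\<in>carrier (P (i + 1)). restrict \<psi> (carrier (P (i + 2))) (d (i + 1) x)) x"
      proof (cases "x \<in> carrier (P (i + 1))")
        case True
        have gc: "g (i + 1) x \<in> carrier (S (i + 2))" using linD(3)[OF s(6)[of "i + 1"] True] unfolding 2 .
        have fc: "f (i + 2) (g (i + 1) x) \<in> carrier (P (i + 2))" using linD(3)[OF s(5) gc] .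
        show ?thesis using True de[OF True] gc fc ps(2)[OF gc] p(2)[OF True] unfolding 2 by simp
      qed (simp add: hom_set_undefined[OF y])
    qed
    then show "y \<in> precomp (P (i + 1)) (d (i + 1)) ` hom_set A (P (i + 2)) (regular A)"
      using lin_hom_set[OF ps(1)] by blast
  qed
qed

lemma gorenstein_projective_iff_steps:
  fixes A :: "('k, 'a) module"
  assumes A: "fd_algebra K A"
  shows "gorenstein_projective A N \<longleftrightarrow> fg_module A N \<and> (\<exists>(S :: int \<Rightarrow> ('k, 'a) fd_mod) f P g u v.
    (\<forall>i. gp_step A (S i) (f i) (P i) (g i) (S (i + 1))) \<and> iso_pair A N (S 0) u v)"
proof
  assume N: "gorenstein_projective A N"
  then have fg: "fg_module A N" by (simp add: gorenstein_projective_def)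
  obtain P :: "int \<Rightarrow> ('k, 'a) fd_mod" and d where P: "\<And>i. fg_projective A (P i)" "exact_sequence A P d"
    "exact_under_Hom_to A P d (regular A)" and iso: "lmod_iso A N (sub_module (P 0) (d (- 1) ` carrier (P (- 1))))"
    using N unfolding gorenstein_projective_def by blast
  define S where "S i = sub_module (P i) (d (i - 1) ` carrier (P (i - 1)))" for i
  have st: "gp_step A (S i) (\<lambda>x. x) (P i) (d i) (S (i + 1))" for i
    using complex_imp_steps[OF A P, of i] by (simp add: S_def)
  have "lmod_iso A N (S 0)" using iso by (simp add: S_def)
  then obtain u v where "iso_pair A N (S 0) u v" using lmod_iso_iff[OF fg_left[OF fg] fg_left[OF gp_stepD(1)[OF st[of 0]]]] by blast
  then show "fg_module A N \<and> (\<exists>(S :: int \<Rightarrow> ('k, 'a) fd_mod) f P g u v.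
    (\<forall>i. gp_step A (S i) (f i) (P i) (g i) (S (i + 1))) \<and> iso_pair A N (S 0) u v)"
    using fg st by (intro conjI exI[of _ S] exI[of _ "\<lambda>i x. x"] exI[of _ P] exI[of _ d] exI[of _ u] exI[of _ v]) auto
next
  assume "fg_module A N \<and> (\<exists>(S :: int \<Rightarrow> ('k, 'a) fd_mod) f P g u v.
    (\<forall>i. gp_step A (S i) (f i) (P i) (g i) (S (i + 1))) \<and> iso_pair A N (S 0) u v)"
  then obtain S :: "int \<Rightarrow> ('k, 'a) fd_mod" and f P g u v where fg: "fg_module A N" and
    st: "\<And>i. gp_step A (S i) (f i) (P i) (g i) (S (i + 1))" and iso: "iso_pair A N (S 0) u v" by blast
  note c = steps_imp_complex[where S=S and f=f and P=P and g=g, OF A st]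
  let ?d = "\<lambda>i. restrict (\<lambda>x. f (i + 1) (g i x)) (carrier (P i))"
  have im: "?d (- 1) ` carrier (P (- 1)) = f 0 ` carrier (S 0)" using c(3)[of "- 1"] by simp
  note s0 = gp_stepD[OF st[of 0]]
  let ?I = "f 0 ` carrier (S 0)"
  have I: "submodule ?I A (P 0)" by (rule submodule_image[OF s0(5) submodule_carrier[OF fg_left[OF s0(1)]]])
  have "lin A (S 0) (sub_module (P 0) ?I) (f 0)" by (rule lin_into_sub[OF s0(5) I]) simp
  then have "\<exists>w. iso_pair A (S 0) (sub_module (P 0) ?I) (f 0) w"
    using bij_iso_pair[of A "S 0" "sub_module (P 0) ?I" "f 0"] s0(7) by (auto simp: bij_betw_def)
  then have "lmod_iso A N (sub_module (P 0) (?d (- 1) ` carrier (P (- 1))))"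
    unfolding im lmod_iso_iff[OF fg_left[OF fg] left_module_sub[OF fg_left[OF s0(2)] I]]
    using iso_pair_trans[OF iso] by blast
  moreover have "fg_projective A (P i)" for i using gp_stepD(2,4)[OF st] fg_projective_iff[OF A] by auto
  ultimately show "gorenstein_projective A N"
    unfolding gorenstein_projective_def using fg c(1,2) by (intro conjI exI[of _ P] exI[of _ ?d]) auto
qed

lemma gp_step_iso_left:
  assumes st: "gp_step A S f P g C" and i: "iso_pair A N S u v" and N: "fg_module A N"
  shows "gp_step A N (\<lambda>x. f (u x)) P g C"
proof -
  note s = gp_stepD[OF st] and i' = iso_pairD[OF i]
  have im: "u ` carrier N = carrier S" using iso_pair_bij[OF i] by (simp add: bij_betw_def)
  have "inj_on (\<lambda>x. f (u x)) (carrier N)"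
    using comp_inj_on[of u "carrier N" f] iso_pair_bij[OF i] s(7) im by (simp add: bij_betw_def comp_def)
  moreover have "(\<lambda>x. f (u x)) ` carrier N = f ` carrier S" unfolding im[symmetric] image_image ..
  moreover have "\<exists>\<psi>. lin A P (regular A) \<psi> \<and> (\<forall>x\<in>carrier N. \<psi> (f (u x)) = \<phi> x)" if p: "lin A N (regular A) \<phi>" for \<phi>
  proof -
    obtain \<psi> where "lin A P (regular A) \<psi>" "\<And>y. y \<in> carrier S \<Longrightarrow> \<psi> (f y) = \<phi> (v y)"
      using s(10)[OF lin_compose[OF i'(2) p]] by blast
    then show ?thesis using linD(3)[OF i'(1)] i'(3) by (intro exI[of _ \<psi>]) simp
  qed
  ultimately show ?thesis unfolding gp_step_def using s(2-9) lin_compose[OF i'(1) s(5)] N by simp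
qed

lemma gp_step_iso_right:
  assumes st: "gp_step A C f P g S" and i: "iso_pair A N S u v" and N: "fg_module A N"
  shows "gp_step A C f P (\<lambda>x. v (g x)) N"
proof -
  note s = gp_stepD[OF st] and i' = iso_pairD[OF i]
  have im: "v ` carrier S = carrier N" using iso_pair_bij[OF iso_pair_sym[OF i]] by (simp add: bij_betw_def)
  have "(\<lambda>x. v (g x)) ` carrier P = carrier N" unfolding im[symmetric] s(8)[symmetric] image_image ..
  moreover have "v (g x) = \<zero>\<^bsub>N\<^esub> \<longleftrightarrow> g x = \<zero>\<^bsub>S\<^esub>" if "x \<in> carrier P" for x
    using i'(4)[OF linD(3)[OF s(6) that]] lin_zero[OF i'(1)] lin_zero[OF i'(2)] by metis
  then have "f ` carrier C = {x \<in> carrier P. v (g x) = \<zero>\<^bsub>N\<^esub>}" unfolding s(9) by auto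
  ultimately show ?thesis unfolding gp_step_def using s lin_compose[OF s(6) i'(2)] N by auto
qed

lemma gorenstein_projective_steps:
  fixes A :: "('k, 'a) module" and N :: "('k, 'a) fd_mod"
  assumes A: "fd_algebra K A" and N: "gorenstein_projective A N"
  shows "\<exists>f P g C. gp_step A N f P g C \<and> gorenstein_projective A C"
    and "\<exists>C f P g. gp_step A C f P g N \<and> gorenstein_projective A C"
proof -
  obtain S :: "int \<Rightarrow> ('k, 'a) fd_mod" and f P g u v where fg: "fg_module A N" and
    st: "\<And>i. gp_step A (S i) (f i) (P i) (g i) (S (i + 1))" and iso: "iso_pair A N (S 0) u v"
    using N unfolding gorenstein_projective_iff_steps[OF A] by blast
  have gor: "gorenstein_projective A (S k)" for k
  proof -
    have fgk: "fg_module A (S k)" by (rule gp_stepD(1)[OF st])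
    have "gp_step A (S (i + k)) (f (i + k)) (P (i + k)) (g (i + k)) (S ((i + 1) + k))" for i
      using st[of "i + k"] by (simp add: algebra_simps)
    moreover have "iso_pair A (S k) (S (0 + k)) (\<lambda>x. x) (\<lambda>x. x)" using lin_id[OF fg_left[OF fgk]] by (simp add: iso_pair_def)
    ultimately show ?thesis unfolding gorenstein_projective_iff_steps[OF A]
      using fgk by (intro conjI exI[of _ "\<lambda>i. S (i + k)"] exI[of _ "\<lambda>i. f (i + k)"] exI[of _ "\<lambda>i. P (i + k)"]
        exI[of _ "\<lambda>i. g (i + k)"] exI[of _ "\<lambda>x. x"]) auto
  qed
  show "\<exists>f P g C. gp_step A N f P g C \<and> gorenstein_projective A C"
    using gp_step_iso_left[OF st[of 0] iso fg] gor by blast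
  have "gp_step A (S (- 1)) (f (- 1)) (P (- 1)) (g (- 1)) (S 0)" using st[of "- 1"] by simp
  then show "\<exists>C f P g. gp_step A C f P g N \<and> gorenstein_projective A C"
    using gp_step_iso_right[OF _ iso fg] gor by blast
qed

text \<open>Splicing the steps that start at \<open>N\<close> and those that end at \<open>N\<close> gives a complete resolution.\<close>

lemma gorenstein_projective_coinduct:
  fixes A :: "('k, 'a) module" and N :: "('k, 'a) fd_mod"
  assumes A: "fd_algebra K A" and N: "Q N"
    and r: "\<And>N. Q N \<Longrightarrow> \<exists>f P g C. gp_step A N f P g C \<and> Q C"
    and l: "\<And>N. Q N \<Longrightarrow> \<exists>C f P g. gp_step A C f P g N \<and> Q C"
  shows "gorenstein_projective A N"
proof -
  obtain R where R: "\<And>N. Q N \<Longrightarrow> Q (R N) \<and> (\<exists>f P g. gp_step A N f P g (R N))" using r by metis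
  obtain L where L: "\<And>N. Q N \<Longrightarrow> Q (L N) \<and> (\<exists>f P g. gp_step A (L N) f P g N)" using l by metis
  have Rn: "Q ((R ^^ n) N)" for n by (induction n) (use N R in auto)
  have Ln: "Q ((L ^^ n) N)" for n by (induction n) (use N L in auto)
  \<comment> \<open>Iterated cosyzygies to the right of \<open>N\<close>, iterated syzygies to the left.\<close>
  define S where "S i = (if i \<ge> 0 then (R ^^ nat i) N else (L ^^ nat (- i)) N)" for i :: int
  have "\<exists>f P g. gp_step A (S i) f P g (S (i + 1))" for i
  proof (cases "i \<ge> 0")
    case True
    then have "S (i + 1) = R (S i)" by (simp add: S_def nat_add_distrib)
    then show ?thesis using R[OF Rn[of "nat i"]] True by (simp add: S_def)
  next
    case False
    define m where "m = nat (- (i + 1))"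
    have "nat (- i) = Suc m" using False by (simp add: m_def)
    then have "S i = L ((L ^^ m) N)" using False by (simp add: S_def)
    moreover have "S (i + 1) = (L ^^ m) N"
    proof (cases "i + 1 = 0")
      case True then show ?thesis by (simp add: S_def m_def)
    next
      case F: False then show ?thesis using False by (simp add: S_def m_def)
    qed
    ultimately show ?thesis using L[OF Ln[of m]] by simp
  qed
  then obtain f P g where st: "\<And>i. gp_step A (S i) (f i) (P i) (g i) (S (i + 1))" by metis
  have S0: "S 0 = N" by (simp add: S_def)
  have fg: "fg_module A N" using gp_stepD(1)[OF st[of 0]] by (simp add: S0)
  have "iso_pair A N (S 0) (\<lambda>x. x) (\<lambda>x. x)" using lin_id[OF fg_left[OF fg]] by (simp add: S0 iso_pair_def)
  then show ?thesis unfolding gorenstein_projective_iff_steps[OF A] using fg st by blast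
qed

text \<open>\<open>V\<close> is a direct summand of \<open>N\<close> up to projectives: the identity of \<open>V\<close> is the sum of a map through
  \<open>N\<close> and a map through the projective module \<open>Q\<close>.  Unlike being a direct summand, this passes to
  syzygies and cosyzygies formed with arbitrary projective modules.\<close>

definition stable_summand :: "('k, 'a) module \<Rightarrow> ('k, 'a) fd_mod \<Rightarrow> ('k, 'a) fd_mod \<Rightarrow> ('k, 'a) fd_mod \<Rightarrow> bool" where
  "stable_summand A V N Q \<longleftrightarrow> fg_module A V \<and> proj A Q \<and> (\<exists>i p i' p'. lin A V N i \<and> lin A N V p \<and>
     lin A V Q i' \<and> lin A Q V p' \<and> (\<forall>x\<in>carrier V. x = p (i x) \<oplus>\<^bsub>V\<^esub> p' (i' x)))"

text \<open>Map \<open>V\<close> to a projective module \<open>P'\<close> through which all maps from \<open>V\<close> to projectives factor; this is an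
  embedding, as \<open>N\<close> and hence \<open>V\<close> embed into projectives.  The maps between \<open>V\<close>, \<open>N\<close> and \<open>Q\<close> extend to the projective terms; the difference of the identity of \<open>P'\<close> and
  the extended composite \<open>t\<close> vanishes on \<open>V\<close>, so it factors over the cokernel and gives there the map
  through a projective module.\<close>

lemma stable_summand_cosyzygy:
  fixes A :: "('k, 'a) module"
  assumes A: "fd_algebra K A" and ss: "stable_summand A V N Q" and st: "gp_step A N j P \<pi> C"
  shows "\<exists>f P' \<pi>' C'. gp_step A V f P' \<pi>' C' \<and> stable_summand A C' C P'"
proof -
  obtain i p i' p' where V: "fg_module A V" and Q: "proj A Q" and i: "lin A V N i" and p: "lin A N V p" and
    i': "lin A V Q i'" and p': "lin A Q V p'" and id: "\<And>x. x \<in> carrier V \<Longrightarrow> x = p (i x) \<oplus>\<^bsub>V\<^esub> p' (i' x)"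
    using ss unfolding stable_summand_def by blast
  note s = gp_stepD[OF st]
  have lV: "left_module A V" by (rule fg_left[OF V])
  interpret V: abelian_group V using lV by (rule left_moduleD)
  obtain P' :: "('k, 'a) fd_mod" and f where P': "fg_module A P'" "proj A P'" and f: "lin A V P' f"
    and ext: "\<And>\<phi>. lin A V (regular A) \<phi> \<Longrightarrow> \<exists>\<psi>. lin A P' (regular A) \<psi> \<and> (\<forall>x\<in>carrier V. \<psi> (f x) = \<phi> x)"
    using left_proj_approximation[OF A V] by blast
  have lP': "left_module A P'" by (rule fg_left[OF P'(1)])
  interpret P': abelian_group P' using lP' by (rule left_moduleD)
  obtain \<alpha> where al: "lin A P' P \<alpha>" "\<And>x. x \<in> carrier V \<Longrightarrow> \<alpha> (f x) = j (i x)"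
    using addE_extend[OF s(4) f lin_compose[OF i s(5)] ext] by blast
  obtain \<alpha>' where al': "lin A P' Q \<alpha>'" "\<And>x. x \<in> carrier V \<Longrightarrow> \<alpha>' (f x) = i' x"
    using addE_extend[OF Q f i' ext] by blast
  obtain \<beta> where be: "lin A P P' \<beta>" "\<And>x. x \<in> carrier N \<Longrightarrow> \<beta> (j x) = f (p x)"
    using addE_extend[OF P'(2) s(5) lin_compose[OF p f] s(10)] by blast
  let ?t = "\<lambda>x. \<beta> (\<alpha> x) \<oplus>\<^bsub>P'\<^esub> f (p' (\<alpha>' x))"
  have lt: "lin A P' P' ?t"
    by (rule lin_plus[OF lin_compose[OF al(1) be(1)] lin_compose[OF al'(1) lin_compose[OF p' f]]])
  let ?\<delta> = "\<lambda>x. x \<ominus>\<^bsub>P'\<^esub> ?t x"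
  have ld: "lin A P' P' ?\<delta>" by (rule lin_diff[OF lin_id[OF lP'] lt])
  have tf: "?t (f x) = f x" if x: "x \<in> carrier V" for x
  proof -
    have c: "i x \<in> carrier N" "p (i x) \<in> carrier V" "p' (i' x) \<in> carrier V"
      using linD(3)[OF i x] linD(3)[OF p] linD(3)[OF i' x] linD(3)[OF p'] by auto
    have "?t (f x) = f (p (i x) \<oplus>\<^bsub>V\<^esub> p' (i' x))" using al(2)[OF x] al'(2)[OF x] be(2)[OF c(1)] linD(4)[OF f c(2,3)] by simp
    then show ?thesis using id[OF x] by simp
  qed
  have inj: "inj_on f (carrier V)"
  proof (rule lin_injI[OF f])
    fix x assume x: "x \<in> carrier V" "f x = \<zero>\<^bsub>P'\<^esub>"
    have "j (i x) = \<zero>\<^bsub>P\<^esub>" using al(2)[OF x(1)] x(2) lin_zero[OF al(1)] by simp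
    then have "i x = \<zero>\<^bsub>N\<^esub>"
      using inj_onD[OF s(7), of "i x" "\<zero>\<^bsub>N\<^esub>"] linD(3)[OF i x(1)] lin_zero[OF s(5)] left_module_closed(1)[OF linD(1)[OF s(5)]] by simp
    moreover have "i' x = \<zero>\<^bsub>Q\<^esub>" using al'(2)[OF x(1)] x(2) lin_zero[OF al'(1)] by simp
    ultimately have "x = \<zero>\<^bsub>V\<^esub> \<oplus>\<^bsub>V\<^esub> \<zero>\<^bsub>V\<^esub>" using id[OF x(1)] lin_zero[OF p] lin_zero[OF p'] by simp
    then show "x = \<zero>\<^bsub>V\<^esub>" by simp
  qed
  have I: "submodule (f ` carrier V) A P'" by (rule submodule_image[OF f submodule_carrier[OF lV]])
  obtain C' :: "('k, 'a) fd_mod" and \<pi>' where C': "fg_module A C'" "lin A P' C' \<pi>'" "\<pi>' ` carrier P' = carrier C'"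
    "\<And>x. x \<in> carrier P' \<Longrightarrow> \<pi>' x = \<zero>\<^bsub>C'\<^esub> \<longleftrightarrow> x \<in> f ` carrier V"
    using fd_quotient[OF A P'(1) I] by blast
  interpret C': abelian_group C' using C'(2) by (rule linD)
  have zf: "\<pi>' (f x) = \<zero>\<^bsub>C'\<^esub>" if "x \<in> carrier V" for x using C'(4)[OF linD(3)[OF f that]] that by blast
  have "f ` carrier V = {x \<in> carrier P'. \<pi>' x = \<zero>\<^bsub>C'\<^esub>}" using C'(4) linD(3)[OF f] by auto
  then have step: "gp_step A V f P' \<pi>' C'"
    unfolding gp_step_def using V P' C' f inj ext by simp
  have "\<exists>a. lin A C' C a \<and> (\<forall>x\<in>carrier P'. a (\<pi>' x) = \<pi> (\<alpha> x))"
  proof (rule lin_factor[OF C'(2,3) lin_compose[OF al(1) s(6)]])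
    fix x assume "x \<in> carrier P'" "\<pi>' x = \<zero>\<^bsub>C'\<^esub>"
    then obtain y where y: "y \<in> carrier V" "x = f y" using C'(4) by auto
    then show "\<pi> (\<alpha> x) = \<zero>\<^bsub>C\<^esub>" using al(2) gp_step_zero[OF st linD(3)[OF i y(1)]] by simp
  qed
  then obtain a where a: "lin A C' C a" "\<And>x. x \<in> carrier P' \<Longrightarrow> a (\<pi>' x) = \<pi> (\<alpha> x)" by blast
  have "\<exists>b. lin A C C' b \<and> (\<forall>x\<in>carrier P. b (\<pi> x) = \<pi>' (\<beta> x))"
  proof (rule lin_factor[OF s(6,8) lin_compose[OF be(1) C'(2)]])
    fix x assume "x \<in> carrier P" "\<pi> x = \<zero>\<^bsub>C\<^esub>"
    then have "x \<in> j ` carrier N" using s(9) by blast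
    then obtain y where y: "y \<in> carrier N" "x = j y" by auto
    then show "\<pi>' (\<beta> x) = \<zero>\<^bsub>C'\<^esub>" using be(2) zf linD(3)[OF p y(1)] by simp
  qed
  then obtain b where b: "lin A C C' b" "\<And>x. x \<in> carrier P \<Longrightarrow> b (\<pi> x) = \<pi>' (\<beta> x)" by blast
  have "\<exists>e. lin A C' P' e \<and> (\<forall>x\<in>carrier P'. e (\<pi>' x) = ?\<delta> x)"
  proof (rule lin_factor[OF C'(2,3) ld])
    fix x assume x: "x \<in> carrier P'" "\<pi>' x = \<zero>\<^bsub>C'\<^esub>"
    then obtain y where y: "y \<in> carrier V" "x = f y" using C'(4) by auto
    show "?\<delta> x = \<zero>\<^bsub>P'\<^esub>" using tf[OF y(1)] x(1) y(2) by (simp add: a_minus_def P'.r_neg)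
  qed
  then obtain e where e: "lin A C' P' e" "\<And>x. x \<in> carrier P' \<Longrightarrow> e (\<pi>' x) = ?\<delta> x" by blast
  have "c = b (a c) \<oplus>\<^bsub>C'\<^esub> \<pi>' (e c)" if c: "c \<in> carrier C'" for c
  proof -
    obtain x where x: "x \<in> carrier P'" "c = \<pi>' x" using c C'(3) by auto
    have cl: "\<alpha> x \<in> carrier P" "\<beta> (\<alpha> x) \<in> carrier P'" "p' (\<alpha>' x) \<in> carrier V" "f (p' (\<alpha>' x)) \<in> carrier P'"
      "\<pi>' x \<in> carrier C'" "\<pi>' (\<beta> (\<alpha> x)) \<in> carrier C'"
      using x(1) linD(3)[OF al(1)] linD(3)[OF be(1)] linD(3)[OF al'(1)] linD(3)[OF p'] linD(3)[OF f] linD(3)[OF C'(2)] by auto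
    have "\<pi>' (?\<delta> x) = \<pi>' x \<ominus>\<^bsub>C'\<^esub> \<pi>' (\<beta> (\<alpha> x))"
      using cl x(1) zf[OF cl(3)] by (simp add: lin_minus[OF C'(2)] linD(4)[OF C'(2)])
    then have "b (a c) \<oplus>\<^bsub>C'\<^esub> \<pi>' (e c) = \<pi>' (\<beta> (\<alpha> x)) \<oplus>\<^bsub>C'\<^esub> (\<pi>' x \<ominus>\<^bsub>C'\<^esub> \<pi>' (\<beta> (\<alpha> x)))"
      using x a(2) b(2) e(2) cl by simp
    also have "\<dots> = c" using cl x(2) by (simp add: a_minus_def C'.a_lcomm C'.r_neg)
    finally show ?thesis by simp
  qed
  then have "stable_summand A C' C P'"
    unfolding stable_summand_def using C'(1,2) P'(2) a(1) b(1) e(1) by blast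
  then show ?thesis using step by blast
qed

text \<open>Dually, lift the maps to projective modules over \<open>V\<close> and \<open>N\<close>: the identity minus the lifted composite maps
  \<open>P'\<close> into the kernel of \<open>P' \<rightarrow> V\<close>.  A linear form on this kernel extends to \<open>P'\<close> because its part through
  \<open>C\<close> extends to \<open>P\<close>.\<close>

lemma stable_summand_syzygy:
  fixes A :: "('k, 'a) module"
  assumes A: "fd_algebra K A" and ss: "stable_summand A V N Q" and st: "gp_step A C j P \<epsilon> N"
  shows "\<exists>C' f' P' f. gp_step A C' f' P' f V \<and> stable_summand A C' C P'"
proof -
  obtain i p i' p' where V: "fg_module A V" and Q: "proj A Q" and i: "lin A V N i" and p: "lin A N V p" and
    i': "lin A V Q i'" and p': "lin A Q V p'" and id: "\<And>x. x \<in> carrier V \<Longrightarrow> x = p (i x) \<oplus>\<^bsub>V\<^esub> p' (i' x)"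
    using ss unfolding stable_summand_def by blast
  note s = gp_stepD[OF st]
  have lV: "left_module A V" by (rule fg_left[OF V])
  interpret V: abelian_group V using lV by (rule left_moduleD)
  obtain P' :: "('k, 'a) fd_mod" and f where P': "fg_module A P'" "proj A P'" and f: "lin A P' V f" "f ` carrier P' = carrier V"
    using enough_proj[OF A V] by blast
  have lP': "left_module A P'" by (rule fg_left[OF P'(1)])
  interpret P': abelian_group P' using lP' by (rule left_moduleD)
  have "(\<lambda>x. i (f x)) ` carrier P' \<subseteq> \<epsilon> ` carrier P" unfolding s(8) using linD(3)[OF i] linD(3)[OF f(1)] by auto
  then obtain \<alpha> where al: "lin A P' P \<alpha>" "\<And>x. x \<in> carrier P' \<Longrightarrow> \<epsilon> (\<alpha> x) = i (f x)"
    using proj_lift[OF P'(2) s(6) lin_compose[OF f(1) i]] by auto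
  have "(\<lambda>x. p (\<epsilon> x)) ` carrier P \<subseteq> f ` carrier P'" unfolding f(2) using linD(3)[OF p] linD(3)[OF s(6)] by auto
  then obtain \<beta> where be: "lin A P P' \<beta>" "\<And>x. x \<in> carrier P \<Longrightarrow> f (\<beta> x) = p (\<epsilon> x)"
    using proj_lift[OF s(4) f(1) lin_compose[OF s(6) p]] by auto
  have "p' ` carrier Q \<subseteq> f ` carrier P'" unfolding f(2) using linD(3)[OF p'] by auto
  then obtain \<beta>' where be': "lin A Q P' \<beta>'" "\<And>x. x \<in> carrier Q \<Longrightarrow> f (\<beta>' x) = p' x"
    using proj_lift[OF Q f(1) p'] by auto
  let ?t = "\<lambda>x. \<beta> (\<alpha> x) \<oplus>\<^bsub>P'\<^esub> \<beta>' (i' (f x))"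
  have lt: "lin A P' P' ?t"
    by (rule lin_plus[OF lin_compose[OF al(1) be(1)] lin_compose[OF f(1) lin_compose[OF i' be'(1)]]])
  let ?\<delta> = "\<lambda>x. x \<ominus>\<^bsub>P'\<^esub> ?t x"
  have ld: "lin A P' P' ?\<delta>" by (rule lin_diff[OF lin_id[OF lP'] lt])
  let ?Z = "{x \<in> carrier P'. f x = \<zero>\<^bsub>V\<^esub>}"
  let ?C = "sub_module P' ?Z"
  have Z: "submodule ?Z A P'" by (rule submodule_kernel[OF f(1)])
  have fC: "fg_module A ?C" by (rule fd_fg_sub[OF A P'(1) Z])
  have dZ: "?\<delta> x \<in> ?Z" if x: "x \<in> carrier P'" for x
  proof -
    have c: "f x \<in> carrier V" "\<alpha> x \<in> carrier P" "\<beta> (\<alpha> x) \<in> carrier P'" "i' (f x) \<in> carrier Q" "\<beta>' (i' (f x)) \<in> carrier P'"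
      using x linD(3)[OF f(1)] linD(3)[OF al(1)] linD(3)[OF be(1)] linD(3)[OF i'] linD(3)[OF be'(1)] by auto
    have "f (?\<delta> x) = f x \<ominus>\<^bsub>V\<^esub> (p (i (f x)) \<oplus>\<^bsub>V\<^esub> p' (i' (f x)))"
      using x c be(2)[OF c(2)] be'(2)[OF c(4)] al(2)[OF x] by (simp add: lin_minus[OF f(1)] linD(4)[OF f(1)])
    also have "\<dots> = f x \<ominus>\<^bsub>V\<^esub> f x" using id[OF c(1)] by simp
    also have "\<dots> = \<zero>\<^bsub>V\<^esub>" using c by (simp add: a_minus_def V.r_neg)
    finally show ?thesis using linD(3)[OF ld x] by simp
  qed
  have dC: "lin A P' ?C ?\<delta>" by (rule lin_into_sub[OF ld Z]) (use dZ in auto)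
  have bj: "lin A C ?C (\<lambda>c. \<beta> (j c))"
  proof (rule lin_into_sub[OF lin_compose[OF s(5) be(1)] Z])
    show "(\<lambda>c. \<beta> (j c)) ` carrier C \<subseteq> ?Z"
      using be(2) gp_step_zero[OF st] lin_zero[OF p] linD(3)[OF s(5)] linD(3)[OF be(1)] by auto
  qed
  have jC: "submodule (j ` carrier C) A P" by (rule submodule_image[OF s(5) submodule_carrier[OF linD(1)[OF s(5)]]])
  have aZ: "\<alpha> x \<in> j ` carrier C" if "x \<in> ?Z" for x
    unfolding s(9) using that al(2) linD(3)[OF al(1)] lin_zero[OF i] by auto
  have aC: "lin A ?C (sub_module P (j ` carrier C)) \<alpha>"
    by (rule lin_into_sub[OF lin_compose[OF lin_sub_incl[OF lP' Z] al(1)] jC]) (use aZ in auto)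
  have "lin A C (sub_module P (j ` carrier C)) j" by (rule lin_into_sub[OF s(5) jC]) simp
  then obtain j' where j': "iso_pair A C (sub_module P (j ` carrier C)) j j'"
    using bij_iso_pair[of A C "sub_module P (j ` carrier C)" j] s(7) by (auto simp: bij_betw_def)
  let ?a = "\<lambda>x. j' (\<alpha> x)"
  have la: "lin A ?C C ?a" by (rule lin_compose[OF aC iso_pairD(2)[OF j']])
  have ja: "j (?a x) = \<alpha> x" if "x \<in> ?Z" for x using iso_pairD(4)[OF j'] aZ[OF that] by simp
  have split: "x = \<beta> (\<alpha> x) \<oplus>\<^bsub>P'\<^esub> ?\<delta> x" if x: "x \<in> ?Z" for x
  proof -
    have c: "x \<in> carrier P'" "\<beta> (\<alpha> x) \<in> carrier P'" using x linD(3)[OF al(1)] linD(3)[OF be(1)] by auto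
    have "\<beta>' (i' (f x)) = \<zero>\<^bsub>P'\<^esub>" using x lin_zero[OF i'] lin_zero[OF be'(1)] by simp
    then show ?thesis using c by (simp add: a_minus_def P'.a_lcomm P'.r_neg)
  qed
  have "\<exists>\<psi>. lin A P' (regular A) \<psi> \<and> (\<forall>x\<in>?Z. \<psi> x = \<phi> x)" if ph: "lin A ?C (regular A) \<phi>" for \<phi>
  proof -
    obtain \<psi> where ps: "lin A P (regular A) \<psi>" "\<And>c. c \<in> carrier C \<Longrightarrow> \<psi> (j c) = \<phi> (\<beta> (j c))"
      using s(10)[OF lin_compose[OF bj ph]] by blast
    show ?thesis
    proof (intro exI conjI ballI)
      show "lin A P' (regular A) (\<lambda>x. \<psi> (\<alpha> x) \<oplus>\<^bsub>regular A\<^esub> \<phi> (?\<delta> x))"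
        by (rule lin_plus[OF lin_compose[OF al(1) ps(1)] lin_compose[OF dC ph]])
      fix x assume x: "x \<in> ?Z"
      have 1: "\<beta> (\<alpha> x) \<in> carrier ?C" "?\<delta> x \<in> carrier ?C" "?a x \<in> carrier C"
        using linD(3)[OF bj, of "?a x"] linD(3)[OF la, of x] ja[OF x] dZ[of x] x by auto
      have "\<psi> (\<alpha> x) = \<phi> (\<beta> (\<alpha> x))" using ps(2)[OF 1(3)] ja[OF x] by simp
      then have "\<psi> (\<alpha> x) \<oplus>\<^bsub>regular A\<^esub> \<phi> (?\<delta> x) = \<phi> (\<beta> (\<alpha> x) \<oplus>\<^bsub>?C\<^esub> ?\<delta> x)" using linD(4)[OF ph 1(1,2)] by simp
      also have "\<beta> (\<alpha> x) \<oplus>\<^bsub>?C\<^esub> ?\<delta> x = x" using split[OF x] by simp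
      finally show "\<psi> (\<alpha> x) \<oplus>\<^bsub>regular A\<^esub> \<phi> (?\<delta> x) = \<phi> x" .
    qed
  qed
  then have step: "gp_step A ?C (\<lambda>x. x) P' f V"
    unfolding gp_step_def using V P' f fC lin_sub_incl[OF lP' Z] by simp
  have "stable_summand A ?C C P'"
    unfolding stable_summand_def
  proof (intro conjI exI)
    show "lin A ?C C ?a" "lin A C ?C (\<lambda>c. \<beta> (j c))" "lin A ?C P' (\<lambda>x. x)" "lin A P' ?C ?\<delta>"
      by (rule la bj lin_sub_incl[OF lP' Z] dC)+
    show "\<forall>x\<in>carrier ?C. x = \<beta> (j (?a x)) \<oplus>\<^bsub>?C\<^esub> ?\<delta> x" using ja split by simp
  qed (use fC P' in auto)
  then show ?thesis using step by blast
qed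

text \<open>The class of stable summands of Gorenstein projective modules is closed under syzygies and
  cosyzygies.\<close>

lemma gorenstein_projective_summand:
  fixes A :: "('k, 'a) module" and N V :: "('k, 'a) fd_mod"
  assumes A: "fd_algebra K A" and N: "gorenstein_projective A N" and V: "fg_module A V"
    and r: "summand_pair A V N i p"
  shows "gorenstein_projective A V"
proof (rule gorenstein_projective_coinduct[OF A, where Q="\<lambda>V. \<exists>N Q. gorenstein_projective A N \<and> stable_summand A V N Q"])
  obtain f P g C where st: "gp_step A N f P g C" using gorenstein_projective_steps(1)[OF A N] by blast
  note R = retractD[OF r] and lP = addED(2)[OF gp_stepD(4)[OF st]] and lV = fg_left[OF V]
  interpret V: abelian_group V using lV by (rule left_moduleD)
  have "stable_summand A V N P"
    unfolding stable_summand_def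
  proof (intro conjI V gp_stepD(4)[OF st], rule exI[of _ i], rule exI[of _ p],
      rule exI[of _ "\<lambda>_. \<zero>\<^bsub>P\<^esub>"], rule exI[of _ "\<lambda>_. \<zero>\<^bsub>V\<^esub>"], intro conjI R lin_0 lV lP)
    show "\<forall>x\<in>carrier V. x = p (i x) \<oplus>\<^bsub>V\<^esub> \<zero>\<^bsub>V\<^esub>" using R(3) by simp
  qed
  then show "\<exists>N Q. gorenstein_projective A N \<and> stable_summand A V N Q" using N by blast
next
  fix V :: "('k, 'a) fd_mod" assume "\<exists>N Q. gorenstein_projective A N \<and> stable_summand A V N Q"
  then obtain N Q where N: "gorenstein_projective A N" and ss: "stable_summand A V N Q" by blast
  show "\<exists>f P g C. gp_step A V f P g C \<and> (\<exists>N Q. gorenstein_projective A N \<and> stable_summand A C N Q)"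
    using gorenstein_projective_steps(1)[OF A N] stable_summand_cosyzygy[OF A ss] by metis
  show "\<exists>C f P g. gp_step A C f P g V \<and> (\<exists>N Q. gorenstein_projective A N \<and> stable_summand A C N Q)"
    using gorenstein_projective_steps(2)[OF A N] stable_summand_syzygy[OF A ss] by metis
qed

section \<open>The functor \<open>Hom(E,-)\<close>\<close>

text \<open>The endomorphism algebra, its regular module and the space of endomorphisms share their additive
  structure, but they are different records.\<close>

lemma abelian_group_cong:
  fixes G :: "('a, 'm) ring_scheme" and H :: "('a, 'n) ring_scheme"
  assumes "abelian_group G" "carrier H = carrier G" "\<zero>\<^bsub>H\<^esub> = \<zero>\<^bsub>G\<^esub>" "ring.add H = ring.add G"
  shows "abelian_group H"
proof -
  interpret G: abelian_group G by (rule assms)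
  show ?thesis
    by (rule abelian_groupI) (auto simp: assms G.a_ac intro: bexI[of _ "\<ominus>\<^bsub>G\<^esub> x" for x] G.l_neg)
qed

lemma left_module_cong:
  fixes M N :: "('a, 'm) module"
  assumes "left_module R M" "carrier N = carrier M" "\<zero>\<^bsub>N\<^esub> = \<zero>\<^bsub>M\<^esub>" "ring.add N = ring.add M" "smult N = smult M"
  shows "left_module R N"
proof -
  have "abelian_group N"
    by (rule abelian_group_cong[OF left_moduleD(2)[OF assms(1)] assms(2-4)])
  then show ?thesis
    using assms by (simp add: left_module_def left_module_axioms_def)
qed

lemma lin_cong_target:
  fixes M N :: "('a, 'm) module"
  assumes "carrier N = carrier M" "\<zero>\<^bsub>N\<^esub> = \<zero>\<^bsub>M\<^esub>" "ring.add N = ring.add M" "smult N = smult M"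
  shows "lin R V N f \<longleftrightarrow> lin R V M f" "lin R N V g \<longleftrightarrow> lin R M V g"
  using left_module_cong[of R M N] left_module_cong[of R N M] assms by (auto simp: lin_def)

lemma End_algebra_simps [simp]:
  "carrier (End_algebra A E) = hom_set A E E" "\<one>\<^bsub>End_algebra A E\<^esub> = (\<lambda>x\<in>carrier E. x)"
  "\<zero>\<^bsub>End_algebra A E\<^esub> = (\<lambda>x\<in>carrier E. \<zero>\<^bsub>E\<^esub>)"
  "f \<oplus>\<^bsub>End_algebra A E\<^esub> g = (\<lambda>x\<in>carrier E. f x \<oplus>\<^bsub>E\<^esub> g x)"
  "f \<otimes>\<^bsub>End_algebra A E\<^esub> g = (\<lambda>x\<in>carrier E. f (g x))"
  "k \<odot>\<^bsub>End_algebra A E\<^esub> f = (\<lambda>x\<in>carrier E. (k \<odot>\<^bsub>A\<^esub> \<one>\<^bsub>A\<^esub>) \<odot>\<^bsub>E\<^esub> f x)"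
  by (simp_all add: End_algebra_def Hom_simps compose_def)

text \<open>\<open>Hom(E,V)\<close> as a left module over the opposite of the endomorphism algebra of \<open>E\<close>.\<close>

definition Hom_module :: "('k, 'a) module \<Rightarrow> ('a, 'e) module \<Rightarrow> ('a, 'm) module \<Rightarrow> ('e \<Rightarrow> 'e, 'e \<Rightarrow> 'm) module"
  where "Hom_module A E V = \<lparr>carrier = hom_set A E V, monoid.mult = undefined, one = undefined,
     ring.zero = \<zero>\<^bsub>Hom A E V\<^esub>, ring.add = ring.add (Hom A E V),
     smult = (\<lambda>\<gamma> f. compose (carrier E) f \<gamma>)\<rparr>"

lemma Hom_module_simps [simp]:
  "carrier (Hom_module A E V) = hom_set A E V" "\<zero>\<^bsub>Hom_module A E V\<^esub> = (\<lambda>x\<in>carrier E. \<zero>\<^bsub>V\<^esub>)"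
  "f \<oplus>\<^bsub>Hom_module A E V\<^esub> g = (\<lambda>x\<in>carrier E. f x \<oplus>\<^bsub>V\<^esub> g x)"
  "\<gamma> \<odot>\<^bsub>Hom_module A E V\<^esub> f = (\<lambda>x\<in>carrier E. f (\<gamma> x))"
  by (simp_all add: Hom_module_def Hom_simps compose_def)

lemma postcomp_eq: "postcomp E u h = (\<lambda>e\<in>carrier E. u (h e))"
  by (simp add: postcomp_def compose_def)

lemma hom_set_closed: "h \<in> hom_set A M N \<Longrightarrow> x \<in> carrier M \<Longrightarrow> h x \<in> carrier N"
  by (auto simp: Hom_def)

lemma hom_set_cong_sub:
  assumes "left_module A M" "submodule H A M"
  shows "hom_set A E (sub_module M H) = {h \<in> hom_set A E M. h ` carrier E \<subseteq> H}"
  using submoduleD(1)[OF assms(2)] by (auto simp: Hom_def PiE_def Pi_def)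

lemmas hom_unfolds = End_algebra_simps opposite_simps Hom_module_simps postcomp_eq Hom_space_simps restrict_scalars_simps

locale generator_context =
  fixes K :: "'k ring" and L :: "('k, 'a) module" and E :: "('a, 'e) module"
  assumes fd: "fd_algebra K L" and gen: "generator L E"
begin

abbreviation \<Gamma> :: "('k, 'e \<Rightarrow> 'e) module" where "\<Gamma> \<equiv> opposite (End_algebra L E)"
abbreviation F :: "('a, 'm) module \<Rightarrow> ('e \<Rightarrow> 'e, 'e \<Rightarrow> 'm) module" where "F V \<equiv> Hom_module L E V"

lemma fgE: "fg_module L E" and lE: "left_module L E"
  using gen by (auto simp: generator_def fg_left)

lemma gen_addE: "addE L E (regular L)"
  using gen in_add_iff[OF lE, of "regular L"] by (simp add: generator_def)

lemma rL: "ring L" by (rule fd_algebraD(3)[OF fd])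

lemma Hom_space_add: "left_module L V \<Longrightarrow> abelian_group (Hom_space L E V)"
  by (rule left_moduleD(2)[OF left_module_Hom_space[OF fd lE]])

lemma End_group: "abelian_group (End_algebra L E)"
proof -
  interpret H: abelian_group "Hom_space L E E" by (rule Hom_space_add[OF lE])
  show ?thesis by (rule abelian_group_cong[OF H.abelian_group_axioms]) (auto simp: fun_eq_iff)
qed

lemma ring_End: "ring (End_algebra L E)"
proof (rule ringI[OF End_group])
  interpret abelian_group E using lE by (rule left_moduleD)
  note c = hom_set_closed[of _ L E E]
  show "monoid (End_algebra L E)"
  proof (rule monoidI)
    fix x y assume "x \<in> carrier (End_algebra L E)" "y \<in> carrier (End_algebra L E)"
    then show "x \<otimes>\<^bsub>End_algebra L E\<^esub> y \<in> carrier (End_algebra L E)"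
      using lin_hom_set[OF lin_compose[OF hom_set_lin[OF _ lE lE] hom_set_lin[OF _ lE lE]]] by simp
  next
    fix x y z assume "x \<in> carrier (End_algebra L E)" "y \<in> carrier (End_algebra L E)" "z \<in> carrier (End_algebra L E)"
    then show "x \<otimes>\<^bsub>End_algebra L E\<^esub> y \<otimes>\<^bsub>End_algebra L E\<^esub> z = x \<otimes>\<^bsub>End_algebra L E\<^esub> (y \<otimes>\<^bsub>End_algebra L E\<^esub> z)"
      unfolding hom_unfolds by (intro restrict_ext) (use c[of z] in simp)
  next
    fix x assume x: "x \<in> carrier (End_algebra L E)"
    have "(\<lambda>e\<in>carrier E. (\<lambda>e\<in>carrier E. e) (x e)) = (\<lambda>e\<in>carrier E. x e)" by (rule restrict_ext) (use c[of x] x in simp)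
    then show "\<one>\<^bsub>End_algebra L E\<^esub> \<otimes>\<^bsub>End_algebra L E\<^esub> x = x" using hom_set_restrict[of x L E E] x by simp
    have "(\<lambda>e\<in>carrier E. x ((\<lambda>e\<in>carrier E. e) e)) = (\<lambda>e\<in>carrier E. x e)" by (rule restrict_ext) simp
    then show "x \<otimes>\<^bsub>End_algebra L E\<^esub> \<one>\<^bsub>End_algebra L E\<^esub> = x" using hom_set_restrict[of x L E E] x by simp
  qed (use lin_hom_set[OF lin_id[OF lE]] in simp)
next
  fix x y z assume "x \<in> carrier (End_algebra L E)" "y \<in> carrier (End_algebra L E)" "z \<in> carrier (End_algebra L E)"
  then have xyz: "x \<in> hom_set L E E" "y \<in> hom_set L E E" "z \<in> hom_set L E E" by auto
  note c = hom_set_closed[OF xyz(1)] hom_set_closed[OF xyz(2)] hom_set_closed[OF xyz(3)]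
  show "(x \<oplus>\<^bsub>End_algebra L E\<^esub> y) \<otimes>\<^bsub>End_algebra L E\<^esub> z =
    x \<otimes>\<^bsub>End_algebra L E\<^esub> z \<oplus>\<^bsub>End_algebra L E\<^esub> y \<otimes>\<^bsub>End_algebra L E\<^esub> z"
    unfolding hom_unfolds by (intro restrict_ext) (use c in simp)
  show "z \<otimes>\<^bsub>End_algebra L E\<^esub> (x \<oplus>\<^bsub>End_algebra L E\<^esub> y) =
    z \<otimes>\<^bsub>End_algebra L E\<^esub> x \<oplus>\<^bsub>End_algebra L E\<^esub> z \<otimes>\<^bsub>End_algebra L E\<^esub> y"
    unfolding hom_unfolds by (intro restrict_ext) (use c linD(4)[OF hom_set_lin[OF xyz(3) lE lE]] in simp)
qed

lemma ring_\<Gamma>: "ring \<Gamma>"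
  by (rule ring_opposite[OF ring_End])

lemma fd_\<Gamma>: "fd_algebra K \<Gamma>"
proof -
  note D = fd_algebraD[OF fd]
  have l: "left_module K (Hom_space L E E)" by (rule left_module_Hom_space[OF fd lE lE])
  have eq: "carrier \<Gamma> = carrier (Hom_space L E E)" "\<zero>\<^bsub>\<Gamma>\<^esub> = \<zero>\<^bsub>Hom_space L E E\<^esub>"
    "ring.add \<Gamma> = ring.add (Hom_space L E E)" "smult \<Gamma> = smult (Hom_space L E E)"
    by (auto simp: fun_eq_iff)
  have lG: "left_module K \<Gamma>" by (rule left_module_cong[OF l eq])
  note m = left_module.smult_l_distr[OF lG] left_module.smult_r_distr[OF lG] left_module.smult_assoc1[OF lG]
    left_module.smult_one[OF lG] left_module_closed(5)[OF lG]
  interpret K: field K by (rule D)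
  have md: "module K \<Gamma>"
    by (rule moduleI[OF K.cring_axioms left_moduleD(2)[OF lG]]) (use m in auto)
  have fg: "fg_module K \<Gamma>"
  proof (rule fg_image[OF _ _ fg_Hom_space[OF fd fgE fgE]])
    show "lin K (Hom_space L E E) \<Gamma> (\<lambda>x. x)" using lin_id[OF lG] lin_cong_target(2)[OF eq[symmetric]] by blast
    show "(\<lambda>x. x) ` carrier (Hom_space L E E) = carrier \<Gamma>" using eq(1) by simp
  qed
  have c: "k \<odot>\<^bsub>L\<^esub> \<one>\<^bsub>L\<^esub> \<in> carrier L" if "k \<in> carrier K" for k by (rule D(6)[OF that])
  show ?thesis
  proof (intro fd_algebra.intro fd_algebra_axioms.intro)
    fix k x y assume k: "k \<in> carrier K" and "x \<in> carrier \<Gamma>" "y \<in> carrier \<Gamma>"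
    then have xy: "x \<in> hom_set L E E" "y \<in> hom_set L E E" by auto
    show "(k \<odot>\<^bsub>\<Gamma>\<^esub> x) \<otimes>\<^bsub>\<Gamma>\<^esub> y = k \<odot>\<^bsub>\<Gamma>\<^esub> (x \<otimes>\<^bsub>\<Gamma>\<^esub> y)"
      unfolding hom_unfolds by (intro restrict_ext) (use hom_set_closed[OF xy(1)] linD(5)[OF hom_set_lin[OF xy(2) lE lE] c[OF k]] in simp)
    show "x \<otimes>\<^bsub>\<Gamma>\<^esub> (k \<odot>\<^bsub>\<Gamma>\<^esub> y) = k \<odot>\<^bsub>\<Gamma>\<^esub> (x \<otimes>\<^bsub>\<Gamma>\<^esub> y)"
      unfolding hom_unfolds by (intro restrict_ext) (use hom_set_closed[OF xy(1)] in simp)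
  qed (use md fg ring_\<Gamma> K.field_axioms in \<open>auto simp: fg_module_def\<close>)
qed

lemma left_module_F:
  assumes V: "left_module L V"
  shows "left_module \<Gamma> (F V)"
proof -
  have "abelian_group (F V)"
    by (rule abelian_group_cong[OF Hom_space_add[OF V]]) (auto simp: fun_eq_iff)
  moreover have "left_module_axioms \<Gamma> (F V)"
  proof (rule left_module_axioms.intro)
    fix f assume "f \<in> carrier (F V)"
    then have f: "f \<in> hom_set L E V" by simp
    note lf = hom_set_lin[OF f lE V]
    have "(\<lambda>e\<in>carrier E. f ((\<lambda>e\<in>carrier E. e) e)) = (\<lambda>e\<in>carrier E. f e)" by (rule restrict_ext) simp
    then show "\<one>\<^bsub>\<Gamma>\<^esub> \<odot>\<^bsub>F V\<^esub> f = f" using hom_set_restrict[OF f] by simp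
    fix a assume "a \<in> carrier \<Gamma>" then have a: "a \<in> hom_set L E E" by simp
    note la = hom_set_lin[OF a lE lE] and ca = hom_set_closed[OF a]
    show "a \<odot>\<^bsub>F V\<^esub> f \<in> carrier (F V)" using lin_hom_set[OF lin_compose[OF la lf]] by simp
    { fix b assume "b \<in> carrier \<Gamma>" then have b: "b \<in> hom_set L E E" by simp
      show "(a \<oplus>\<^bsub>\<Gamma>\<^esub> b) \<odot>\<^bsub>F V\<^esub> f = a \<odot>\<^bsub>F V\<^esub> f \<oplus>\<^bsub>F V\<^esub> b \<odot>\<^bsub>F V\<^esub> f"
        unfolding hom_unfolds by (intro restrict_ext) (use ca hom_set_closed[OF b] linD(4)[OF lf] in simp)
      show "(a \<otimes>\<^bsub>\<Gamma>\<^esub> b) \<odot>\<^bsub>F V\<^esub> f = a \<odot>\<^bsub>F V\<^esub> (b \<odot>\<^bsub>F V\<^esub> f)"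
        unfolding hom_unfolds by (intro restrict_ext) (use ca in simp) }
    fix g assume "g \<in> carrier (F V)"
    show "a \<odot>\<^bsub>F V\<^esub> (f \<oplus>\<^bsub>F V\<^esub> g) = a \<odot>\<^bsub>F V\<^esub> f \<oplus>\<^bsub>F V\<^esub> a \<odot>\<^bsub>F V\<^esub> g"
      unfolding hom_unfolds by (intro restrict_ext) (use ca in simp)
  qed
  ultimately show ?thesis using ring_\<Gamma> by (simp add: left_module_def)
qed

lemma F_regular:
  "carrier (regular \<Gamma>) = carrier (F E)" "\<zero>\<^bsub>regular \<Gamma>\<^esub> = \<zero>\<^bsub>F E\<^esub>"
  "ring.add (regular \<Gamma>) = ring.add (F E)" "smult (regular \<Gamma>) = smult (F E)"
  by (auto simp: fun_eq_iff)

lemma lin_F_regular: "lin \<Gamma> V (regular \<Gamma>) f \<longleftrightarrow> lin \<Gamma> V (F E) f" "lin \<Gamma> (regular \<Gamma>) V g \<longleftrightarrow> lin \<Gamma> (F E) V g"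
  by (rule lin_cong_target[OF F_regular])+

lemma fg_F:
  assumes V: "fg_module L V"
  shows "fg_module \<Gamma> (F V)"
proof (rule fg_of_restrict[OF fd_\<Gamma> left_module_F[OF fg_left[OF V]]])
  have lV: "left_module L V" by (rule fg_left[OF V])
  have r: "left_module K (restrict_scalars \<Gamma> (F V))" by (rule left_module_restrict[OF fd_\<Gamma> left_module_F[OF lV]])
  have "lin K (Hom_space L E V) (restrict_scalars \<Gamma> (F V)) (\<lambda>x. x)"
  proof (rule linI[OF left_module_Hom_space[OF fd lE lV] r])
    fix k f assume k: "k \<in> carrier K" and "f \<in> carrier (Hom_space L E V)"
    then have lf: "lin L E V f" using hom_set_lin[OF _ lE lV] by simp
    show "k \<odot>\<^bsub>Hom_space L E V\<^esub> f = k \<odot>\<^bsub>restrict_scalars \<Gamma> (F V)\<^esub> f"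
      unfolding hom_unfolds by (intro restrict_ext) (use linD(5)[OF lf fd_algebraD(6)[OF fd k]] in simp)
  qed auto
  then show "fg_module K (restrict_scalars \<Gamma> (F V))"
    by (rule fg_image[OF _ _ fg_Hom_space[OF fd fgE V]]) simp
qed

lemma lin_postcomp:
  assumes u: "lin L V Y u"
  shows "lin \<Gamma> (F V) (F Y) (postcomp E u)"
proof (rule linI[OF left_module_F[OF linD(1)[OF u]] left_module_F[OF linD(2)[OF u]]])
  fix h assume "h \<in> carrier (F V)"
  then have h: "h \<in> hom_set L E V" by simp
  note lh = hom_set_lin[OF h lE linD(1)[OF u]]
  show "postcomp E u h \<in> carrier (F Y)" unfolding postcomp_eq using lin_hom_set[OF lin_compose[OF lh u]] by simp
  { fix k assume "k \<in> carrier (F V)"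
    then show "postcomp E u (h \<oplus>\<^bsub>F V\<^esub> k) = postcomp E u h \<oplus>\<^bsub>F Y\<^esub> postcomp E u k"
      unfolding hom_unfolds by (intro restrict_ext) (use hom_set_closed[OF h] hom_set_closed[of k L E V] linD(4)[OF u] in simp) }
  fix \<gamma> assume "\<gamma> \<in> carrier \<Gamma>"
  then show "postcomp E u (\<gamma> \<odot>\<^bsub>F V\<^esub> h) = \<gamma> \<odot>\<^bsub>F Y\<^esub> postcomp E u h"
    unfolding hom_unfolds by (intro restrict_ext) (use hom_set_closed[of \<gamma> L E E] in simp)
qed

lemma lin_eval_into:
  assumes i: "lin L E (regular L) i" and V: "left_module L V" and x: "x \<in> carrier V"
  shows "lin L E V (\<lambda>e. i e \<odot>\<^bsub>V\<^esub> x)"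
  by (rule lin_compose[OF i lin_from_regular[OF V x]])

text \<open>Because \<open>E\<close> is a generator, the unit of the algebra is a sum of values of maps \<open>E \<rightarrow> \<Lambda>\<close>.  Multiplied
  with \<open>x\<close>, this writes \<open>x\<close> as a sum of values of maps \<open>E \<rightarrow> V\<close>.\<close>

lemma trace_induct:
  assumes V: "left_module L V" and x: "x \<in> carrier V" and z: "Q \<zero>\<^bsub>V\<^esub>"
    and add: "\<And>x y. x \<in> carrier V \<Longrightarrow> y \<in> carrier V \<Longrightarrow> Q x \<Longrightarrow> Q y \<Longrightarrow> Q (x \<oplus>\<^bsub>V\<^esub> y)"
    and h: "\<And>h e. lin L E V h \<Longrightarrow> e \<in> carrier E \<Longrightarrow> Q (h e)"
  shows "Q x"
proof -
  interpret L: ring L by (rule rL)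
  have "Q (f \<one>\<^bsub>L\<^esub> \<odot>\<^bsub>V\<^esub> x)" if "through L E (regular L) (regular L) f" for f
    using that
  proof induction
    case (zero f)
    then show ?case using z by (simp add: left_module_zero_smult[OF V x])
  next
    case (step f p i g)
    have f: "lin L (regular L) (regular L) f"
      by (rule through_lin[OF step(1)]) (rule left_module_regular[OF rL])+
    have c: "f \<one>\<^bsub>L\<^esub> \<in> carrier L" "p \<one>\<^bsub>L\<^esub> \<in> carrier E" "i (p \<one>\<^bsub>L\<^esub>) \<in> carrier L"
      using linD(3)[OF f] linD(3)[OF step(2)] linD(3)[OF step(3)] by auto
    have "g \<one>\<^bsub>L\<^esub> \<odot>\<^bsub>V\<^esub> x = f \<one>\<^bsub>L\<^esub> \<odot>\<^bsub>V\<^esub> x \<oplus>\<^bsub>V\<^esub> i (p \<one>\<^bsub>L\<^esub>) \<odot>\<^bsub>V\<^esub> x"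
      using step(4) c x by (simp add: left_module.smult_l_distr[OF V])
    moreover have "Q (i (p \<one>\<^bsub>L\<^esub>) \<odot>\<^bsub>V\<^esub> x)" by (rule h[OF lin_eval_into[OF step(3) V x] c(2)])
    ultimately show ?case using add step.IH c left_module_closed(5)[OF V] x by simp
  qed
  from this[OF addED(3)[OF gen_addE]] show ?thesis by (simp add: left_module.smult_one[OF V x])
qed

lemma F_faithful:
  assumes u: "lin L V Y u" and v: "lin L V Y v"
    and e: "\<And>h e. h \<in> hom_set L E V \<Longrightarrow> e \<in> carrier E \<Longrightarrow> u (h e) = v (h e)" and x: "x \<in> carrier V"
  shows "u x = v x"
proof (rule trace_induct[OF linD(1)[OF u] x, where Q="\<lambda>x. u x = v x"])
  fix h c assume h: "lin L E V h" "c \<in> carrier E"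
  show "u (h c) = v (h c)" using e[OF lin_hom_set[OF h(1)] h(2)] h(2) by simp
qed (use lin_zero[OF u] lin_zero[OF v] linD(4)[OF u] linD(4)[OF v] in auto)

text \<open>Surjectivity may be tested on maps from \<open>E\<close>, because a submodule is spanned by their images.\<close>

lemma F_reflects_image:
  assumes g: "lin L M N g" and H: "submodule H L N"
    and lift: "\<And>k. k \<in> hom_set L E N \<Longrightarrow> k ` carrier E \<subseteq> H \<Longrightarrow> \<exists>h\<in>hom_set L E M. \<forall>e\<in>carrier E. g (h e) = k e"
  shows "H \<subseteq> g ` carrier M"
proof
  fix y assume y: "y \<in> H"
  have N: "left_module L N" by (rule linD(2)[OF g])
  have I: "submodule (g ` carrier M) L N" by (rule submodule_image[OF g submodule_carrier[OF linD(1)[OF g]]])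
  show "y \<in> g ` carrier M"
  proof (rule trace_induct[OF left_module_sub[OF N H], where Q="\<lambda>y. y \<in> g ` carrier M"])
    fix k e assume k: "lin L E (sub_module N H) k" and e: "e \<in> carrier E"
    have "restrict k (carrier E) \<in> hom_set L E N" by (rule lin_hom_set[OF lin_compose[OF k lin_sub_incl[OF N H]]])
    then obtain h where "h \<in> hom_set L E M" "\<forall>e\<in>carrier E. g (h e) = k e"
      using lift[of "restrict k (carrier E)"] linD(3)[OF k] by auto
    then show "k e \<in> g ` carrier M" using e hom_set_closed by (metis imageI)
  qed (use y submoduleD(2,3)[OF I] in auto)
qed

text \<open>Full faithfulness.  Writing \<open>1 = \<Sum> i\<^sub>j(e\<^sub>j)\<close> with \<open>i\<^sub>j : E \<rightarrow> \<Lambda>\<close>, the map inducing \<open>g\<close> must send \<open>x\<close>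
  to \<open>\<Sum> g(e \<mapsto> i\<^sub>j(e) x)(e\<^sub>j)\<close>.\<close>

lemma F_full:
  assumes V: "left_module L V" and Y: "left_module L Y" and g: "lin \<Gamma> (F V) (F Y) g"
  shows "\<exists>u. lin L V Y u \<and> (\<forall>h\<in>hom_set L E V. g h = postcomp E u h)"
proof -
  interpret L: ring L by (rule rL)
  interpret Y: abelian_group Y using Y by (rule left_moduleD)
  have gc: "g h \<in> hom_set L E Y" if "h \<in> hom_set L E V" for h using linD(3)[OF g, of h] that by simp
  note hV = hom_set_lin[OF _ lE V] and hY = hom_set_lin[OF _ lE Y]
  have gcc: "g h e \<in> carrier Y" if "h \<in> hom_set L E V" "e \<in> carrier E" for h e by (rule hom_set_closed[OF gc[OF that(1)] that(2)])
  \<comment> \<open>Induction over the partial sums \<open>f\<close> of the identity of the algebra; \<open>u\<close> is the corresponding partial sum.\<close>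
  have "\<exists>u. (\<forall>x\<in>carrier V. u x \<in> carrier Y) \<and> (\<forall>x\<in>carrier V. \<forall>y\<in>carrier V. u (x \<oplus>\<^bsub>V\<^esub> y) = u x \<oplus>\<^bsub>Y\<^esub> u y) \<and>
    (\<forall>h\<in>hom_set L E V. \<forall>e\<in>carrier E. u (h e) = g h (f \<one>\<^bsub>L\<^esub> \<odot>\<^bsub>E\<^esub> e))"
    if "through L E (regular L) (regular L) f" for f
    using that
  proof induction
    case (zero f)
    have "g h (f \<one>\<^bsub>L\<^esub> \<odot>\<^bsub>E\<^esub> e) = \<zero>\<^bsub>Y\<^esub>" if "h \<in> hom_set L E V" "e \<in> carrier E" for h e
      using zero that lin_zero[OF hY[OF gc[OF that(1)]]] by (simp add: left_module_zero_smult[OF lE that(2)])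
    then show ?case by (intro exI[of _ "\<lambda>_. \<zero>\<^bsub>Y\<^esub>"]) simp
  next
    case (step f p i f')
    obtain u where u: "\<And>x. x \<in> carrier V \<Longrightarrow> u x \<in> carrier Y"
      "\<And>x y. x \<in> carrier V \<Longrightarrow> y \<in> carrier V \<Longrightarrow> u (x \<oplus>\<^bsub>V\<^esub> y) = u x \<oplus>\<^bsub>Y\<^esub> u y"
      "\<And>h e. h \<in> hom_set L E V \<Longrightarrow> e \<in> carrier E \<Longrightarrow> u (h e) = g h (f \<one>\<^bsub>L\<^esub> \<odot>\<^bsub>E\<^esub> e)"
      using step.IH by blast
    have f: "lin L (regular L) (regular L) f"
      by (rule through_lin[OF step(1)]) (rule left_module_regular[OF rL])+
    let ?c = "p \<one>\<^bsub>L\<^esub>"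
    have c: "f \<one>\<^bsub>L\<^esub> \<in> carrier L" "?c \<in> carrier E" "i ?c \<in> carrier L"
      using linD(3)[OF f] linD(3)[OF step(2)] linD(3)[OF step(3)] by auto
    define k where "k x = (\<lambda>e\<in>carrier E. i e \<odot>\<^bsub>V\<^esub> x)" for x
    have k: "k x \<in> hom_set L E V" if "x \<in> carrier V" for x unfolding k_def by (rule lin_hom_set[OF lin_eval_into[OF step(3) V that]])
    have ic: "i e \<in> carrier L" if "e \<in> carrier E" for e using linD(3)[OF step(3) that] by simp
    let ?u = "\<lambda>x. u x \<oplus>\<^bsub>Y\<^esub> g (k x) ?c"
    have "?u (x \<oplus>\<^bsub>V\<^esub> y) = ?u x \<oplus>\<^bsub>Y\<^esub> ?u y" if xy: "x \<in> carrier V" "y \<in> carrier V" for x y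
    proof -
      have "k (x \<oplus>\<^bsub>V\<^esub> y) = k x \<oplus>\<^bsub>F V\<^esub> k y"
        unfolding Hom_module_simps unfolding k_def
        by (rule restrict_ext) (use xy ic in \<open>simp add: left_module.smult_r_distr[OF V]\<close>)
      then have "g (k (x \<oplus>\<^bsub>V\<^esub> y)) ?c = g (k x) ?c \<oplus>\<^bsub>Y\<^esub> g (k y) ?c"
        using linD(4)[OF g, of "k x" "k y"] k xy c(2) by simp
      then show ?thesis using u(1,2) xy gcc[OF k c(2)] by (simp add: Y.a_ac)
    qed
    moreover have "?u (h e) = g h (f' \<one>\<^bsub>L\<^esub> \<odot>\<^bsub>E\<^esub> e)" if h: "h \<in> hom_set L E V" and e: "e \<in> carrier E" for h e
    proof -
      let ?\<gamma> = "\<lambda>d\<in>carrier E. i d \<odot>\<^bsub>E\<^esub> e"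
      have gm: "?\<gamma> \<in> hom_set L E E" by (rule lin_hom_set[OF lin_eval_into[OF step(3) lE e]])
      have "k (h e) = ?\<gamma> \<odot>\<^bsub>F V\<^esub> h"
        unfolding Hom_module_simps unfolding k_def
        by (rule restrict_ext) (use linD(5)[OF hV[OF h] ic e] in simp)
      then have "g (k (h e)) = ?\<gamma> \<odot>\<^bsub>F Y\<^esub> g h" using linD(5)[OF g, of ?\<gamma> h] gm h by simp
      then have "g (k (h e)) ?c = g h (i ?c \<odot>\<^bsub>E\<^esub> e)" using c(2) by simp
      moreover have "f' \<one>\<^bsub>L\<^esub> \<odot>\<^bsub>E\<^esub> e = f \<one>\<^bsub>L\<^esub> \<odot>\<^bsub>E\<^esub> e \<oplus>\<^bsub>E\<^esub> i ?c \<odot>\<^bsub>E\<^esub> e"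
        using step(4) c e by (simp add: left_module.smult_l_distr[OF lE])
      ultimately show ?thesis
        using u(3)[OF h e] linD(4)[OF hY[OF gc[OF h]]] left_module_closed(5)[OF lE _ e] c by simp
    qed
    moreover have "?u x \<in> carrier Y" if "x \<in> carrier V" for x using u(1)[OF that] gcc[OF k[OF that] c(2)] by simp
    ultimately show ?case by (intro exI[of _ ?u]) blast
  qed
  from this[OF addED(3)[OF gen_addE]] obtain u where u: "\<And>x. x \<in> carrier V \<Longrightarrow> u x \<in> carrier Y"
    "\<And>x y. x \<in> carrier V \<Longrightarrow> y \<in> carrier V \<Longrightarrow> u (x \<oplus>\<^bsub>V\<^esub> y) = u x \<oplus>\<^bsub>Y\<^esub> u y"
    "\<And>h e. h \<in> hom_set L E V \<Longrightarrow> e \<in> carrier E \<Longrightarrow> u (h e) = g h (\<one>\<^bsub>L\<^esub> \<odot>\<^bsub>E\<^esub> e)" by blast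
  have uh: "u (h e) = g h e" if "h \<in> hom_set L E V" "e \<in> carrier E" for h e
    using u(3)[OF that] left_module.smult_one[OF lE that(2)] by simp
  interpret V: abelian_group V using V by (rule left_moduleD)
  have sm: "u (a \<odot>\<^bsub>V\<^esub> x) = a \<odot>\<^bsub>Y\<^esub> u x" if a: "a \<in> carrier L" and x: "x \<in> carrier V" for a x
  proof (rule trace_induct[OF V x, where Q="\<lambda>x. u (a \<odot>\<^bsub>V\<^esub> x) = a \<odot>\<^bsub>Y\<^esub> u x"])
    have "u \<zero>\<^bsub>V\<^esub> \<oplus>\<^bsub>Y\<^esub> u \<zero>\<^bsub>V\<^esub> = u \<zero>\<^bsub>V\<^esub>" using u(2)[of "\<zero>\<^bsub>V\<^esub>" "\<zero>\<^bsub>V\<^esub>"] by simp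
    then have "u \<zero>\<^bsub>V\<^esub> = \<zero>\<^bsub>Y\<^esub>" using u(1)[of "\<zero>\<^bsub>V\<^esub>"] by simp
    then show "u (a \<odot>\<^bsub>V\<^esub> \<zero>\<^bsub>V\<^esub>) = a \<odot>\<^bsub>Y\<^esub> u \<zero>\<^bsub>V\<^esub>" by (simp add: left_module_smult_zero[OF V a] left_module_smult_zero[OF Y a])
  next
    fix y z assume "y \<in> carrier V" "z \<in> carrier V" "u (a \<odot>\<^bsub>V\<^esub> y) = a \<odot>\<^bsub>Y\<^esub> u y" "u (a \<odot>\<^bsub>V\<^esub> z) = a \<odot>\<^bsub>Y\<^esub> u z"
    then show "u (a \<odot>\<^bsub>V\<^esub> (y \<oplus>\<^bsub>V\<^esub> z)) = a \<odot>\<^bsub>Y\<^esub> u (y \<oplus>\<^bsub>V\<^esub> z)"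
      using u(1,2) a left_module_closed(5)[OF V a] by (simp add: left_module.smult_r_distr[OF V] left_module.smult_r_distr[OF Y])
  next
    fix h e assume h: "lin L E V h" and e: "e \<in> carrier E"
    let ?h = "restrict h (carrier E)"
    have hh: "?h \<in> hom_set L E V" by (rule lin_hom_set[OF h])
    have ae: "a \<odot>\<^bsub>E\<^esub> e \<in> carrier E" by (rule left_module_closed(5)[OF lE a e])
    have "u (a \<odot>\<^bsub>V\<^esub> h e) = u (?h (a \<odot>\<^bsub>E\<^esub> e))" using linD(5)[OF h a e] ae by simp
    also have "\<dots> = g ?h (a \<odot>\<^bsub>E\<^esub> e)" by (rule uh[OF hh ae])
    also have "\<dots> = a \<odot>\<^bsub>Y\<^esub> g ?h e" by (rule linD(5)[OF hY[OF gc[OF hh]] a e])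
    also have "g ?h e = u (h e)" using uh[OF hh e] e by simp
    finally show "u (a \<odot>\<^bsub>V\<^esub> h e) = a \<odot>\<^bsub>Y\<^esub> u (h e)" .
  qed
  have "lin L V Y u" by (rule linI[OF V Y]) (use u sm in auto)
  moreover have "g h = postcomp E u h" if h: "h \<in> hom_set L E V" for h
    unfolding postcomp_eq using hom_set_undefined[OF gc[OF h]] uh[OF h] by (auto simp: fun_eq_iff)
  ultimately show ?thesis by blast
qed

lemma postcomp_id: "h \<in> hom_set L E V \<Longrightarrow> (\<And>x. x \<in> carrier V \<Longrightarrow> u x = x) \<Longrightarrow> postcomp E u h = h"
  unfolding postcomp_eq using hom_set_undefined[of h L E V] hom_set_closed[of h L E V] by (auto simp: fun_eq_iff)

lemma postcomp_compose: "h \<in> hom_set L E V \<Longrightarrow> postcomp E v (postcomp E u h) = postcomp E (\<lambda>x. v (u x)) h"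
  unfolding postcomp_eq by (auto intro!: restrict_ext)

lemma postcomp_restrict: "h \<in> hom_set L E V \<Longrightarrow> postcomp E (restrict d (carrier V)) h = postcomp E d h"
  unfolding postcomp_eq by (rule restrict_ext) (simp add: hom_set_closed)

lemma F_summand:
  assumes r: "summand_pair L V Y i p"
  shows "summand_pair \<Gamma> (F V) (F Y) (postcomp E i) (postcomp E p)"
proof -
  note R = retractD[OF r]
  have "postcomp E p (postcomp E i h) = h" if "h \<in> hom_set L E V" for h
    unfolding postcomp_compose[OF that] by (rule postcomp_id[OF that]) (use R(3) in simp)
  then show ?thesis using lin_postcomp[OF R(1)] lin_postcomp[OF R(2)] by (simp add: summand_pair_def)
qed

lemma F_iso:
  assumes i: "iso_pair L V Y u v"
  shows "iso_pair \<Gamma> (F V) (F Y) (postcomp E u) (postcomp E v)"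
  using F_summand[OF iso_pair_retract(1)[OF i]] F_summand[OF iso_pair_retract(2)[OF i]]
  by (simp add: summand_pair_def iso_pair_def)

text \<open>A relation between composites may be checked after applying the functor.\<close>

lemma F_full_id:
  assumes u: "lin L V Y u" and v: "lin L Y V v"
    and e: "\<And>h. h \<in> hom_set L E V \<Longrightarrow> postcomp E v (postcomp E u h) = h" and x: "x \<in> carrier V"
  shows "v (u x) = x"
proof (rule F_faithful[OF lin_compose[OF u v] lin_id[OF linD(1)[OF u]] _ x])
  fix h c assume h: "h \<in> hom_set L E V" and c: "c \<in> carrier E"
  show "v (u (h c)) = h c" using fun_cong[OF e[OF h], of c] c by (simp add: postcomp_eq)
qed

lemma F_reflects_iso:
  assumes V: "left_module L V" and Y: "left_module L Y" and i: "iso_pair \<Gamma> (F V) (F Y) f g"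
  shows "\<exists>u v. iso_pair L V Y u v"
proof -
  note I = iso_pairD[OF i]
  obtain u where u: "lin L V Y u" "\<And>h. h \<in> hom_set L E V \<Longrightarrow> f h = postcomp E u h" using F_full[OF V Y I(1)] by blast
  obtain v where v: "lin L Y V v" "\<And>h. h \<in> hom_set L E Y \<Longrightarrow> g h = postcomp E v h" using F_full[OF Y V I(2)] by blast
  have fc: "f h \<in> hom_set L E Y" if "h \<in> hom_set L E V" for h using linD(3)[OF I(1)] that by simp
  have gc: "g h \<in> hom_set L E V" if "h \<in> hom_set L E Y" for h using linD(3)[OF I(2)] that by simp
  have "v (u x) = x" if "x \<in> carrier V" for x
  proof (rule F_full_id[OF u(1) v(1) _ that])
    fix h assume h: "h \<in> hom_set L E V"
    show "postcomp E v (postcomp E u h) = h" using u(2)[OF h] v(2)[OF fc[OF h]] I(3)[of h] h by simp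
  qed
  moreover have "u (v x) = x" if "x \<in> carrier Y" for x
  proof (rule F_full_id[OF v(1) u(1) _ that])
    fix h assume h: "h \<in> hom_set L E Y"
    show "postcomp E u (postcomp E v h) = h" using v(2)[OF h] u(2)[OF gc[OF h]] I(4)[of h] h by simp
  qed
  ultimately show ?thesis using u(1) v(1) unfolding iso_pair_def by blast
qed

lemma through_F:
  assumes "through L E V Y u" and V: "left_module L V" and Y: "left_module L Y"
  shows "through \<Gamma> (regular \<Gamma>) (F V) (F Y) (postcomp E u)"
  using assms(1)
proof induction
  case (zero u)
  then show ?case
    by (intro through.zero) (use hom_set_closed in \<open>fastforce simp: postcomp_eq intro!: restrict_ext\<close>)
next
  case (step u p i w)
  have u: "lin L V Y u" by (rule through_lin[OF step(1) V Y])
  show ?case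
  proof (rule through.step[OF step.IH, unfolded lin_F_regular, OF lin_postcomp[OF step(2)] lin_postcomp[OF step(3)]])
    show "\<forall>h\<in>carrier (F V). postcomp E w h = postcomp E u h \<oplus>\<^bsub>F Y\<^esub> postcomp E i (postcomp E p h)"
    proof
      fix h assume "h \<in> carrier (F V)"
      then have h: "h \<in> hom_set L E V" by simp
      show "postcomp E w h = postcomp E u h \<oplus>\<^bsub>F Y\<^esub> postcomp E i (postcomp E p h)"
        unfolding postcomp_eq Hom_module_simps by (rule restrict_ext) (use step(4) hom_set_closed[OF h] in simp)
    qed
  qed
qed

lemma through_F_reflect:
  assumes "through \<Gamma> (regular \<Gamma>) (F V) (F Y) g" and V: "left_module L V" and Y: "left_module L Y"
  shows "\<exists>u. through L E V Y u \<and> (\<forall>h\<in>hom_set L E V. g h = postcomp E u h)"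
  using assms(1)
proof induction
  case (zero g)
  then show ?case by (intro exI[of _ "\<lambda>_. \<zero>\<^bsub>Y\<^esub>"] conjI through.zero) (auto simp: postcomp_eq)
next
  case (step f p i g)
  obtain u where u: "through L E V Y u" "\<And>h. h \<in> hom_set L E V \<Longrightarrow> f h = postcomp E u h" using step.IH by blast
  obtain p' where p: "lin L V E p'" "\<And>h. h \<in> hom_set L E V \<Longrightarrow> p h = postcomp E p' h"
    using F_full[OF V lE] step(2) unfolding lin_F_regular by blast
  obtain i' where i: "lin L E Y i'" "\<And>h. h \<in> hom_set L E E \<Longrightarrow> i h = postcomp E i' h"
    using F_full[OF lE Y] step(3) unfolding lin_F_regular by blast
  show ?case
  proof (intro exI conjI ballI)
    show "through L E V Y (\<lambda>x. u x \<oplus>\<^bsub>Y\<^esub> i' (p' x))" by (rule through.step[OF u(1) p(1) i(1)]) simp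
    fix h assume h: "h \<in> hom_set L E V"
    have "p h \<in> hom_set L E E" using linD(3)[OF step(2), of h] h by simp
    then have "g h = postcomp E u h \<oplus>\<^bsub>F Y\<^esub> postcomp E i' (postcomp E p' h)"
      using step(4) h u(2)[OF h] p(2)[OF h] i(2) by simp
    then show "g h = postcomp E (\<lambda>x. u x \<oplus>\<^bsub>Y\<^esub> i' (p' x)) h"
      by (simp only: postcomp_eq Hom_module_simps) (auto intro!: restrict_ext)
  qed
qed

text \<open>The functor turns the maps \<open>V \<rightarrow> E \<rightarrow> V\<close> whose sum is the identity into maps through the regular
  module \<open>Hom(E,E)\<close>; full faithfulness gives the converse.\<close>

lemma F_proj_iff:
  assumes V: "left_module L V"
  shows "proj \<Gamma> (F V) \<longleftrightarrow> addE L E V"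
proof
  assume "addE L E V"
  then have "through \<Gamma> (regular \<Gamma>) (F V) (F V) (postcomp E (\<lambda>x. x))" by (intro through_F V addED(3))
  then have "through \<Gamma> (regular \<Gamma>) (F V) (F V) (\<lambda>h. h)"
    by (rule through_cong) (simp add: postcomp_id)
  then show "proj \<Gamma> (F V)" using left_module_F[OF V] left_module_regular[OF ring_\<Gamma>] by (simp add: addE_def)
next
  assume "proj \<Gamma> (F V)"
  then obtain u where u: "through L E V V u" "\<And>h. h \<in> hom_set L E V \<Longrightarrow> h = postcomp E u h"
    using through_F_reflect[OF addED(3) V V] by blast
  have "u x = x" if "x \<in> carrier V" for x
  proof (rule F_faithful[OF through_lin[OF u(1) V V] lin_id[OF V] _ that])
    fix h e assume "h \<in> hom_set L E V" "e \<in> carrier E"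
    then show "u (h e) = h e" using fun_cong[OF u(2), of h e] by (simp add: postcomp_eq)
  qed
  then have "through L E V V (\<lambda>x. x)" by (intro through_cong[OF u(1)]) simp
  then show "addE L E V" using V lE by (simp add: addE_def)
qed

text \<open>The functor is left exact.\<close>

lemma kernel_F:
  assumes h: "h \<in> hom_set L E Z" and H: "{x \<in> carrier Z. f x = \<zero>\<^bsub>M\<^esub>} = H"
  shows "postcomp E f h = \<zero>\<^bsub>F M\<^esub> \<longleftrightarrow> h ` carrier E \<subseteq> H"
proof
  assume z: "postcomp E f h = \<zero>\<^bsub>F M\<^esub>"
  show "h ` carrier E \<subseteq> H"
  proof
    fix y assume "y \<in> h ` carrier E"
    then obtain e where e: "e \<in> carrier E" "y = h e" by auto
    then show "y \<in> H" using fun_cong[OF z, of e] hom_set_closed[OF h e(1)] H by (auto simp: postcomp_eq)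
  qed
next
  assume s: "h ` carrier E \<subseteq> H"
  show "postcomp E f h = \<zero>\<^bsub>F M\<^esub>"
    unfolding postcomp_eq Hom_module_simps by (rule restrict_ext) (use s H in auto)
qed

lemma F_sub:
  assumes "left_module L M" "submodule H L M"
  shows "F (sub_module M H) = sub_module (F M) {h \<in> hom_set L E M. h ` carrier E \<subseteq> H}"
  unfolding Hom_module_def hom_set_cong_sub[OF assms] by (simp add: Hom_def)

lemma submodule_F:
  assumes "left_module L M" "submodule H L M"
  shows "submodule {h \<in> hom_set L E M. h ` carrier E \<subseteq> H} \<Gamma> (F M)"
proof -
  have l: "lin \<Gamma> (F (sub_module M H)) (F M) (postcomp E (\<lambda>x. x))" by (rule lin_postcomp[OF lin_sub_incl[OF assms]])
  have "postcomp E (\<lambda>x. x) ` carrier (F (sub_module M H)) = carrier (F (sub_module M H))"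
    using postcomp_id[of _ "sub_module M H" "\<lambda>x. x"] by (auto simp: image_iff)
  then show ?thesis
    using submodule_image[OF l submodule_carrier[OF linD(1)[OF l]]] hom_set_cong_sub[OF assms, of E] by simp
qed

text \<open>The power of \<open>\<Gamma> = Hom(E,E)\<close> through which a map factors is taken in the form \<open>Hom(E,E\<^sup>n)\<close>.\<close>

lemma proj_summand_F_power:
  assumes "through \<Gamma> (regular \<Gamma>) P Q f" and P: "left_module \<Gamma> P" and Q: "left_module \<Gamma> Q"
  shows "\<exists>n a b. lin \<Gamma> P (F (power_module E n)) a \<and> lin \<Gamma> (F (power_module E n)) Q b \<and> (\<forall>x\<in>carrier P. f x = b (a x))"
  using assms(1)
proof induction
  case (zero f)
  let ?P = "F (power_module E 0)"
  have lP: "left_module \<Gamma> ?P" by (rule left_module_F[OF left_module_power[OF lE]])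
  show ?case
    by (rule exI[of _ 0], rule exI[of _ "\<lambda>_. \<zero>\<^bsub>?P\<^esub>"], rule exI[of _ "\<lambda>_. \<zero>\<^bsub>Q\<^esub>"])
      (use zero lin_0[OF P lP] lin_0[OF lP Q] in blast)
next
  case (step f p i g)
  obtain n a b where ab: "lin \<Gamma> P (F (power_module E n)) a" "lin \<Gamma> (F (power_module E n)) Q b"
    "\<And>x. x \<in> carrier P \<Longrightarrow> f x = b (a x)" using step.IH by blast
  let ?n = "power_module E n" and ?s = "power_module E (Suc n)"
  have ln: "left_module L ?n" by (rule left_module_power[OF lE])
  interpret E: abelian_group E using lE by (rule left_moduleD)
  let ?j = "\<lambda>x. x(n := \<zero>\<^bsub>E\<^esub>)" and ?k = "\<lambda>e. \<lambda>i\<in>{..<Suc n}. if i = n then e else \<zero>\<^bsub>E\<^esub>"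
  let ?r = "\<lambda>x. restrict x {..<n}" and ?e = "\<lambda>x. x n"
  have j: "lin L ?n ?s ?j" by (rule lin_power_extend[OF lin_id[OF ln] lin_0[OF ln lE]])
  have k: "lin L E ?s ?k" by (rule lin_power_unit[OF lE])
  have r: "lin L ?s ?n ?r" by (rule lin_power_restrict[OF lE])
  have e: "lin L ?s E ?e" by (rule lin_power_nth[OF lE]) simp
  have p: "lin \<Gamma> P (F E) p" and i: "lin \<Gamma> (F E) Q i" using step(2,3) by (simp_all only: lin_F_regular)
  let ?a = "\<lambda>x. postcomp E ?j (a x) \<oplus>\<^bsub>F ?s\<^esub> postcomp E ?k (p x)"
  let ?b = "\<lambda>h. b (postcomp E ?r h) \<oplus>\<^bsub>Q\<^esub> i (postcomp E ?e h)"
  have la: "lin \<Gamma> P (F ?s) ?a"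
    by (rule lin_plus[OF lin_compose[OF ab(1) lin_postcomp[OF j]] lin_compose[OF p lin_postcomp[OF k]]])
  have lb: "lin \<Gamma> (F ?s) Q ?b"
    by (rule lin_plus[OF lin_compose[OF lin_postcomp[OF r] ab(2)] lin_compose[OF lin_postcomp[OF e] i]])
  have "g x = ?b (?a x)" if x: "x \<in> carrier P" for x
  proof -
    have ax: "a x \<in> hom_set L E ?n" and px: "p x \<in> hom_set L E E" using linD(3)[OF ab(1) x] linD(3)[OF p x] by auto
    have sum: "?j y \<oplus>\<^bsub>?s\<^esub> ?k c = y(n := c)" if y: "y \<in> carrier ?n" and c: "c \<in> carrier E" for y c
    proof
      fix m
      have "y m \<in> carrier E" if "m < n" using y that PiE_mem[of y "{..<n}" "\<lambda>_. carrier E" m] by simp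
      moreover have "y m = undefined" if "\<not> m < n" using y that by (auto simp: PiE_def extensional_def)
      ultimately show "(?j y \<oplus>\<^bsub>?s\<^esub> ?k c) m = (y(n := c)) m" using c by (auto simp: restrict_def less_Suc_eq)
    qed
    have "postcomp E ?r (?a x) = a x"
    proof
      fix c show "postcomp E ?r (?a x) c = a x c"
      proof (cases "c \<in> carrier E")
        case True
        have y: "a x c \<in> carrier ?n" by (rule hom_set_closed[OF ax True])
        have "postcomp E ?r (?a x) c = ?r (?j (a x c) \<oplus>\<^bsub>?s\<^esub> ?k (p x c))"
          using True by (simp only: postcomp_eq Hom_module_simps restrict_apply')
        also have "\<dots> = ?r ((a x c)(n := p x c))" using sum[OF y hom_set_closed[OF px True]] by (simp only:)
        also have "\<dots> = ?r (a x c)" by (rule restrict_ext) simp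
        also have "\<dots> = a x c" using y by (simp add: PiE_def extensional_restrict)
        finally show ?thesis .
      qed (simp add: postcomp_eq hom_set_undefined[OF ax])
    qed
    moreover have "postcomp E ?e (?a x) = p x"
    proof
      fix c show "postcomp E ?e (?a x) c = p x c"
      proof (cases "c \<in> carrier E")
        case True
        have "postcomp E ?e (?a x) c = ?e (?j (a x c) \<oplus>\<^bsub>?s\<^esub> ?k (p x c))"
          using True by (simp only: postcomp_eq Hom_module_simps restrict_apply')
        also have "\<dots> = ?e ((a x c)(n := p x c))" using sum[OF hom_set_closed[OF ax True] hom_set_closed[OF px True]] by (simp only:)
        finally show ?thesis by simp
      qed (simp add: postcomp_eq hom_set_undefined[OF px])
    qed
    ultimately show ?thesis using step(4) x ab(3)[OF x] by (simp only:)
  qed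
  then show ?case using la lb by (intro exI[of _ "Suc n"] exI[of _ ?a] exI[of _ ?b]) blast
qed

text \<open>A projective module is a direct summand of some \<open>Hom(E,E\<^sup>n)\<close>; by full faithfulness the corresponding
  idempotent comes from an idempotent of \<open>E\<^sup>n\<close>, which splits.\<close>

lemma proj_is_F:
  assumes P: "proj \<Gamma> P"
  shows "\<exists>(Z :: ('k, 'a) fd_mod) u v. fg_module L Z \<and> addE L E Z \<and> iso_pair \<Gamma> P (F Z) u v"
proof -
  have lP: "left_module \<Gamma> P" by (rule addED(2)[OF P])
  obtain n a b where a: "lin \<Gamma> P (F (power_module E n)) a" and b: "lin \<Gamma> (F (power_module E n)) P b"
    and ba: "\<And>x. x \<in> carrier P \<Longrightarrow> x = b (a x)"
    using proj_summand_F_power[OF addED(3)[OF P] lP lP] by blast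
  let ?n = "power_module E n"
  have ln: "left_module L ?n" by (rule left_module_power[OF lE])
  obtain \<epsilon> where ep: "lin L ?n ?n \<epsilon>" "\<And>h. h \<in> hom_set L E ?n \<Longrightarrow> a (b h) = postcomp E \<epsilon> h"
    using F_full[OF ln ln lin_compose[OF b a]] by blast
  have ac: "a x \<in> hom_set L E ?n" if "x \<in> carrier P" for x using linD(3)[OF a that] by simp
  have bc: "b h \<in> carrier P" if "h \<in> hom_set L E ?n" for h using linD(3)[OF b, of h] that by simp
  have idem: "\<epsilon> (\<epsilon> y) = \<epsilon> y" if "y \<in> carrier ?n" for y
  proof (rule F_faithful[OF lin_compose[OF ep(1) ep(1)] ep(1) _ that])
    fix h e assume h: "h \<in> hom_set L E ?n" and e: "e \<in> carrier E"
    have "postcomp E \<epsilon> (postcomp E \<epsilon> h) = postcomp E \<epsilon> h"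
      using ep(2)[OF h] ep(2)[OF ac[OF bc[OF h]]] ba[OF bc[OF h]] by simp
    from fun_cong[OF this, of e] show "\<epsilon> (\<epsilon> (h e)) = \<epsilon> (h e)" using e by (simp add: postcomp_eq)
  qed
  let ?I = "\<epsilon> ` carrier ?n"
  have I: "submodule ?I L ?n" by (rule submodule_image[OF ep(1) submodule_carrier[OF ln]])
  let ?Z = "sub_module ?n ?I"
  have "lin L ?n ?Z \<epsilon>" by (rule lin_into_sub[OF ep(1) I]) simp
  then have "summand_pair L ?Z ?n (\<lambda>x. x) \<epsilon>"
    using lin_sub_incl[OF ln I] idem unfolding summand_pair_def by auto
  then have Z: "addE L E ?Z" by (rule addE_retract[OF _ addE_power[OF lE]])
  have S: "submodule {h \<in> hom_set L E ?n. h ` carrier E \<subseteq> ?I} \<Gamma> (F ?n)" by (rule submodule_F[OF ln I])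
  have "iso_pair \<Gamma> P (F ?Z) a b"
    unfolding iso_pair_def
  proof (intro conjI ballI)
    have ai: "a x ` carrier E \<subseteq> ?I" if x: "x \<in> carrier P" for x
    proof
      fix y assume "y \<in> a x ` carrier E"
      then obtain e where e: "e \<in> carrier E" "y = a x e" by auto
      have "a x = postcomp E \<epsilon> (a x)" using ep(2)[OF ac[OF x]] ba[OF x] by simp
      then have "y = \<epsilon> (a x e)" using fun_cong[of "a x" _ e] e by (metis postcomp_eq restrict_apply')
      then show "y \<in> ?I" using hom_set_closed[OF ac[OF x] e(1)] by blast
    qed
    show "lin \<Gamma> P (F ?Z) a"
      unfolding F_sub[OF ln I] by (rule lin_into_sub[OF a S]) (use ac ai in blast)
    show "lin \<Gamma> (F ?Z) P b"
      unfolding F_sub[OF ln I] by (rule lin_compose[OF lin_sub_incl[OF left_module_F[OF ln] S] b])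
    show "b (a x) = x" if "x \<in> carrier P" for x using ba[OF that] by simp
    fix h assume "h \<in> carrier (F ?Z)"
    then have h: "h \<in> hom_set L E ?n" "h ` carrier E \<subseteq> ?I" unfolding F_sub[OF ln I] by auto
    have "\<epsilon> (h e) = h e" if "e \<in> carrier E" for e using h(2) that idem by auto
    then have "postcomp E \<epsilon> h = h" unfolding postcomp_eq using hom_set_undefined[OF h(1)] by (auto simp: fun_eq_iff)
    then show "a (b h) = h" using ep(2)[OF h(1)] by simp
  qed
  moreover obtain Z' :: "('k, 'a) fd_mod" and c d where "fg_module L Z'" "iso_pair L ?Z Z' c d"
    using fd_copy[OF fd addE_fg[OF fgE Z]] by metis
  ultimately show ?thesis
    using iso_pair_trans[OF _ F_iso] addE_retract[OF iso_pair_retract(2) Z] by blast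
qed

end

section \<open>Transfer along \<open>Hom(E,-)\<close>\<close>

text \<open>In terms of \<^const>\<open>lin\<close> instead of extensional maps the condition can be transported along
  isomorphisms of the terms.\<close>

lemma exact_at_Hom_to_iff:
  assumes d0: "lin B Z0 Z1 d0" and d1: "lin B Z1 Z2 d1" and W: "left_module B W"
  shows "exact_at (Hom B Z2 W) (precomp Z1 d1) (Hom B Z1 W) (precomp Z0 d0) (Hom B Z0 W) \<longleftrightarrow>
    (\<forall>y. lin B Z1 W y \<longrightarrow> ((\<exists>\<psi>. lin B Z2 W \<psi> \<and> (\<forall>x\<in>carrier Z1. y x = \<psi> (d1 x))) \<longleftrightarrow>
      (\<forall>x\<in>carrier Z0. y (d0 x) = \<zero>\<^bsub>W\<^esub>)))" (is "?l \<longleftrightarrow> ?r")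
proof -
  note l0 = linD[OF d0] and l1 = linD[OF d1]
  have im: "restrict y (carrier Z1) \<in> precomp Z1 d1 ` hom_set B Z2 W \<longleftrightarrow>
    (\<exists>\<psi>. lin B Z2 W \<psi> \<and> (\<forall>x\<in>carrier Z1. y x = \<psi> (d1 x)))" if y: "lin B Z1 W y" for y
  proof
    assume "restrict y (carrier Z1) \<in> precomp Z1 d1 ` hom_set B Z2 W"
    then obtain \<psi> where p: "\<psi> \<in> hom_set B Z2 W" "restrict y (carrier Z1) = (\<lambda>x\<in>carrier Z1. \<psi> (d1 x))"
      by (auto simp: precomp_eq)
    have "y x = \<psi> (d1 x)" if "x \<in> carrier Z1" for x using fun_cong[OF p(2), of x] that by simp
    then show "\<exists>\<psi>. lin B Z2 W \<psi> \<and> (\<forall>x\<in>carrier Z1. y x = \<psi> (d1 x))" using hom_set_lin[OF p(1) l1(2) W] by blast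
  next
    assume "\<exists>\<psi>. lin B Z2 W \<psi> \<and> (\<forall>x\<in>carrier Z1. y x = \<psi> (d1 x))"
    then obtain \<psi> where p: "lin B Z2 W \<psi>" "\<And>x. x \<in> carrier Z1 \<Longrightarrow> y x = \<psi> (d1 x)" by blast
    have "restrict y (carrier Z1) = precomp Z1 d1 (restrict \<psi> (carrier Z2))"
      unfolding precomp_eq by (rule restrict_ext) (use p(2) l1(3) in simp)
    then show "restrict y (carrier Z1) \<in> precomp Z1 d1 ` hom_set B Z2 W" using lin_hom_set[OF p(1)] by blast
  qed
  have ker: "precomp Z0 d0 (restrict y (carrier Z1)) = \<zero>\<^bsub>Hom B Z0 W\<^esub> \<longleftrightarrow> (\<forall>x\<in>carrier Z0. y (d0 x) = \<zero>\<^bsub>W\<^esub>)" for y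
  proof
    assume e: "precomp Z0 d0 (restrict y (carrier Z1)) = \<zero>\<^bsub>Hom B Z0 W\<^esub>"
    show "\<forall>x\<in>carrier Z0. y (d0 x) = \<zero>\<^bsub>W\<^esub>"
    proof
      fix x assume "x \<in> carrier Z0"
      then show "y (d0 x) = \<zero>\<^bsub>W\<^esub>" using fun_cong[OF e, of x] l0(3) by (simp add: precomp_eq Hom_simps)
    qed
  next
    assume "\<forall>x\<in>carrier Z0. y (d0 x) = \<zero>\<^bsub>W\<^esub>"
    then show "precomp Z0 d0 (restrict y (carrier Z1)) = \<zero>\<^bsub>Hom B Z0 W\<^esub>"
      unfolding precomp_eq Hom_simps by (intro restrict_ext) (use l0(3) in simp)
  qed
  have sub: "precomp Z1 d1 ` hom_set B Z2 W \<subseteq> hom_set B Z1 W"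
    unfolding precomp_eq using lin_hom_set[OF lin_compose[OF d1 hom_set_lin[OF _ l1(2) W]]] by blast
  show ?thesis
  proof
    assume l: ?l
    show ?r
    proof (intro allI impI)
      fix y assume y: "lin B Z1 W y"
      have "restrict y (carrier Z1) \<in> precomp Z1 d1 ` hom_set B Z2 W \<longleftrightarrow>
        restrict y (carrier Z1) \<in> {y \<in> hom_set B Z1 W. precomp Z0 d0 y = \<zero>\<^bsub>Hom B Z0 W\<^esub>}"
        using l unfolding exact_at_def by (simp only:)
      then show "(\<exists>\<psi>. lin B Z2 W \<psi> \<and> (\<forall>x\<in>carrier Z1. y x = \<psi> (d1 x))) \<longleftrightarrow> (\<forall>x\<in>carrier Z0. y (d0 x) = \<zero>\<^bsub>W\<^esub>)"
        using im[OF y] ker[of y] lin_hom_set[OF y] by blast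
    qed
  next
    assume r: ?r
    have "y \<in> precomp Z1 d1 ` hom_set B Z2 W \<longleftrightarrow> precomp Z0 d0 y = \<zero>\<^bsub>Hom B Z0 W\<^esub>" if y: "y \<in> hom_set B Z1 W" for y
    proof -
      have ly: "lin B Z1 W y" by (rule hom_set_lin[OF y l0(2) W])
      show ?thesis using im[OF ly] ker[of y] r ly unfolding hom_set_restrict[OF y] by blast
    qed
    then show ?l unfolding exact_at_def using sub by blast
  qed
qed

text \<open>The image in degree one defines an \<open>E\<close>-Gorenstein projective module, but the image in degree zero a
  Gorenstein projective module; shifting reconciles the two conventions.\<close>

lemma complex_shift:
  shows "exact_sequence R Z d \<Longrightarrow> exact_sequence R (\<lambda>i. Z (i + k)) (\<lambda>i. d (i + k))"
    and "exact_under_Hom_to R Z d W \<Longrightarrow> exact_under_Hom_to R (\<lambda>i. Z (i + k)) (\<lambda>i. d (i + k)) W"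
    and "exact_under_Hom_from R Z d W \<Longrightarrow> exact_under_Hom_from R (\<lambda>i. Z (i + k)) (\<lambda>i. d (i + k)) W"
proof -
  have a: "i + 1 + k = i + k + 1" "i + 2 + k = i + k + 2" for i by simp_all
  show "exact_sequence R Z d \<Longrightarrow> exact_sequence R (\<lambda>i. Z (i + k)) (\<lambda>i. d (i + k))"
    unfolding exact_sequence_def a by blast
  show "exact_under_Hom_to R Z d W \<Longrightarrow> exact_under_Hom_to R (\<lambda>i. Z (i + k)) (\<lambda>i. d (i + k)) W"
    unfolding exact_under_Hom_to_def a by blast
  show "exact_under_Hom_from R Z d W \<Longrightarrow> exact_under_Hom_from R (\<lambda>i. Z (i + k)) (\<lambda>i. d (i + k)) W"
    unfolding exact_under_Hom_from_def a by blast
qed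

lemma rmin_iso:
  assumes P: "rmin A P f" and i: "iso_pair A P Q b c"
    and k: "\<And>x y. x \<in> carrier Q \<Longrightarrow> y \<in> carrier Q \<Longrightarrow> f' x = f' y \<Longrightarrow> f (c x) = f (c y)"
  shows "rmin A Q f'"
  unfolding rmin_def
proof (intro allI impI)
  fix h assume h: "lin A Q Q h" and e: "\<forall>x\<in>carrier Q. f' (h x) = f' x"
  note I = iso_pairD[OF i]
  let ?h = "\<lambda>x. c (h (b x))"
  have "lin A P P ?h" by (rule lin_compose[OF lin_compose[OF I(1) h] I(2)])
  moreover have "f (?h x) = f x" if x: "x \<in> carrier P" for x
    using k[OF linD(3)[OF h linD(3)[OF I(1) x]] linD(3)[OF I(1) x]] e linD(3)[OF I(1) x] I(3)[OF x] by simp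
  ultimately have b: "bij_betw ?h (carrier P) (carrier P)" using P by (auto simp: rmin_def)
  have "bij_betw (\<lambda>x. b (?h (c x))) (carrier Q) (carrier Q)"
    using bij_betw_trans[OF bij_betw_trans[OF iso_pair_bij[OF iso_pair_sym[OF i]] b] iso_pair_bij[OF i]]
    by (simp add: comp_def)
  then show "bij_betw h (carrier Q) (carrier Q)"
    by (rule bij_betw_cong[THEN iffD1, rotated]) (use I(4) linD(3)[OF h] in simp)
qed

context generator_context
begin

text \<open>In the following lemmas the maps \<open>\<delta>\<close> between \<open>\<Gamma>\<close>-modules correspond to \<open>Hom(E,d)\<close> under chosen
  isomorphisms \<open>c\<close>, which allow the terms to be arbitrary models of the modules \<open>Hom(E,Z)\<close>.\<close>

lemma F_image:
  assumes i0: "iso_pair \<Gamma> (F Z0) P0 c0 b0"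
    and e0: "\<And>h. h \<in> hom_set L E Z0 \<Longrightarrow> \<delta>0 (c0 h) = c1 (postcomp E d0 h)"
  shows "\<delta>0 ` carrier P0 = c1 ` postcomp E d0 ` hom_set L E Z0"
proof -
  have "c0 ` hom_set L E Z0 = carrier P0" using iso_pair_bij[OF i0] by (simp add: bij_betw_def)
  then show ?thesis unfolding image_image using e0 by (metis (no_types, lifting) image_cong image_image)
qed

lemma exact_at_F_iff:
  assumes d0: "lin L Z0 Z1 d0" and d1: "lin L Z1 Z2 d1"
    and i0: "iso_pair \<Gamma> (F Z0) P0 c0 b0" and i1: "iso_pair \<Gamma> (F Z1) P1 c1 b1" and i2: "iso_pair \<Gamma> (F Z2) P2 c2 b2"
    and e0: "\<And>h. h \<in> hom_set L E Z0 \<Longrightarrow> \<delta>0 (c0 h) = c1 (postcomp E d0 h)"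
    and e1: "\<And>h. h \<in> hom_set L E Z1 \<Longrightarrow> \<delta>1 (c1 h) = c2 (postcomp E d1 h)"
  shows "exact_at (Hom L E Z0) (postcomp E d0) (Hom L E Z1) (postcomp E d1) (Hom L E Z2) \<longleftrightarrow> exact_at P0 \<delta>0 P1 \<delta>1 P2"
proof -
  have im: "c0 ` hom_set L E Z0 = carrier P0" "c1 ` hom_set L E Z1 = carrier P1" "inj_on c1 (hom_set L E Z1)"
    using iso_pair_bij[OF i0] iso_pair_bij[OF i1] by (auto simp: bij_betw_def)
  have pc0: "postcomp E d0 h \<in> hom_set L E Z1" if "h \<in> hom_set L E Z0" for h
    using linD(3)[OF lin_postcomp[OF d0], of h] that by simp
  have pc1: "postcomp E d1 h \<in> hom_set L E Z2" if "h \<in> hom_set L E Z1" for h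
    using linD(3)[OF lin_postcomp[OF d1], of h] that by simp
  have A: "\<delta>0 ` carrier P0 = c1 ` postcomp E d0 ` hom_set L E Z0" by (rule F_image[OF i0]) (rule e0)
  have z: "\<delta>1 (c1 h) = \<zero>\<^bsub>P2\<^esub> \<longleftrightarrow> postcomp E d1 h = \<zero>\<^bsub>F Z2\<^esub>" if h: "h \<in> hom_set L E Z1" for h
  proof -
    have "b2 (c2 (postcomp E d1 h)) = postcomp E d1 h" using iso_pairD(3)[OF i2] pc1[OF h] by simp
    then show ?thesis unfolding e1[OF h] using lin_zero[OF iso_pairD(1)[OF i2]] lin_zero[OF iso_pairD(2)[OF i2]] by metis
  qed
  have B: "{y \<in> carrier P1. \<delta>1 y = \<zero>\<^bsub>P2\<^esub>} = c1 ` {h \<in> hom_set L E Z1. postcomp E d1 h = \<zero>\<^bsub>F Z2\<^esub>}"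
  proof (intro equalityI subsetI)
    fix y assume y: "y \<in> {y \<in> carrier P1. \<delta>1 y = \<zero>\<^bsub>P2\<^esub>}"
    then obtain h where "h \<in> hom_set L E Z1" "y = c1 h" using im(2) by blast
    then show "y \<in> c1 ` {h \<in> hom_set L E Z1. postcomp E d1 h = \<zero>\<^bsub>F Z2\<^esub>}" using y z by blast
  next
    fix y assume "y \<in> c1 ` {h \<in> hom_set L E Z1. postcomp E d1 h = \<zero>\<^bsub>F Z2\<^esub>}"
    then obtain h where "h \<in> hom_set L E Z1" "y = c1 h" "postcomp E d1 h = \<zero>\<^bsub>F Z2\<^esub>" by blast
    then show "y \<in> {y \<in> carrier P1. \<delta>1 y = \<zero>\<^bsub>P2\<^esub>}" using im(2) z by blast
  qed
  have C: "postcomp E d0 ` hom_set L E Z0 \<subseteq> hom_set L E Z1" using pc0 by blast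
  show "exact_at (Hom L E Z0) (postcomp E d0) (Hom L E Z1) (postcomp E d1) (Hom L E Z2) \<longleftrightarrow> exact_at P0 \<delta>0 P1 \<delta>1 P2"
    unfolding exact_at_def A B
    using inj_on_image_eq_iff[OF im(3) C, of "{h \<in> hom_set L E Z1. postcomp E d1 h = \<zero>\<^bsub>F Z2\<^esub>}"]
    by (simp add: Hom_simps)
qed

text \<open>By full faithfulness \<open>Hom(Z,E) = Hom(F Z, F E)\<close>, naturally in \<open>Z\<close>, and \<open>F E\<close> is the regular module.\<close>

lemma exact_at_Hom_F_iff:
  assumes d0: "lin L Z0 Z1 d0" and d1: "lin L Z1 Z2 d1" and \<delta>0: "lin \<Gamma> P0 P1 \<delta>0" and \<delta>1: "lin \<Gamma> P1 P2 \<delta>1"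
    and i0: "iso_pair \<Gamma> (F Z0) P0 c0 b0" and i1: "iso_pair \<Gamma> (F Z1) P1 c1 b1" and i2: "iso_pair \<Gamma> (F Z2) P2 c2 b2"
    and e0: "\<And>h. h \<in> hom_set L E Z0 \<Longrightarrow> \<delta>0 (c0 h) = c1 (postcomp E d0 h)"
    and e1: "\<And>h. h \<in> hom_set L E Z1 \<Longrightarrow> \<delta>1 (c1 h) = c2 (postcomp E d1 h)"
  shows "exact_at (Hom L Z2 E) (precomp Z1 d1) (Hom L Z1 E) (precomp Z0 d0) (Hom L Z0 E) \<longleftrightarrow>
    exact_at (Hom \<Gamma> P2 (regular \<Gamma>)) (precomp P1 \<delta>1) (Hom \<Gamma> P1 (regular \<Gamma>)) (precomp P0 \<delta>0) (Hom \<Gamma> P0 (regular \<Gamma>))"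
proof -
  note lZ = linD(1)[OF d0] linD(1)[OF d1] linD(2)[OF d1]
  note I0 = iso_pairD[OF i0] and I1 = iso_pairD[OF i1] and I2 = iso_pairD[OF i2]
  have pc: "postcomp E d0 h \<in> hom_set L E Z1" if "h \<in> hom_set L E Z0" for h
    using linD(3)[OF lin_postcomp[OF d0], of h] that by simp
  have pc1: "postcomp E d1 h \<in> hom_set L E Z2" if "h \<in> hom_set L E Z1" for h
    using linD(3)[OF lin_postcomp[OF d1], of h] that by simp
  have cond0: "(\<forall>x\<in>carrier P0. \<eta> (\<delta>0 x) = \<zero>\<^bsub>F E\<^esub>) \<longleftrightarrow> (\<forall>x\<in>carrier Z0. y (d0 x) = \<zero>\<^bsub>E\<^esub>)"
    if y: "lin L Z1 E y" and ey: "\<And>h. h \<in> hom_set L E Z1 \<Longrightarrow> \<eta> (c1 h) = postcomp E y h" for y \<eta>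
  proof -
    have 1: "\<eta> (\<delta>0 (c0 h)) = postcomp E (\<lambda>x. y (d0 x)) h" if "h \<in> hom_set L E Z0" for h
      using e0[OF that] ey[OF pc[OF that]] postcomp_compose[OF that, of y d0] by simp
    show ?thesis
    proof
      assume z: "\<forall>x\<in>carrier P0. \<eta> (\<delta>0 x) = \<zero>\<^bsub>F E\<^esub>"
      show "\<forall>x\<in>carrier Z0. y (d0 x) = \<zero>\<^bsub>E\<^esub>"
      proof
        fix x assume x: "x \<in> carrier Z0"
        show "y (d0 x) = \<zero>\<^bsub>E\<^esub>"
        proof (rule F_faithful[OF lin_compose[OF d0 y] lin_0[OF lZ(1) lE] _ x])
          fix h e assume h: "h \<in> hom_set L E Z0" and e: "e \<in> carrier E"
          have "postcomp E (\<lambda>x. y (d0 x)) h = \<zero>\<^bsub>F E\<^esub>" using 1[OF h] z linD(3)[OF I0(1), of h] h by simp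
          from fun_cong[OF this, of e] show "y (d0 (h e)) = \<zero>\<^bsub>E\<^esub>" using e by (simp add: postcomp_eq)
        qed
      qed
    next
      assume z: "\<forall>x\<in>carrier Z0. y (d0 x) = \<zero>\<^bsub>E\<^esub>"
      show "\<forall>x\<in>carrier P0. \<eta> (\<delta>0 x) = \<zero>\<^bsub>F E\<^esub>"
      proof
        fix x assume x: "x \<in> carrier P0"
        have h: "b0 x \<in> hom_set L E Z0" using linD(3)[OF I0(2) x] by simp
        have "postcomp E (\<lambda>x. y (d0 x)) (b0 x) = \<zero>\<^bsub>F E\<^esub>"
          unfolding postcomp_eq Hom_module_simps by (rule restrict_ext) (use z hom_set_closed[OF h] in simp)
        then show "\<eta> (\<delta>0 x) = \<zero>\<^bsub>F E\<^esub>" using 1[OF h] I0(4)[OF x] by simp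
      qed
    qed
  qed
  have cond1: "(\<exists>\<chi>. lin \<Gamma> P2 (F E) \<chi> \<and> (\<forall>x\<in>carrier P1. \<eta> x = \<chi> (\<delta>1 x))) \<longleftrightarrow>
      (\<exists>\<psi>. lin L Z2 E \<psi> \<and> (\<forall>x\<in>carrier Z1. y x = \<psi> (d1 x)))"
    if y: "lin L Z1 E y" and ey: "\<And>h. h \<in> hom_set L E Z1 \<Longrightarrow> \<eta> (c1 h) = postcomp E y h" for y \<eta>
  proof
    assume "\<exists>\<chi>. lin \<Gamma> P2 (F E) \<chi> \<and> (\<forall>x\<in>carrier P1. \<eta> x = \<chi> (\<delta>1 x))"
    then obtain \<chi> where x: "lin \<Gamma> P2 (F E) \<chi>" "\<And>x. x \<in> carrier P1 \<Longrightarrow> \<eta> x = \<chi> (\<delta>1 x)" by blast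
    obtain \<psi> where p: "lin L Z2 E \<psi>" "\<And>h. h \<in> hom_set L E Z2 \<Longrightarrow> \<chi> (c2 h) = postcomp E \<psi> h"
      using F_full[OF lZ(3) lE lin_compose[OF I2(1) x(1)]] by blast
    have "y w = \<psi> (d1 w)" if w: "w \<in> carrier Z1" for w
    proof (rule F_faithful[OF y lin_compose[OF d1 p(1)] _ w])
      fix h e assume h: "h \<in> hom_set L E Z1" and e: "e \<in> carrier E"
      have "postcomp E y h = postcomp E (\<lambda>x. \<psi> (d1 x)) h"
        using ey[OF h] x(2)[of "c1 h"] linD(3)[OF I1(1), of h] h e1[OF h] p(2)[OF pc1[OF h]] postcomp_compose[OF h, of \<psi> d1] by simp
      from fun_cong[OF this, of e] show "y (h e) = \<psi> (d1 (h e))" using e by (simp add: postcomp_eq)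
    qed
    then show "\<exists>\<psi>. lin L Z2 E \<psi> \<and> (\<forall>x\<in>carrier Z1. y x = \<psi> (d1 x))" using p(1) by blast
  next
    assume "\<exists>\<psi>. lin L Z2 E \<psi> \<and> (\<forall>x\<in>carrier Z1. y x = \<psi> (d1 x))"
    then obtain \<psi> where p: "lin L Z2 E \<psi>" "\<And>x. x \<in> carrier Z1 \<Longrightarrow> y x = \<psi> (d1 x)" by blast
    have "\<eta> x = postcomp E \<psi> (b2 (\<delta>1 x))" if x: "x \<in> carrier P1" for x
    proof -
      have h: "b1 x \<in> hom_set L E Z1" using linD(3)[OF I1(2) x] by simp
      have "postcomp E y (b1 x) = postcomp E (\<lambda>x. \<psi> (d1 x)) (b1 x)"
        unfolding postcomp_eq by (rule restrict_ext) (use p(2) hom_set_closed[OF h] in simp)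
      moreover have "b2 (\<delta>1 x) = postcomp E d1 (b1 x)"
        using e1[OF h] I1(4)[OF x] I2(3)[of "postcomp E d1 (b1 x)"] pc1[OF h] by simp
      ultimately show ?thesis using ey[OF h] I1(4)[OF x] postcomp_compose[OF h, of \<psi> d1] by simp
    qed
    then show "\<exists>\<chi>. lin \<Gamma> P2 (F E) \<chi> \<and> (\<forall>x\<in>carrier P1. \<eta> x = \<chi> (\<delta>1 x))"
      using lin_compose[OF I2(2) lin_postcomp[OF p(1)]] by blast
  qed
  have toL: "\<exists>y. lin L Z1 E y \<and> (\<forall>h\<in>hom_set L E Z1. \<eta> (c1 h) = postcomp E y h)" if "lin \<Gamma> P1 (F E) \<eta>" for \<eta>
    using F_full[OF lZ(2) lE lin_compose[OF I1(1) that]] .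
  have to\<Gamma>: "\<exists>\<eta>. lin \<Gamma> P1 (F E) \<eta> \<and> (\<forall>h\<in>hom_set L E Z1. \<eta> (c1 h) = postcomp E y h)" if "lin L Z1 E y" for y
    using lin_compose[OF I1(2) lin_postcomp[OF that]] I1(3) by (intro exI[of _ "\<lambda>x. postcomp E y (b1 x)"]) simp
  have z: "\<zero>\<^bsub>regular \<Gamma>\<^esub> = \<zero>\<^bsub>F E\<^esub>" by (rule F_regular(2))
  let ?A = "\<lambda>y. (\<exists>\<psi>. lin L Z2 E \<psi> \<and> (\<forall>x\<in>carrier Z1. y x = \<psi> (d1 x))) = (\<forall>x\<in>carrier Z0. y (d0 x) = \<zero>\<^bsub>E\<^esub>)"
  let ?B = "\<lambda>\<eta>. (\<exists>\<chi>. lin \<Gamma> P2 (F E) \<chi> \<and> (\<forall>x\<in>carrier P1. \<eta> x = \<chi> (\<delta>1 x))) = (\<forall>x\<in>carrier P0. \<eta> (\<delta>0 x) = \<zero>\<^bsub>F E\<^esub>)"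
  have match: "?B \<eta> = ?A y" if "lin L Z1 E y" "\<And>h. h \<in> hom_set L E Z1 \<Longrightarrow> \<eta> (c1 h) = postcomp E y h" for y \<eta>
    by (simp only: cond0[OF that] cond1[OF that])
  have "(\<forall>y. lin L Z1 E y \<longrightarrow> ?A y) = (\<forall>\<eta>. lin \<Gamma> P1 (F E) \<eta> \<longrightarrow> ?B \<eta>)"
  proof (rule iffI; intro allI impI)
    fix \<eta> assume H: "\<forall>y. lin L Z1 E y \<longrightarrow> ?A y" and "lin \<Gamma> P1 (F E) \<eta>"
    then obtain y where y: "lin L Z1 E y" "\<And>h. h \<in> hom_set L E Z1 \<Longrightarrow> \<eta> (c1 h) = postcomp E y h" using toL by blast
    show "?B \<eta>" by (rule iffD2[OF match[OF y] mp[OF spec[OF H] y(1)]])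
  next
    fix y assume H: "\<forall>\<eta>. lin \<Gamma> P1 (F E) \<eta> \<longrightarrow> ?B \<eta>" and y: "lin L Z1 E y"
    obtain \<eta> where e: "lin \<Gamma> P1 (F E) \<eta>" "\<And>h. h \<in> hom_set L E Z1 \<Longrightarrow> \<eta> (c1 h) = postcomp E y h"
      using to\<Gamma>[OF y] by blast
    show "?A y" by (rule iffD1[OF match[OF y e(2)] mp[OF spec[OF H] e(1)]])
  qed
  then show ?thesis
    unfolding exact_at_Hom_to_iff[OF d0 d1 lE] exact_at_Hom_to_iff[OF \<delta>0 \<delta>1 left_module_regular[OF ring_\<Gamma>]] lin_F_regular z .
qed

text \<open>The image of a map in an exact, \<open>Hom(E,-)\<close>-exact sequence is a kernel, so its image under the left
  exact functor is the corresponding image over \<open>\<Gamma>\<close>.\<close>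

lemma F_syzygy:
  assumes d0: "lin L Z0 Z1 d0" and d1: "lin L Z1 Z2 d1"
    and i1: "iso_pair \<Gamma> (F Z1) P1 c1 b1"
    and e0: "\<delta>0 ` carrier P0 = c1 ` postcomp E d0 ` hom_set L E Z0" and \<delta>0: "lin \<Gamma> P0 P1 \<delta>0"
    and ex: "exact_at Z0 d0 Z1 d1 Z2"
    and exF: "exact_at (Hom L E Z0) (postcomp E d0) (Hom L E Z1) (postcomp E d1) (Hom L E Z2)"
  shows "\<exists>u v. iso_pair \<Gamma> (F (sub_module Z1 (d0 ` carrier Z0))) (sub_module P1 (\<delta>0 ` carrier P0)) u v"
proof -
  note lZ = linD(1)[OF d0] linD(1)[OF d1]
  let ?I = "d0 ` carrier Z0"
  have I: "submodule ?I L Z1" by (rule submodule_image[OF d0 submodule_carrier[OF lZ(1)]])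
  have S: "submodule (\<delta>0 ` carrier P0) \<Gamma> P1" by (rule submodule_image[OF \<delta>0 submodule_carrier[OF linD(1)[OF \<delta>0]]])
  let ?H = "{h \<in> hom_set L E Z1. h ` carrier E \<subseteq> ?I}"
  have "{y \<in> carrier Z1. d1 y = \<zero>\<^bsub>Z2\<^esub>} = ?I" using ex by (simp add: exact_at_def)
  then have "postcomp E d1 h = \<zero>\<^bsub>Hom L E Z2\<^esub> \<longleftrightarrow> h ` carrier E \<subseteq> ?I" if "h \<in> hom_set L E Z1" for h
    using kernel_F[of h Z1 d1 Z2 ?I] that by (simp add: Hom_simps)
  then have H: "?H = postcomp E d0 ` hom_set L E Z0" using exF unfolding exact_at_def by blast
  have FS: "F (sub_module Z1 ?I) = sub_module (F Z1) ?H" by (rule F_sub[OF lZ(2) I])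
  have sH: "submodule ?H \<Gamma> (F Z1)" by (rule submodule_F[OF lZ(2) I])
  have l: "lin \<Gamma> (F (sub_module Z1 ?I)) (sub_module P1 (\<delta>0 ` carrier P0)) c1"
    unfolding FS
    by (rule lin_into_sub[OF lin_compose[OF lin_sub_incl[OF left_module_F[OF lZ(2)] sH] iso_pairD(1)[OF i1]] S])
      (simp add: e0 H)
  have "inj_on c1 ?H" by (rule inj_on_subset[of _ "hom_set L E Z1"]) (use iso_pair_bij[OF i1] in \<open>auto simp: bij_betw_def\<close>)
  then have "bij_betw c1 (carrier (F (sub_module Z1 ?I))) (carrier (sub_module P1 (\<delta>0 ` carrier P0)))"
    unfolding FS bij_betw_def by (simp add: e0 H)
  then show ?thesis using bij_iso_pair[OF l] by blast
qed

text \<open>Applying the functor to a sequence in \<open>add E\<close> gives a complex of projective modules.  It is exact since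
  the sequence is exact under \<open>Hom(E,-)\<close>, and exact under \<open>Hom(-,\<Gamma>)\<close> since the sequence is exact under
  \<open>Hom(-,E)\<close>.\<close>

lemma E_gorenstein_projective_imp:
  fixes M :: "('k, 'a) fd_mod" and N :: "('k, 'e \<Rightarrow> 'e) fd_mod"
  assumes M: "E_gorenstein_projective L E M" and N: "fg_module \<Gamma> N" and i: "iso_pair \<Gamma> N (F M) u v"
  shows "gorenstein_projective \<Gamma> N"
proof -
  have fgM: "fg_module L M" using M by (simp add: E_gorenstein_projective_def)
  obtain Z :: "int \<Rightarrow> ('k, 'a) fd_mod" and d where Z: "\<And>i. in_add L E (Z i)" and ex: "exact_sequence L Z d"
    and to: "exact_under_Hom_to L Z d E" and fro: "exact_under_Hom_from L Z d E"
    and iso: "lmod_iso L M (sub_module (Z 1) (d 0 ` carrier (Z 0)))"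
    using M unfolding E_gorenstein_projective_def by blast
  have Z': "fg_module L (Z i)" "addE L E (Z i)" for i using Z in_add_iff[OF lE, of "Z i"] by auto
  note lZ = fg_left[OF Z'(1)]
  have d: "lin L (Z i) (Z (i + 1)) (d i)" for i by (rule hom_set_lin[OF _ lZ lZ]) (use ex in \<open>simp add: exact_sequence_def\<close>)
  have d2: "lin L (Z (i + 1)) (Z (i + 2)) (d (i + 1))" for i using d[of "i + 1"] by (simp add: add.assoc)
  have "\<exists>(P :: ('k, 'e \<Rightarrow> 'e) fd_mod) c b. fg_module \<Gamma> P \<and> iso_pair \<Gamma> (F (Z i)) P c b" for i
    using fd_copy[OF fd_\<Gamma> fg_F[OF Z'(1)[of i]]] by metis
  then obtain P :: "int \<Rightarrow> ('k, 'e \<Rightarrow> 'e) fd_mod" and c b where P: "\<And>i. fg_module \<Gamma> (P i)"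
    and cb: "\<And>i. iso_pair \<Gamma> (F (Z i)) (P i) (c i) (b i)" by metis
  define \<delta> where "\<delta> i = restrict (\<lambda>x. c (i + 1) (postcomp E (d i) (b i x))) (carrier (P i))" for i
  have dl: "lin \<Gamma> (P i) (P (i + 1)) (\<lambda>x. c (i + 1) (postcomp E (d i) (b i x)))" for i
    by (rule lin_compose[OF lin_compose[OF iso_pairD(2)[OF cb] lin_postcomp[OF d]] iso_pairD(1)[OF cb]])
  have \<delta>h: "\<delta> i \<in> hom_set \<Gamma> (P i) (P (i + 1))" for i unfolding \<delta>_def by (rule lin_hom_set[OF dl])
  have \<delta>l: "lin \<Gamma> (P i) (P (i + 1)) (\<delta> i)" for i unfolding \<delta>_def by (rule lin_restrict[OF dl])
  have \<delta>l2: "lin \<Gamma> (P (i + 1)) (P (i + 2)) (\<delta> (i + 1))" for i using \<delta>l[of "i + 1"] by (simp add: add.assoc)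
  have e: "\<delta> i (c i h) = c (i + 1) (postcomp E (d i) h)" if "h \<in> hom_set L E (Z i)" for i h
    using iso_pairD(3)[OF cb, of h i] linD(3)[OF iso_pairD(1)[OF cb], of h i] that by (simp add: \<delta>_def)
  have e2: "\<delta> (i + 1) (c (i + 1) h) = c (i + 2) (postcomp E (d (i + 1)) h)" if "h \<in> hom_set L E (Z (i + 1))" for i h
    using e[OF that] by (simp add: add.assoc)
  have fromi: "exact_at (Hom L E (Z i)) (postcomp E (d i)) (Hom L E (Z (i + 1))) (postcomp E (d (i + 1))) (Hom L E (Z (i + 2)))" for i
    using fro by (simp add: exact_under_Hom_from_def)
  have exi: "exact_at (P i) (\<delta> i) (P (i + 1)) (\<delta> (i + 1)) (P (i + 2))" for i
  proof -
    have "exact_at (Hom L E (Z i)) (postcomp E (d i)) (Hom L E (Z (i + 1))) (postcomp E (d (i + 1))) (Hom L E (Z (i + 2))) \<longleftrightarrow>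
      exact_at (P i) (\<delta> i) (P (i + 1)) (\<delta> (i + 1)) (P (i + 2))"
      by (rule exact_at_F_iff[OF d[of i] d2[of i] cb[of i] cb[of "i + 1"] cb[of "i + 2"]]) (rule e e2; assumption)+
    then show ?thesis using fromi by blast
  qed
  have toi: "exact_at (Hom \<Gamma> (P (i + 2)) (regular \<Gamma>)) (precomp (P (i + 1)) (\<delta> (i + 1)))
      (Hom \<Gamma> (P (i + 1)) (regular \<Gamma>)) (precomp (P i) (\<delta> i)) (Hom \<Gamma> (P i) (regular \<Gamma>))" for i
  proof -
    have "exact_at (Hom L (Z (i + 2)) E) (precomp (Z (i + 1)) (d (i + 1))) (Hom L (Z (i + 1)) E) (precomp (Z i) (d i)) (Hom L (Z i) E) \<longleftrightarrow>
      exact_at (Hom \<Gamma> (P (i + 2)) (regular \<Gamma>)) (precomp (P (i + 1)) (\<delta> (i + 1)))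
      (Hom \<Gamma> (P (i + 1)) (regular \<Gamma>)) (precomp (P i) (\<delta> i)) (Hom \<Gamma> (P i) (regular \<Gamma>))"
      by (rule exact_at_Hom_F_iff[OF d[of i] d2[of i] \<delta>l[of i] \<delta>l2[of i] cb[of i] cb[of "i + 1"] cb[of "i + 2"]]) (rule e e2; assumption)+
    then show ?thesis using to by (simp add: exact_under_Hom_to_def)
  qed
  have exP: "exact_sequence \<Gamma> P \<delta>" using \<delta>h exi by (simp add: exact_sequence_def)
  have toP: "exact_under_Hom_to \<Gamma> P \<delta> (regular \<Gamma>)" using toi by (simp add: exact_under_Hom_to_def)
  have proj: "fg_projective \<Gamma> (P i)" for i
    unfolding fg_projective_iff[OF fd_\<Gamma>]
    using P addE_retract[OF iso_pair_retract(2)[OF cb[of i]]] F_proj_iff[OF lZ[of i]] Z'(2) by blast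
  have ex0: "exact_at (Z 0) (d 0) (Z 1) (d 1) (Z 2)"
    using ex by (auto simp: exact_sequence_def dest!: spec[of _ 0])
  have d0: "lin L (Z 0) (Z 1) (d 0)" "lin L (Z 1) (Z 2) (d 1)" "lin \<Gamma> (P 0) (P 1) (\<delta> 0)"
    using d[of 0] d2[of 0] \<delta>l[of 0] by auto
  have im0: "\<delta> 0 ` carrier (P 0) = c 1 ` postcomp E (d 0) ` hom_set L E (Z 0)"
    by (rule F_image[OF cb]) (use e[of _ 0] in simp)
  have f0: "exact_at (Hom L E (Z 0)) (postcomp E (d 0)) (Hom L E (Z 1)) (postcomp E (d 1)) (Hom L E (Z 2))"
    using fromi[of 0] by simp
  obtain s t where st: "iso_pair \<Gamma> (F (sub_module (Z 1) (d 0 ` carrier (Z 0)))) (sub_module (P 1) (\<delta> 0 ` carrier (P 0))) s t"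
    using F_syzygy[OF d0(1,2) cb im0 d0(3) ex0 f0] by blast
  have lI: "left_module L (sub_module (Z 1) (d 0 ` carrier (Z 0)))"
    by (rule left_module_sub[OF lZ submodule_image[OF d0(1) submodule_carrier[OF lZ]]])
  obtain q r where "iso_pair L M (sub_module (Z 1) (d 0 ` carrier (Z 0))) q r"
    using iso lmod_iso_iff[OF fg_left[OF fgM] lI] by blast
  then have "\<exists>f g. iso_pair \<Gamma> N (sub_module (P 1) (\<delta> 0 ` carrier (P 0))) f g"
    using iso_pair_trans[OF iso_pair_trans[OF i F_iso] st] by blast
  then have "lmod_iso \<Gamma> N (sub_module (P 1) (\<delta> 0 ` carrier (P 0)))"
    using lmod_iso_iff[OF fg_left[OF N] linD(2)[OF iso_pairD(1)[OF st]]] by blast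
  then show ?thesis
    unfolding gorenstein_projective_def
    using N proj complex_shift(1)[OF exP, of 1] complex_shift(2)[OF toP, of 1]
    by (intro conjI exI[of _ "\<lambda>i. P (i + 1)"] exI[of _ "\<lambda>i. \<delta> (i + 1)"]) auto
qed

text \<open>Conversely, a complex of projective modules comes from a sequence in \<open>add E\<close>.  That this sequence is
  itself exact follows from its exactness under \<open>Hom(E,-)\<close>, because \<open>E\<close> is a generator.\<close>

lemma E_gorenstein_projectiveI:
  fixes M :: "('k, 'a) fd_mod" and N :: "('k, 'e \<Rightarrow> 'e) fd_mod"
  assumes N: "gorenstein_projective \<Gamma> N" and M: "fg_module L M" and i: "iso_pair \<Gamma> N (F M) u v"
  shows "E_gorenstein_projective L E M"
proof -
  have fgN: "fg_module \<Gamma> N" using N by (simp add: gorenstein_projective_def)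
  obtain P :: "int \<Rightarrow> ('k, 'e \<Rightarrow> 'e) fd_mod" and \<delta> where proj: "\<And>i. fg_projective \<Gamma> (P i)" and ex: "exact_sequence \<Gamma> P \<delta>"
    and to: "exact_under_Hom_to \<Gamma> P \<delta> (regular \<Gamma>)" and iso: "lmod_iso \<Gamma> N (sub_module (P 0) (\<delta> (- 1) ` carrier (P (- 1))))"
    using N unfolding gorenstein_projective_def by blast
  have P: "fg_module \<Gamma> (P i)" "proj \<Gamma> (P i)" for i using proj[of i] fg_projective_iff[OF fd_\<Gamma>] by auto
  note lP = fg_left[OF P(1)]
  have \<delta>: "lin \<Gamma> (P i) (P (i + 1)) (\<delta> i)" for i by (rule hom_set_lin[OF _ lP lP]) (use ex in \<open>simp add: exact_sequence_def\<close>)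
  have \<delta>2: "lin \<Gamma> (P (i + 1)) (P (i + 2)) (\<delta> (i + 1))" for i using \<delta>[of "i + 1"] by (simp add: add.assoc)
  have "\<exists>(Z :: ('k, 'a) fd_mod) c b. fg_module L Z \<and> addE L E Z \<and> iso_pair \<Gamma> (F Z) (P i) c b" for i
    using proj_is_F[OF P(2)[of i]] iso_pair_sym by blast
  then obtain Z :: "int \<Rightarrow> ('k, 'a) fd_mod" and c b where Z: "\<And>i. fg_module L (Z i)" "\<And>i. addE L E (Z i)"
    and cb: "\<And>i. iso_pair \<Gamma> (F (Z i)) (P i) (c i) (b i)" by metis
  note lZ = fg_left[OF Z(1)]
  have "\<exists>d. d \<in> hom_set L (Z i) (Z (i + 1)) \<and> (\<forall>h\<in>hom_set L E (Z i). b (i + 1) (\<delta> i (c i h)) = postcomp E d h)" for i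
  proof -
    obtain d where d: "lin L (Z i) (Z (i + 1)) d" "\<And>h. h \<in> hom_set L E (Z i) \<Longrightarrow> b (i + 1) (\<delta> i (c i h)) = postcomp E d h"
      using F_full[OF lZ lZ lin_compose[OF lin_compose[OF iso_pairD(1)[OF cb] \<delta>] iso_pairD(2)[OF cb]]] by blast
    then show ?thesis
      using d(2) lin_hom_set[OF d(1)] by (intro exI[of _ "restrict d (carrier (Z i))"]) (simp add: postcomp_restrict)
  qed
  then obtain d where dh: "\<And>i. d i \<in> hom_set L (Z i) (Z (i + 1))"
    and db: "\<And>i h. h \<in> hom_set L E (Z i) \<Longrightarrow> b (i + 1) (\<delta> i (c i h)) = postcomp E (d i) h" by metis
  have d: "lin L (Z i) (Z (i + 1)) (d i)" for i by (rule hom_set_lin[OF dh lZ lZ])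
  have d2: "lin L (Z (i + 1)) (Z (i + 2)) (d (i + 1))" for i using d[of "i + 1"] by (simp add: add.assoc)
  have e: "\<delta> i (c i h) = c (i + 1) (postcomp E (d i) h)" if h: "h \<in> hom_set L E (Z i)" for i h
    using db[OF h] iso_pairD(4)[OF cb[of "i + 1"], of "\<delta> i (c i h)"] linD(3)[OF \<delta>, of "c i h" i] linD(3)[OF iso_pairD(1)[OF cb], of h i] h by simp
  have e2: "\<delta> (i + 1) (c (i + 1) h) = c (i + 2) (postcomp E (d (i + 1)) h)" if "h \<in> hom_set L E (Z (i + 1))" for i h
    using e[OF that] by (simp add: add.assoc)
  have exi: "exact_at (P i) (\<delta> i) (P (i + 1)) (\<delta> (i + 1)) (P (i + 2))" for i
    using ex by (simp add: exact_sequence_def)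
  have fromi: "exact_at (Hom L E (Z i)) (postcomp E (d i)) (Hom L E (Z (i + 1))) (postcomp E (d (i + 1))) (Hom L E (Z (i + 2)))" for i
  proof -
    have "exact_at (Hom L E (Z i)) (postcomp E (d i)) (Hom L E (Z (i + 1))) (postcomp E (d (i + 1))) (Hom L E (Z (i + 2))) \<longleftrightarrow>
      exact_at (P i) (\<delta> i) (P (i + 1)) (\<delta> (i + 1)) (P (i + 2))"
      by (rule exact_at_F_iff[OF d[of i] d2[of i] cb[of i] cb[of "i + 1"] cb[of "i + 2"]]) (rule e e2; assumption)+
    then show ?thesis using exi by blast
  qed
  have toi: "exact_at (Hom L (Z (i + 2)) E) (precomp (Z (i + 1)) (d (i + 1)))
      (Hom L (Z (i + 1)) E) (precomp (Z i) (d i)) (Hom L (Z i) E)" for i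
  proof -
    have "exact_at (Hom L (Z (i + 2)) E) (precomp (Z (i + 1)) (d (i + 1))) (Hom L (Z (i + 1)) E) (precomp (Z i) (d i)) (Hom L (Z i) E) \<longleftrightarrow>
      exact_at (Hom \<Gamma> (P (i + 2)) (regular \<Gamma>)) (precomp (P (i + 1)) (\<delta> (i + 1)))
      (Hom \<Gamma> (P (i + 1)) (regular \<Gamma>)) (precomp (P i) (\<delta> i)) (Hom \<Gamma> (P i) (regular \<Gamma>))"
      by (rule exact_at_Hom_F_iff[OF d[of i] d2[of i] \<delta>[of i] \<delta>2[of i] cb[of i] cb[of "i + 1"] cb[of "i + 2"]]) (rule e e2; assumption)+
    then show ?thesis using to by (simp add: exact_under_Hom_to_def)
  qed
  have Zex: "exact_at (Z i) (d i) (Z (i + 1)) (d (i + 1)) (Z (i + 2))" for i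
    unfolding exact_at_def
  proof
    have ker: "postcomp E (d i) ` hom_set L E (Z i) = {y \<in> hom_set L E (Z (i + 1)). postcomp E (d (i + 1)) y = (\<lambda>x\<in>carrier E. \<zero>\<^bsub>Z (i + 2)\<^esub>)}"
      using fromi[of i] by (simp add: exact_at_def Hom_simps)
    have dd: "d (i + 1) (d i x) = \<zero>\<^bsub>Z (i + 2)\<^esub>" if x: "x \<in> carrier (Z i)" for x
    proof (rule F_faithful[OF lin_compose[OF d d2] lin_0[OF lZ lZ] _ x])
      fix h w assume h: "h \<in> hom_set L E (Z i)" and w: "w \<in> carrier E"
      have "postcomp E (d i) h \<in> {y \<in> hom_set L E (Z (i + 1)). postcomp E (d (i + 1)) y = (\<lambda>x\<in>carrier E. \<zero>\<^bsub>Z (i + 2)\<^esub>)}"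
        unfolding ker[symmetric] using h by blast
      then have "postcomp E (d (i + 1)) (postcomp E (d i) h) = (\<lambda>x\<in>carrier E. \<zero>\<^bsub>Z (i + 2)\<^esub>)" by simp
      from fun_cong[OF this, of w] show "d (i + 1) (d i (h w)) = \<zero>\<^bsub>Z (i + 2)\<^esub>" using w by (simp add: postcomp_eq)
    qed
    show "d i ` carrier (Z i) \<subseteq> {y \<in> carrier (Z (i + 1)). d (i + 1) y = \<zero>\<^bsub>Z (i + 2)\<^esub>}"
      using dd linD(3)[OF d] by auto
    show "{y \<in> carrier (Z (i + 1)). d (i + 1) y = \<zero>\<^bsub>Z (i + 2)\<^esub>} \<subseteq> d i ` carrier (Z i)"
    proof (rule F_reflects_image[OF d submodule_kernel[OF d2]])
      fix k assume k: "k \<in> hom_set L E (Z (i + 1))" "k ` carrier E \<subseteq> {y \<in> carrier (Z (i + 1)). d (i + 1) y = \<zero>\<^bsub>Z (i + 2)\<^esub>}"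
      have "postcomp E (d (i + 1)) k = (\<lambda>x\<in>carrier E. \<zero>\<^bsub>Z (i + 2)\<^esub>)"
        unfolding postcomp_eq by (rule restrict_ext) (use k(2) in auto)
      then have "k \<in> postcomp E (d i) ` hom_set L E (Z i)" unfolding ker using k(1) by simp
      then obtain h where h: "h \<in> hom_set L E (Z i)" "k = postcomp E (d i) h" by blast
      then show "\<exists>h\<in>hom_set L E (Z i). \<forall>e\<in>carrier E. d i (h e) = k e" by (intro bexI[of _ h]) (simp_all add: postcomp_eq)
    qed
  qed
  have exZ: "exact_sequence L Z d" using dh Zex by (simp add: exact_sequence_def)
  have toZ: "exact_under_Hom_to L Z d E" using toi by (simp add: exact_under_Hom_to_def)
  have fromZ: "exact_under_Hom_from L Z d E" using fromi by (simp add: exact_under_Hom_from_def)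
  have add: "in_add L E (Z i)" for i using Z in_add_iff[OF lE, of "Z i"] by auto
  let ?m = "- 1 :: int"
  have m: "lin L (Z ?m) (Z 0) (d ?m)" "lin L (Z 0) (Z 1) (d 0)" "lin \<Gamma> (P ?m) (P 0) (\<delta> ?m)"
    using d[of ?m] d[of 0] \<delta>[of ?m] by auto
  have im: "\<delta> ?m ` carrier (P ?m) = c 0 ` postcomp E (d ?m) ` hom_set L E (Z ?m)"
    by (rule F_image[OF cb]) (use e[of _ ?m] in simp)
  have exm: "exact_at (Z ?m) (d ?m) (Z 0) (d 0) (Z 1)"
    "exact_at (Hom L E (Z ?m)) (postcomp E (d ?m)) (Hom L E (Z 0)) (postcomp E (d 0)) (Hom L E (Z 1))"
    using Zex[of ?m] fromi[of ?m] by simp_all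
  obtain s t where st: "iso_pair \<Gamma> (F (sub_module (Z 0) (d ?m ` carrier (Z ?m)))) (sub_module (P 0) (\<delta> ?m ` carrier (P ?m))) s t"
    using F_syzygy[OF m(1,2) cb im m(3) exm] by blast
  have lI: "left_module L (sub_module (Z 0) (d ?m ` carrier (Z ?m)))"
    by (rule left_module_sub[OF lZ submodule_image[OF m(1) submodule_carrier[OF lZ]]])
  obtain q r where "iso_pair \<Gamma> N (sub_module (P 0) (\<delta> ?m ` carrier (P ?m))) q r"
    using iso lmod_iso_iff[OF fg_left[OF fgN] linD(2)[OF iso_pairD(1)[OF st]]] by blast
  then have "\<exists>f g. iso_pair \<Gamma> (F M) (F (sub_module (Z 0) (d ?m ` carrier (Z ?m)))) f g"
    using iso_pair_trans[OF iso_pair_trans[OF iso_pair_sym[OF i]] iso_pair_sym[OF st]] by blast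
  then have "\<exists>f g. iso_pair L M (sub_module (Z 0) (d ?m ` carrier (Z ?m))) f g"
    using F_reflects_iso[OF fg_left[OF M] lI] by blast
  then have "lmod_iso L M (sub_module (Z 0) (d ?m ` carrier (Z ?m)))" using lmod_iso_iff[OF fg_left[OF M] lI] by blast
  then show ?thesis
    unfolding E_gorenstein_projective_def
    using M add complex_shift(1)[OF exZ, of ?m] complex_shift(2)[OF toZ, of ?m] complex_shift(3)[OF fromZ, of ?m]
    by (intro conjI exI[of _ "\<lambda>i. Z (i + ?m)"] exI[of _ "\<lambda>i. d (i + ?m)"]) auto
qed

end

section \<open>Minimal presentations along \<open>Hom(E,-)\<close>\<close>

context generator_context
begin

text \<open>Lifting maps from \<open>E\<close> is enough, since \<open>add E\<close> consists of direct summands of powers of \<open>E\<close>; and it is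
  necessary, since the modules over which the definition quantifies include an isomorphic copy of
  \<open>E\<close>.\<close>

lemma right_add_approximation_iff:
  fixes Z M :: "('k, 'a) fd_mod"
  assumes M: "left_module L M"
  shows "right_add_approximation L E Z f M \<longleftrightarrow> in_add L E Z \<and> f \<in> hom_set L Z M \<and>
    (\<forall>k\<in>hom_set L E M. \<exists>h\<in>hom_set L E Z. \<forall>e\<in>carrier E. f (h e) = k e)"
proof
  assume a: "right_add_approximation L E Z f M"
  then have Z: "in_add L E Z" and f: "f \<in> hom_set L Z M"
    and l: "\<And>Y :: ('k, 'a) fd_mod. in_add L E Y \<Longrightarrow> postcomp Y f ` hom_set L Y Z = hom_set L Y M"
    by (auto simp: right_add_approximation_def)
  have lZ: "left_module L Z" using Z in_add_iff[OF lE, of Z] by (auto simp: fg_left)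
  obtain E' :: "('k, 'a) fd_mod" and u v where E': "fg_module L E'" and i: "iso_pair L E E' u v"
    using fd_copy[OF fd fgE] by metis
  note I = iso_pairD[OF i]
  have "in_add L E E'" using in_add_iff[OF lE, of E'] E' addE_retract[OF iso_pair_retract(2)[OF i] addE_self[OF lE]] by blast
  note l' = l[OF this]
  have "\<exists>h\<in>hom_set L E Z. \<forall>e\<in>carrier E. f (h e) = k e" if k: "k \<in> hom_set L E M" for k
  proof -
    have "(\<lambda>x\<in>carrier E'. k (v x)) \<in> postcomp E' f ` hom_set L E' Z"
      unfolding l' by (rule lin_hom_set[OF lin_compose[OF I(2) hom_set_lin[OF k lE M]]])
    then obtain h where h: "h \<in> hom_set L E' Z" "(\<lambda>x\<in>carrier E'. k (v x)) = (\<lambda>x\<in>carrier E'. f (h x))"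
      unfolding postcomp_eq by blast
    have "f (h (u e)) = k e" if e: "e \<in> carrier E" for e
      using fun_cong[OF h(2), of "u e"] linD(3)[OF I(1) e] I(3)[OF e] by simp
    then show ?thesis
      using lin_hom_set[OF lin_compose[OF I(1) hom_set_lin[OF h(1) fg_left[OF E'] lZ]]]
      by (intro bexI[of _ "\<lambda>e\<in>carrier E. h (u e)"]) simp_all
  qed
  then show "in_add L E Z \<and> f \<in> hom_set L Z M \<and> (\<forall>k\<in>hom_set L E M. \<exists>h\<in>hom_set L E Z. \<forall>e\<in>carrier E. f (h e) = k e)"
    using Z f by blast
next
  assume a: "in_add L E Z \<and> f \<in> hom_set L Z M \<and> (\<forall>k\<in>hom_set L E M. \<exists>h\<in>hom_set L E Z. \<forall>e\<in>carrier E. f (h e) = k e)"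
  have lZ: "left_module L Z" using a in_add_iff[OF lE, of Z] by (auto simp: fg_left)
  have lf: "lin L Z M f" by (rule hom_set_lin[OF _ lZ M]) (use a in simp)
  have "postcomp Y f ` hom_set L Y Z = hom_set L Y M" if Y: "in_add L E Y" for Y :: "('k, 'a) fd_mod"
  proof (intro equalityI subsetI)
    have Y': "addE L E Y" "left_module L Y" using Y in_add_iff[OF lE, of Y] by (auto simp: fg_left)
    fix h assume "h \<in> postcomp Y f ` hom_set L Y Z"
    then obtain k where k: "k \<in> hom_set L Y Z" "h = (\<lambda>x\<in>carrier Y. f (k x))" by (auto simp: postcomp_eq)
    show "h \<in> hom_set L Y M" unfolding k(2) by (rule lin_hom_set[OF lin_compose[OF hom_set_lin[OF k(1) Y'(2) lZ] lf]])
  next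
    have Y': "addE L E Y" "left_module L Y" using Y in_add_iff[OF lE, of Y] by (auto simp: fg_left)
    fix h assume h: "h \<in> hom_set L Y M"
    have "\<exists>u'. lin L Y Z u' \<and> (\<forall>x\<in>carrier Y. f (u' x) = h x)"
    proof (rule addE_lift[OF Y'(1) lf hom_set_lin[OF h Y'(2) M]])
      fix k assume "lin L E M k"
      then obtain h' where h': "h' \<in> hom_set L E Z" "\<And>e. e \<in> carrier E \<Longrightarrow> f (h' e) = restrict k (carrier E) e"
        using a lin_hom_set[of L E M k] by blast
      then show "\<exists>k'. lin L E Z k' \<and> (\<forall>e\<in>carrier E. f (k' e) = k e)" using hom_set_lin[OF h'(1) lE lZ] by (intro exI[of _ h']) simp
    qed
    then obtain u where u: "lin L Y Z u" "\<And>x. x \<in> carrier Y \<Longrightarrow> f (u x) = h x" by blast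
    have "h = postcomp Y f (restrict u (carrier Y))"
      unfolding postcomp_eq using hom_set_undefined[OF h] u(2) by (auto simp: fun_eq_iff)
    then show "h \<in> postcomp Y f ` hom_set L Y Z" using lin_hom_set[OF u(1)] by blast
  qed
  then show "right_add_approximation L E Z f M" using a by (simp add: right_add_approximation_def)
qed

lemma right_minimal_iff_rmin_F:
  assumes f: "f \<in> hom_set L Z M" and lZ: "left_module L Z" and lM: "left_module L M"
  shows "right_minimal L Z f \<longleftrightarrow> rmin \<Gamma> (F Z) (postcomp E f)"
proof
  have lf: "lin L Z M f" by (rule hom_set_lin[OF f lZ lM])
  assume m: "right_minimal L Z f"
  show "rmin \<Gamma> (F Z) (postcomp E f)"
    unfolding rmin_def
  proof (intro allI impI)
    fix g assume g: "lin \<Gamma> (F Z) (F Z) g" and e: "\<forall>x\<in>carrier (F Z). postcomp E f (g x) = postcomp E f x"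
    obtain u where u: "lin L Z Z u" "\<And>h. h \<in> hom_set L E Z \<Longrightarrow> g h = postcomp E u h" using F_full[OF lZ lZ g] by blast
    have fu: "f (u x) = f x" if x: "x \<in> carrier Z" for x
    proof (rule F_faithful[OF lin_compose[OF u(1) lf] lf _ x])
      fix h c assume h: "h \<in> hom_set L E Z" and c: "c \<in> carrier E"
      have "postcomp E f (postcomp E u h) = postcomp E f h" using bspec[OF e, of h] h u(2)[OF h] by simp
      from fun_cong[OF this, of c] show "f (u (h c)) = f (h c)" using c by (simp add: postcomp_eq)
    qed
    have "compose (carrier Z) f (restrict u (carrier Z)) = f"
      unfolding compose_def using fu hom_set_undefined[OF f] by (auto simp: fun_eq_iff)
    then have "bij_betw (restrict u (carrier Z)) (carrier Z) (carrier Z)"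
      using m lin_hom_set[OF u(1)] unfolding right_minimal_def by blast
    then have "bij_betw u (carrier Z) (carrier Z)" by (simp cong: bij_betw_cong)
    then obtain v where "iso_pair L Z Z u v" using bij_iso_pair[OF u(1)] by blast
    from iso_pair_bij[OF F_iso[OF this]] show "bij_betw g (carrier (F Z)) (carrier (F Z))"
      by (rule bij_betw_cong[THEN iffD1, rotated]) (use u(2) in simp)
  qed
next
  assume m: "rmin \<Gamma> (F Z) (postcomp E f)"
  show "right_minimal L Z f"
    unfolding right_minimal_def
  proof (intro ballI impI)
    fix h assume h: "h \<in> hom_set L Z Z" and e: "compose (carrier Z) f h = f"
    have lh: "lin L Z Z h" by (rule hom_set_lin[OF h lZ lZ])
    have fh: "f (h x) = f x" if "x \<in> carrier Z" for x using fun_cong[OF e, of x] that by (simp add: compose_def)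
    have "postcomp E f (postcomp E h k) = postcomp E f k" if k: "k \<in> hom_set L E Z" for k
      unfolding postcomp_eq by (rule restrict_ext) (use fh hom_set_closed[OF k] in simp)
    then have "bij_betw (postcomp E h) (carrier (F Z)) (carrier (F Z))"
      using m lin_postcomp[OF lh] by (simp add: rmin_def)
    then obtain g where g: "iso_pair \<Gamma> (F Z) (F Z) (postcomp E h) g" using bij_iso_pair[OF lin_postcomp[OF lh]] by blast
    note G = iso_pairD[OF g]
    obtain v where v: "lin L Z Z v" "\<And>k. k \<in> hom_set L E Z \<Longrightarrow> g k = postcomp E v k" using F_full[OF lZ lZ G(2)] by blast
    have pc: "postcomp E h k \<in> hom_set L E Z" if "k \<in> hom_set L E Z" for k using linD(3)[OF G(1), of k] that by simp
    have "v (h x) = x" if "x \<in> carrier Z" for x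
    proof (rule F_full_id[OF lh v(1) _ that])
      fix k assume k: "k \<in> hom_set L E Z"
      show "postcomp E v (postcomp E h k) = k" using v(2)[OF pc[OF k]] G(3)[of k] k by simp
    qed
    moreover have "h (v x) = x" if "x \<in> carrier Z" for x
    proof (rule F_full_id[OF v(1) lh _ that])
      fix k assume k: "k \<in> hom_set L E Z"
      show "postcomp E h (postcomp E v k) = k" using v(2)[OF k] G(4)[of k] k by simp
    qed
    ultimately have "iso_pair L Z Z h v" using lh v(1) by (simp add: iso_pair_def)
    then show "bij_betw h (carrier Z) (carrier Z)" by (rule iso_pair_bij)
  qed
qed

lemma eq_postcompI: "k \<in> hom_set L E Y \<Longrightarrow> \<forall>e\<in>carrier E. f (h e) = k e \<Longrightarrow> k = postcomp E f h"
  unfolding postcomp_eq using hom_set_undefined[of k L E Y] by (auto simp: fun_eq_iff)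

text \<open>The functor maps right \<open>add E\<close>-approximations to surjections from projective modules.  By full
  faithfulness it preserves right minimality and the surjectivity of \<open>Hom(f1,M)\<close>.\<close>

lemma E_rigid_imp_presentation:
  fixes M :: "('k, 'a) fd_mod"
  assumes M: "E_rigid L E M"
  shows "\<exists>(E1 :: ('k, 'a) fd_mod) f1 (E0 :: ('k, 'a) fd_mod) f0.
    min_pres \<Gamma> (F E1) (postcomp E f1) (F E0) (postcomp E f0) (F M) \<and> rigid \<Gamma> (F E1) (postcomp E f1) (F E0) (F M)"
proof -
  have lM: "left_module L M" using M by (simp add: E_rigid_def fg_left)
  obtain E1 E0 :: "('k, 'a) fd_mod" and f1 f0 where p: "minimal_add_presentation L E E1 f1 E0 f0 M"
    and su: "precomp E1 f1 ` hom_set L E0 M = hom_set L E1 M" using M unfolding E_rigid_def by blast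
  have p': "f1 \<in> hom_set L E1 E0" "f0 \<in> hom_set L E0 M" "f1 ` carrier E1 = {y \<in> carrier E0. f0 y = \<zero>\<^bsub>M\<^esub>}"
    "f0 ` carrier E0 = carrier M" "right_add_approximation L E E0 f0 M" "right_minimal L E0 f0"
    "right_add_approximation L E E1 f1 (sub_module E0 (f1 ` carrier E1))" "right_minimal L E1 f1"
    using p by (auto simp: minimal_add_presentation_def exact_at_def minimal_right_add_approximation_def)
  have add: "addE L E E0" "left_module L E0" "addE L E E1" "left_module L E1"
    using p'(5,7) in_add_iff[OF lE, of E0] in_add_iff[OF lE, of E1] by (auto simp: right_add_approximation_def fg_left)
  have l1: "lin L E1 E0 f1" and l0: "lin L E0 M f0" by (rule hom_set_lin[OF p'(1) add(4,2)], rule hom_set_lin[OF p'(2) add(2) lM])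
  have sI: "submodule (f1 ` carrier E1) L E0" by (rule submodule_image[OF l1 submodule_carrier[OF add(4)]])
  have lI: "left_module L (sub_module E0 (f1 ` carrier E1))" by (rule left_module_sub[OF add(2) sI])
  have f1': "f1 \<in> hom_set L E1 (sub_module E0 (f1 ` carrier E1))" using p'(7) by (simp add: right_add_approximation_def)
  have pc0: "postcomp E f0 h \<in> hom_set L E M" if "h \<in> hom_set L E E0" for h
    using linD(3)[OF lin_postcomp[OF l0], of h] that by simp
  have pc1: "postcomp E f1 h \<in> hom_set L E E0" if "h \<in> hom_set L E E1" for h
    using linD(3)[OF lin_postcomp[OF l1], of h] that by simp
  have im0: "postcomp E f0 ` carrier (F E0) = carrier (F M)"
  proof (intro equalityI subsetI)
    fix k assume "k \<in> carrier (F M)"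
    then have k: "k \<in> hom_set L E M" by simp
    then obtain h where h: "h \<in> hom_set L E E0" "\<forall>e\<in>carrier E. f0 (h e) = k e"
      using p'(5) unfolding right_add_approximation_iff[OF lM] by blast
    show "k \<in> postcomp E f0 ` carrier (F E0)" using eq_postcompI[where f=f0 and h=h, OF k h(2)] h(1) by simp
  qed (use pc0 in auto)
  have im1: "postcomp E f1 ` carrier (F E1) = {h \<in> carrier (F E0). postcomp E f0 h = \<zero>\<^bsub>F M\<^esub>}"
  proof (intro equalityI subsetI)
    fix k assume "k \<in> postcomp E f1 ` carrier (F E1)"
    then obtain h where h: "h \<in> hom_set L E E1" "k = postcomp E f1 h" by auto
    have "k ` carrier E \<subseteq> f1 ` carrier E1" using hom_set_closed[OF h(1)] by (auto simp: h(2) postcomp_eq)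
    then show "k \<in> {h \<in> carrier (F E0). postcomp E f0 h = \<zero>\<^bsub>F M\<^esub>}"
      using kernel_F[OF _ p'(3)[symmetric], of k] pc1[OF h(1)] h(2) by simp
  next
    fix k assume "k \<in> {h \<in> carrier (F E0). postcomp E f0 h = \<zero>\<^bsub>F M\<^esub>}"
    then have k: "k \<in> hom_set L E E0" "postcomp E f0 k = \<zero>\<^bsub>F M\<^esub>" by auto
    have "k \<in> hom_set L E (sub_module E0 (f1 ` carrier E1))"
      unfolding hom_set_cong_sub[OF add(2) sI] using k kernel_F[OF k(1) p'(3)[symmetric]] by simp
    then obtain h where h: "h \<in> hom_set L E E1" "\<forall>e\<in>carrier E. f1 (h e) = k e"
      using p'(7) unfolding right_add_approximation_iff[OF lI] by blast
    show "k \<in> postcomp E f1 ` carrier (F E1)" using eq_postcompI[where f=f1 and h=h, OF k(1) h(2)] h(1) by simp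
  qed
  have "min_pres \<Gamma> (F E1) (postcomp E f1) (F E0) (postcomp E f0) (F M)"
    unfolding min_pres_def
    using F_proj_iff[OF add(4)] F_proj_iff[OF add(2)] add lin_postcomp[OF l1] lin_postcomp[OF l0] im0 im1
      right_minimal_iff_rmin_F[OF p'(2) add(2) lM] right_minimal_iff_rmin_F[OF f1' add(4) lI] p'(6,8) by blast
  moreover have "rigid \<Gamma> (F E1) (postcomp E f1) (F E0) (F M)"
    unfolding rigid_def
  proof (intro allI impI)
    fix v assume v: "lin \<Gamma> (F E1) (F M) v"
    obtain u where u: "lin L E1 M u" "\<And>h. h \<in> hom_set L E E1 \<Longrightarrow> v h = postcomp E u h" using F_full[OF add(4) lM v] by blast
    have "restrict u (carrier E1) \<in> precomp E1 f1 ` hom_set L E0 M" unfolding su by (rule lin_hom_set[OF u(1)])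
    then obtain w where w: "w \<in> hom_set L E0 M" "restrict u (carrier E1) = (\<lambda>x\<in>carrier E1. w (f1 x))"
      by (auto simp: precomp_eq)
    have wu: "w (f1 x) = u x" if "x \<in> carrier E1" for x using fun_cong[OF w(2), of x] that by simp
    have "postcomp E w (postcomp E f1 h) = v h" if h: "h \<in> hom_set L E E1" for h
      unfolding u(2)[OF h] postcomp_eq by (rule restrict_ext) (use wu hom_set_closed[OF h] in simp)
    then show "\<exists>w. lin \<Gamma> (F E0) (F M) w \<and> (\<forall>x\<in>carrier (F E1). w (postcomp E f1 x) = v x)"
      using lin_postcomp[OF hom_set_lin[OF w(1) add(2) lM]] by (intro exI[of _ "postcomp E w"]) simp
  qed
  ultimately show ?thesis by blast
qed

text \<open>Conversely, a minimal projective presentation of \<open>Hom(E,M)\<close> comes from maps \<open>E1 \<rightarrow> E0 \<rightarrow> M\<close>; exactness of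
  the presentation makes them approximations, and since \<open>E\<close> is a generator they form an exact
  sequence.\<close>

lemma presentation_imp_E_rigid:
  fixes M :: "('k, 'a) fd_mod"
  assumes M: "fg_module L M" and i: "iso_pair \<Gamma> N (F M) u v"
    and pr: "min_pres \<Gamma> P1 g1 P0 g0 N" and rig: "rigid \<Gamma> P1 g1 P0 N"
  shows "E_rigid L E M"
proof -
  note I = iso_pairD[OF i] and D = min_presD[OF pr]
  have lM: "left_module L M" by (rule fg_left[OF M])
  obtain E1 :: "('k, 'a) fd_mod" and b1 c1 where E1: "fg_module L E1" "addE L E E1" "iso_pair \<Gamma> P1 (F E1) b1 c1"
    using proj_is_F[OF D(1)] by blast
  obtain E0 :: "('k, 'a) fd_mod" and b0 c0 where E0: "fg_module L E0" "addE L E E0" "iso_pair \<Gamma> P0 (F E0) b0 c0"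
    using proj_is_F[OF D(2)] by blast
  note l1 = fg_left[OF E1(1)] and l0 = fg_left[OF E0(1)] and B1 = iso_pairD[OF E1(3)] and B0 = iso_pairD[OF E0(3)]
  obtain f1' where f1': "lin L E1 E0 f1'" "\<And>h. h \<in> hom_set L E E1 \<Longrightarrow> b0 (g1 (c1 h)) = postcomp E f1' h"
    using F_full[OF l1 l0 lin_compose[OF lin_compose[OF B1(2) D(3)] B0(1)]] by blast
  obtain f0' where f0': "lin L E0 M f0'" "\<And>h. h \<in> hom_set L E E0 \<Longrightarrow> u (g0 (c0 h)) = postcomp E f0' h"
    using F_full[OF l0 lM lin_compose[OF lin_compose[OF B0(2) D(4)] I(1)]] by blast
  define f1 where "f1 = restrict f1' (carrier E1)"
  define f0 where "f0 = restrict f0' (carrier E0)"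
  have h1: "f1 \<in> hom_set L E1 E0" and h0: "f0 \<in> hom_set L E0 M"
    unfolding f1_def f0_def by (rule lin_hom_set[OF f1'(1)], rule lin_hom_set[OF f0'(1)])
  have lf1: "lin L E1 E0 f1" and lf0: "lin L E0 M f0" by (rule hom_set_lin[OF h1 l1 l0], rule hom_set_lin[OF h0 l0 lM])
  have e1: "postcomp E f1 h = b0 (g1 (c1 h))" if "h \<in> hom_set L E E1" for h
    unfolding f1_def postcomp_restrict[OF that] using f1'(2)[OF that] by simp
  have e0: "postcomp E f0 h = u (g0 (c0 h))" if "h \<in> hom_set L E E0" for h
    unfolding f0_def postcomp_restrict[OF that] using f0'(2)[OF that] by simp
  have c0h: "c0 h \<in> carrier P0" if "h \<in> hom_set L E E0" for h using linD(3)[OF B0(2), of h] that by simp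
  have c1h: "c1 h \<in> carrier P1" if "h \<in> hom_set L E E1" for h using linD(3)[OF B1(2), of h] that by simp
  have z: "postcomp E f0 h = \<zero>\<^bsub>F M\<^esub> \<longleftrightarrow> g0 (c0 h) = \<zero>\<^bsub>N\<^esub>" if h: "h \<in> hom_set L E E0" for h
    unfolding e0[OF h] using I(3)[OF linD(3)[OF D(4) c0h[OF h]]] lin_zero[OF I(1)] lin_zero[OF I(2)] by metis
  have sur: "\<exists>h\<in>hom_set L E E0. k = postcomp E f0 h" if k: "k \<in> hom_set L E M" for k
  proof -
    have "v k \<in> g0 ` carrier P0" unfolding D(5) using linD(3)[OF I(2), of k] k by simp
    then obtain x where x: "x \<in> carrier P0" "v k = g0 x" by auto
    have "b0 x \<in> hom_set L E E0" using linD(3)[OF B0(1) x(1)] by simp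
    moreover from this have "postcomp E f0 (b0 x) = k" using e0 B0(3)[OF x(1)] x(2) I(4)[of k] k by simp
    ultimately show ?thesis by blast
  qed
  have ker: "\<exists>h\<in>hom_set L E E1. k = postcomp E f1 h" if k: "k \<in> hom_set L E E0" "postcomp E f0 k = \<zero>\<^bsub>F M\<^esub>" for k
  proof -
    have "c0 k \<in> g1 ` carrier P1" unfolding D(6) using z[OF k(1)] k(2) c0h[OF k(1)] by simp
    then obtain x where x: "x \<in> carrier P1" "c0 k = g1 x" by auto
    have "b1 x \<in> hom_set L E E1" using linD(3)[OF B1(1) x(1)] by simp
    moreover from this have "postcomp E f1 (b1 x) = k" using e1 B1(3)[OF x(1)] x(2) B0(4)[of k] k(1) by simp
    ultimately show ?thesis by metis
  qed
  have zero: "postcomp E f0 (postcomp E f1 h) = \<zero>\<^bsub>F M\<^esub>" if h: "h \<in> hom_set L E E1" for h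
  proof -
    have p: "postcomp E f1 h \<in> hom_set L E E0" using linD(3)[OF lin_postcomp[OF lf1], of h] h by simp
    have gc: "g1 (c1 h) \<in> {x \<in> carrier P0. g0 x = \<zero>\<^bsub>N\<^esub>}" unfolding D(6)[symmetric] using c1h[OF h] by blast
    have "c0 (postcomp E f1 h) = g1 (c1 h)" unfolding e1[OF h] using B0(3) gc by simp
    then show ?thesis using z[OF p] gc by simp
  qed
  have f0s: "f0 ` carrier E0 = carrier M"
  proof
    show "f0 ` carrier E0 \<subseteq> carrier M" using linD(3)[OF lf0] by auto
    show "carrier M \<subseteq> f0 ` carrier E0"
    proof (rule F_reflects_image[OF lf0 submodule_carrier[OF lM]])
      fix k assume "k \<in> hom_set L E M"
      then obtain h where "h \<in> hom_set L E E0" "k = postcomp E f0 h" using sur by blast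
      then show "\<exists>h\<in>hom_set L E E0. \<forall>e\<in>carrier E. f0 (h e) = k e" by (intro bexI[of _ h]) (simp_all add: postcomp_eq)
    qed
  qed
  have ex: "f1 ` carrier E1 = {y \<in> carrier E0. f0 y = \<zero>\<^bsub>M\<^esub>}"
  proof
    have "f0 (f1 x) = \<zero>\<^bsub>M\<^esub>" if x: "x \<in> carrier E1" for x
    proof (rule F_faithful[OF lin_compose[OF lf1 lf0] lin_0[OF l1 lM] _ x])
      fix h e assume h: "h \<in> hom_set L E E1" and e: "e \<in> carrier E"
      from fun_cong[OF zero[OF h], of e] show "f0 (f1 (h e)) = \<zero>\<^bsub>M\<^esub>" using e by (simp add: postcomp_eq)
    qed
    then show "f1 ` carrier E1 \<subseteq> {y \<in> carrier E0. f0 y = \<zero>\<^bsub>M\<^esub>}" using linD(3)[OF lf1] by auto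
    show "{y \<in> carrier E0. f0 y = \<zero>\<^bsub>M\<^esub>} \<subseteq> f1 ` carrier E1"
    proof (rule F_reflects_image[OF lf1 submodule_kernel[OF lf0]])
      fix k assume k: "k \<in> hom_set L E E0" "k ` carrier E \<subseteq> {y \<in> carrier E0. f0 y = \<zero>\<^bsub>M\<^esub>}"
      then have "postcomp E f0 k = \<zero>\<^bsub>F M\<^esub>" using kernel_F[OF k(1) refl] by blast
      then obtain h where "h \<in> hom_set L E E1" "k = postcomp E f1 h" using ker[OF k(1)] by blast
      then show "\<exists>h\<in>hom_set L E E1. \<forall>e\<in>carrier E. f1 (h e) = k e" by (intro bexI[of _ h]) (simp_all add: postcomp_eq)
    qed
  qed
  let ?I = "f1 ` carrier E1"
  have sI: "submodule ?I L E0" by (rule submodule_image[OF lf1 submodule_carrier[OF l1]])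
  have lI: "left_module L (sub_module E0 ?I)" by (rule left_module_sub[OF l0 sI])
  have h1I: "f1 \<in> hom_set L E1 (sub_module E0 ?I)"
    by (rule hom_set_restrictI[OF lin_into_sub[OF lf1 sI] refl hom_set_undefined[OF h1]]) simp
  have add: "in_add L E E0" "in_add L E E1" using in_add_iff[OF lE, of E0] in_add_iff[OF lE, of E1] E0 E1 by auto
  have ap0: "right_add_approximation L E E0 f0 (sub_module M (f0 ` carrier E0))"
    unfolding f0s sub_module_carrier right_add_approximation_iff[OF lM]
  proof (intro conjI ballI add h0)
    fix k assume "k \<in> hom_set L E M"
    then obtain h where "h \<in> hom_set L E E0" "k = postcomp E f0 h" using sur by blast
    then show "\<exists>h\<in>hom_set L E E0. \<forall>e\<in>carrier E. f0 (h e) = k e" by (intro bexI[of _ h]) (simp_all add: postcomp_eq)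
  qed
  have ap1: "right_add_approximation L E E1 f1 (sub_module E0 ?I)"
    unfolding right_add_approximation_iff[OF lI]
  proof (intro conjI ballI add h1I)
    fix k assume "k \<in> hom_set L E (sub_module E0 ?I)"
    then have k: "k \<in> hom_set L E E0" "k ` carrier E \<subseteq> ?I" unfolding hom_set_cong_sub[OF l0 sI] by auto
    then have "postcomp E f0 k = \<zero>\<^bsub>F M\<^esub>" using kernel_F[OF k(1) ex[symmetric]] by blast
    then obtain h where "h \<in> hom_set L E E1" "k = postcomp E f1 h" using ker[OF k(1)] by blast
    then show "\<exists>h\<in>hom_set L E E1. \<forall>e\<in>carrier E. f1 (h e) = k e" by (intro bexI[of _ h]) (simp_all add: postcomp_eq)
  qed
  have "rmin \<Gamma> (F E0) (postcomp E f0)"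
  proof (rule rmin_iso[OF D(7) E0(3)])
    fix x y assume xy: "x \<in> carrier (F E0)" "y \<in> carrier (F E0)" "postcomp E f0 x = postcomp E f0 y"
    then have "v (u (g0 (c0 x))) = v (u (g0 (c0 y)))" using e0 by simp
    then show "g0 (c0 x) = g0 (c0 y)" using I(3) linD(3)[OF D(4)] c0h xy by simp
  qed
  then have m0: "right_minimal L E0 f0" using right_minimal_iff_rmin_F[OF h0 l0 lM] by blast
  have "rmin \<Gamma> (F E1) (postcomp E f1)"
  proof (rule rmin_iso[OF D(8) E1(3)])
    fix x y assume xy: "x \<in> carrier (F E1)" "y \<in> carrier (F E1)" "postcomp E f1 x = postcomp E f1 y"
    then have "c0 (b0 (g1 (c1 x))) = c0 (b0 (g1 (c1 y)))" using e1 by simp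
    then show "g1 (c1 x) = g1 (c1 y)" using B0(3) linD(3)[OF D(3)] c1h xy by simp
  qed
  then have m1: "right_minimal L E1 f1" using right_minimal_iff_rmin_F[OF h1 l1 l0] by blast
  have "minimal_add_presentation L E E1 f1 E0 f0 M"
    unfolding minimal_add_presentation_def minimal_right_add_approximation_def exact_at_def
    using h1 h0 ex f0s ap0 ap1 m0 m1 by blast
  moreover have "precomp E1 f1 ` hom_set L E0 M = hom_set L E1 M"
  proof (intro equalityI subsetI)
    fix k assume "k \<in> precomp E1 f1 ` hom_set L E0 M"
    then obtain w where w: "w \<in> hom_set L E0 M" "k = (\<lambda>x\<in>carrier E1. w (f1 x))" by (auto simp: precomp_eq)
    show "k \<in> hom_set L E1 M" unfolding w(2) by (rule lin_hom_set[OF lin_compose[OF lf1 hom_set_lin[OF w(1) l0 lM]]])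
  next
    fix k assume k: "k \<in> hom_set L E1 M"
    have lk: "lin L E1 M k" by (rule hom_set_lin[OF k l1 lM])
    have "lin \<Gamma> P1 N (\<lambda>x. v (postcomp E k (b1 x)))"
      by (rule lin_compose[OF lin_compose[OF B1(1) lin_postcomp[OF lk]] I(2)])
    then obtain w where w: "lin \<Gamma> P0 N w" "\<And>x. x \<in> carrier P1 \<Longrightarrow> w (g1 x) = v (postcomp E k (b1 x))"
      using rig unfolding rigid_def by blast
    obtain y where y: "lin L E0 M y" "\<And>h. h \<in> hom_set L E E0 \<Longrightarrow> u (w (c0 h)) = postcomp E y h"
      using F_full[OF l0 lM lin_compose[OF lin_compose[OF B0(2) w(1)] I(1)]] by blast
    have "y (f1 x) = k x" if x: "x \<in> carrier E1" for x
    proof (rule F_faithful[OF lin_compose[OF lf1 y(1)] lk _ x])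
      fix h e assume h: "h \<in> hom_set L E E1" and e: "e \<in> carrier E"
      have p: "postcomp E f1 h \<in> hom_set L E E0" using linD(3)[OF lin_postcomp[OF lf1], of h] h by simp
      have q: "postcomp E k h \<in> hom_set L E M" using linD(3)[OF lin_postcomp[OF lk], of h] h by simp
      have "c0 (postcomp E f1 h) = g1 (c1 h)" unfolding e1[OF h] using B0(3) linD(3)[OF D(3) c1h[OF h]] by simp
      then have "postcomp E y (postcomp E f1 h) = u (v (postcomp E k (b1 (c1 h))))"
        using y(2)[OF p] w(2)[OF c1h[OF h]] by simp
      also have "\<dots> = postcomp E k h" using B1(4)[of h] h I(4)[of "postcomp E k h"] q by simp
      finally have "postcomp E y (postcomp E f1 h) = postcomp E k h" .
      from fun_cong[OF this, of e] show "y (f1 (h e)) = k (h e)" using e by (simp add: postcomp_eq)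
    qed
    then have "k = precomp E1 f1 (restrict y (carrier E0))"
      unfolding precomp_eq using hom_set_undefined[OF k] linD(3)[OF lf1] by (auto simp: fun_eq_iff)
    then show "k \<in> precomp E1 f1 ` hom_set L E0 M" using lin_hom_set[OF y(1)] by blast
  qed
  ultimately show ?thesis unfolding E_rigid_def using M by blast
qed

end

section \<open>Decompositions\<close>

text \<open>One of the two summands in Fitting's decomposition vanishes.\<close>

lemma indecomposable_endomorphism:
  assumes fl: "fin_len A M" and ind: "indecomposable A M" and h: "lin A M M h"
  shows "bij_betw h (carrier M) (carrier M) \<or> (\<exists>k. \<forall>x\<in>carrier M. (h ^^ k) x = \<zero>\<^bsub>M\<^esub>)"
proof -
  obtain k where k: "k > 0" "direct_decomp A M ((h ^^ k) ` carrier M) {x \<in> carrier M. (h ^^ k) x = \<zero>\<^bsub>M\<^esub>}"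
    by (rule fitting[OF fl h])
  let ?I = "(h ^^ k) ` carrier M" and ?Q = "{x \<in> carrier M. (h ^^ k) x = \<zero>\<^bsub>M\<^esub>}"
  interpret M: abelian_group M using h by (rule linD)
  consider "?I = {\<zero>\<^bsub>M\<^esub>}" | "?Q = {\<zero>\<^bsub>M\<^esub>}" using ind k(2) unfolding indecomposable_def by blast
  then show ?thesis
  proof cases
    case 1 then show ?thesis by blast
  next
    case 2
    have "?I \<subseteq> carrier M" using linD(3)[OF lin_funpow[OF h]] by auto
    moreover have "carrier M = ?I <+>\<^bsub>M\<^esub> {\<zero>\<^bsub>M\<^esub>}" using k(2) 2 by (simp add: direct_decomp_def)
    ultimately have I: "?I = carrier M" by (auto simp: set_add_def' subset_iff)
    obtain j where j: "k = Suc j" using k(1) gr0_implies_Suc by blast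
    have "h ` carrier M = carrier M"
    proof
      show "h ` carrier M \<subseteq> carrier M" using linD(3)[OF h] by auto
      show "carrier M \<subseteq> h ` carrier M"
        using I linD(3)[OF lin_funpow[OF h, of j]] unfolding j by auto
    qed
    then show ?thesis using surj_endo_bij[OF fl h] by blast
  qed
qed

text \<open>The endomorphism ring is local: if \<open>a + b = 1\<close> with \<open>a\<close> nilpotent, then \<open>b\<close> is injective, hence not
  nilpotent unless \<open>M = 0\<close>.\<close>

lemma indecomposable_local:
  assumes fl: "fin_len A M" and ind: "indecomposable A M" and a: "lin A M M a" and b: "lin A M M b"
    and ab: "\<And>x. x \<in> carrier M \<Longrightarrow> a x \<oplus>\<^bsub>M\<^esub> b x = x"
  shows "bij_betw a (carrier M) (carrier M) \<or> bij_betw b (carrier M) (carrier M)"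
proof (rule ccontr)
  assume n: "\<not> ?thesis"
  interpret M: abelian_group M using a by (rule linD)
  obtain k where k: "\<And>x. x \<in> carrier M \<Longrightarrow> (a ^^ k) x = \<zero>\<^bsub>M\<^esub>"
    using indecomposable_endomorphism[OF fl ind a] n by blast
  obtain m where m: "\<And>x. x \<in> carrier M \<Longrightarrow> (b ^^ m) x = \<zero>\<^bsub>M\<^esub>"
    using indecomposable_endomorphism[OF fl ind b] n by blast
  have inj: "x = \<zero>\<^bsub>M\<^esub>" if x: "x \<in> carrier M" "b x = \<zero>\<^bsub>M\<^esub>" for x
  proof -
    have "a x = x" using ab[OF x(1)] x(2) linD(3)[OF a x(1)] by simp
    then have "(a ^^ j) x = x" for j by (induction j) auto
    then show ?thesis using k[OF x(1)] by metis
  qed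
  have "x = \<zero>\<^bsub>M\<^esub>" if "x \<in> carrier M" "(b ^^ j) x = \<zero>\<^bsub>M\<^esub>" for j x
    using that(2)
  proof (induction j)
    case (Suc j)
    then have "(b ^^ j) x = \<zero>\<^bsub>M\<^esub>" using inj[of "(b ^^ j) x"] linD(3)[OF lin_funpow[OF b] that(1)] by simp
    then show ?case by (rule Suc.IH)
  qed simp
  then have "carrier M = {\<zero>\<^bsub>M\<^esub>}" using m by auto
  then show False using ind by (simp add: indecomposable_def)
qed

text \<open>The identity is a finite sum of maps through \<open>E\<close>.  As the endomorphism ring is local, one of them is
  an automorphism, and then the module is a summand of \<open>E\<close> itself, not only of a power.\<close>

lemma indecomposable_addE_summand:
  assumes fl: "fin_len A M" and ind: "indecomposable A M" and M: "addE A E M"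
  shows "\<exists>i p. summand_pair A M E i p"
proof -
  have l: "left_module A M" by (rule addED(2)[OF M])
  interpret M: abelian_group M using l by (rule left_moduleD)
  have "bij_betw f (carrier M) (carrier M) \<longrightarrow> (\<exists>i p. summand_pair A M E i p)" if "through A E M M f" for f
    using that
  proof induction
    case (zero f)
    show ?case
    proof
      assume b: "bij_betw f (carrier M) (carrier M)"
      have "carrier M \<subseteq> {\<zero>\<^bsub>M\<^esub>}" using zero b by (auto simp: bij_betw_def)
      then have "carrier M = {\<zero>\<^bsub>M\<^esub>}" by auto
      then show "\<exists>i p. summand_pair A M E i p" using ind by (simp add: indecomposable_def)
    qed
  next
    case (step f p i g)
    show ?case
    proof
      assume b: "bij_betw g (carrier M) (carrier M)"
      have lf: "lin A M M f" by (rule through_lin[OF step(1) l l])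
      have lg: "lin A M M g" by (rule through_lin[OF through.step[OF step(1-4)] l l])
      obtain t where t: "iso_pair A M M g t" using bij_iso_pair[OF lg b] by blast
      note T = iso_pairD[OF t]
      \<comment> \<open>Divide by the automorphism \<open>g\<close>: one of the two parts of the identity is invertible.\<close>
      let ?a = "\<lambda>x. f (t x)" and ?b = "\<lambda>x. i (p (t x))"
      have la: "lin A M M ?a" and lb: "lin A M M ?b"
        by (rule lin_compose[OF T(2) lf], rule lin_compose[OF T(2) lin_compose[OF step(2,3)]])
      have "?a x \<oplus>\<^bsub>M\<^esub> ?b x = x" if "x \<in> carrier M" for x
        using step(4) linD(3)[OF T(2) that] T(4)[OF that] by simp
      then consider "bij_betw ?a (carrier M) (carrier M)" | "bij_betw ?b (carrier M) (carrier M)"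
        using indecomposable_local[OF fl ind la lb] by blast
      then show "\<exists>i p. summand_pair A M E i p"
      proof cases
        case 1
        have "bij_betw (\<lambda>x. ?a (g x)) (carrier M) (carrier M)"
          using bij_betw_trans[OF b 1] by (simp add: comp_def)
        then have "bij_betw f (carrier M) (carrier M)"
          by (rule bij_betw_cong[THEN iffD1, rotated]) (use T(3) in simp)
        then show ?thesis using step.IH by blast
      next
        case 2
        obtain s where s: "iso_pair A M M ?b s" using bij_iso_pair[OF lb 2] by blast
        have "summand_pair A M E (\<lambda>x. p (t (s x))) i"
          unfolding summand_pair_def
          using lin_compose[OF iso_pairD(2)[OF s] lin_compose[OF T(2) step(2)]] step(3) iso_pairD(4)[OF s] by blast
        then show ?thesis by blast
      qed
    qed
  qed
  from this[OF addED(3)[OF M]] show ?thesis by (simp add: bij_betw_def)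
qed

lemma addE_direct_decomp:
  assumes l: "left_module A M" and d: "direct_decomp A M H1 H2"
    and 1: "addE A E (sub_module M H1)" and 2: "addE A E (sub_module M H2)"
  shows "addE A E M"
proof -
  obtain r s where r: "summand_pair A (sub_module M H1) M (\<lambda>x. x) r" and s: "summand_pair A (sub_module M H2) M (\<lambda>x. x) s"
    and e: "\<And>x. x \<in> carrier M \<Longrightarrow> x = r x \<oplus>\<^bsub>M\<^esub> s x"
    using direct_decomp_retract[OF l d] by blast
  have "through A E M M r" "through A E M M s"
    using through_post[OF addE_through'[OF 1 retractD(2)[OF r]] l retractD(1)[OF r]]
      through_post[OF addE_through'[OF 2 retractD(2)[OF s]] l retractD(1)[OF s]] by auto
  then have "through A E M M (\<lambda>x. r x \<oplus>\<^bsub>M\<^esub> s x)" by (intro through_add l)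
  then have "through A E M M (\<lambda>x. x)" by (rule through_cong) (rule e)
  then show ?thesis using addED(1)[OF 1] l by (simp add: addE_def)
qed

text \<open>A module of finite length is a direct sum of indecomposable ones, by induction on the length; this is
  carried out on the submodules that are summands of \<open>M\<close>.\<close>

lemma indecomposable_summands_addE:
  assumes fl: "fin_len A M" and E: "left_module A E"
    and ind: "\<And>H r. \<lbrakk>summand_pair A (sub_module M H) M (\<lambda>x. x) r; indecomposable A (sub_module M H)\<rbrakk> \<Longrightarrow>
      addE A E (sub_module M H)"
  shows "addE A E M"
proof -
  obtain \<mu> where \<mu>: "strict_measure A M \<mu>" and l: "left_module A M" using fl by (auto simp: fin_len_def)
  have "addE A E (sub_module M H)" if "\<exists>r. summand_pair A (sub_module M H) M (\<lambda>x. x) r" for H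
    using that
  proof (induction "\<mu> H" arbitrary: H rule: less_induct)
    case less
    let ?H = "sub_module M H"
    obtain r where r: "summand_pair A ?H M (\<lambda>x. x) r" using less.prems by blast
    note R = retractD[OF r]
    have lH: "left_module A ?H" by (rule linD(1)[OF R(1)])
    have sH: "submodule H A M" using submodule_image[OF R(1) submodule_carrier[OF lH]] by simp
    have part: "addE A E (sub_module M H1)"
      if d: "direct_decomp A ?H H1 H2" "H2 \<noteq> {\<zero>\<^bsub>M\<^esub>}" and s: "summand_pair A (sub_module ?H H1) ?H (\<lambda>x. x) q" for H1 H2 q
    proof (rule less.hyps)
      have "submodule H1 A ?H" "submodule H2 A ?H" and i: "H1 \<inter> H2 = {\<zero>\<^bsub>M\<^esub>}"
        using d(1) by (auto simp: direct_decomp_def)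
      then have s12: "submodule H1 A M" "H1 \<subseteq> H" "submodule H2 A M" "H2 \<subseteq> H"
        unfolding submodule_sub_iff[OF l sH] by auto
      have "H1 \<noteq> H" using i d(2) s12(4) by auto
      then show "\<mu> H1 < \<mu> H" using strict_measureD[OF \<mu> s12(1) sH] s12(2) by auto
      show "\<exists>r. summand_pair A (sub_module M H1) M (\<lambda>x. x) r" using retract_trans[OF s r] by auto
    qed
    consider "H = {\<zero>\<^bsub>M\<^esub>}" | "indecomposable A ?H"
      | H1 H2 where "direct_decomp A ?H H1 H2" "H1 \<noteq> {\<zero>\<^bsub>M\<^esub>}" "H2 \<noteq> {\<zero>\<^bsub>M\<^esub>}"
      by (auto simp: indecomposable_def)
    then show ?case
    proof cases
      case 1
      have "through A E ?H ?H (\<lambda>x. x)" by (rule through.zero) (simp add: 1)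
      then show ?thesis using E lH by (simp add: addE_def)
    next
      case 2
      then show ?thesis by (rule ind[OF r])
    next
      case 3
      obtain p q where pq: "summand_pair A (sub_module ?H H1) ?H (\<lambda>x. x) p" "summand_pair A (sub_module ?H H2) ?H (\<lambda>x. x) q"
        using direct_decomp_retract[OF lH 3(1)] by blast
      have "direct_decomp A ?H H2 H1"
      proof -
        interpret H: abelian_group ?H using lH by (rule left_moduleD)
        have "H1 \<subseteq> carrier ?H" "H2 \<subseteq> carrier ?H" using 3(1) submoduleD(1)[of _ A ?H] by (auto simp: direct_decomp_def)
        then have "H2 <+>\<^bsub>?H\<^esub> H1 = H1 <+>\<^bsub>?H\<^esub> H2" using H.a_comm by (fastforce simp: set_add_def')
        then show ?thesis using 3(1) by (auto simp: direct_decomp_def)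
      qed
      then have "addE A E (sub_module ?H H1)" "addE A E (sub_module ?H H2)"
        using part[OF 3(1,3) pq(1)] part[OF _ 3(2) pq(2)] by auto
      then show ?thesis by (rule addE_direct_decomp[OF lH 3(1)])
    qed
  qed
  from this[of "carrier M"] show ?thesis
    using lin_id[OF l] by (auto simp: summand_pair_def)
qed

section \<open>Gorenstein projective rigid modules\<close>

context generator_context
begin

text \<open>A Gorenstein projective module embeds into a projective module with a cokernel that also embeds into
  one.  So it is the kernel of a map between projective modules, that is, of \<open>Hom(E,d)\<close> for some
  \<open>d : Z \<rightarrow> Z'\<close> in \<open>add E\<close>, and the left exact functor \<open>Hom(E,-)\<close> maps the kernel of \<open>d\<close> to it.\<close>

lemma gorenstein_projective_is_F:
  fixes N :: "('k, 'e \<Rightarrow> 'e) fd_mod"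
  assumes N: "gorenstein_projective \<Gamma> N"
  shows "\<exists>(M :: ('k, 'a) fd_mod) u v. fg_module L M \<and> iso_pair \<Gamma> N (F M) u v"
proof -
  obtain f P g C where st: "gp_step \<Gamma> N f P g C" and C: "gorenstein_projective \<Gamma> C"
    using gorenstein_projective_steps(1)[OF fd_\<Gamma> N] by blast
  obtain f' P' g' C' where st': "gp_step \<Gamma> C f' P' g' C'" using gorenstein_projective_steps(1)[OF fd_\<Gamma> C] by blast
  note S = gp_stepD[OF st] and S' = gp_stepD[OF st']
  obtain Z :: "('k, 'a) fd_mod" and b c where Z: "fg_module L Z" and bc: "iso_pair \<Gamma> P (F Z) b c" using proj_is_F[OF S(4)] by blast
  obtain Z' :: "('k, 'a) fd_mod" and b' c' where Z': "fg_module L Z'" and bc': "iso_pair \<Gamma> P' (F Z') b' c'" using proj_is_F[OF S'(4)] by blast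
  note B = iso_pairD[OF bc] and B' = iso_pairD[OF bc'] and lZ = fg_left[OF Z] and lZ' = fg_left[OF Z']
  obtain d where d: "lin L Z Z' d" "\<And>h. h \<in> hom_set L E Z \<Longrightarrow> b' (f' (g (c h))) = postcomp E d h"
    using F_full[OF lZ lZ' lin_compose[OF lin_compose[OF lin_compose[OF B(2) S(6)] S'(5)] B'(1)]] by blast
  let ?H = "{x \<in> carrier Z. d x = \<zero>\<^bsub>Z'\<^esub>}"
  have sH: "submodule ?H L Z" by (rule submodule_kernel[OF d(1)])
  let ?M = "sub_module Z ?H" and ?S = "{h \<in> hom_set L E Z. h ` carrier E \<subseteq> ?H}"
  have FM: "F ?M = sub_module (F Z) ?S" by (rule F_sub[OF lZ sH])
  have lC: "left_module \<Gamma> C" by (rule fg_left[OF S(3)])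
  have sS: "submodule ?S \<Gamma> (F Z)" by (rule submodule_F[OF lZ sH])
  have lfb: "lin \<Gamma> N (F Z) (\<lambda>x. b (f x))" by (rule lin_compose[OF S(5) B(1)])
  have "(\<lambda>x. b (f x)) ` carrier N = ?S"
  proof (intro equalityI subsetI)
    fix h assume "h \<in> (\<lambda>x. b (f x)) ` carrier N"
    then obtain x where x: "x \<in> carrier N" "h = b (f x)" by blast
    have h: "h \<in> hom_set L E Z" using linD(3)[OF lfb x(1)] x(2) by simp
    have "c h = f x" unfolding x(2) by (rule B(3)[OF linD(3)[OF S(5) x(1)]])
    then have "postcomp E d h = \<zero>\<^bsub>F Z'\<^esub>"
      using d(2)[OF h] gp_step_zero[OF st x(1)] lin_zero[OF S'(5)] lin_zero[OF B'(1)] by simp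
    then show "h \<in> ?S" using kernel_F[OF h refl, of d Z'] h by simp
  next
    fix h assume "h \<in> ?S"
    then have h: "h \<in> hom_set L E Z" "h ` carrier E \<subseteq> ?H" by auto
    have "b' (f' (g (c h))) = \<zero>\<^bsub>F Z'\<^esub>" using d(2)[OF h(1)] kernel_F[OF h(1) refl, of d Z'] h(2) by simp
    moreover have c: "c h \<in> carrier P" "g (c h) \<in> carrier C" "f' (g (c h)) \<in> carrier P'"
      using linD(3)[OF B(2), of h] linD(3)[OF S(6)] linD(3)[OF S'(5)] h(1) by auto
    ultimately have "f' (g (c h)) = c' \<zero>\<^bsub>F Z'\<^esub>" using B'(3)[OF c(3)] by metis
    then have "f' (g (c h)) = f' \<zero>\<^bsub>C\<^esub>" using lin_zero[OF B'(2)] lin_zero[OF S'(5)] by simp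
    then have "g (c h) = \<zero>\<^bsub>C\<^esub>" by (rule inj_onD[OF S'(7) _ c(2) left_module_closed(1)[OF lC]])
    then obtain x where "x \<in> carrier N" "c h = f x" using S(9) c(1) by blast
    then show "h \<in> (\<lambda>x. b (f x)) ` carrier N" using B(4)[of h] h(1) by (intro image_eqI[of _ _ x]) simp_all
  qed
  moreover have "inj_on (\<lambda>x. b (f x)) (carrier N)"
  proof (rule inj_onI)
    fix x y assume xy: "x \<in> carrier N" "y \<in> carrier N" "b (f x) = b (f y)"
    then have "f x = f y" using B(3) linD(3)[OF S(5)] by metis
    then show "x = y" using inj_onD[OF S(7)] xy by blast
  qed
  ultimately have "bij_betw (\<lambda>x. b (f x)) (carrier N) (carrier (F ?M))" unfolding FM by (simp add: bij_betw_def)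
  moreover have "lin \<Gamma> N (F ?M) (\<lambda>x. b (f x))"
    unfolding FM by (rule lin_into_sub[OF lfb sS]) (use \<open>_ = ?S\<close> in blast)
  ultimately have "iso_pair \<Gamma> N (F ?M) (\<lambda>x. b (f x)) (inv_into (carrier N) (\<lambda>x. b (f x)))" by (intro bij_iso_pair)
  then show ?thesis using fd_fg_sub[OF fd Z sH] by blast
qed

text \<open>Write \<open>N = Hom(E,M)\<close>.  The hypothesis speaks of indecomposable modules only, so it is applied to the
  indecomposable summands of \<open>M\<close>: their images are summands of \<open>N\<close>, hence again Gorenstein projective and
  \<open>\<tau>\<close>-rigid.\<close>

lemma CM_E_free_imp_CM_tau_tilting_free:
  assumes free: "CM_E_free L E"
  shows "CM_tau_tilting_free K \<Gamma>"
  unfolding CM_tau_tilting_free_def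
proof (intro allI impI, elim conjE)
  fix N :: "('k, 'e \<Rightarrow> 'e) fd_mod"
  assume fgN: "fg_module \<Gamma> N" and gN: "gorenstein_projective \<Gamma> N" and tN: "tau_rigid K \<Gamma> N"
  obtain M :: "('k, 'a) fd_mod" and u v where M: "fg_module L M" and i: "iso_pair \<Gamma> N (F M) u v"
    using gorenstein_projective_is_F[OF gN] by blast
  obtain P1 P0 :: "('k, 'e \<Rightarrow> 'e) fd_mod" and f1 f0 where pN: "min_pres \<Gamma> P1 f1 P0 f0 N" "rigid \<Gamma> P1 f1 P0 N"
    using tau_rigid_imp_rigid_presentation[OF fd_\<Gamma> tN] by blast
  have lM: "left_module L M" by (rule fg_left[OF M])
  have "addE L E M"
  proof (rule indecomposable_summands_addE[OF fd_fin_len[OF fd M] lE])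
    fix H r assume r: "summand_pair L (sub_module M H) M (\<lambda>x. x) r" and ind: "indecomposable L (sub_module M H)"
    let ?H = "sub_module M H"
    note R = retractD[OF r]
    have lH: "left_module L ?H" by (rule linD(1)[OF R(1)])
    have "submodule H L M" using submodule_image[OF R(1) submodule_carrier[OF lH]] by simp
    then have fgH: "fg_module L ?H" by (rule fd_fg_sub[OF fd M])
    obtain V :: "('k, 'e \<Rightarrow> 'e) fd_mod" and s t where V: "fg_module \<Gamma> V" and st: "iso_pair \<Gamma> (F ?H) V s t"
      using fd_copy[OF fd_\<Gamma> fg_F[OF fgH]] by metis
    have VN: "summand_pair \<Gamma> V N (\<lambda>x. v (postcomp E (\<lambda>x. x) (t x))) (\<lambda>x. s (postcomp E r (u x)))"
      by (rule retract_trans[OF retract_trans[OF iso_pair_retract(2)[OF st] F_summand[OF r]] iso_pair_retract(2)[OF i]])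
    have "gorenstein_projective \<Gamma> V" by (rule gorenstein_projective_summand[OF fd_\<Gamma> gN V VN])
    then have "E_gorenstein_projective L E ?H" by (rule E_gorenstein_projectiveI[OF _ fgH iso_pair_sym[OF st]])
    moreover have "tau_rigid K \<Gamma> V" by (rule rigid_presentation_imp_tau_rigid[OF fd_\<Gamma> V VN pN])
    then have "E_rigid L E ?H"
      using tau_rigid_imp_rigid_presentation[OF fd_\<Gamma>, of V] presentation_imp_E_rigid[OF fgH iso_pair_sym[OF st]] by blast
    ultimately have "direct_summand L ?H E" using free fgH ind unfolding CM_E_free_def by blast
    then obtain a b where "summand_pair L ?H E a b" using direct_summand_iff[OF lH lE] by blast
    then show "addE L E ?H" by (rule addE_retract[OF _ addE_self[OF lE]])
  qed
  then have "proj \<Gamma> (F M)" using F_proj_iff[OF lM] by blast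
  then have "proj \<Gamma> N" by (rule addE_retract[OF iso_pair_retract(1)[OF i]])
  then show "fg_projective \<Gamma> N" using fgN fg_projective_iff[OF fd_\<Gamma>] by blast
qed

lemma CM_tau_tilting_free_imp_CM_E_free:
  assumes free: "CM_tau_tilting_free K \<Gamma>"
  shows "CM_E_free L E"
  unfolding CM_E_free_def
proof (intro allI impI, elim conjE)
  fix M :: "('k, 'a) fd_mod"
  assume M: "fg_module L M" and ind: "indecomposable L M" and gM: "E_gorenstein_projective L E M" and rM: "E_rigid L E M"
  have lM: "left_module L M" by (rule fg_left[OF M])
  obtain N :: "('k, 'e \<Rightarrow> 'e) fd_mod" and u v where N: "fg_module \<Gamma> N" and i: "iso_pair \<Gamma> (F M) N u v"
    using fd_copy[OF fd_\<Gamma> fg_F[OF M]] by metis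
  have "gorenstein_projective \<Gamma> N" by (rule E_gorenstein_projective_imp[OF gM N iso_pair_sym[OF i]])
  moreover have "tau_rigid K \<Gamma> N"
    using E_rigid_imp_presentation[OF rM] rigid_presentation_imp_tau_rigid[OF fd_\<Gamma> N iso_pair_retract(2)[OF i]] by blast
  ultimately have "proj \<Gamma> N" using free N fg_projective_iff[OF fd_\<Gamma>] unfolding CM_tau_tilting_free_def by blast
  then have "proj \<Gamma> (F M)" by (rule addE_retract[OF iso_pair_retract(1)[OF i]])
  then have "addE L E M" using F_proj_iff[OF lM] by blast
  then show "direct_summand L M E"
    using indecomposable_addE_summand[OF fd_fin_len[OF fd M] ind] direct_summand_iff[OF lM lE] by blast
qed

end

theorem corollary1p3:
  fixes K :: "'k ring" and \<Lambda> :: "('k, 'a) module" and E :: "('a, 'e) module"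
  assumes "algebraically_closed K"
    and "fd_algebra K \<Lambda>"
    and "generator \<Lambda> E"
  shows "CM_E_free \<Lambda> E \<longleftrightarrow> CM_tau_tilting_free K (opposite (End_algebra \<Lambda> E))"
proof -
  interpret generator_context K \<Lambda> E using assms(2,3) by (rule generator_context.intro)
  show ?thesis using CM_E_free_imp_CM_tau_tilting_free CM_tau_tilting_free_imp_CM_E_free by blast
qed

end
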